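(* Let $\alpha\ge\gamma$, $y\in\mathbb T^N$ and $\mathbf b=(b_1,\dots,b_M)\in F_\alpha(y)$. Define $\mathbf v=(v_1,\dots,v_M)$ by $$v_i(x)=\inf\ \mathbb E_i\left[\int_0^\tau L_{\omega(s)}(x+\mathcal I(\Xi)(s),-\Xi(s))+\alpha\,ds+b_{\omega(\tau)}\right],\qquad i\in\{1,\dots,M\},$$ where the infimum is taken over all bounded stopping times $\tau$ and all $\Xi\in\mathcal K(\tau,y-x)$. Then: (i) $\mathbf v(y)=\mathbf b$; (ii) $\mathbf v$ is the maximal subsolution of (HJ$\alpha$) taking the value $\mathbf b$ at $y$ (maximality is understood componentwise on $\mathbb T^N$); (iii) if $\alpha=\gamma$ and $y\in\mathcal A$, then $\mathbf v$ is a critical solution, i.e. a solution of (HJ$\gamma$).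
   Context: **System.** $\mathbb T^N=\mathbb R^N/\mathbb Z^N$ is the flat torus; $+,-$ also denote its group operations, and points of $\mathbb R^N$ are identified with their projections on $\mathbb T^N$ where needed. For $i\in\{1,\dots,M\}$, $H_i:\mathbb T^N\times\mathbb R^N\to\mathbb R$, $(x,p)\mapsto H_i(x,p)$, is continuous in both variables, convex in $p$ and superlinear in $p$. The Lagrangians are $L_i(x,q)=\max_{p\in\mathbb R^N}(p\cdot q-H_i(x,p))$. $\Lambda=(\Lambda_{ij})$ is an $M\times M$ real matrix with rows $\Lambda^1,\dots,\Lambda^M$ such that every non-diagonal entry is nonpositive, every row sums to $0$, and $\Lambda$ is irreducible (for every nonempty $I\subsetneq\{1,\dots,M\}$ there are $i\in I$, $j\notin I$ with $\Lambda_{ij}\neq0$). For $\alpha\in\mathbb R$, (HJ$\alpha$) is the system $H_i(x,Du_i)+\Lambda^i\cdot\mathbf u=\alpha$ on $\mathbb T^N$, $i=1,\dots,M$. A continuous $\mathbf u=(u_1,\dots,u_M):\mathbb T^N\to\mathbb R^M$ is a subsolution (resp. supersolution) of (HJ$\alpha$) if $H_i(x,D\psi(x))+\Lambda^i\cdot\mathbf u(x)\le\alpha$ (resp. $\ge\alpha$) for every $x\in\mathbb T^N$, $i$, and $\psi\in C^1(\mathbb T^N)$ such that $u_i-\psi$ attains a maximum (resp. minimum) at $x$; a solution is both. The critical value is $\gamma=\inf\{\alpha\in\mathbb R : \text{(HJ}\alpha)\text{ admits subsolutions}\}$; "critical" (sub)solutions are those of (HJ$\gamma$). For $\alpha\ge\gamma$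 and $x\in\mathbb T^N$, $F_\alpha(x)=\{\mathbf b\in\mathbb R^M : \text{there is a subsolution } \mathbf u \text{ of (HJ}\alpha)\text{ with }\mathbf u(x)=\mathbf b\}$. It is known that the family of subsolutions of (HJ$\alpha$) taking the same value at a given point, if nonempty, admits a maximal element. The Aubry set $\mathcal A\subset\mathbb T^N$ is the set of points $y$ such that any maximal critical subsolution taking a given value at $y$ is a solution of (HJ$\gamma$) (i.e. for every $\mathbf b\in F_\gamma(y)$, the maximal subsolution of (HJ$\gamma$) taking the value $\mathbf b$ at $y$ is a solution of (HJ$\gamma$)). **Random setting.** $\mathcal D$ is the space of cadlag paths $\omega:[0,+\infty)\to\{1,\dots,M\}$; $\mathcal F$ is the $\sigma$-algebra generated by the evaluations $\omega\mapsto\omega(s)$, $s\ge0$, and $\mathcal F_t$ the one generated by those with $s\le t$. $\mathcal S\subset\mathbb R^M$ is the simplex of probability vectors (regarded as row vectors). For $\mathbf a\in\mathcal S$, $\mathbb P_{\mathbf a}$ is the unique probability measure on $(\mathcal D,\mathcal F)$ with $$\mathbb P_{\mathbf a}(\omega(t_1)=j_1,\dots,\omega(t_k)=j_k)=(\mathbf a e^{-t_1\Lambda})_{j_1}\prod_{l=2}^k\big(e^{-(t_l-t_{l-1})\Lambda}\big)_{j_{l-1}j_l}$$ for all $k\in\mathbb N$, $0\le t_1<\dots<t_k$ and indices $j_1,\dots,j_k$. $\mathbb E_{\mathbf a}$ is the expectation with respect to $\mathbb P_{\mathbf a}$, and $\mathbb E_i=\mathbb E_{\mathbf e_i}$ with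 $\mathbf e_i$ the $i$-th canonical basis vector. "Almost surely" (a.s.) means up to a set that is $\mathbb P_{\mathbf a}$-null for some, equivalently all, $\mathbf a\in\mathcal S$ with strictly positive components. A stopping time is a nonnegative random variable $\tau$ on $(\mathcal D,\mathcal F)$ with $\{\tau\le t\}\in\mathcal F_t$ for all $t\ge0$. **Controls.** $\mathcal D(0,+\infty;\mathbb R^N)$ is the space of cadlag paths $[0,+\infty)\to\mathbb R^N$ with the Skorohod metric and its Borel $\sigma$-algebra (generated by the evaluations). A control is a measurable map $\Xi:\mathcal D\to\mathcal D(0,+\infty;\mathbb R^N)$ such that (i) for every $t>0$ there is $R>0$ with $\sup_{[0,t]}|\Xi|<R$ a.s.; (ii) $\Xi$ is nonanticipating: for every $t>0$, $\omega_1=\omega_2$ in $[0,t]$ implies $\Xi(\omega_1)=\Xi(\omega_2)$ in $[0,t]$. For $\xi\in\mathcal D(0,+\infty;\mathbb R^N)$, $\mathcal I(\xi)(t)\in\mathbb T^N$ is the projection on $\mathbb T^N$ of $\int_0^t\xi\,ds$; $\mathcal I(\Xi)$ is defined $\omega$ by $\omega$. For a bounded stopping time $\tau$ and $x,y\in\mathbb T^N$, $\mathcal K(\tau,y-x)$ is the set of controls $\Xi$ with $\mathcal I(\Xi)(\tau)=y-x$ a.s. *)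

theory Defs
  imports "HOL-Probability.Probability"
begin

section \<open>The flat torus\<close>

definition integer_equiv :: "real ^ 'n \<Rightarrow> real ^ 'n \<Rightarrow> bool" where
  "integer_equiv x y \<longleftrightarrow> (\<forall>i. x $ i - y $ i \<in> \<int>)"

lemma equivp_integer_equiv: "equivp integer_equiv"
proof (rule equivpI)
  show "reflp integer_equiv"
    by (simp add: reflp_def integer_equiv_def)
  show "symp integer_equiv"
    unfolding symp_def integer_equiv_def by (metis Ints_minus minus_diff_eq)
  show "transp integer_equiv"
  proof (rule transpI)
    fix x y z :: "real ^ 'n"
    assume "integer_equiv x y" "integer_equiv y z"
    then have "(x $ i - y $ i) + (y $ i - z $ i) \<in> \<int>" for i
      unfolding integer_equiv_def by (meson Ints_add)
    then show "integer_equiv x z"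
      by (simp add: integer_equiv_def)
  qed
qed

quotient_type 'n torus = "real ^ 'n" / "integer_equiv :: real ^ 'n::finite \<Rightarrow> _"
  morphisms rep_torus torus_of
  by (rule equivp_integer_equiv)

instantiation torus :: (finite) ab_group_add
begin

lift_definition zero_torus :: "'a torus" is "0" .

lift_definition plus_torus :: "'a torus \<Rightarrow> 'a torus \<Rightarrow> 'a torus" is "(+)"
  unfolding integer_equiv_def by (metis Ints_add add_diff_add vector_add_component)

lift_definition uminus_torus :: "'a torus \<Rightarrow> 'a torus" is "uminus"
  unfolding integer_equiv_def by (metis Ints_minus minus_diff_minus vector_uminus_component)

definition minus_torus :: "'a torus \<Rightarrow> 'a torus \<Rightarrow> 'a torus" where
  "minus_torus x y = x + - y"

instance
  by standard (simp_all add: minus_torus_def, (transfer, simp add: integer_equiv_def algebra_simps)+)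

end

text \<open>The quotient topology.\<close>

instantiation torus :: (finite) topological_space
begin

definition open_torus :: "'a torus set \<Rightarrow> bool" where
  "open_torus U \<longleftrightarrow> open (torus_of -` U)"

instance
  by standard (auto simp: open_torus_def vimage_Union)

end

text \<open>\<open>C\<^sup>1\<close> functions on the torus: the lift to the covering space is differentiable, and the
  gradient is a continuous field \<open>G\<close> on the torus; \<open>G\<close> is determined by \<open>\<psi>\<close>.\<close>

definition torus_C1_gradient :: "('n::finite torus \<Rightarrow> real) \<Rightarrow> ('n torus \<Rightarrow> real ^ 'n) \<Rightarrow> bool" where
  "torus_C1_gradient \<psi> G \<longleftrightarrow>
     continuous_on UNIV G \<and> (\<forall>z. GDERIV (\<lambda>x. \<psi> (torus_of x)) z :> G (torus_of z))"


section \<open>Weakly coupled Hamilton--Jacobi systems\<close>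

definition superlinear :: "('a::real_normed_vector \<Rightarrow> real) \<Rightarrow> bool" where
  "superlinear h \<longleftrightarrow> filterlim (\<lambda>p. h p / norm p) at_top at_infinity"

text \<open>The supremum is attained when \<open>H i x\<close> is continuous and superlinear.\<close>

definition lagrangian :: "('m \<Rightarrow> 'n::finite torus \<Rightarrow> real ^ 'n \<Rightarrow> real)
    \<Rightarrow> 'm \<Rightarrow> 'n torus \<Rightarrow> real ^ 'n \<Rightarrow> real" where
  "lagrangian H i x q = (SUP p. p \<bullet> q - H i x p)"

definition irreducible_matrix :: "real ^ 'm ^ 'm \<Rightarrow> bool" where
  "irreducible_matrix \<Lambda> \<longleftrightarrow>
     (\<forall>I. I \<noteq> {} \<and> I \<noteq> UNIV \<longrightarrow> (\<exists>i\<in>I. \<exists>j. j \<notin> I \<and> \<Lambda> $ i $ j \<noteq> 0))"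

definition coupling_matrix :: "real ^ 'm ^ 'm \<Rightarrow> bool" where
  "coupling_matrix \<Lambda> \<longleftrightarrow>
     (\<forall>i j. i \<noteq> j \<longrightarrow> \<Lambda> $ i $ j \<le> 0) \<and> (\<forall>i. (\<Sum>j\<in>UNIV. \<Lambda> $ i $ j) = 0) \<and> irreducible_matrix \<Lambda>"

definition subsolution :: "('m::finite \<Rightarrow> 'n::finite torus \<Rightarrow> real ^ 'n \<Rightarrow> real) \<Rightarrow> real ^ 'm ^ 'm
    \<Rightarrow> real \<Rightarrow> ('n torus \<Rightarrow> real ^ 'm) \<Rightarrow> bool" where
  "subsolution H \<Lambda> \<alpha> u \<longleftrightarrow> continuous_on UNIV u \<and>
     (\<forall>x i \<psi> G. torus_C1_gradient \<psi> G \<and> (\<forall>z. u z $ i - \<psi> z \<le> u x $ i - \<psi> x) \<longrightarrow>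
        H i x (G x) + \<Lambda> $ i \<bullet> u x \<le> \<alpha>)"

definition supersolution :: "('m::finite \<Rightarrow> 'n::finite torus \<Rightarrow> real ^ 'n \<Rightarrow> real) \<Rightarrow> real ^ 'm ^ 'm
    \<Rightarrow> real \<Rightarrow> ('n torus \<Rightarrow> real ^ 'm) \<Rightarrow> bool" where
  "supersolution H \<Lambda> \<alpha> u \<longleftrightarrow> continuous_on UNIV u \<and>
     (\<forall>x i \<psi> G. torus_C1_gradient \<psi> G \<and> (\<forall>z. u x $ i - \<psi> x \<le> u z $ i - \<psi> z) \<longrightarrow>
        \<alpha> \<le> H i x (G x) + \<Lambda> $ i \<bullet> u x)"

definition solution :: "('m::finite \<Rightarrow> 'n::finite torus \<Rightarrow> real ^ 'n \<Rightarrow> real) \<Rightarrow> real ^ 'm ^ 'm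
    \<Rightarrow> real \<Rightarrow> ('n torus \<Rightarrow> real ^ 'm) \<Rightarrow> bool" where
  "solution H \<Lambda> \<alpha> u \<longleftrightarrow> subsolution H \<Lambda> \<alpha> u \<and> supersolution H \<Lambda> \<alpha> u"

definition critical_value ::
  "('m::finite \<Rightarrow> 'n::finite torus \<Rightarrow> real ^ 'n \<Rightarrow> real) \<Rightarrow> real ^ 'm ^ 'm \<Rightarrow> real" where
  "critical_value H \<Lambda> = Inf {\<alpha>. \<exists>u. subsolution H \<Lambda> \<alpha> u}"

definition admissible_values :: "('m::finite \<Rightarrow> 'n::finite torus \<Rightarrow> real ^ 'n \<Rightarrow> real)
    \<Rightarrow> real ^ 'm ^ 'm \<Rightarrow> real \<Rightarrow> 'n torus \<Rightarrow> (real ^ 'm) set" where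
  "admissible_values H \<Lambda> \<alpha> x = {b. \<exists>u. subsolution H \<Lambda> \<alpha> u \<and> u x = b}"

definition maximal_subsolution :: "('m::finite \<Rightarrow> 'n::finite torus \<Rightarrow> real ^ 'n \<Rightarrow> real)
    \<Rightarrow> real ^ 'm ^ 'm \<Rightarrow> real \<Rightarrow> 'n torus \<Rightarrow> real ^ 'm \<Rightarrow> ('n torus \<Rightarrow> real ^ 'm) \<Rightarrow> bool" where
  "maximal_subsolution H \<Lambda> \<alpha> y b u \<longleftrightarrow> subsolution H \<Lambda> \<alpha> u \<and> u y = b \<and>
     (\<forall>w. subsolution H \<Lambda> \<alpha> w \<and> w y = b \<longrightarrow> (\<forall>x i. w x $ i \<le> u x $ i))"

definition aubry_set ::
  "('m::finite \<Rightarrow> 'n::finite torus \<Rightarrow> real ^ 'n \<Rightarrow> real) \<Rightarrow> real ^ 'm ^ 'm \<Rightarrow> 'n torus set" where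
  "aubry_set H \<Lambda> = {y. \<forall>b\<in>admissible_values H \<Lambda> (critical_value H \<Lambda>) y. \<forall>u.
     maximal_subsolution H \<Lambda> (critical_value H \<Lambda>) y b u \<longrightarrow> solution H \<Lambda> (critical_value H \<Lambda>) u}"


section \<open>The random switching process\<close>

text \<open>Cadlag paths on \<open>[0, \<infinity>)\<close> are functions on the reals, fixed to be \<open>undefined\<close> at
  negative times so that equality of paths is equality on \<open>[0, \<infinity>)\<close>.\<close>

definition cadlag_paths :: "'a topology \<Rightarrow> (real \<Rightarrow> 'a) set" where
  "cadlag_paths T = {f \<in> extensional {0..}.
     (\<forall>t\<ge>0. limitin T f (f t) (at_right t)) \<and> (\<forall>t>0. \<exists>l. limitin T f l (at_left t))}"

abbreviation switching_paths :: "(real \<Rightarrow> 'm::finite) set" where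
  "switching_paths \<equiv> cadlag_paths (discrete_topology UNIV)"

definition path_algebra :: "(real \<Rightarrow> 'm::finite) measure" where
  "path_algebra = sigma switching_paths {{\<omega> \<in> switching_paths. \<omega> s = j} | s j. 0 \<le> s}"

definition path_filtration :: "real \<Rightarrow> (real \<Rightarrow> 'm::finite) measure" where
  "path_filtration t =
     sigma switching_paths {{\<omega> \<in> switching_paths. \<omega> s = j} | s j. 0 \<le> s \<and> s \<le> t}"

definition matrix_exp :: "real ^ 'm ^ 'm \<Rightarrow> real ^ 'm::finite ^ 'm" where
  "matrix_exp A = (\<Sum>k. (1 / fact k) *\<^sub>R (((**) A) ^^ k) (mat 1))"

definition simplex_vectors :: "(real ^ 'm::finite) set" where
  "simplex_vectors = {a. (\<forall>i. 0 \<le> a $ i) \<and> (\<Sum>i\<in>UNIV. a $ i) = 1}"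

definition is_path_law :: "real ^ 'm ^ 'm \<Rightarrow> real ^ 'm \<Rightarrow> (real \<Rightarrow> 'm::finite) measure \<Rightarrow> bool" where
  "is_path_law \<Lambda> a P \<longleftrightarrow> prob_space P \<and> sets P = sets path_algebra \<and>
     (\<forall>k\<ge>1. \<forall>t :: nat \<Rightarrow> real. \<forall>j :: nat \<Rightarrow> 'm. 0 \<le> t 1 \<and> strict_mono_on {1..k} t \<longrightarrow>
        measure P {\<omega> \<in> switching_paths. \<forall>l\<in>{1..k}. \<omega> (t l) = j l} =
          (a v* matrix_exp (- t 1 *\<^sub>R \<Lambda>)) $ (j 1) *
          (\<Prod>l = 2..k. matrix_exp (- (t l - t (l - 1)) *\<^sub>R \<Lambda>) $ (j (l - 1)) $ (j l)))"

definition path_law :: "real ^ 'm ^ 'm \<Rightarrow> real ^ 'm \<Rightarrow> (real \<Rightarrow> 'm::finite) measure" where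
  "path_law \<Lambda> a = (THE P. is_path_law \<Lambda> a P)"

text \<open>The null sets are the same for all initial distributions with positive components.\<close>

definition almost_surely :: "real ^ 'm ^ 'm \<Rightarrow> ((real \<Rightarrow> 'm::finite) \<Rightarrow> bool) \<Rightarrow> bool" where
  "almost_surely \<Lambda> Q \<longleftrightarrow>
     (\<forall>a\<in>simplex_vectors. (\<forall>i. 0 < a $ i) \<longrightarrow> (AE \<omega> in path_law \<Lambda> a. Q \<omega>))"

definition bounded_stopping_time :: "((real \<Rightarrow> 'm::finite) \<Rightarrow> real) \<Rightarrow> bool" where
  "bounded_stopping_time \<tau> \<longleftrightarrow> stopping_time path_filtration \<tau> \<and>
     (\<forall>\<omega>\<in>switching_paths. 0 \<le> \<tau> \<omega>) \<and> (\<exists>T. \<forall>\<omega>\<in>switching_paths. \<tau> \<omega> \<le> T)"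


section \<open>Controls and the value function\<close>

text \<open>The evaluations generate the Borel sets of the Skorohod metric.\<close>

definition velocity_algebra :: "(real \<Rightarrow> real ^ 'n::finite) measure" where
  "velocity_algebra = sigma (cadlag_paths euclidean)
     {{\<xi> \<in> cadlag_paths euclidean. \<xi> s \<in> B} | s B. 0 \<le> s \<and> B \<in> sets borel}"

definition is_control ::
  "real ^ 'm ^ 'm \<Rightarrow> ((real \<Rightarrow> 'm::finite) \<Rightarrow> (real \<Rightarrow> real ^ 'n::finite)) \<Rightarrow> bool" where
  "is_control \<Lambda> \<Xi> \<longleftrightarrow> \<Xi> \<in> measurable path_algebra velocity_algebra \<and>
     (\<forall>t>0. \<exists>R>0. almost_surely \<Lambda> (\<lambda>\<omega>. (SUP s\<in>{0..t}. norm (\<Xi> \<omega> s)) < R)) \<and>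
     (\<forall>t>0. \<forall>\<omega>1\<in>switching_paths. \<forall>\<omega>2\<in>switching_paths.
        (\<forall>s\<in>{0..t}. \<omega>1 s = \<omega>2 s) \<longrightarrow> (\<forall>s\<in>{0..t}. \<Xi> \<omega>1 s = \<Xi> \<omega>2 s))"

definition torus_path :: "(real \<Rightarrow> real ^ 'n::finite) \<Rightarrow> real \<Rightarrow> 'n torus" where
  "torus_path \<xi> t = torus_of (LBINT s:{0..t}. \<xi> s)"

definition controls_reaching :: "real ^ 'm ^ 'm \<Rightarrow> ((real \<Rightarrow> 'm::finite) \<Rightarrow> real) \<Rightarrow> 'n::finite torus
    \<Rightarrow> ((real \<Rightarrow> 'm) \<Rightarrow> (real \<Rightarrow> real ^ 'n)) set" where
  "controls_reaching \<Lambda> \<tau> z =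
     {\<Xi>. is_control \<Lambda> \<Xi> \<and> almost_surely \<Lambda> (\<lambda>\<omega>. torus_path (\<Xi> \<omega>) (\<tau> \<omega>) = z)}"

definition expected_cost :: "('m::finite \<Rightarrow> 'n::finite torus \<Rightarrow> real ^ 'n \<Rightarrow> real) \<Rightarrow> real ^ 'm ^ 'm
    \<Rightarrow> real \<Rightarrow> real ^ 'm \<Rightarrow> 'm \<Rightarrow> 'n torus \<Rightarrow> ((real \<Rightarrow> 'm) \<Rightarrow> real)
    \<Rightarrow> ((real \<Rightarrow> 'm) \<Rightarrow> (real \<Rightarrow> real ^ 'n)) \<Rightarrow> real" where
  "expected_cost H \<Lambda> \<alpha> b i x \<tau> \<Xi> =
     (LINT \<omega>|path_law \<Lambda> (axis i 1).
        (LBINT s:{0..\<tau> \<omega>}. lagrangian H (\<omega> s) (x + torus_path (\<Xi> \<omega>) s) (- \<Xi> \<omega> s) + \<alpha>)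
        + b $ (\<omega> (\<tau> \<omega>)))"

definition value_function :: "('m::finite \<Rightarrow> 'n::finite torus \<Rightarrow> real ^ 'n \<Rightarrow> real) \<Rightarrow> real ^ 'm ^ 'm
    \<Rightarrow> real \<Rightarrow> 'n torus \<Rightarrow> real ^ 'm \<Rightarrow> 'n torus \<Rightarrow> real ^ 'm" where
  "value_function H \<Lambda> \<alpha> y b x =
     (\<chi> i. Inf {expected_cost H \<Lambda> \<alpha> b i x \<tau> \<Xi> | \<tau> \<Xi>.
        bounded_stopping_time \<tau> \<and> \<Xi> \<in> controls_reaching \<Lambda> \<tau> (y - x)})"

end

theory Submission
  imports Defs
begin

text \<open>Every subsolution with value \<open>b\<close> at \<open>y\<close> lies below \<open>v\<close>, and \<open>v\<close> is itself a
  subsolution with \<open>v y = b\<close>; hence \<open>v\<close> is the maximal one. That \<open>v\<close> is a critical solution when \<open>y\<close> lies in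
  the Aubry set is then the definition of that set.

  \<^bold>\<open>Subsolutions lie below the expected cost\<close> (\<open>subsolution_le_expected_cost\<close>). For smooth \<open>w\<close> this is
  Dynkin's formula: along a controlled path, \<open>w (x(t)) $ \<omega>(t)\<close> has drift \<open>Dw \<bullet> \<Xi> - \<Lambda> w\<close>, and by the
  Fenchel--Young inequality and the subsolution inequality this drift is at least \<open>-(L + \<alpha>)\<close>. A continuous \<open>w\<close>
  is replaced by its sup-convolution \<open>u\<close> with a periodic penalty, which is a \<open>C\<^sup>1\<close> test function on the whole
  torus. The maximiser for \<open>x\<close> is a competitor for \<open>x + e\<close>, so \<open>u\<close> has a lower expansion
  at \<open>x\<close> with quadratic error and a slope at which the viscosity inequality holds. This
  gives the drift bound over a time step \<open>h\<close> for an arbitrary measurable velocity, up to \<open>O(h\<^sup>2)\<close>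
  (\<open>subsolution_one_step\<close>). Switches are handled by the Markov property together with
  \<open>P\<^sub>k(\<omega>(h) = j) = \<delta>\<^sub>k\<^sub>j - h \<Lambda>\<^sub>k\<^sub>j + O(h\<^sup>2)\<close> (\<open>generator_step\<close>). Summing over a grid, with the
  stopping time rounded up to the grid, leaves an error of order \<open>h\<close>.

  \<^bold>\<open>The value function is a subsolution\<close> (\<open>V_viscosity\<close>). One may travel with constant velocity \<open>q\<close> for a time
  \<open>h\<close> and then follow a nearly optimal strategy that depends on the state found at time \<open>h\<close>. There is one
  such strategy for each of the finitely many states, so the combination is again a measurable control, and the
  result is the inequality \<open>dynamic_programming\<close>. It shows that \<open>v\<close> is Lipschitz; dividing it by \<open>h\<close> at a maximum of \<open>v\<^sub>i - \<psi>\<close> gives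
  \<open>- q \<bullet> D\<psi> - L\<^sub>i(x, - q) + (\<Lambda> v)\<^sub>i \<le> \<alpha>\<close> for every \<open>q\<close>, and the supremum over \<open>q\<close> recovers \<open>H\<^sub>i\<close> because
  \<open>H\<^sub>i\<close> is convex.

  \<^bold>\<open>The path law.\<close> \<open>path_law\<close> is a definite description, so nothing can be said about expectations before
  the law is shown to exist and to be unique. Uniqueness holds because cylinders generate the path algebra. For
  existence, a Poisson clock rings with a rate that dominates the diagonal of \<open>\<Lambda>\<close>, and at each ring the state moves
  by the stochastic matrix \<open>1 - \<Lambda> / rate\<close>. The Markov property (\<open>markov\<close>) follows by conditioning
  on the first ring: this yields a renewal equation, \<open>exp (- t \<Lambda>)\<close> solves the same equation, and bounded
  solutions are unique.\<close>

section \<open>Operations on cadlag paths\<close>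

lemma eventually_at_right_shift:
  fixes t h :: real
  shows "eventually (\<lambda>s. P (s + h)) (at_right t) \<longleftrightarrow> eventually P (at_right (t + h))"
proof -
  have "filtermap (\<lambda>s. s + h) (at_right t) = at_right (t + h)"
    using filtermap_at_right_shift[of "-h" t] by simp
  then show ?thesis
    by (metis eventually_filtermap)
qed

lemma eventually_at_left_shift:
  fixes t h :: real
  shows "eventually (\<lambda>s. P (s + h)) (at_left t) \<longleftrightarrow> eventually P (at_left (t + h))"
proof -
  have "filtermap (\<lambda>s. s - (-h)) (at_left t) = at_left (t - (-h))"
    unfolding filter_eq_iff eventually_filtermap eventually_at_filter filtermap_nhds_shift[symmetric]
    by (simp add: eventually_filtermap)
  then have "filtermap (\<lambda>s. s + h) (at_left t) = at_left (t + h)"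
    by simp
  then show ?thesis
    by (metis eventually_filtermap)
qed

lemma cadlag_left_limit:
  "f \<in> cadlag_paths T \<Longrightarrow> 0 < t \<Longrightarrow> \<exists>l. limitin T f l (at_left t)"
  unfolding cadlag_paths_def by blast

definition time_shift :: "real \<Rightarrow> (real \<Rightarrow> 'a) \<Rightarrow> real \<Rightarrow> 'a" where
  "time_shift h f = (\<lambda>s. if s < 0 then undefined else f (s + h))"

definition spliced :: "real \<Rightarrow> (real \<Rightarrow> 'a) \<Rightarrow> (real \<Rightarrow> 'a) \<Rightarrow> real \<Rightarrow> 'a" where
  "spliced h f g = (\<lambda>s. if s < 0 then undefined else if s < h then f s else g (s - h))"

definition stopped_at :: "real \<Rightarrow> (real \<Rightarrow> 'a) \<Rightarrow> real \<Rightarrow> 'a" where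
  "stopped_at t f = (\<lambda>s. if s < 0 then undefined else f (min s t))"

definition constant_path :: "'a \<Rightarrow> real \<Rightarrow> 'a" where
  "constant_path c = (\<lambda>s. if s < 0 then undefined else c)"

lemma constant_path_cadlag: "c \<in> topspace T \<Longrightarrow> constant_path c \<in> cadlag_paths T"
proof -
  assume c: "c \<in> topspace T"
  have "limitin T (constant_path c) c (at_right t)" if "0 \<le> t" for t
  proof (rule limitin_transform_eventually)
    show "limitin T (\<lambda>_. c) c (at_right t)" using c by simp
    show "\<forall>\<^sub>F s in at_right t. c = constant_path c s"
      using that by (auto simp: eventually_at_right_field constant_path_def intro!: exI[of _ "t+1"])
  qed
  moreover have "limitin T (constant_path c) c (at_left t)" if "0 < t" for t
  proof (rule limitin_transform_eventually)
    show "limitin T (\<lambda>_. c) c (at_left t)" using c by simp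
    show "\<forall>\<^sub>F s in at_left t. c = constant_path c s"
      using that by (auto simp: eventually_at_left_field constant_path_def intro!: exI[of _ 0])
  qed
  ultimately show ?thesis
    by (auto simp: cadlag_paths_def constant_path_def extensional_def)
qed

lemma time_shift_cadlag:
  assumes "f \<in> cadlag_paths T" "0 \<le> h"
  shows "time_shift h f \<in> cadlag_paths T"
proof -
  have R: "limitin T (time_shift h f) (f (t + h)) (at_right t)" if "0 \<le> t" for t
  proof (rule limitin_transform_eventually)
    have "limitin T f (f (t + h)) (at_right (t + h))"
      using assms that by (auto simp: cadlag_paths_def)
    then show "limitin T (\<lambda>s. f (s + h)) (f (t + h)) (at_right t)"
      by (simp add: limitin_def eventually_at_right_shift[of "\<lambda>s. f s \<in> _"])
    show "\<forall>\<^sub>F s in at_right t. f (s + h) = time_shift h f s"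
      using that by (auto simp: eventually_at_right_field time_shift_def intro!: exI[of _ "t+1"])
  qed
  have L: "\<exists>l. limitin T (time_shift h f) l (at_left t)" if t0: "0 < t" for t
  proof -
    obtain l where "limitin T f l (at_left (t + h))"
      using cadlag_left_limit[OF assms(1), of "t + h"] assms(2) t0 by auto
    then have l: "limitin T (\<lambda>s. f (s + h)) l (at_left t)"
      by (simp add: limitin_def eventually_at_left_shift[of "\<lambda>s. f s \<in> _"])
    have "\<forall>\<^sub>F s in at_left t. f (s + h) = time_shift h f s"
      using that by (auto simp: eventually_at_left_field time_shift_def intro!: exI[of _ 0])
    from limitin_transform_eventually[OF this l] show ?thesis by blast
  qed
  show ?thesis
    using R L by (auto simp: cadlag_paths_def time_shift_def extensional_def)
qed

lemma spliced_cadlag: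
  assumes f: "f \<in> cadlag_paths T" and g: "g \<in> cadlag_paths T" and h: "0 \<le> h"
  shows "spliced h f g \<in> cadlag_paths T"
proof -
  have R: "limitin T (spliced h f g) (spliced h f g t) (at_right t)" if "0 \<le> t" for t
  proof (cases "t < h")
    case True
    have "limitin T f (f t) (at_right t)"
      using f that by (auto simp: cadlag_paths_def)
    moreover have "\<forall>\<^sub>F s in at_right t. f s = spliced h f g s"
      using that True by (auto simp: eventually_at_right_field spliced_def intro!: exI[of _ h])
    ultimately show ?thesis
      using limitin_transform_eventually that True by (fastforce simp: spliced_def)
  next
    case False
    have "limitin T g (g (t - h)) (at_right (t - h))"
      using g that False by (auto simp: cadlag_paths_def)
    then have "limitin T (\<lambda>s. g (s + (- h))) (g (t - h)) (at_right t)"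
      unfolding limitin_def
      by (subst eventually_at_right_shift[of "\<lambda>s. g s \<in> _"]) auto
    moreover have "\<forall>\<^sub>F s in at_right t. g (s + (- h)) = spliced h f g s"
      using that False by (auto simp: eventually_at_right_field spliced_def intro!: exI[of _ "t+1"])
    moreover have "spliced h f g t = g (t - h)"
      using that False by (simp add: spliced_def)
    ultimately show ?thesis
      using limitin_transform_eventually by metis
  qed
  have L: "\<exists>l. limitin T (spliced h f g) l (at_left t)" if t0: "0 < t" for t
  proof (cases "t \<le> h")
    case True
    obtain l where l: "limitin T f l (at_left t)"
      using cadlag_left_limit[OF f] t0 by blast
    have "\<forall>\<^sub>F s in at_left t. f s = spliced h f g s"
      using that True by (auto simp: eventually_at_left_field spliced_def intro!: exI[of _ 0])
    from limitin_transform_eventually[OF this l] show ?thesis by blast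
  next
    case False
    then obtain l where "limitin T g l (at_left (t - h))"
      using cadlag_left_limit[OF g, of "t - h"] by auto
    then have l: "limitin T (\<lambda>s. g (s + (- h))) l (at_left t)"
      unfolding limitin_def
      by (subst eventually_at_left_shift[of "\<lambda>s. g s \<in> _"]) auto
    have "\<forall>\<^sub>F s in at_left t. g (s + (- h)) = spliced h f g s"
      using h False by (auto simp: eventually_at_left_field spliced_def intro!: exI[of _ h])
    from limitin_transform_eventually[OF this l] show ?thesis by blast
  qed
  show ?thesis
    using R L by (auto simp: cadlag_paths_def spliced_def extensional_def)
qed

lemma cadlag_in_topspace: "f \<in> cadlag_paths T \<Longrightarrow> 0 \<le> t \<Longrightarrow> f t \<in> topspace T"
  by (auto simp: cadlag_paths_def limitin_def)

lemma stopped_at_cadlag: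
  assumes "f \<in> cadlag_paths T" "0 \<le> t"
  shows "stopped_at t f \<in> cadlag_paths T"
proof -
  have "stopped_at t f = spliced t f (constant_path (f t))"
    by (auto simp: stopped_at_def spliced_def constant_path_def fun_eq_iff min_def)
  with assms show ?thesis
    by (metis spliced_cadlag constant_path_cadlag cadlag_in_topspace)
qed

lemma cadlag_right_continuous:
  "f \<in> cadlag_paths euclidean \<Longrightarrow> 0 \<le> t \<Longrightarrow> (f \<longlongrightarrow> f t) (at_right t)"
  by (auto simp: cadlag_paths_def limitin_canonical_iff)

lemma switching_right_constant:
  assumes "\<omega> \<in> switching_paths" "0 \<le> t"
  shows "\<forall>\<^sub>F s in at_right t. \<omega> s = \<omega> t"
proof -
  have "limitin (discrete_topology UNIV) \<omega> (\<omega> t) (at_right t)"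
    using assms by (auto simp: cadlag_paths_def)
  then have "\<forall>\<^sub>F s in at_right t. \<omega> s \<in> {\<omega> t}"
    unfolding limitin_def by (auto simp: Ball_def)
  then show ?thesis
    by simp
qed

text \<open>One-sided limits bound the path near every point of the compact interval. Since the supremum of an
  unbounded set of reals is an unspecified number, the bound on the speed in the definition of a control says
  something about the speed only through this lemma.\<close>

lemma cadlag_bounded_on:
  fixes f :: "real \<Rightarrow> 'a::real_normed_vector"
  assumes f: "f \<in> cadlag_paths euclidean"
  shows "bounded (f ` {0..t})"
proof -
  have nbhd: "\<exists>e>0. bounded (f ` ({0..t} \<inter> ball x e))" if x: "x \<in> {0..t}" for x
  proof -
    have "(f \<longlongrightarrow> f x) (at_right x)"
      using f x cadlag_right_continuous by auto
    then have "\<forall>\<^sub>F s in at_right x. dist (f s) (f x) < 1"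
      by (rule tendstoD) simp
    then obtain r where r: "r > x" "\<And>s. x < s \<Longrightarrow> s < r \<Longrightarrow> dist (f s) (f x) < 1"
      by (auto simp: eventually_at_right_field)
    obtain l q where l: "q < x" "\<And>s. 0 \<le> s \<Longrightarrow> q < s \<Longrightarrow> s < x \<Longrightarrow> dist (f s) l < 1"
    proof (cases "x = 0")
      case True
      then show ?thesis using that[of "-1" 0] by auto
    next
      case False
      then obtain l where "(f \<longlongrightarrow> l) (at_left x)"
        using cadlag_left_limit[OF f, of x] x by (auto simp: limitin_canonical_iff)
      then have "\<forall>\<^sub>F s in at_left x. dist (f s) l < 1"
        by (rule tendstoD) simp
      then show ?thesis
        using that by (auto simp: eventually_at_left_field)
    qed
    let ?e = "min (r - x) (x - q)"
    have "f ` ({0..t} \<inter> ball x ?e) \<subseteq> ball (f x) 1 \<union> ball l 1 \<union> {f x}"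
    proof
      fix z assume "z \<in> f ` ({0..t} \<inter> ball x ?e)"
      then obtain s where s: "z = f s" "0 \<le> s" "dist x s < ?e" by auto
      consider "s = x" | "s < x" | "s > x" by linarith
      then show "z \<in> ball (f x) 1 \<union> ball l 1 \<union> {f x}"
        using s r l by cases (auto simp: dist_real_def dist_commute)
    qed
    then have "bounded (f ` ({0..t} \<inter> ball x ?e))"
      by (rule bounded_subset[rotated]) (auto intro: bounded_ball)
    moreover have "?e > 0" using r l by auto
    ultimately show ?thesis by blast
  qed
  then obtain e where e: "\<And>x. x \<in> {0..t} \<Longrightarrow> e x > 0 \<and> bounded (f ` ({0..t} \<inter> ball x (e x)))"
    by metis
  have "compact {0..t}" by simp
  moreover have "\<And>x. x \<in> {0..t} \<Longrightarrow> open (ball x (e x))" by simp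
  moreover have "{0..t} \<subseteq> (\<Union>x\<in>{0..t}. ball x (e x))"
    using e by fastforce
  ultimately obtain K where K: "K \<subseteq> {0..t}" "finite K" "{0..t} \<subseteq> (\<Union>x\<in>K. ball x (e x))"
    by (rule compactE_image)
  have "f ` {0..t} \<subseteq> (\<Union>x\<in>K. f ` ({0..t} \<inter> ball x (e x)))"
  proof
    fix z assume "z \<in> f ` {0..t}"
    then obtain s where s: "z = f s" "s \<in> {0..t}" by blast
    with K(3) obtain x where "x \<in> K" "s \<in> ball x (e x)" by blast
    with s show "z \<in> (\<Union>x\<in>K. f ` ({0..t} \<inter> ball x (e x)))" by blast
  qed
  moreover have "bounded (\<Union>x\<in>K. f ` ({0..t} \<inter> ball x (e x)))"
    using K e by (intro bounded_UN) auto
  ultimately show ?thesis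
    by (rule bounded_subset[rotated])
qed


section \<open>Measurability of path functionals\<close>

lemma space_path_algebra [simp]: "space path_algebra = switching_paths"
  unfolding path_algebra_def by (intro space_measure_of) auto

lemma space_path_filtration [simp]: "space (path_filtration t) = switching_paths"
  unfolding path_filtration_def by (intro space_measure_of) auto

lemma space_velocity_algebra [simp]: "space velocity_algebra = cadlag_paths euclidean"
  unfolding velocity_algebra_def by (intro space_measure_of) auto

lemma measurable_path_algebraI:
  fixes f :: "'a \<Rightarrow> real \<Rightarrow> 'm::finite"
  assumes "\<And>x. x \<in> space M \<Longrightarrow> f x \<in> switching_paths"
    and "\<And>s. 0 \<le> s \<Longrightarrow> (\<lambda>x. f x s) \<in> M \<rightarrow>\<^sub>M count_space UNIV"
  shows "f \<in> M \<rightarrow>\<^sub>M path_algebra"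
  unfolding path_algebra_def
proof (rule measurable_measure_of)
  fix A :: "(real \<Rightarrow> 'm) set"
  assume "A \<in> {{\<omega> \<in> switching_paths. \<omega> s = j} | s j. 0 \<le> s}"
  then obtain s j where A: "A = {\<omega> \<in> switching_paths. \<omega> s = j}" "0 \<le> s" by auto
  have "f -` A \<inter> space M = (\<lambda>x. f x s) -` {j} \<inter> space M"
    using assms(1) by (auto simp: A)
  also have "\<dots> \<in> sets M"
    by (rule measurable_sets[OF assms(2)[OF A(2)]]) simp
  finally show "f -` A \<inter> space M \<in> sets M" .
qed (use assms in auto)

lemma measurable_path_filtrationI:
  fixes f :: "'a \<Rightarrow> real \<Rightarrow> 'm::finite"
  assumes "\<And>x. x \<in> space M \<Longrightarrow> f x \<in> switching_paths"
    and "\<And>s. 0 \<le> s \<Longrightarrow> s \<le> t \<Longrightarrow> (\<lambda>x. f x s) \<in> M \<rightarrow>\<^sub>M count_space UNIV"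
  shows "f \<in> M \<rightarrow>\<^sub>M path_filtration t"
  unfolding path_filtration_def
proof (rule measurable_measure_of)
  fix A :: "(real \<Rightarrow> 'm) set"
  assume "A \<in> {{\<omega> \<in> switching_paths. \<omega> s = j} | s j. 0 \<le> s \<and> s \<le> t}"
  then obtain s j where A: "A = {\<omega> \<in> switching_paths. \<omega> s = j}" "0 \<le> s" "s \<le> t" by auto
  have "f -` A \<inter> space M = (\<lambda>x. f x s) -` {j} \<inter> space M"
    using assms(1) by (auto simp: A)
  also have "\<dots> \<in> sets M"
    by (rule measurable_sets[OF assms(2)[OF A(2,3)]]) simp
  finally show "f -` A \<inter> space M \<in> sets M" .
qed (use assms in auto)

lemma measurable_velocity_algebraI:
  fixes f :: "'a \<Rightarrow> real \<Rightarrow> real ^ 'n::finite"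
  assumes "\<And>x. x \<in> space M \<Longrightarrow> f x \<in> cadlag_paths euclidean"
    and "\<And>s. 0 \<le> s \<Longrightarrow> (\<lambda>x. f x s) \<in> borel_measurable M"
  shows "f \<in> M \<rightarrow>\<^sub>M velocity_algebra"
  unfolding velocity_algebra_def
proof (rule measurable_measure_of)
  fix A :: "(real \<Rightarrow> real ^ 'n) set"
  assume "A \<in> {{\<xi> \<in> cadlag_paths euclidean. \<xi> s \<in> B} | s B. 0 \<le> s \<and> B \<in> sets borel}"
  then obtain s B where A: "A = {\<xi> \<in> cadlag_paths euclidean. \<xi> s \<in> B}" "0 \<le> s" "B \<in> sets borel"
    by auto
  have "f -` A \<inter> space M = (\<lambda>x. f x s) -` B \<inter> space M"
    using assms(1) by (auto simp: A)
  also have "\<dots> \<in> sets M"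
    by (rule measurable_sets[OF assms(2)[OF A(2)] A(3)])
  finally show "f -` A \<inter> space M \<in> sets M" .
qed (use assms in auto)

lemma measurable_path_eval:
  fixes s :: real
  assumes "0 \<le> s"
  shows "(\<lambda>\<omega>::real \<Rightarrow> 'm::finite. \<omega> s) \<in> path_algebra \<rightarrow>\<^sub>M count_space UNIV"
proof (rule measurable_count_space_eq2_countable[THEN iffD2], auto)
  fix j :: 'm
  have "{\<omega> \<in> switching_paths. \<omega> s = j} \<in> sets path_algebra"
    unfolding path_algebra_def using assms
    by (subst sets_measure_of) (auto intro!: sigma_sets.Basic)
  moreover have "(\<lambda>\<omega>. \<omega> s) -` {j} \<inter> switching_paths = {\<omega> \<in> switching_paths. \<omega> s = j}"
    by auto
  ultimately show "(\<lambda>\<omega>. \<omega> s) -` {j} \<inter> switching_paths \<in> sets path_algebra" by simp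
qed

lemma measurable_filtration_eval:
  fixes s :: real
  assumes "0 \<le> s" "s \<le> t"
  shows "(\<lambda>\<omega>::real \<Rightarrow> 'm::finite. \<omega> s) \<in> path_filtration t \<rightarrow>\<^sub>M count_space UNIV"
proof (rule measurable_count_space_eq2_countable[THEN iffD2], auto)
  fix j :: 'm
  have "{\<omega> \<in> switching_paths. \<omega> s = j} \<in> sets (path_filtration t)"
    unfolding path_filtration_def using assms
    by (subst sets_measure_of) (auto intro!: sigma_sets.Basic)
  moreover have "(\<lambda>\<omega>. \<omega> s) -` {j} \<inter> switching_paths = {\<omega> \<in> switching_paths. \<omega> s = j}"
    by auto
  ultimately show "(\<lambda>\<omega>. \<omega> s) -` {j} \<inter> switching_paths \<in> sets (path_filtration t)" by simp
qed

lemma measurable_velocity_eval: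
  fixes s :: real
  assumes "0 \<le> s"
  shows "(\<lambda>\<xi>::real \<Rightarrow> real ^ 'n::finite. \<xi> s) \<in> borel_measurable velocity_algebra"
proof (rule measurableI)
  fix B :: "(real ^ 'n) set" assume "B \<in> sets borel"
  then have "{\<xi> \<in> cadlag_paths euclidean. \<xi> s \<in> B} \<in> sets velocity_algebra"
    unfolding velocity_algebra_def using assms
    by (subst sets_measure_of) (auto intro!: sigma_sets.Basic)
  moreover have "(\<lambda>\<xi>. \<xi> s) -` B \<inter> space velocity_algebra = {\<xi> \<in> cadlag_paths euclidean. \<xi> s \<in> B}"
    by auto
  ultimately show "(\<lambda>\<xi>. \<xi> s) -` B \<inter> space velocity_algebra \<in> sets velocity_algebra" by simp
qed simp

lemma sets_path_filtration_subset: "sets (path_filtration t) \<subseteq> sets path_algebra"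
  unfolding path_filtration_def path_algebra_def
  by (subst (1 2) sets_measure_of) (auto intro!: sigma_sets_mono')

lemma measurable_time_shift:
  assumes "0 \<le> h"
  shows "time_shift h \<in> path_algebra \<rightarrow>\<^sub>M (path_algebra :: (real \<Rightarrow> 'm::finite) measure)"
  using assms
  by (intro measurable_path_algebraI)
     (auto intro!: time_shift_cadlag, auto simp: time_shift_def intro!: measurable_path_eval)

lemma measurable_time_shift_filtration:
  assumes "0 \<le> h"
  shows "time_shift h \<in> path_filtration (t + h) \<rightarrow>\<^sub>M (path_filtration t :: (real \<Rightarrow> 'm::finite) measure)"
  using assms
  by (intro measurable_path_filtrationI)
     (auto intro!: time_shift_cadlag, auto simp: time_shift_def intro!: measurable_filtration_eval)

lemma measurable_stopped_at:
  assumes "0 \<le> t"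
  shows "stopped_at t \<in> path_algebra \<rightarrow>\<^sub>M (path_algebra :: (real \<Rightarrow> 'm::finite) measure)"
  using assms
  by (intro measurable_path_algebraI)
     (auto intro!: stopped_at_cadlag, auto simp: stopped_at_def intro!: measurable_path_eval)

text \<open>An event that is observable up to time \<open>t\<close> cannot tell a path from the same path frozen at
  \<open>t\<close>. In this form adaptedness of stopping times and nonanticipation of controls can be treated alike.\<close>

lemma path_filtration_stopped_iff:
  fixes A :: "(real \<Rightarrow> 'm::finite) set"
  assumes A: "A \<in> sets (path_filtration t)" and t: "0 \<le> t" and \<omega>: "\<omega> \<in> switching_paths"
  shows "stopped_at t \<omega> \<in> A \<longleftrightarrow> \<omega> \<in> A"
proof -
  have "A \<in> sigma_sets switching_paths
      {{\<omega> \<in> switching_paths. \<omega> s = j} | s (j::'m). 0 \<le> s \<and> s \<le> t}"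
    using A unfolding path_filtration_def by (subst (asm) sets_measure_of) auto
  then show ?thesis
  proof (induction rule: sigma_sets.induct)
    case (Basic a)
    then obtain s j where "a = {\<omega> \<in> switching_paths. \<omega> s = j}" "0 \<le> s" "s \<le> t" by auto
    then show ?case
      using \<omega> stopped_at_cadlag[OF \<omega> t] by (auto simp: stopped_at_def min_def)
  qed (use \<omega> stopped_at_cadlag[OF \<omega> t] in auto)
qed

text \<open>The value at \<open>s\<close> is the limit of the values at the next point of the grid of mesh
  \<open>1 / n\<close> to the right of \<open>s\<close>, and there are countably many such points. Times are clipped at \<open>0\<close> because paths
  are \<open>undefined\<close> at negative times.\<close>

lemma joint_measurable_right_continuous:
  fixes f :: "'a \<Rightarrow> real \<Rightarrow> 'b::metric_space"
  assumes f: "\<And>s. 0 \<le> s \<Longrightarrow> (\<lambda>x. f x s) \<in> borel_measurable M"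
    and lim: "\<And>x s. x \<in> space M \<Longrightarrow> 0 \<le> s \<Longrightarrow> (f x \<longlongrightarrow> f x s) (at_right s)"
  shows "(\<lambda>(x, s). f x (max 0 s)) \<in> borel_measurable (M \<Otimes>\<^sub>M borel)"
proof (rule borel_measurable_LIMSEQ_metric)
  fix n :: nat
  let ?k = "\<lambda>z::'a \<times> real. nat \<lfloor>real (Suc n) * max 0 (snd z)\<rfloor>"
  have "(\<lambda>z. f (fst z) ((real (?k z) + 1) / real (Suc n))) \<in> borel_measurable (M \<Otimes>\<^sub>M borel)"
  proof (rule measurable_compose_countable[where g = ?k and f = "\<lambda>k z. f (fst z) ((real k + 1) / real (Suc n))"])
    show "(\<lambda>z. f (fst z) ((real k + 1) / real (Suc n))) \<in> borel_measurable (M \<Otimes>\<^sub>M borel)" for k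
      by (rule measurable_compose[OF measurable_fst f]) simp
  qed measurable
  then show "(\<lambda>z. f (fst z) ((real (?k z) + 1) / real (Suc n))) \<in> borel_measurable (M \<Otimes>\<^sub>M borel)" .
next
  fix z assume z: "z \<in> space (M \<Otimes>\<^sub>M (borel :: real measure))"
  obtain x s0 where xs: "z = (x, s0)" by (cases z)
  define s where "s = max 0 s0"
  have s: "0 \<le> s" and x: "x \<in> space M" using z by (auto simp: s_def xs space_pair_measure)
  let ?t = "\<lambda>n. (real (nat \<lfloor>real (Suc n) * s\<rfloor>) + 1) / real (Suc n)"
  have t: "s < ?t n \<and> ?t n \<le> s + inverse (real (Suc n))" for n
  proof -
    have "0 \<le> \<lfloor>real (Suc n) * s\<rfloor>"
      using s by simp
    then have "real (nat \<lfloor>real (Suc n) * s\<rfloor>) = of_int \<lfloor>real (Suc n) * s\<rfloor>"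
      by simp
    moreover have "of_int \<lfloor>real (Suc n) * s\<rfloor> \<le> real (Suc n) * s"
      "real (Suc n) * s < of_int \<lfloor>real (Suc n) * s\<rfloor> + 1"
      by linarith+
    ultimately show ?thesis
      by (simp add: field_simps del: of_nat_Suc)
  qed
  have "?t \<longlonglongrightarrow> s"
  proof (rule tendsto_sandwich[of "\<lambda>_. s" _ _ "\<lambda>n. s + inverse (real (Suc n))"])
    show "(\<lambda>n. s + inverse (real (Suc n))) \<longlonglongrightarrow> s"
      using tendsto_add[OF tendsto_const LIMSEQ_inverse_real_of_nat, of s] by simp
  qed (use t in \<open>auto intro!: always_eventually less_imp_le\<close>)
  then have "filterlim ?t (at_right s) sequentially"
    using t by (auto simp: filterlim_at simp del: of_nat_Suc intro!: always_eventually)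
       (metis less_irrefl)
  then have "(\<lambda>n. f x (?t n)) \<longlonglongrightarrow> f x s"
    using filterlim_compose[OF lim[OF x s]] by blast
  then show "(\<lambda>n. f (fst z) ((real (nat \<lfloor>real (Suc n) * max 0 (snd z)\<rfloor>) + 1) / real (Suc n)))
      \<longlonglongrightarrow> (case z of (x, s) \<Rightarrow> f x (max 0 s))"
    by (simp add: xs s_def)
qed

lemma joint_measurable_path:
  "(\<lambda>(\<omega>, s). \<omega> (max 0 s)) \<in> (path_algebra :: (real \<Rightarrow> 'm::finite) measure) \<Otimes>\<^sub>M borel \<rightarrow>\<^sub>M count_space UNIV"
proof (rule measurable_count_space_eq2_countable[THEN iffD2], safe)
  fix j :: 'm
  have "(\<lambda>(\<omega>, s). (\<lambda>s. indicator {j} (\<omega> s)) (max 0 s) :: real)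
      \<in> borel_measurable ((path_algebra :: (real \<Rightarrow> 'm::finite) measure) \<Otimes>\<^sub>M borel)"
  proof (rule joint_measurable_right_continuous)
    fix s :: real assume "0 \<le> s"
    then show "(\<lambda>\<omega>::real \<Rightarrow> 'm. indicator {j} (\<omega> s) :: real) \<in> borel_measurable path_algebra"
      by (intro measurable_compose[OF measurable_path_eval]) auto
  next
    fix \<omega> :: "real \<Rightarrow> 'm" and s :: real
    assume "\<omega> \<in> space path_algebra" "0 \<le> s"
    then have "\<forall>\<^sub>F r in at_right s. \<omega> r = \<omega> s"
      by (intro switching_right_constant) auto
    then show "((\<lambda>s. indicator {j} (\<omega> s) :: real) \<longlongrightarrow> indicator {j} (\<omega> s)) (at_right s)"
      by (intro tendsto_eventually) (auto elim: eventually_mono)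
  qed
  then have "(\<lambda>(\<omega>, s). indicator {j} (\<omega> (max 0 s)) :: real) -` {1} \<inter>
      space ((path_algebra :: (real \<Rightarrow> 'm::finite) measure) \<Otimes>\<^sub>M borel) \<in> sets (path_algebra \<Otimes>\<^sub>M borel)"
    by (rule measurable_sets) simp
  also have "(\<lambda>(\<omega>, s). indicator {j} (\<omega> (max 0 s)) :: real) -` {1} \<inter>
      space ((path_algebra :: (real \<Rightarrow> 'm::finite) measure) \<Otimes>\<^sub>M borel) =
     (\<lambda>(\<omega>, s). \<omega> (max 0 s)) -` {j} \<inter> space (path_algebra \<Otimes>\<^sub>M borel)"
    by (auto simp: indicator_def split: if_splits)
  finally show "(\<lambda>(\<omega>::real \<Rightarrow> 'm, s). \<omega> (max 0 s)) -` {j} \<inter> space (path_algebra \<Otimes>\<^sub>M borel)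
    \<in> sets (path_algebra \<Otimes>\<^sub>M borel)" .
qed auto

lemma measurable_path_at_random_time:
  fixes X :: "'a \<Rightarrow> real \<Rightarrow> 'm::finite"
  assumes X: "X \<in> M \<rightarrow>\<^sub>M path_algebra" and \<sigma>: "\<sigma> \<in> borel_measurable M"
    and nonneg: "\<And>x. x \<in> space M \<Longrightarrow> 0 \<le> \<sigma> x"
  shows "(\<lambda>x. X x (\<sigma> x)) \<in> M \<rightarrow>\<^sub>M count_space UNIV"
proof -
  have "(\<lambda>x. (X x, \<sigma> x)) \<in> M \<rightarrow>\<^sub>M path_algebra \<Otimes>\<^sub>M borel"
    using X \<sigma> by measurable
  from measurable_compose[OF this joint_measurable_path]
  have "(\<lambda>x. X x (max 0 (\<sigma> x))) \<in> M \<rightarrow>\<^sub>M count_space UNIV" by simp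
  then show ?thesis
    by (rule measurable_cong[THEN iffD1, rotated]) (use nonneg in auto)
qed

lemma joint_measurable_time_shift:
  "(\<lambda>(\<omega>, h). time_shift (max 0 h) \<omega>)
     \<in> (path_algebra :: (real \<Rightarrow> 'm::finite) measure) \<Otimes>\<^sub>M borel \<rightarrow>\<^sub>M path_algebra"
proof (rule measurable_path_algebraI)
  fix s :: real assume s: "0 \<le> s"
  have "(\<lambda>x::(real \<Rightarrow> 'm) \<times> real. fst x (s + max 0 (snd x))) \<in> path_algebra \<Otimes>\<^sub>M borel \<rightarrow>\<^sub>M count_space UNIV"
    by (rule measurable_path_at_random_time) (use s in auto)
  then show "(\<lambda>x. (case x of (\<omega>::real \<Rightarrow> 'm, h) \<Rightarrow> time_shift (max 0 h) \<omega>) s)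
    \<in> path_algebra \<Otimes>\<^sub>M borel \<rightarrow>\<^sub>M count_space UNIV"
    using s by (simp add: time_shift_def case_prod_beta')
qed (auto simp: space_pair_measure intro: time_shift_cadlag)

section \<open>The matrix exponential\<close>

lemma sums_matrixI:
  fixes f :: "nat \<Rightarrow> real ^ 'm ^ 'm::finite"
  assumes "\<And>i j. (\<lambda>k. f k $ i $ j) sums (s $ i $ j)"
  shows "f sums s"
  using assms unfolding sums_def by (intro vec_tendstoI) simp

lemma matrix_mult_component: "(A ** B) $ i $ j = (\<Sum>k\<in>UNIV. A $ i $ k * B $ k $ j)"
  by (simp add: matrix_matrix_mult_def)

lemma matrix_funpow_scaleR:
  fixes A :: "real ^ 'm ^ 'm::finite"
  shows "(((**) (c *\<^sub>R A)) ^^ k) (mat 1) = c ^ k *\<^sub>R (((**) A) ^^ k) (mat 1)"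
proof (induction k)
  case (Suc k)
  then show ?case
    by (simp add: vec_eq_iff matrix_mult_component sum_distrib_left algebra_simps)
qed simp

lemma matrix_funpow_bound:
  fixes A :: "real ^ 'm ^ 'm::finite"
  shows "\<bar>(((**) A) ^^ k) (mat 1) $ i $ j\<bar> \<le> (\<Sum>i\<in>UNIV. \<Sum>j\<in>UNIV. \<bar>A $ i $ j\<bar>) ^ k"
proof (induction k arbitrary: i j)
  case 0
  then show ?case by (simp add: mat_def)
next
  case (Suc k)
  let ?c = "\<Sum>i\<in>UNIV. \<Sum>j\<in>UNIV. \<bar>A $ i $ j\<bar>"
  let ?B = "(((**) A) ^^ k) (mat 1)"
  have "\<bar>(A ** ?B) $ i $ j\<bar> \<le> (\<Sum>l\<in>UNIV. \<bar>A $ i $ l\<bar> * \<bar>?B $ l $ j\<bar>)"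
    unfolding matrix_mult_component by (rule order_trans[OF sum_abs]) (simp add: abs_mult)
  also have "\<dots> \<le> (\<Sum>l\<in>UNIV. \<bar>A $ i $ l\<bar> * ?c ^ k)"
    by (intro sum_mono mult_left_mono Suc.IH) auto
  also have "\<dots> = (\<Sum>l\<in>UNIV. \<bar>A $ i $ l\<bar>) * ?c ^ k"
    by (simp add: sum_distrib_right)
  also have "\<dots> \<le> ?c * ?c ^ k"
    by (intro mult_right_mono member_le_sum[of i UNIV "\<lambda>i. \<Sum>j\<in>UNIV. \<bar>A $ i $ j\<bar>"])
       (auto intro!: sum_nonneg zero_le_power)
  finally show ?case by simp
qed

lemma summable_matrix_exp_component:
  fixes A :: "real ^ 'm ^ 'm::finite"
  shows "summable (\<lambda>k. (- 1) ^ k / fact k * (((**) A) ^^ k) (mat 1) $ i $ j * t ^ k)"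
proof (rule summable_comparison_test)
  let ?c = "\<Sum>i\<in>UNIV. \<Sum>j\<in>UNIV. \<bar>A $ i $ j\<bar>"
  show "summable (\<lambda>k. inverse (fact k) * (?c * \<bar>t\<bar>) ^ k)"
    using summable_exp_generic[of "?c * \<bar>t\<bar>"] by simp
  show "\<exists>N. \<forall>k\<ge>N. norm ((- 1) ^ k / fact k * (((**) A) ^^ k) (mat 1) $ i $ j * t ^ k)
      \<le> inverse (fact k) * (?c * \<bar>t\<bar>) ^ k"
    using matrix_funpow_bound[where A = A and i = i and j = j]
    by (intro exI[of _ 0])
       (auto simp: abs_mult power_abs power_mult_distrib field_simps intro!: mult_left_mono)
qed

definition transition :: "real ^ 'm ^ 'm::finite \<Rightarrow> real \<Rightarrow> 'm \<Rightarrow> 'm \<Rightarrow> real" where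
  "transition \<Lambda> t i j = matrix_exp (- t *\<^sub>R \<Lambda>) $ i $ j"

lemma transition_power_series:
  "transition \<Lambda> t i j = (\<Sum>k. (- 1) ^ k / fact k * (((**) \<Lambda>) ^^ k) (mat 1) $ i $ j * t ^ k)"
proof -
  let ?f = "\<lambda>k. (1 / fact k) *\<^sub>R (((**) (- t *\<^sub>R \<Lambda>)) ^^ k) (mat 1)"
  have eq: "?f k $ i $ j = (- 1) ^ k / fact k * (((**) \<Lambda>) ^^ k) (mat 1) $ i $ j * t ^ k" for k i j
  proof -
    have "(- t) ^ k = (- 1) ^ k * t ^ k"
      by (metis mult_minus1 power_mult_distrib)
    then show ?thesis
      unfolding matrix_funpow_scaleR by simp
  qed
  have "?f sums (\<chi> i j. \<Sum>k. (- 1) ^ k / fact k * (((**) \<Lambda>) ^^ k) (mat 1) $ i $ j * t ^ k)"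
    by (rule sums_matrixI) (simp only: eq vec_lambda_beta summable_sums[OF summable_matrix_exp_component])
  then show ?thesis
    unfolding transition_def matrix_exp_def by (simp add: sums_iff)
qed

lemma transition_0: "transition \<Lambda> 0 i j = (if i = j then 1 else 0)"
  unfolding transition_power_series using powser_zero[of "\<lambda>k. (- 1) ^ k / fact k * (((**) \<Lambda>) ^^ k) (mat 1) $ i $ j"]
  by (simp add: mat_def)

lemma transition_has_derivative:
  "((\<lambda>t. transition \<Lambda> t i j) has_real_derivative - (\<Sum>k\<in>UNIV. \<Lambda> $ i $ k * transition \<Lambda> t k j)) (at t)"
proof -
  define c where "c i n = (- 1) ^ n / fact n * (((**) \<Lambda>) ^^ n) (mat 1) $ i $ j" for i n
  have sm: "summable (\<lambda>n. c i n * t ^ n)" for i t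
    unfolding c_def by (rule summable_matrix_exp_component)
  have d: "diffs (c i) n * t ^ n = - (\<Sum>k\<in>UNIV. \<Lambda> $ i $ k * (c k n * t ^ n))" for n
    by (simp add: c_def diffs_def matrix_mult_component sum_distrib_left sum_distrib_right field_simps
        sum_negf[symmetric] del: of_nat_Suc)
  have "((\<lambda>t. \<Sum>n. c i n * t ^ n) has_real_derivative (\<Sum>n. diffs (c i) n * t ^ n)) (at t)"
    by (rule termdiffs_strong_converges_everywhere) (rule sm)
  also have "(\<Sum>n. diffs (c i) n * t ^ n) = - (\<Sum>n. \<Sum>k\<in>UNIV. \<Lambda> $ i $ k * (c k n * t ^ n))"
    unfolding d by (intro suminf_minus summable_sum summable_mult sm)
  also have "(\<Sum>n. \<Sum>k\<in>UNIV. \<Lambda> $ i $ k * (c k n * t ^ n)) = (\<Sum>k\<in>UNIV. \<Lambda> $ i $ k * (\<Sum>n. c k n * t ^ n))"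
    by (subst suminf_sum) (auto intro!: summable_mult sm sum.cong suminf_mult)
  finally show ?thesis
    by (simp add: transition_power_series c_def)
qed

lemma continuous_transition: "continuous_on A (\<lambda>t. transition \<Lambda> t i j)"
  by (intro continuous_at_imp_continuous_on ballI DERIV_isCont[OF transition_has_derivative])

lemma transition_borel_measurable [measurable]: "(\<lambda>t. transition \<Lambda> t i j) \<in> borel_measurable borel"
  by (intro borel_measurable_continuous_onI continuous_transition)

text \<open>The backward equation in integrated form, for the chain that rings at rate \<open>l\<close> and then moves by the
  matrix \<open>1 - \<Lambda> / l\<close>. It is the fundamental theorem of calculus for \<open>- exp (- l e) exp (- (t - e) \<Lambda>)\<close>
  as a function of \<open>e\<close>.\<close>

lemma transition_renewal:
  assumes "0 < l" "0 \<le> t"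
  shows "transition \<Lambda> t i j = exp (- l * t) * (if i = j then 1 else 0) +
    (LBINT e:{0..t}. l * exp (- l * e) *
       (\<Sum>k\<in>UNIV. ((if i = k then 1 else 0) - \<Lambda> $ i $ k / l) * transition \<Lambda> (t - e) k j))"
proof -
  let ?F = "\<lambda>e. - exp (- l * e) * transition \<Lambda> (t - e) i j"
  let ?f = "\<lambda>e. l * exp (- l * e) *
       (\<Sum>k\<in>UNIV. ((if i = k then 1 else 0) - \<Lambda> $ i $ k / l) * transition \<Lambda> (t - e) k j)"
  have f: "?f e = l * exp (- l * e) * transition \<Lambda> (t - e) i j
      - exp (- l * e) * (\<Sum>k\<in>UNIV. \<Lambda> $ i $ k * transition \<Lambda> (t - e) k j)" for e
  proof -
    have "l * (\<Sum>k\<in>UNIV. ((if i = k then 1 else 0) - \<Lambda> $ i $ k / l) * transition \<Lambda> (t - e) k j)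
      = (\<Sum>k\<in>UNIV. (if k = i then l * transition \<Lambda> (t - e) k j else 0) - \<Lambda> $ i $ k * transition \<Lambda> (t - e) k j)"
      unfolding sum_distrib_left using assms by (intro sum.cong) (auto simp: field_simps)
    also have "\<dots> = l * transition \<Lambda> (t - e) i j - (\<Sum>k\<in>UNIV. \<Lambda> $ i $ k * transition \<Lambda> (t - e) k j)"
      by (simp add: sum_subtractf)
    finally have eq: "l * (\<Sum>k\<in>UNIV. ((if i = k then 1 else 0) - \<Lambda> $ i $ k / l) * transition \<Lambda> (t - e) k j)
      = l * transition \<Lambda> (t - e) i j - (\<Sum>k\<in>UNIV. \<Lambda> $ i $ k * transition \<Lambda> (t - e) k j)" .
    have "?f e = exp (- l * e) * (l * (\<Sum>k\<in>UNIV. ((if i = k then 1 else 0) - \<Lambda> $ i $ k / l) * transition \<Lambda> (t - e) k j))"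
      by (simp only: mult.assoc mult.left_commute)
    then show ?thesis
      unfolding eq by (simp only: right_diff_distrib mult.assoc mult.left_commute)
  qed
  have "(\<integral>e. ?f e * indicator {0..t} e \<partial>lborel) = ?F t - ?F 0"
  proof (rule integral_FTC_Icc_real)
    fix e
    have "((\<lambda>e. transition \<Lambda> (t - e) i j) has_real_derivative
       - (\<Sum>k\<in>UNIV. \<Lambda> $ i $ k * transition \<Lambda> (t - e) k j) * (0 - 1)) (at e)"
      by (rule DERIV_chain'[where g = "\<lambda>t. transition \<Lambda> t i j" and f = "\<lambda>e. t - e", OF _ transition_has_derivative])
         (auto intro!: derivative_eq_intros)
    then show "(?F has_real_derivative ?f e) (at e)"
      unfolding f by (auto intro!: derivative_eq_intros simp: algebra_simps)
    show "isCont ?f e"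
      by (intro continuous_intros continuous_on_interior[OF continuous_on_compose2[OF continuous_transition[of UNIV]], of UNIV]) auto
  qed (use assms in auto)
  then show ?thesis
    by (simp add: set_lebesgue_integral_def transition_0 mult.commute)
qed

section \<open>Construction of the switching process\<close>

definition arrival :: "nat \<Rightarrow> (real \<times> ('m \<Rightarrow> 'm)) stream \<Rightarrow> real" where
  "arrival n X = (\<Sum>k<n. fst (X !! k))"

primrec position :: "'m \<Rightarrow> nat \<Rightarrow> (real \<times> ('m \<Rightarrow> 'm)) stream \<Rightarrow> 'm" where
  "position i 0 X = i"
| "position i (Suc n) X = snd (X !! n) (position i n X)"

text \<open>The stream lists the waiting time before each ring of the clock and the map that then moves the state.
  Thresholds are natural numbers so that the condition is a countable one.\<close>

definition regular_clock :: "(real \<times> ('m \<Rightarrow> 'm)) stream \<Rightarrow> bool" where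
  "regular_clock X \<longleftrightarrow> (\<forall>n. 0 < fst (X !! n)) \<and> (\<forall>K::nat. \<exists>n. real K < arrival n X)"

text \<open>Irregular streams form a null set; they are sent to constant paths so that the result is a
  cadlag path in all cases.\<close>

definition clock_path :: "'m \<Rightarrow> (real \<times> ('m \<Rightarrow> 'm)) stream \<Rightarrow> real \<Rightarrow> 'm" where
  "clock_path i X = (\<lambda>t. if t < 0 then undefined
     else if regular_clock X then position i (LEAST n. t < arrival (Suc n) X) X else i)"

lemma arrival_Suc_Stream: "arrival (Suc n) (x ## X) = fst x + arrival n X"
  unfolding arrival_def by (subst sum.lessThan_Suc_shift) simp

lemma position_Suc_Stream: "position i (Suc n) (x ## X) = position (snd x i) n X"
  by (induction n) auto

lemma regular_clock_Stream: "regular_clock (x ## X) \<longleftrightarrow> 0 < fst x \<and> regular_clock X"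
proof -
  have pos: "(\<forall>n. 0 < fst ((x ## X) !! n)) \<longleftrightarrow> 0 < fst x \<and> (\<forall>n. 0 < fst (X !! n))"
    by (metis not0_implies_Suc snth_Stream snth.simps(1) stream.sel(1))
  have "\<exists>n. real K < arrival n X" if K: "\<forall>K::nat. \<exists>n. real K < arrival n (x ## X)" for K
  proof -
    obtain n where n: "real (nat \<lceil>\<bar>fst x\<bar> + real K\<rceil>) < arrival n (x ## X)"
      using K by blast
    have "\<bar>fst x\<bar> + real K \<le> real (nat \<lceil>\<bar>fst x\<bar> + real K\<rceil>)"
      by linarith
    with n have n': "\<bar>fst x\<bar> + real K < arrival n (x ## X)" by linarith
    then obtain m where "n = Suc m"
      by (cases n) (auto simp: arrival_def)
    with n' show ?thesis
      by (intro exI[of _ m]) (auto simp: arrival_Suc_Stream)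
  qed
  moreover have "\<exists>n. real K < arrival n (x ## X)" if K: "\<forall>K::nat. \<exists>n. real K < arrival n X" and x: "0 < fst x" for K
  proof -
    obtain n where "real K < arrival n X" using K by blast
    then have "real K < arrival (Suc n) (x ## X)"
      using x by (simp add: arrival_Suc_Stream)
    then show ?thesis by blast
  qed
  ultimately show ?thesis
    unfolding regular_clock_def pos by blast
qed

lemma arrival_strict_mono:
  assumes "regular_clock X" "m < n"
  shows "arrival m X < arrival n X"
proof (rule lift_Suc_mono_less[where f = "\<lambda>n. arrival n X", OF _ assms(2)])
  show "arrival n X < arrival (Suc n) X" for n
    using assms(1) by (simp add: arrival_def regular_clock_def)
qed

lemma regular_clock_exceeds:
  assumes "regular_clock X"
  shows "\<exists>n. t < arrival (Suc n) X"
proof -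
  obtain n where "real (nat \<lceil>t\<rceil>) < arrival n X"
    using assms by (auto simp: regular_clock_def)
  then have "t < arrival n X" by linarith
  also have "\<dots> < arrival (Suc n) X"
    using arrival_strict_mono[OF assms] by simp
  finally show ?thesis by blast
qed

lemma clock_path_eq:
  assumes "regular_clock X" "0 \<le> t" "arrival n X \<le> t" "t < arrival (Suc n) X"
  shows "clock_path i X t = position i n X"
proof -
  have "(LEAST n. t < arrival (Suc n) X) = n"
  proof (rule Least_equality)
    fix m assume m: "t < arrival (Suc m) X"
    show "n \<le> m"
    proof (rule ccontr)
      assume "\<not> n \<le> m"
      then have "arrival (Suc m) X \<le> arrival n X"
        using arrival_strict_mono[OF assms(1), of "Suc m" n] by (cases "Suc m = n") auto
      with m assms show False by simp
    qed
  qed fact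
  with assms show ?thesis by (simp add: clock_path_def)
qed

lemma clock_path_interval:
  assumes X: "regular_clock X" and t: "0 \<le> t"
  obtains n where "arrival n X \<le> t" "t < arrival (Suc n) X"
proof -
  define n where "n = (LEAST n. t < arrival (Suc n) X)"
  have n: "t < arrival (Suc n) X"
    unfolding n_def using regular_clock_exceeds[OF X] by (rule LeastI_ex)
  have "arrival n X \<le> t"
  proof (cases n)
    case 0 then show ?thesis using t by (simp add: arrival_def)
  next
    case (Suc m)
    then have "\<not> t < arrival (Suc m) X"
      using not_less_Least[of m "\<lambda>n. t < arrival (Suc n) X"] by (simp add: n_def)
    with Suc show ?thesis by simp
  qed
  with n that show ?thesis by blast
qed

lemma clock_path_interval_left:
  assumes X: "regular_clock X" and t: "0 < t"
  obtains n where "arrival n X < t" "t \<le> arrival (Suc n) X"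
proof -
  obtain n where n: "arrival n X \<le> t" "t < arrival (Suc n) X"
    using clock_path_interval[OF X, of t] t by auto
  show ?thesis
  proof (cases "arrival n X = t")
    case True
    with t obtain m where "n = Suc m"
      by (cases n) (auto simp: arrival_def)
    with True show ?thesis
      using that[of m] arrival_strict_mono[OF X, of m "Suc m"] by auto
  qed (use n that[of n] in auto)
qed

lemma clock_path_switching: "clock_path i X \<in> switching_paths"
proof (cases "regular_clock X")
  case False
  then have "clock_path i X = constant_path i"
    by (auto simp: clock_path_def constant_path_def)
  then show ?thesis by (simp add: constant_path_cadlag)
next
  case X: True
  have R: "limitin (discrete_topology UNIV) (clock_path i X) (clock_path i X t) (at_right t)" if t: "0 \<le> t" for t
  proof -
    obtain n where n: "arrival n X \<le> t" "t < arrival (Suc n) X"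
      using clock_path_interval[OF X t] .
    have "\<forall>\<^sub>F s in at_right t. clock_path i X t = clock_path i X s"
      unfolding eventually_at_right_field
      using n t by (intro exI[of _ "arrival (Suc n) X"]) (auto simp: clock_path_eq[OF X, of _ n])
    then show ?thesis
      by (rule limitin_transform_eventually) simp
  qed
  have L: "\<exists>l. limitin (discrete_topology UNIV) (clock_path i X) l (at_left t)" if t: "0 < t" for t
  proof -
    obtain n where n: "arrival n X < t" "t \<le> arrival (Suc n) X"
      using clock_path_interval_left[OF X t] .
    have "\<forall>\<^sub>F s in at_left t. position i n X = clock_path i X s"
      unfolding eventually_at_left_field
      using n t by (intro exI[of _ "max 0 (arrival n X)"]) (auto simp: clock_path_eq[OF X, of _ n])
    then have "limitin (discrete_topology UNIV) (clock_path i X) (position i n X) (at_left t)"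
      by (rule limitin_transform_eventually) simp
    then show ?thesis by blast
  qed
  show ?thesis
    using R L by (auto simp: cadlag_paths_def clock_path_def extensional_def)
qed

lemma clock_path_Stream:
  assumes X: "regular_clock X" and x: "0 < fst x" and t: "0 \<le> t"
  shows "clock_path i (x ## X) t = (if t < fst x then i else clock_path (snd x i) X (t - fst x))"
proof (cases "t < fst x")
  case True
  then have "clock_path i (x ## X) t = position i 0 (x ## X)"
    by (intro clock_path_eq) (use assms in \<open>auto simp: regular_clock_Stream arrival_Suc_Stream\<close>, auto simp: arrival_def)
  with True show ?thesis by simp
next
  case False
  then obtain n where n: "arrival n X \<le> t - fst x" "t - fst x < arrival (Suc n) X"
    using clock_path_interval[OF X, of "t - fst x"] by auto
  then have "clock_path i (x ## X) t = position i (Suc n) (x ## X)"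
    by (intro clock_path_eq) (use assms in \<open>auto simp: regular_clock_Stream arrival_Suc_Stream\<close>)
  moreover have "clock_path (snd x i) X (t - fst x) = position (snd x i) n X"
    using False n by (intro clock_path_eq X) auto
  ultimately show ?thesis
    using False by (simp add: position_Suc_Stream del: position.simps)
qed

lemma time_shift_clock_path_before:
  assumes "regular_clock X" "0 \<le> t" "t < fst x"
  shows "time_shift t (clock_path i (x ## X)) = clock_path i ((fst x - t, snd x) ## X)"
proof
  fix s
  show "time_shift t (clock_path i (x ## X)) s = clock_path i ((fst x - t, snd x) ## X) s"
  proof (cases "s < 0")
    case True then show ?thesis by (simp add: time_shift_def clock_path_def)
  next
    case False
    then show ?thesis
      using assms by (simp add: time_shift_def clock_path_Stream)
        (auto simp: algebra_simps)
  qed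
qed

lemma time_shift_clock_path_after:
  assumes "regular_clock X" "0 < fst x" "fst x \<le> t"
  shows "time_shift t (clock_path i (x ## X)) = time_shift (t - fst x) (clock_path (snd x i) X)"
proof
  fix s
  show "time_shift t (clock_path i (x ## X)) s = time_shift (t - fst x) (clock_path (snd x i) X) s"
    using assms by (simp add: time_shift_def clock_path_Stream algebra_simps)
qed


locale switching =
  fixes \<Lambda> :: "real ^ 'm ^ 'm::finite"
  assumes off_diagonal: "\<And>i j. i \<noteq> j \<Longrightarrow> \<Lambda> $ i $ j \<le> 0"
    and row_sum: "\<And>i. (\<Sum>j\<in>UNIV. \<Lambda> $ i $ j) = 0"
begin

text \<open>The summand \<open>1\<close> keeps the rate positive even if there is a single state and \<open>\<Lambda> = 0\<close>.\<close>

definition rate :: real where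
  "rate = 1 + (\<Sum>i\<in>UNIV. \<bar>\<Lambda> $ i $ i\<bar>)"

definition jump :: "'m \<Rightarrow> 'm \<Rightarrow> real" where
  "jump i k = (if i = k then 1 else 0) - \<Lambda> $ i $ k / rate"

lemma rate_pos: "0 < rate"
  unfolding rate_def by (smt (verit) sum_nonneg abs_ge_zero)

lemma rate_ge: "\<Lambda> $ i $ i \<le> rate"
proof -
  have "\<bar>\<Lambda> $ i $ i\<bar> \<le> (\<Sum>i\<in>UNIV. \<bar>\<Lambda> $ i $ i\<bar>)"
    by (rule member_le_sum) auto
  then show ?thesis by (simp add: rate_def)
qed

lemma jump_nonneg: "0 \<le> jump i k"
  using rate_pos rate_ge[of i] off_diagonal[of i k]
  by (auto simp: jump_def field_simps)

lemma jump_sum: "(\<Sum>k\<in>UNIV. jump i k) = 1"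
  by (simp add: jump_def sum_subtractf sum_divide_distrib[symmetric] row_sum)

definition jump_pmf :: "'m \<Rightarrow> 'm pmf" where
  "jump_pmf i = embed_pmf (jump i)"

lemma pmf_jump: "pmf (jump_pmf i) k = jump i k"
  unfolding jump_pmf_def
  by (rule pmf_embed_pmf)
     (auto simp: jump_nonneg nn_integral_count_space_finite sum_ennreal jump_sum)

text \<open>One map moves all states at once, which makes the successive moves independent and identically
  distributed whatever the current state is.\<close>

definition moves :: "('m \<Rightarrow> 'm) pmf" where
  "moves = Pi_pmf UNIV undefined jump_pmf"

definition tick :: "(real \<times> ('m \<Rightarrow> 'm)) measure" where
  "tick = density lborel (exponential_density rate) \<Otimes>\<^sub>M measure_pmf moves"

definition ticks :: "(real \<times> ('m \<Rightarrow> 'm)) stream measure" where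
  "ticks = stream_space tick"

lemma prob_space_tick: "prob_space tick"
proof -
  interpret A: prob_space "density lborel (exponential_density rate)"
    by (rule prob_space_exponential_density[OF rate_pos])
  interpret B: prob_space "measure_pmf moves" by (rule prob_space_measure_pmf)
  interpret pair_prob_space "density lborel (exponential_density rate)" "measure_pmf moves" ..
  show ?thesis unfolding tick_def by (rule P.prob_space_axioms)
qed

sublocale tick: prob_space tick by (rule prob_space_tick)
sublocale ticks: prob_space ticks
  unfolding ticks_def by (rule tick.prob_space_stream_space)

lemma sets_tick [measurable_cong]: "sets tick = sets (borel \<Otimes>\<^sub>M count_space UNIV)"
  unfolding tick_def by (intro sets_pair_measure_cong) (auto simp: sets_measure_pmf)

lemma space_tick [simp]: "space tick = UNIV"
  unfolding tick_def by (simp add: space_pair_measure)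

lemma sets_ticks [measurable_cong]: "sets ticks = sets (stream_space (borel \<Otimes>\<^sub>M count_space UNIV))"
  unfolding ticks_def by (rule sets_stream_space_cong) (rule sets_tick)

lemma space_ticks [simp]: "space ticks = UNIV"
  unfolding ticks_def by (simp add: space_stream_space)

lemma nn_integral_tick:
  assumes f: "f \<in> borel_measurable tick"
  shows "(\<integral>\<^sup>+x. f x \<partial>tick) =
    (\<integral>\<^sup>+e. ennreal (exponential_density rate e) * (\<integral>\<^sup>+F. f (e, F) \<partial>measure_pmf moves) \<partial>lborel)"
proof -
  have f': "f \<in> borel_measurable (density lborel (exponential_density rate) \<Otimes>\<^sub>M measure_pmf moves)"
    using f by (simp add: tick_def)
  have m: "(\<lambda>e. \<integral>\<^sup>+F. f (e, F) \<partial>measure_pmf moves) \<in> borel_measurable lborel"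
    using measure_pmf.borel_measurable_nn_integral_fst[OF f'] by simp
  show ?thesis
    unfolding tick_def
    by (subst measure_pmf.nn_integral_fst[OF f', symmetric])
       (subst nn_integral_density, use m in auto)
qed

lemma measurable_arrival [measurable]: "arrival n \<in> borel_measurable ticks"
  unfolding arrival_def by measurable

lemma measurable_snd_tick: "(\<lambda>X. snd (X !! n)) \<in> ticks \<rightarrow>\<^sub>M count_space UNIV"
  by measurable

lemma measurable_position: "position i n \<in> ticks \<rightarrow>\<^sub>M count_space UNIV"
proof (induction n)
  case (Suc n)
  have "(\<lambda>X. snd (X !! n) (position i n X)) \<in> ticks \<rightarrow>\<^sub>M count_space UNIV"
    by (rule measurable_compose_countable'[where g = "position i n" and f = "\<lambda>k X. snd (X !! n) k" and I = UNIV])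
       (auto intro!: Suc countable_finite measurable_compose[OF measurable_snd_tick])
  then show ?case by (simp add: fun_eq_iff cong: measurable_cong)
qed (simp add: fun_eq_iff cong: measurable_cong)

lemma measurable_regular_clock [measurable]: "Measurable.pred ticks regular_clock"
  unfolding regular_clock_def by measurable

lemma measurable_clock_path: "clock_path i \<in> ticks \<rightarrow>\<^sub>M path_algebra"
proof (rule measurable_path_algebraI)
  fix s :: real assume s: "0 \<le> s"
  have "(\<lambda>X. position i (LEAST n. s < arrival (Suc n) X) X) \<in> ticks \<rightarrow>\<^sub>M count_space UNIV"
    by (rule measurable_compose_countable[where f = "\<lambda>n X. position i n X"])
       (auto intro: measurable_position)
  then show "(\<lambda>X. clock_path i X s) \<in> ticks \<rightarrow>\<^sub>M count_space UNIV"
    using s by (simp add: clock_path_def)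
qed (rule clock_path_switching)

lemma AE_tick_pos: "AE x in tick. 0 < fst x"
proof -
  have "(\<integral>\<^sup>+x. indicator {x. \<not> 0 < fst x} x \<partial>tick) =
     (\<integral>\<^sup>+e. ennreal (exponential_density rate e) * (\<integral>\<^sup>+F. indicator {x. \<not> 0 < fst x} (e, F) \<partial>measure_pmf moves) \<partial>lborel)"
    by (rule nn_integral_tick) measurable
  also have "\<dots> = (\<integral>\<^sup>+e. 0 \<partial>(lborel :: real measure))"
  proof (rule nn_integral_cong_AE)
    show "AE e in lborel. ennreal (exponential_density rate e) *
        (\<integral>\<^sup>+F. indicator {x. \<not> 0 < fst x} (e, F) \<partial>measure_pmf moves) = 0"
      using AE_lborel_singleton[of 0]
      by eventually_elim (auto simp: exponential_density_def indicator_def)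
  qed
  finally have null: "(\<integral>\<^sup>+x. indicator {x. \<not> 0 < fst x} x \<partial>tick) = 0" by simp
  have [measurable]: "(\<lambda>x. fst x) \<in> borel_measurable tick" by measurable
  have "Measurable.pred tick (\<lambda>x. 0 < fst x)" by measurable
  from AE_iff_nn_integral[OF predE[OF this]] null show ?thesis by blast
qed

lemma nn_integral_exp_neg_tick:
  "(\<integral>\<^sup>+x. ennreal (exp (- fst x)) \<partial>tick) = ennreal (rate / (rate + 1))"
proof -
  interpret A: prob_space "density lborel (exponential_density (rate + 1))"
    by (rule prob_space_exponential_density) (use rate_pos in auto)
  have "(\<integral>\<^sup>+x. ennreal (exp (- fst x)) \<partial>tick) =
     (\<integral>\<^sup>+e. ennreal (exponential_density rate e) * (\<integral>\<^sup>+F. ennreal (exp (- fst (e, F))) \<partial>measure_pmf moves) \<partial>lborel)"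
    by (rule nn_integral_tick) measurable
  also have "\<dots> = (\<integral>\<^sup>+e. ennreal (rate / (rate + 1)) * ennreal (exponential_density (rate + 1) e) \<partial>lborel)"
    using rate_pos
    by (intro nn_integral_cong)
       (simp add: ennreal_mult[symmetric] exponential_density_def exp_add[symmetric] measure_pmf.emeasure_space_1
         field_simps del: ennreal_mult)
  also have "\<dots> = ennreal (rate / (rate + 1)) * emeasure (density lborel (exponential_density (rate + 1))) UNIV"
    by (subst nn_integral_cmult) (auto simp: emeasure_density)
  finally show ?thesis
    using A.emeasure_space_1 by simp
qed

lemma nn_integral_exp_neg_arrival:
  "(\<integral>\<^sup>+X. ennreal (exp (- arrival n X)) \<partial>ticks) = ennreal (rate / (rate + 1)) ^ n"
proof (induction n)
  case 0
  then show ?case by (simp add: arrival_def ticks.emeasure_space_1[simplified])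
next
  case (Suc n)
  have "(\<integral>\<^sup>+X. ennreal (exp (- arrival (Suc n) X)) \<partial>ticks)
      = (\<integral>\<^sup>+x. (\<integral>\<^sup>+X. ennreal (exp (- fst x)) * ennreal (exp (- arrival n X)) \<partial>ticks) \<partial>tick)"
    unfolding ticks_def
    by (subst tick.nn_integral_stream_space)
       (auto simp: ticks_def[symmetric] arrival_Suc_Stream exp_add[symmetric] ennreal_mult[symmetric]
          intro!: nn_integral_cong)
  also have "\<dots> = (\<integral>\<^sup>+x. ennreal (exp (- fst x)) * ennreal (rate / (rate + 1)) ^ n \<partial>tick)"
    by (subst nn_integral_cmult) (auto simp: Suc)
  also have "\<dots> = (\<integral>\<^sup>+x. ennreal (exp (- fst x)) \<partial>tick) * ennreal (rate / (rate + 1)) ^ n"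
    by (rule nn_integral_multc) measurable
  finally show ?case
    by (simp add: nn_integral_exp_neg_tick)
qed

text \<open>The \<open>n\<close>-th arrival time \<open>S\<close> satisfies \<open>E[exp (- S)] = c ^ n\<close> with \<open>c < 1\<close>, so by
  Markov's inequality it cannot stay below a threshold for all \<open>n\<close> with positive probability.\<close>

lemma AE_regular_clock: "AE X in ticks. regular_clock X"
proof -
  have "AE X in ticks. \<exists>n. real K < arrival n X" for K
  proof -
    let ?A = "{X. \<forall>n. arrival n X \<le> real K}"
    let ?c = "rate / (rate + 1)"
    have [measurable]: "?A \<in> sets ticks"
    proof -
      have "{X \<in> space ticks. \<forall>n. arrival n X \<le> real K} \<in> sets ticks" by measurable
      then show ?thesis by simp
    qed
    have c: "0 \<le> ?c" "?c < 1" using rate_pos by auto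
    have le: "emeasure ticks ?A \<le> ennreal (exp (real K) * ?c ^ n)" for n
    proof -
      have "emeasure ticks ?A = (\<integral>\<^sup>+X. indicator ?A X \<partial>ticks)" by simp
      also have "\<dots> \<le> (\<integral>\<^sup>+X. ennreal (exp (real K)) * ennreal (exp (- arrival n X)) \<partial>ticks)"
      proof (rule nn_integral_mono)
        fix X
        show "indicator ?A X \<le> ennreal (exp (real K)) * ennreal (exp (- arrival n X))"
        proof (cases "X \<in> ?A")
          case True
          then have "arrival n X \<le> real K" by simp
          then have "1 \<le> exp (real K) * exp (- arrival n X)"
            by (simp add: exp_add[symmetric])
          then have "ennreal 1 \<le> ennreal (exp (real K) * exp (- arrival n X))"
            by (rule ennreal_leI)
          then show ?thesis using True by (simp add: ennreal_mult)
        qed simp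
      qed
      also have "\<dots> = ennreal (exp (real K)) * ennreal ?c ^ n"
        by (subst nn_integral_cmult) (auto simp: nn_integral_exp_neg_arrival)
      finally show ?thesis
        using c by (simp add: ennreal_mult ennreal_power)
    qed
    have "(\<lambda>n. exp (real K) * ?c ^ n) \<longlonglongrightarrow> exp (real K) * 0"
      using c by (intro tendsto_mult_left LIMSEQ_realpow_zero)
    then have "(\<lambda>n. ennreal (exp (real K) * ?c ^ n)) \<longlonglongrightarrow> ennreal 0"
      by (intro tendsto_ennrealI) simp
    then have "emeasure ticks ?A \<le> ennreal 0"
      by (rule LIMSEQ_le_const) (use le in auto)
    then have "?A \<in> null_sets ticks" by (auto simp: null_sets_def)
    then show ?thesis
      by (rule AE_I') (auto simp: not_less)
  qed
  then have "AE X in ticks. \<forall>K::nat. \<exists>n. real K < arrival n X"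
    by (simp add: AE_all_countable)
  moreover have "AE X in ticks. stream_all (\<lambda>x. 0 < fst x) X"
    unfolding ticks_def by (rule tick.AE_stream_all[OF _ AE_tick_pos]) measurable
  ultimately show ?thesis
    by eventually_elim (auto simp: regular_clock_def stream_all_def)
qed

definition chain :: "'m \<Rightarrow> (real \<Rightarrow> 'm) measure" where
  "chain i = distr ticks path_algebra (clock_path i)"

lemma sets_chain [simp, measurable_cong]: "sets (chain i) = sets path_algebra"
  by (simp add: chain_def)

lemma space_chain [simp]: "space (chain i) = switching_paths"
  by (simp add: chain_def)

lemma prob_space_chain: "prob_space (chain i)"
  unfolding chain_def by (rule ticks.prob_space_distr[OF measurable_clock_path])

sublocale chain: prob_space "chain i" for i by (rule prob_space_chain)

end

section \<open>The Markov property\<close>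

context switching
begin

lemma sets_shift_event:
  assumes [measurable]: "B \<in> sets path_algebra" and t: "0 \<le> t"
  shows "{\<omega> \<in> switching_paths. \<omega> t = j \<and> time_shift t \<omega> \<in> B} \<in> sets (path_algebra :: (real \<Rightarrow> 'm) measure)"
proof -
  have [measurable]: "(\<lambda>\<omega>. \<omega> t) \<in> (path_algebra :: (real \<Rightarrow> 'm) measure) \<rightarrow>\<^sub>M count_space UNIV"
    "time_shift t \<in> path_algebra \<rightarrow>\<^sub>M (path_algebra :: (real \<Rightarrow> 'm) measure)"
    using t by (auto intro: measurable_path_eval measurable_time_shift)
  have "{\<omega> \<in> space path_algebra. \<omega> t = j \<and> time_shift t \<omega> \<in> B} \<in> sets (path_algebra :: (real \<Rightarrow> 'm) measure)"
    by measurable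
  then show ?thesis by simp
qed

definition hit :: "(real \<Rightarrow> 'm) set \<Rightarrow> 'm \<Rightarrow> 'm \<Rightarrow> real \<Rightarrow> real" where
  "hit B j i t = measure (chain i) {\<omega> \<in> switching_paths. \<omega> t = j \<and> time_shift t \<omega> \<in> B}"

definition shift_event :: "(real \<Rightarrow> 'm) set \<Rightarrow> 'm \<Rightarrow> real \<Rightarrow> (real \<Rightarrow> 'm) \<Rightarrow> ennreal" where
  "shift_event B j t \<omega> = indicator {\<omega>. \<omega> t = j \<and> time_shift t \<omega> \<in> B} \<omega>"

lemma measurable_shift_event_joint:
  assumes [measurable]: "B \<in> sets path_algebra"
  shows "(\<lambda>(t, \<omega>). shift_event B j (max 0 t) \<omega>) \<in> borel_measurable (borel \<Otimes>\<^sub>M (path_algebra :: (real \<Rightarrow> 'm) measure))"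
proof -
  have swap: "(\<lambda>(t, \<omega>). (\<omega>, t)) \<in> borel \<Otimes>\<^sub>M (path_algebra :: (real \<Rightarrow> 'm) measure) \<rightarrow>\<^sub>M path_algebra \<Otimes>\<^sub>M borel"
    by measurable
  have [measurable]:
    "(\<lambda>(t, \<omega>). \<omega> (max 0 t)) \<in> borel \<Otimes>\<^sub>M (path_algebra :: (real \<Rightarrow> 'm) measure) \<rightarrow>\<^sub>M count_space UNIV"
    using measurable_compose[OF swap joint_measurable_path] by (simp add: case_prod_beta')
  have [measurable]:
    "(\<lambda>(t, \<omega>). time_shift (max 0 t) \<omega>) \<in> borel \<Otimes>\<^sub>M (path_algebra :: (real \<Rightarrow> 'm) measure) \<rightarrow>\<^sub>M path_algebra"
    using measurable_compose[OF swap joint_measurable_time_shift] by (simp add: case_prod_beta')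
  have "Measurable.pred (borel \<Otimes>\<^sub>M (path_algebra :: (real \<Rightarrow> 'm) measure))
     (\<lambda>x. (case x of (t, \<omega>) \<Rightarrow> \<omega> (max 0 t)) = j \<and> (case x of (t, \<omega>) \<Rightarrow> time_shift (max 0 t) \<omega>) \<in> B)"
    by measurable
  then have "(\<lambda>x. indicator {x. (case x of (t, \<omega>) \<Rightarrow> \<omega> (max 0 t)) = j \<and>
       (case x of (t, \<omega>) \<Rightarrow> time_shift (max 0 t) \<omega>) \<in> B} x :: ennreal)
     \<in> borel_measurable (borel \<Otimes>\<^sub>M (path_algebra :: (real \<Rightarrow> 'm) measure))"
    by (intro borel_measurable_indicator') auto
  then show ?thesis
    by (simp add: shift_event_def indicator_def case_prod_beta' cong: if_cong)
qed

lemma hit_nn_integral: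
  assumes B: "B \<in> sets path_algebra" and t: "0 \<le> t"
  shows "ennreal (hit B j i t) = (\<integral>\<^sup>+\<omega>. shift_event B j t \<omega> \<partial>chain i)"
proof -
  have "(\<integral>\<^sup>+\<omega>. shift_event B j t \<omega> \<partial>chain i) =
      (\<integral>\<^sup>+\<omega>. indicator {\<omega> \<in> switching_paths. \<omega> t = j \<and> time_shift t \<omega> \<in> B} \<omega> \<partial>chain i)"
    by (intro nn_integral_cong) (auto simp: shift_event_def indicator_def)
  also have "\<dots> = emeasure (chain i) {\<omega> \<in> switching_paths. \<omega> t = j \<and> time_shift t \<omega> \<in> B}"
    using sets_shift_event[OF B t] by simp
  finally show ?thesis
    by (simp add: hit_def chain.emeasure_eq_measure)
qed

lemma measurable_hit:
  assumes B: "B \<in> sets path_algebra"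
  shows "(\<lambda>t. hit B j i (max 0 t)) \<in> borel_measurable borel"
proof -
  have "(\<lambda>(t, \<omega>). shift_event B j (max 0 t) \<omega>) \<in> borel_measurable (borel \<Otimes>\<^sub>M chain i)"
    using measurable_shift_event_joint[OF B] by (simp cong: measurable_cong_sets sets_pair_measure_cong)
  then have "(\<lambda>t. \<integral>\<^sup>+\<omega>. shift_event B j (max 0 t) \<omega> \<partial>chain i) \<in> borel_measurable borel"
    by (rule chain.borel_measurable_nn_integral)
  then have "(\<lambda>t. enn2real (ennreal (hit B j i (max 0 t)))) \<in> borel_measurable borel"
    by (simp add: hit_nn_integral[OF B])
  then show ?thesis by (simp add: hit_def)
qed

lemma measurable_shift_event:
  assumes B: "B \<in> sets path_algebra" and t: "0 \<le> t"
  shows "shift_event B j t \<in> borel_measurable (path_algebra :: (real \<Rightarrow> 'm) measure)"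
  using measurable_compose[OF measurable_Pair1'[of t borel path_algebra] measurable_shift_event_joint[OF B, of j]] t
  by simp

lemma nn_integral_chain:
  assumes "f \<in> borel_measurable path_algebra"
  shows "(\<integral>\<^sup>+\<omega>. f \<omega> \<partial>chain i) = (\<integral>\<^sup>+X. f (clock_path i X) \<partial>ticks)"
  unfolding chain_def by (rule nn_integral_distr[OF measurable_clock_path]) (use assms in simp)

lemma nn_integral_moves:
  "(\<integral>\<^sup>+F. f (F i) \<partial>measure_pmf moves) = (\<Sum>k\<in>UNIV. f k * ennreal (jump i k))"
proof -
  have "map_pmf (\<lambda>F. F i) moves = jump_pmf i"
    unfolding moves_def by (subst Pi_pmf_component) auto
  then have "(\<integral>\<^sup>+F. f (F i) \<partial>measure_pmf moves) = (\<integral>\<^sup>+k. f k \<partial>measure_pmf (jump_pmf i))"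
    by (metis nn_integral_map_pmf)
  also have "\<dots> = (\<Sum>k\<in>UNIV. f k * ennreal (jump i k))"
    by (subst nn_integral_measure_pmf_support[of UNIV]) (auto simp: pmf_jump)
  finally show ?thesis .
qed

lemma measurable_Stream_ticks:
  "(\<lambda>(x, X). x ## X) \<in> tick \<Otimes>\<^sub>M ticks \<rightarrow>\<^sub>M ticks"
  unfolding ticks_def by measurable

lemma measurable_first_tick:
  assumes f: "f \<in> borel_measurable path_algebra"
  shows "(\<lambda>x. \<integral>\<^sup>+X. f (clock_path i (x ## X)) \<partial>ticks) \<in> borel_measurable tick"
proof (rule ticks.borel_measurable_nn_integral)
  show "(\<lambda>(x, X). f (clock_path i (x ## X))) \<in> borel_measurable (tick \<Otimes>\<^sub>M ticks)"
    using measurable_compose[OF measurable_Stream_ticks measurable_compose[OF measurable_clock_path f]]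
    by (simp add: case_prod_beta')
qed

lemma nn_integral_chain_first_tick:
  assumes f: "f \<in> borel_measurable path_algebra"
  shows "(\<integral>\<^sup>+\<omega>. f \<omega> \<partial>chain i) = (\<integral>\<^sup>+e. ennreal (exponential_density rate e) *
     (\<integral>\<^sup>+F. (\<integral>\<^sup>+X. f (clock_path i ((e, F) ## X)) \<partial>ticks) \<partial>measure_pmf moves) \<partial>lborel)"
proof -
  have "(\<integral>\<^sup>+\<omega>. f \<omega> \<partial>chain i) = (\<integral>\<^sup>+X. f (clock_path i X) \<partial>ticks)"
    by (rule nn_integral_chain[OF f])
  also have "\<dots> = (\<integral>\<^sup>+x. (\<integral>\<^sup>+X. f (clock_path i (x ## X)) \<partial>ticks) \<partial>tick)"
    using measurable_compose[OF measurable_clock_path f]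
    unfolding ticks_def by (rule tick.nn_integral_stream_space)
  also have "\<dots> = (\<integral>\<^sup>+e. ennreal (exponential_density rate e) *
     (\<integral>\<^sup>+F. (\<integral>\<^sup>+X. f (clock_path i ((e, F) ## X)) \<partial>ticks) \<partial>measure_pmf moves) \<partial>lborel)"
    by (rule nn_integral_tick[OF measurable_first_tick[OF f]])
  finally show ?thesis .
qed

text \<open>Condition on the first ring \<open>e\<close>. If \<open>t < e\<close>, the state has not moved, and since the exponential
  distribution has no memory the remaining wait \<open>e - t\<close> starts a fresh path from \<open>i\<close>. If \<open>e \<le> t\<close>, the process starts
  afresh from the state to which the first map sends \<open>i\<close>, with time \<open>t - e\<close> to go.\<close>

lemma hit_renewal_nn:
  assumes B: "B \<in> sets path_algebra" and t: "0 \<le> t"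
  shows "ennreal (hit B j i t) = ennreal (exp (- rate * t) * (if i = j then measure (chain i) B else 0)) +
    (\<integral>\<^sup>+e. ennreal (rate * exp (- rate * e) * (\<Sum>k\<in>UNIV. jump i k * hit B j k (max 0 (t - e)))) *
       indicator {0..t} e \<partial>lborel)"
proof -
  let ?d = "\<lambda>e. ennreal (exponential_density rate e)"
  let ?K = "\<lambda>r. (\<integral>\<^sup>+F. (\<integral>\<^sup>+X. indicator B (clock_path i ((r, F) ## X)) \<partial>ticks) \<partial>measure_pmf moves) :: ennreal"
  let ?J = "\<lambda>e. \<Sum>k\<in>UNIV. ennreal (hit B j k (max 0 (t - e))) * ennreal (jump i k)"
  have IB: "indicator B \<in> borel_measurable path_algebra" using B by simp
  have inner: "(\<integral>\<^sup>+F. (\<integral>\<^sup>+X. shift_event B j t (clock_path i ((e, F) ## X)) \<partial>ticks) \<partial>measure_pmf moves)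
      = (if t < e then (if i = j then ?K (e - t) else 0) else ?J e)" if e: "0 < e" for e
  proof (cases "t < e")
    case True
    have "(\<integral>\<^sup>+X. shift_event B j t (clock_path i ((e, F) ## X)) \<partial>ticks) =
       (if i = j then \<integral>\<^sup>+X. indicator B (clock_path i ((e - t, F) ## X)) \<partial>ticks else 0)" for F
    proof -
      have "(\<integral>\<^sup>+X. shift_event B j t (clock_path i ((e, F) ## X)) \<partial>ticks) =
       (\<integral>\<^sup>+X. (if i = j then indicator B (clock_path i ((e - t, F) ## X)) else 0) \<partial>ticks)"
      proof (rule nn_integral_cong_AE)
        show "AE X in ticks. shift_event B j t (clock_path i ((e, F) ## X)) =
          (if i = j then indicator B (clock_path i ((e - t, F) ## X)) else 0)"
          using AE_regular_clock
          by eventually_elim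
            (use True e t in \<open>auto simp: shift_event_def indicator_def clock_path_Stream time_shift_clock_path_before\<close>)
      qed
      then show ?thesis by simp
    qed
    with True show ?thesis by simp
  next
    case False
    have "(\<integral>\<^sup>+X. shift_event B j t (clock_path i ((e, F) ## X)) \<partial>ticks) =
        ennreal (hit B j (F i) (max 0 (t - e)))" for F
    proof -
      have "(\<integral>\<^sup>+X. shift_event B j t (clock_path i ((e, F) ## X)) \<partial>ticks) =
         (\<integral>\<^sup>+X. shift_event B j (t - e) (clock_path (F i) X) \<partial>ticks)"
      proof (rule nn_integral_cong_AE)
        show "AE X in ticks. shift_event B j t (clock_path i ((e, F) ## X)) =
          shift_event B j (t - e) (clock_path (F i) X)"
          using AE_regular_clock
          by eventually_elim
            (use False e t in \<open>auto simp: shift_event_def indicator_def clock_path_Stream time_shift_clock_path_after\<close>)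
      qed
      also have "\<dots> = (\<integral>\<^sup>+\<omega>. shift_event B j (t - e) \<omega> \<partial>chain (F i))"
        by (rule nn_integral_chain[symmetric], rule measurable_shift_event[OF B]) (use False in auto)
      also have "\<dots> = ennreal (hit B j (F i) (t - e))"
        by (rule hit_nn_integral[OF B, symmetric]) (use False in auto)
      finally show ?thesis using False by simp
    qed
    then show ?thesis
      using False nn_integral_moves[of "\<lambda>k. ennreal (hit B j k (max 0 (t - e)))" i] by simp
  qed
  have K_meas [measurable]: "?K \<in> borel_measurable borel"
  proof -
    have "(\<lambda>x. \<integral>\<^sup>+X. indicator B (clock_path i (x ## X)) \<partial>ticks) \<in> borel_measurable (borel \<Otimes>\<^sub>M measure_pmf moves)"
      using measurable_first_tick[OF IB, of i] by (simp add: tick_def cong: measurable_cong_sets sets_pair_measure_cong)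
    from measure_pmf.borel_measurable_nn_integral_fst[OF this] show ?thesis by simp
  qed
  have hit_meas [measurable]: "(\<lambda>e. hit B j k (max 0 (t - e))) \<in> borel_measurable borel" for k
    using measurable_compose[OF _ measurable_hit[OF B, of j k], of "\<lambda>e. t - e" borel] by simp
  have "ennreal (hit B j i t) = (\<integral>\<^sup>+\<omega>. shift_event B j t \<omega> \<partial>chain i)"
    by (rule hit_nn_integral[OF B t])
  also have "\<dots> = (\<integral>\<^sup>+e. ?d e *
     (\<integral>\<^sup>+F. (\<integral>\<^sup>+X. shift_event B j t (clock_path i ((e, F) ## X)) \<partial>ticks) \<partial>measure_pmf moves) \<partial>lborel)"
    by (rule nn_integral_chain_first_tick[OF measurable_shift_event[OF B t]])
  also have "\<dots> = (\<integral>\<^sup>+e. (if i = j then ?d e * ?K (e - t) * indicator {t<..} e else 0) + ?d e * ?J e * indicator {0..t} e \<partial>lborel)"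
  proof (rule nn_integral_cong_AE)
    show "AE e in lborel. ?d e *
       (\<integral>\<^sup>+F. (\<integral>\<^sup>+X. shift_event B j t (clock_path i ((e, F) ## X)) \<partial>ticks) \<partial>measure_pmf moves) =
       (if i = j then ?d e * ?K (e - t) * indicator {t<..} e else 0) + ?d e * ?J e * indicator {0..t} e"
      using AE_lborel_singleton[of 0]
    proof eventually_elim
      case (elim e)
      show ?case
      proof (cases "0 < e")
        case True
        show ?thesis unfolding inner[OF True] using True by (auto simp: indicator_def)
      next
        case False
        with elim t show ?thesis by (simp add: exponential_density_def indicator_def)
      qed
    qed
  qed
  also have "\<dots> = (\<integral>\<^sup>+e. (if i = j then ?d e * ?K (e - t) * indicator {t<..} e else 0) \<partial>lborel)
      + (\<integral>\<^sup>+e. ?d e * ?J e * indicator {0..t} e \<partial>lborel)"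
    by (rule nn_integral_add) measurable
  also have "(\<integral>\<^sup>+e. (if i = j then ?d e * ?K (e - t) * indicator {t<..} e else 0) \<partial>lborel) =
      ennreal (exp (- rate * t) * (if i = j then measure (chain i) B else 0))"
  proof (cases "i = j")
    case True
    have "(\<integral>\<^sup>+e. ?d e * ?K (e - t) * indicator {t<..} e \<partial>lborel) =
      (\<integral>\<^sup>+r. ?d (t + r) * ?K (t + r - t) * indicator {t<..} (t + r) \<partial>lborel)"
      by (subst nn_integral_real_affine[where c = 1 and t = t]) simp_all
    also have "\<dots> = (\<integral>\<^sup>+r. ennreal (exp (- rate * t)) * (?d r * ?K r) \<partial>lborel)"
    proof (rule nn_integral_cong_AE)
      show "AE r in lborel. ?d (t + r) * ?K (t + r - t) * indicator {t<..} (t + r) =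
        ennreal (exp (- rate * t)) * (?d r * ?K r)"
        using AE_lborel_singleton[of 0]
      proof eventually_elim
        case (elim r)
        have "?d (t + r) = ennreal (exp (- rate * t)) * ?d r" if "0 < r"
          using that t rate_pos
          by (simp add: exponential_density_def ennreal_mult[symmetric] exp_add[symmetric] algebra_simps)
        then show ?case
          using elim by (cases "0 < r") (auto simp: exponential_density_def mult.assoc)
      qed
    qed
    also have "\<dots> = ennreal (exp (- rate * t)) * (\<integral>\<^sup>+r. ?d r * ?K r \<partial>lborel)"
      by (rule nn_integral_cmult) measurable
    also have "(\<integral>\<^sup>+r. ?d r * ?K r \<partial>lborel) = (\<integral>\<^sup>+\<omega>. indicator B \<omega> \<partial>chain i)"
      by (rule nn_integral_chain_first_tick[OF IB, symmetric])
    also have "\<dots> = ennreal (measure (chain i) B)"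
      using B by (simp add: chain.emeasure_eq_measure)
    finally show ?thesis
      using True by (simp add: ennreal_mult)
  qed simp
  also have "(\<integral>\<^sup>+e. ?d e * ?J e * indicator {0..t} e \<partial>lborel) =
    (\<integral>\<^sup>+e. ennreal (rate * exp (- rate * e) * (\<Sum>k\<in>UNIV. jump i k * hit B j k (max 0 (t - e)))) *
       indicator {0..t} e \<partial>lborel)"
  proof (rule nn_integral_cong)
    fix e
    define S where "S = (\<Sum>k\<in>UNIV. jump i k * hit B j k (max 0 (t - e)))"
    have S: "0 \<le> S"
      unfolding S_def by (intro sum_nonneg mult_nonneg_nonneg jump_nonneg) (simp add: hit_def)
    have "?J e = ennreal S"
      unfolding S_def
      by (subst sum_ennreal[symmetric])
         (auto simp: hit_def jump_nonneg ennreal_mult[symmetric] mult.commute intro!: sum.cong)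
    then have "?d e * ?J e * indicator {0..t} e = ennreal (rate * exp (- rate * e) * S) * indicator {0..t} e"
      using rate_pos S by (auto simp: indicator_def exponential_density_def ennreal_mult[symmetric] mult.commute)
    then show "?d e * ?J e * indicator {0..t} e =
       ennreal (rate * exp (- rate * e) * (\<Sum>k\<in>UNIV. jump i k * hit B j k (max 0 (t - e)))) * indicator {0..t} e"
      by (simp only: S_def)
  qed
  finally show ?thesis .
qed

lemma hit_le_1: "hit B j i t \<le> 1" and hit_nonneg: "0 \<le> hit B j i t"
  by (auto simp: hit_def)

lemma integrable_renewal_kernel:
  assumes [measurable]: "\<And>k. g k \<in> borel_measurable borel" and C: "\<And>k e. e \<in> {0..t} \<Longrightarrow> \<bar>g k e\<bar> \<le> C"
  shows "set_integrable lborel {0..t} (\<lambda>e. rate * exp (- rate * e) * (\<Sum>k\<in>UNIV. jump i k * g k e))"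
  unfolding set_integrable_def
proof (rule Bochner_Integration.integrable_bound)
  show "integrable lborel (\<lambda>e. indicator {0..t} e * (rate * C) :: real)"
    by (rule integrable_mult_left) (auto simp: integrable_indicator_iff emeasure_lborel_Icc_eq)
  show "AE e in lborel. norm (indicator {0..t} e *\<^sub>R (rate * exp (- rate * e) * (\<Sum>k\<in>UNIV. jump i k * g k e)))
      \<le> norm (indicator {0..t} e * (rate * C))"
  proof (rule AE_I2)
    fix e :: real
    show "norm (indicator {0..t} e *\<^sub>R (rate * exp (- rate * e) * (\<Sum>k\<in>UNIV. jump i k * g k e)))
      \<le> norm (indicator {0..t} e * (rate * C))"
    proof (cases "e \<in> {0..t}")
      case True
      have "\<bar>\<Sum>k\<in>UNIV. jump i k * g k e\<bar> \<le> (\<Sum>k\<in>UNIV. jump i k * C)"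
        using C[OF True] by (intro order_trans[OF sum_abs] sum_mono) (auto simp: abs_mult jump_nonneg intro!: mult_left_mono)
      also have "\<dots> = C" by (simp add: sum_distrib_right[symmetric] jump_sum)
      finally have 1: "\<bar>\<Sum>k\<in>UNIV. jump i k * g k e\<bar> \<le> C" .
      have "exp (- rate * e) \<le> 1" using True rate_pos by simp
      then have "exp (- rate * e) * \<bar>\<Sum>k\<in>UNIV. jump i k * g k e\<bar> \<le> 1 * C"
        by (intro mult_mono 1) auto
      then show ?thesis
        using True rate_pos 1 by (simp add: abs_mult mult.assoc)
    qed simp
  qed
qed measurable

lemma hit_renewal:
  assumes B: "B \<in> sets path_algebra" and t: "0 \<le> t"
  shows "hit B j i t = exp (- rate * t) * (if i = j then measure (chain i) B else 0) +
    (LBINT e:{0..t}. rate * exp (- rate * e) * (\<Sum>k\<in>UNIV. jump i k * hit B j k (max 0 (t - e))))"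
proof -
  let ?f = "\<lambda>e. rate * exp (- rate * e) * (\<Sum>k\<in>UNIV. jump i k * hit B j k (max 0 (t - e)))"
  have [measurable]: "(\<lambda>e. hit B j k (max 0 (t - e))) \<in> borel_measurable borel" for k
    using measurable_compose[OF _ measurable_hit[OF B, of j k], of "\<lambda>e. t - e" borel] by simp
  have nn: "0 \<le> ?f e" for e
    using rate_pos by (intro mult_nonneg_nonneg sum_nonneg jump_nonneg hit_nonneg) auto
  have int: "set_integrable lborel {0..t} ?f"
    by (rule integrable_renewal_kernel[where C = 1]) (auto simp: hit_le_1 hit_nonneg abs_of_nonneg)
  have "(\<integral>\<^sup>+e. ennreal (?f e) * indicator {0..t} e \<partial>lborel) = (\<integral>\<^sup>+e. ennreal (indicator {0..t} e *\<^sub>R ?f e) \<partial>lborel)"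
    by (intro nn_integral_cong) (auto simp: indicator_def)
  also have "\<dots> = ennreal (LBINT e:{0..t}. ?f e)"
    unfolding set_lebesgue_integral_def
    by (rule nn_integral_eq_integral) (use int nn in \<open>auto simp: set_integrable_def\<close>)
  finally have eq: "(\<integral>\<^sup>+e. ennreal (?f e) * indicator {0..t} e \<partial>lborel) = ennreal (LBINT e:{0..t}. ?f e)" .
  have I0: "0 \<le> (LBINT e:{0..t}. ?f e)"
    unfolding set_lebesgue_integral_def by (intro Bochner_Integration.integral_nonneg) (use nn in auto)
  have "ennreal (hit B j i t) = ennreal (exp (- rate * t) * (if i = j then measure (chain i) B else 0) + (LBINT e:{0..t}. ?f e))"
    using hit_renewal_nn[OF B t, of j i] I0 unfolding eq by (simp add: ennreal_plus[symmetric] del: ennreal_plus)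
  then show ?thesis
    by (rule ennreal_inj[THEN iffD1, rotated 2]) (use I0 in \<open>auto simp: hit_nonneg\<close>)
qed

lemma exponential_integral:
  assumes "0 \<le> t"
  shows "(LBINT e:{0..t}. rate * exp (- rate * e)) = 1 - exp (- rate * t)"
proof -
  have "(\<integral>e. rate * exp (- rate * e) * indicator {0..t} e \<partial>lborel) = - exp (- rate * t) - (- exp (- rate * 0))"
    by (rule integral_FTC_Icc_real) (use assms in \<open>auto intro!: derivative_eq_intros continuous_intros\<close>)
  moreover have "(LBINT e:{0..t}. rate * exp (- rate * e)) = (\<integral>e. rate * exp (- rate * e) * indicator {0..t} e \<partial>lborel)"
    unfolding set_lebesgue_integral_def by (rule Bochner_Integration.integral_cong) auto
  ultimately show ?thesis by simp
qed

text \<open>Both sides solve the same renewal equation, and the difference of two solutions that are bounded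
  on \<open>[0, T]\<close> vanishes there because the renewal operator is a contraction.\<close>

lemma markov:
  assumes B: "B \<in> sets path_algebra" and t: "0 \<le> t"
  shows "measure (chain i) {\<omega> \<in> switching_paths. \<omega> t = j \<and> time_shift t \<omega> \<in> B}
    = transition \<Lambda> t i j * measure (chain j) B"
proof -
  define T where "T = t"
  define \<beta> where "\<beta> = measure (chain j) B"
  \<comment> \<open>the difference of two solutions of the renewal equation\<close>
  define D where "D k s = hit B j k (max 0 s) - transition \<Lambda> s k j * \<beta>" for k s
  have [measurable]: "(\<lambda>s. hit B j k (max 0 s)) \<in> borel_measurable borel" for k
    by (rule measurable_hit[OF B])
  have D_meas [measurable]: "D k \<in> borel_measurable borel" for k
    unfolding D_def by measurable
  obtain C where C: "\<And>k s. s \<in> {0..T} \<Longrightarrow> \<bar>D k s\<bar> \<le> C"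
  proof -
    have "\<exists>C. \<forall>s\<in>{0..T}. \<bar>transition \<Lambda> s k j\<bar> \<le> C" for k
    proof -
      have "bounded ((\<lambda>s. transition \<Lambda> s k j) ` {0..T})"
        by (intro compact_imp_bounded compact_continuous_image continuous_transition compact_Icc)
      then show ?thesis by (auto simp: bounded_iff)
    qed
    then obtain c where c: "\<And>k s. s \<in> {0..T} \<Longrightarrow> \<bar>transition \<Lambda> s k j\<bar> \<le> c k" by metis
    show ?thesis
    proof (rule that)
      fix k s assume s: "s \<in> {0..T}"
      have "\<bar>transition \<Lambda> s k j\<bar> \<le> (\<Sum>k\<in>UNIV. \<bar>c k\<bar>)"
        using c[OF s, of k] member_le_sum[of k UNIV "\<lambda>k. \<bar>c k\<bar>"] by auto
      moreover have "\<bar>transition \<Lambda> s k j * \<beta>\<bar> \<le> \<bar>transition \<Lambda> s k j\<bar> * 1"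
        unfolding abs_mult by (intro mult_left_mono) (auto simp: \<beta>_def)
      ultimately show "\<bar>D k s\<bar> \<le> 1 + (\<Sum>k\<in>UNIV. \<bar>c k\<bar>)"
        using hit_le_1[of B j k "max 0 s"] hit_nonneg[of B j k "max 0 s"] unfolding D_def by linarith
    qed
  qed
  have D_eq: "D k s = (LBINT e:{0..s}. rate * exp (- rate * e) * (\<Sum>l\<in>UNIV. jump k l * D l (s - e)))"
    if s: "s \<in> {0..T}" for k s
  proof -
    have s0: "0 \<le> s" using s by simp
    let ?h = "\<lambda>e. rate * exp (- rate * e) * (\<Sum>l\<in>UNIV. jump k l * hit B j l (max 0 (s - e)))"
    let ?p = "\<lambda>e. rate * exp (- rate * e) * (\<Sum>l\<in>UNIV. jump k l * (transition \<Lambda> (s - e) l j * \<beta>))"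
    have [measurable]: "(\<lambda>e. hit B j l (max 0 (s - e))) \<in> borel_measurable borel" for l
      using measurable_compose[OF _ measurable_hit[OF B, of j l], of "\<lambda>e. s - e" borel] by simp
    have p_meas: "(\<lambda>e. transition \<Lambda> (s - e) l j * \<beta>) \<in> borel_measurable borel" for l
      by measurable
    have "\<bar>transition \<Lambda> (s - e) l j * \<beta>\<bar> \<le> C + 1" if "e \<in> {0..s}" for l e
    proof -
      have "s - e \<in> {0..T}" using that s by auto
      from C[OF this, of l] show ?thesis
        using hit_le_1[of B j l "max 0 (s - e)"] hit_nonneg[of B j l "max 0 (s - e)"] unfolding D_def by linarith
    qed
    then have ip: "set_integrable lborel {0..s} ?p"
      by (intro integrable_renewal_kernel p_meas)
    have ih: "set_integrable lborel {0..s} ?h"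
      by (rule integrable_renewal_kernel[where C = 1]) (auto simp: hit_le_1 hit_nonneg abs_of_nonneg)
    have "transition \<Lambda> s k j * \<beta> = exp (- rate * s) * (if k = j then \<beta> else 0) +
       (LBINT e:{0..s}. rate * exp (- rate * e) * (\<Sum>l\<in>UNIV. jump k l * transition \<Lambda> (s - e) l j)) * \<beta>"
      by (subst transition_renewal[OF rate_pos s0]) (simp add: jump_def algebra_simps)
    also have "(LBINT e:{0..s}. rate * exp (- rate * e) * (\<Sum>l\<in>UNIV. jump k l * transition \<Lambda> (s - e) l j)) * \<beta> =
       (LBINT e:{0..s}. ?p e)"
      unfolding set_integral_mult_left[symmetric]
      by (simp only: sum_distrib_right mult.assoc sum_distrib_left[symmetric])
    finally have p: "transition \<Lambda> s k j * \<beta> = exp (- rate * s) * (if k = j then \<beta> else 0) + (LBINT e:{0..s}. ?p e)" .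
    have h: "hit B j k s = exp (- rate * s) * (if k = j then \<beta> else 0) + (LBINT e:{0..s}. ?h e)"
      using hit_renewal[OF B s0, of j k] by (auto simp: \<beta>_def)
    have "D k s = (LBINT e:{0..s}. ?h e) - (LBINT e:{0..s}. ?p e)"
      using h p s0 by (simp add: D_def)
    also have "\<dots> = (LBINT e:{0..s}. ?h e - ?p e)"
      by (rule set_integral_diff(2)[OF ih ip, symmetric])
    also have "(\<lambda>e. ?h e - ?p e) = (\<lambda>e. rate * exp (- rate * e) * (\<Sum>l\<in>UNIV. jump k l * D l (s - e)))"
      by (simp only: D_def right_diff_distrib sum_subtractf)
    finally show ?thesis .
  qed
  define c where "c = 1 - exp (- rate * T)"
  have c: "0 \<le> c" "c < 1" using t rate_pos by (auto simp: c_def T_def)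
  have C0: "0 \<le> C" using C[of 0 undefined] t by (auto simp: T_def)
  have bound: "\<bar>D k s\<bar> \<le> C * c ^ n" if "s \<in> {0..T}" for n k s
    using that
  proof (induction n arbitrary: k s)
    case 0 then show ?case using C by simp
  next
    case (Suc n)
    have s0: "0 \<le> s" using Suc by simp
    have Dse: "D l (s - e) \<le> C * c ^ n \<and> - (C * c ^ n) \<le> D l (s - e)" if "e \<in> {0..s}" for l e
      using Suc.IH[of "s - e" l] Suc.prems that by auto
    have intD: "set_integrable lborel {0..s} (\<lambda>e. rate * exp (- rate * e) * (\<Sum>l\<in>UNIV. jump k l * D l (s - e)))"
      by (rule integrable_renewal_kernel[where C = "C * c ^ n"]) (use Dse in \<open>auto simp: abs_le_iff minus_le_iff\<close>)
    have intC: "set_integrable lborel {0..s} (\<lambda>e. rate * exp (- rate * e) * (C * c ^ n))"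
      by (rule borel_integrable_atLeastAtMost'[unfolded set_integrable_def[symmetric]]) (intro continuous_intros)
    have "\<bar>D k s\<bar> = \<bar>LBINT e:{0..s}. rate * exp (- rate * e) * (\<Sum>l\<in>UNIV. jump k l * D l (s - e))\<bar>"
      using D_eq[OF Suc.prems] by simp
    also have "\<dots> \<le> (LBINT e:{0..s}. \<bar>rate * exp (- rate * e) * (\<Sum>l\<in>UNIV. jump k l * D l (s - e))\<bar>)"
      using set_integral_norm_bound[OF intD] by simp
    also have "\<dots> \<le> (LBINT e:{0..s}. rate * exp (- rate * e) * (C * c ^ n))"
    proof (rule set_integral_mono)
      show "set_integrable lborel {0..s} (\<lambda>e. \<bar>rate * exp (- rate * e) * (\<Sum>l\<in>UNIV. jump k l * D l (s - e))\<bar>)"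
        by (rule set_integrable_abs[OF intD])
      fix e assume e: "e \<in> {0..s}"
      have "\<bar>\<Sum>l\<in>UNIV. jump k l * D l (s - e)\<bar> \<le> (\<Sum>l\<in>UNIV. jump k l * (C * c ^ n))"
        using Dse[OF e]
        by (intro order_trans[OF sum_abs] sum_mono) (auto simp: abs_mult jump_nonneg abs_le_iff minus_le_iff intro!: mult_left_mono)
      also have "\<dots> = C * c ^ n" by (simp add: sum_distrib_right[symmetric] jump_sum)
      finally show "\<bar>rate * exp (- rate * e) * (\<Sum>l\<in>UNIV. jump k l * D l (s - e))\<bar> \<le> rate * exp (- rate * e) * (C * c ^ n)"
        using rate_pos by (simp add: abs_mult)
    qed (rule intC)
    also have "\<dots> = (1 - exp (- rate * s)) * (C * c ^ n)"
      by (simp only: set_integral_mult_left exponential_integral[OF s0])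
    also have "\<dots> \<le> c * (C * c ^ n)"
      using Suc.prems rate_pos c C0 by (intro mult_right_mono) (auto simp: c_def)
    finally show ?case by (simp add: mult_ac)
  qed
  have "(\<lambda>n. C * c ^ n) \<longlonglongrightarrow> C * 0"
    using c by (intro tendsto_mult_left LIMSEQ_realpow_zero)
  then have "\<bar>D i T\<bar> \<le> C * 0"
    by (rule LIMSEQ_le_const) (use bound[of T] t in \<open>auto simp: T_def\<close>)
  then have "D i T = 0" by simp
  then show ?thesis
    using t by (simp add: D_def T_def \<beta>_def hit_def)
qed

lemma chain_marginal:
  assumes "0 \<le> t"
  shows "measure (chain i) {\<omega> \<in> switching_paths. \<omega> t = j} = transition \<Lambda> t i j"
proof -
  have "{\<omega> \<in> switching_paths. \<omega> t = j} = {\<omega> \<in> switching_paths. \<omega> t = j \<and> time_shift t \<omega> \<in> switching_paths}"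
    using assms by (auto intro: time_shift_cadlag)
  then show ?thesis
    using markov[OF sets.top assms, of i j] chain.prob_space[of j] by simp
qed

end

section \<open>The path law and conditioning on the past\<close>

text \<open>Each entry gives the time elapsed since the previous visit, so that recursion on the list matches
  shifting the path.\<close>

primrec visits :: "(real \<times> 'm) list \<Rightarrow> (real \<Rightarrow> 'm) \<Rightarrow> bool" where
  "visits [] \<omega> = True"
| "visits (c # cs) \<omega> = (\<omega> (fst c) = snd c \<and> visits cs (time_shift (fst c) \<omega>))"

lemma time_shift_time_shift:
  "0 \<le> s \<Longrightarrow> s \<le> t \<Longrightarrow> time_shift (t - s) (time_shift s \<omega>) = time_shift t \<omega>"
  by (auto simp: time_shift_def fun_eq_iff)

lemma time_shift_0: "\<omega> \<in> cadlag_paths T \<Longrightarrow> time_shift 0 \<omega> = \<omega>"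
  by (auto simp: time_shift_def fun_eq_iff cadlag_paths_def extensional_def)

lemma sets_switching_paths [simp]: "switching_paths \<in> sets path_algebra"
  using sets.top[of path_algebra] by simp

lemma measurable_visits:
  "\<forall>c\<in>set cs. 0 \<le> fst c \<Longrightarrow> {\<omega> \<in> switching_paths. visits cs \<omega>} \<in> sets (path_algebra :: (real \<Rightarrow> 'm::finite) measure)"
proof (induction cs)
  case Nil
  have "space path_algebra \<in> sets (path_algebra :: (real \<Rightarrow> 'm) measure)" by (rule sets.top)
  then show ?case by simp
next
  case (Cons c cs)
  then have [measurable]: "(\<lambda>\<omega>. \<omega> (fst c)) \<in> (path_algebra :: (real \<Rightarrow> 'm) measure) \<rightarrow>\<^sub>M count_space UNIV"
    "time_shift (fst c) \<in> path_algebra \<rightarrow>\<^sub>M (path_algebra :: (real \<Rightarrow> 'm) measure)"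
    "{\<omega> \<in> switching_paths. visits cs \<omega>} \<in> sets (path_algebra :: (real \<Rightarrow> 'm) measure)"
    by (auto intro: measurable_path_eval measurable_time_shift)
  have "{\<omega> \<in> space path_algebra. \<omega> (fst c) = snd c \<and> time_shift (fst c) \<omega> \<in> {\<omega> \<in> switching_paths. visits cs \<omega>}}
    \<in> sets (path_algebra :: (real \<Rightarrow> 'm) measure)"
    by measurable
  also have "{\<omega> \<in> space path_algebra. \<omega> (fst c) = snd c \<and> time_shift (fst c) \<omega> \<in> {\<omega> \<in> switching_paths. visits cs \<omega>}}
     = {\<omega> \<in> switching_paths. visits (c # cs) \<omega>}"
    using Cons.prems by (auto intro: time_shift_cadlag)
  finally show ?case .
qed

lemma constraints_as_visits:
  assumes "sorted (map fst L)" "\<forall>p\<in>set L. r \<le> fst p \<and> fst p \<le> t" "0 \<le> r" "r \<le> t"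
  shows "\<exists>cs. (\<forall>c\<in>set cs. 0 \<le> fst c) \<and> sum_list (map fst cs) \<le> t - r \<and>
     (\<forall>\<omega>. visits cs (time_shift r \<omega>) \<longleftrightarrow> (\<forall>p\<in>set L. \<omega> (fst p) = snd p))"
  using assms
proof (induction L arbitrary: r)
  case Nil
  then show ?case by (intro exI[of _ "[]"]) auto
next
  case (Cons p L)
  have r: "0 \<le> r" "r \<le> fst p" "fst p \<le> t" using Cons.prems by auto
  obtain cs where cs: "\<forall>c\<in>set cs. 0 \<le> fst c" "sum_list (map fst cs) \<le> t - fst p"
     "\<And>\<omega>. visits cs (time_shift (fst p) \<omega>) \<longleftrightarrow> (\<forall>p\<in>set L. \<omega> (fst p) = snd p)"
    using Cons.IH[of "fst p"] Cons.prems by auto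
  show ?case
  proof (intro exI[of _ "(fst p - r, snd p) # cs"] conjI allI)
    fix \<omega> :: "real \<Rightarrow> 'a"
    have "time_shift r \<omega> (fst p - r) = \<omega> (fst p)"
      using r by (simp add: time_shift_def)
    then show "visits ((fst p - r, snd p) # cs) (time_shift r \<omega>) \<longleftrightarrow> (\<forall>p\<in>set (p # L). \<omega> (fst p) = snd p)"
      using cs(3)[of \<omega>] r by (simp add: time_shift_time_shift)
  qed (use cs r in auto)
qed

definition cylinder :: "real set \<Rightarrow> (real \<Rightarrow> 'm::finite) \<Rightarrow> (real \<Rightarrow> 'm) set" where
  "cylinder S f = {\<omega> \<in> switching_paths. \<forall>s\<in>S. \<omega> s = f s}"

lemma sets_prescribed_states:
  assumes "finite I" "\<And>l. l \<in> I \<Longrightarrow> 0 \<le> t l"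
  shows "{\<omega> \<in> switching_paths. \<forall>l\<in>I. \<omega> (t l) = j l} \<in> sets (path_algebra :: (real \<Rightarrow> 'm::finite) measure)"
proof -
  have "{\<omega> \<in> space path_algebra. \<forall>l\<in>I. \<omega> (t l) = j l} \<in> sets (path_algebra :: (real \<Rightarrow> 'm) measure)"
  proof (rule sets.sets_Collect_finite_All[OF _ assms(1)])
    fix l assume "l \<in> I"
    then have [measurable]: "(\<lambda>\<omega>. \<omega> (t l)) \<in> (path_algebra :: (real \<Rightarrow> 'm) measure) \<rightarrow>\<^sub>M count_space UNIV"
      by (intro measurable_path_eval assms(2))
    show "{\<omega> \<in> space path_algebra. \<omega> (t l) = j l} \<in> sets (path_algebra :: (real \<Rightarrow> 'm) measure)" by measurable
  qed
  then show ?thesis by simp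
qed

lemma sets_cylinder:
  assumes "finite S" "S \<subseteq> {0..}"
  shows "cylinder S f \<in> sets (path_algebra :: (real \<Rightarrow> 'm::finite) measure)"
  unfolding cylinder_def by (rule sets_prescribed_states[OF assms(1)]) (use assms(2) in auto)

text \<open>Cylinders over finitely many times are closed under intersection up to the empty set: two
  cylinders that meet are both described by the values of a common path.\<close>

lemma path_measure_eqI:
  fixes M N :: "(real \<Rightarrow> 'm::finite) measure"
  assumes sets: "sets M = sets path_algebra" "sets N = sets path_algebra"
    and fin: "emeasure M switching_paths \<noteq> \<infinity>"
    and eq: "\<And>S f. finite S \<Longrightarrow> S \<subseteq> {0..} \<Longrightarrow> emeasure M (cylinder S f) = emeasure N (cylinder S f)"
  shows "M = N"
proof -
  let ?C = "{cylinder S f | S f. finite S \<and> S \<subseteq> {0..}} :: (real \<Rightarrow> 'm) set set"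
  let ?E = "?C \<union> {{}}"
  have sub: "?E \<subseteq> Pow switching_paths" by (auto simp: cylinder_def)
  have top: "switching_paths \<in> ?E"
    by (intro UnI1 CollectI exI[of _ "{}"]) (auto simp: cylinder_def)
  have "sigma_sets switching_paths ?E = sets (path_algebra :: (real \<Rightarrow> 'm) measure)"
  proof
    show "sigma_sets switching_paths ?E \<subseteq> sets (path_algebra :: (real \<Rightarrow> 'm) measure)"
      using sets.sigma_sets_subset[of ?E "path_algebra :: (real \<Rightarrow> 'm) measure"] by (auto intro: sets_cylinder)
    show "sets (path_algebra :: (real \<Rightarrow> 'm) measure) \<subseteq> sigma_sets switching_paths ?E"
      unfolding path_algebra_def
    proof (subst sets_measure_of)
      show "sigma_sets switching_paths {{\<omega> \<in> switching_paths. \<omega> s = j} | s (j::'m). 0 \<le> s} \<subseteq> sigma_sets switching_paths ?E"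
      proof (intro sigma_sets_mono' subsetI UnI1)
        fix A assume "A \<in> {{\<omega> \<in> switching_paths. \<omega> s = j} | s (j::'m). 0 \<le> s}"
        then obtain s j where A: "A = {\<omega> \<in> switching_paths. \<omega> s = j}" "0 \<le> s" by auto
        show "A \<in> ?C"
          using A by (intro CollectI exI[of _ "{s}"] exI[of _ "\<lambda>_. j"]) (auto simp: cylinder_def)
      qed
    qed auto
  qed
  moreover have "Int_stable ?E"
  proof (rule Int_stableI)
    fix A B assume A: "A \<in> ?E" and B: "B \<in> ?E"
    show "A \<inter> B \<in> ?E"
    proof (cases "A \<inter> B = {}")
      case False
      then obtain S f S' f' where AB: "A = cylinder S f" "B = cylinder S' f'" "finite S" "finite S'" "S \<subseteq> {0..}" "S' \<subseteq> {0..}"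
        using A B by auto
      from False AB obtain \<omega> where "\<forall>s\<in>S. \<omega> s = f s" "\<forall>s\<in>S'. \<omega> s = f' s"
        by (auto simp: cylinder_def)
      then have "A \<inter> B = cylinder (S \<union> S') \<omega>"
        using AB by (auto simp: cylinder_def)
      with AB show ?thesis by blast
    qed auto
  qed
  ultimately show ?thesis
    using sub sets fin top eq
    by (intro measure_eqI_generator_eq[of ?E switching_paths M N "\<lambda>_. switching_paths"]) auto
qed

lemma is_path_law_unique:
  fixes P Q :: "(real \<Rightarrow> 'm::finite) measure"
  assumes P: "is_path_law \<Lambda> a P" and Q: "is_path_law \<Lambda> a Q"
  shows "P = Q"
proof (rule path_measure_eqI)
  interpret P: prob_space P using P by (simp add: is_path_law_def)
  interpret Q: prob_space Q using Q by (simp add: is_path_law_def)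
  show sP: "sets P = sets path_algebra" and sQ: "sets Q = sets path_algebra"
    using P Q by (auto simp: is_path_law_def)
  have spP: "space P = switching_paths" and spQ: "space Q = switching_paths"
    using sets_eq_imp_space_eq[OF sP] sets_eq_imp_space_eq[OF sQ] by auto
  show "emeasure P switching_paths \<noteq> \<infinity>" by simp
  fix S :: "real set" and f :: "real \<Rightarrow> 'm" assume S: "finite S" "S \<subseteq> {0..}"
  have "measure P (cylinder S f) = measure Q (cylinder S f)"
  proof (cases "S = {}")
    case True
    then show ?thesis
      using P.prob_space Q.prob_space spP spQ by (simp add: cylinder_def)
  next
    case False
    \<comment> \<open>the times are numbered from \<open>1\<close>, as in the definition of a path law\<close>
    let ?L = "sorted_list_of_set S"
    define k where "k = card S"
    define t where "t l = ?L ! (l - 1)" for l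
    have k: "1 \<le> k" using False S by (simp add: k_def Suc_leI card_gt_0_iff)
    have len: "length ?L = k" using S by (simp add: k_def)
    have im: "t ` {1..k} = S"
    proof -
      have "t ` {1..k} = (\<lambda>l. ?L ! l) ` {..<k}"
      proof -
        have "{..<k} = (\<lambda>l. l - 1) ` {1..k}"
          by (auto simp: image_iff) (metis One_nat_def Suc_leI atLeastAtMost_iff diff_Suc_1 le_add1 plus_1_eq_Suc)
        then show ?thesis by (simp add: t_def image_image)
      qed
      also have "\<dots> = set ?L" using len by (auto simp: set_conv_nth)
      finally show ?thesis using S by simp
    qed
    have mono: "strict_mono_on {1..k} t"
    proof (rule strict_mono_onI)
      fix r s assume "r \<in> {1..k}" "s \<in> {1..k}" "r < s"
      then show "t r < t s"
        unfolding t_def using len S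
        by (intro sorted_wrt_nth_less[OF strict_sorted_list_of_set]) auto
    qed
    have "t 1 \<in> S" using im k by auto
    then have t1: "0 \<le> t 1" using S by auto
    have cyl: "cylinder S f = {\<omega> \<in> switching_paths. \<forall>l\<in>{1..k}. \<omega> (t l) = (f \<circ> t) l}"
      unfolding cylinder_def im[symmetric] by auto
    show ?thesis
    proof -
      have fdd: "measure R {\<omega> \<in> switching_paths. \<forall>l\<in>{1..k}. \<omega> (t l) = (f \<circ> t) l} =
          (a v* matrix_exp (- t 1 *\<^sub>R \<Lambda>)) $ ((f \<circ> t) 1) *
          (\<Prod>l = 2..k. matrix_exp (- (t l - t (l - 1)) *\<^sub>R \<Lambda>) $ ((f \<circ> t) (l - 1)) $ ((f \<circ> t) l))"
        if "is_path_law \<Lambda> a R" for R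
        using that k t1 mono unfolding is_path_law_def by blast
      show ?thesis
        unfolding cyl fdd[OF P] fdd[OF Q] ..
    qed
  qed
  then show "emeasure P (cylinder S f) = emeasure Q (cylinder S f)"
    by (simp add: P.emeasure_eq_measure Q.emeasure_eq_measure)
qed


context switching
begin

lemma transition_nonneg:
  assumes "0 \<le> t" shows "0 \<le> transition \<Lambda> t i j"
  unfolding chain_marginal[OF assms, symmetric] by (rule measure_nonneg)

lemma transition_le_1:
  assumes "0 \<le> t" shows "transition \<Lambda> t i j \<le> 1"
  unfolding chain_marginal[OF assms, symmetric] by (rule chain.prob_le_1)

text \<open>After a shift to the first visit, the Markov property and induction apply.\<close>

lemma markov_visits:
  assumes "\<forall>c\<in>set cs. 0 \<le> fst c" "sum_list (map fst cs) \<le> t" and C: "C \<in> sets path_algebra"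
  shows "measure (chain i) {\<omega> \<in> switching_paths. visits cs \<omega> \<and> \<omega> t = k \<and> time_shift t \<omega> \<in> C} =
     measure (chain i) {\<omega> \<in> switching_paths. visits cs \<omega> \<and> \<omega> t = k} * measure (chain k) C"
  using assms(1,2)
proof (induction cs arbitrary: i t)
  case Nil
  then show ?case using markov[OF C, of t i k] chain_marginal[of t i k] by simp
next
  case (Cons c cs)
  obtain d j where c: "c = (d, j)" by (cases c)
  have d: "0 \<le> d" and "0 \<le> sum_list (map fst cs)" and le: "sum_list (map fst cs) \<le> t - d"
    using Cons.prems by (auto simp: c intro!: sum_list_nonneg)
  then have dt: "d \<le> t" "0 \<le> t" by auto
  have reduce: "measure (chain i) {\<omega> \<in> switching_paths. visits (c # cs) \<omega> \<and> \<omega> t = k \<and> time_shift t \<omega> \<in> A}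
     = transition \<Lambda> d i j * measure (chain j) {\<omega> \<in> switching_paths. visits cs \<omega> \<and> \<omega> (t - d) = k \<and> time_shift (t - d) \<omega> \<in> A}"
    if A: "A \<in> sets path_algebra" for A
  proof -
    let ?S = "{\<omega> \<in> switching_paths. visits cs \<omega> \<and> \<omega> (t - d) = k \<and> time_shift (t - d) \<omega> \<in> A}"
    have "?S = {\<omega> \<in> switching_paths. visits cs \<omega>} \<inter> {\<omega> \<in> switching_paths. \<omega> (t - d) = k \<and> time_shift (t - d) \<omega> \<in> A}"
      by auto
    also have "\<dots> \<in> sets path_algebra"
      using Cons.prems dt by (intro sets.Int measurable_visits sets_shift_event A) auto
    finally have S: "?S \<in> sets path_algebra" .
    have "{\<omega> \<in> switching_paths. visits (c # cs) \<omega> \<and> \<omega> t = k \<and> time_shift t \<omega> \<in> A} =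
       {\<omega> \<in> switching_paths. \<omega> d = j \<and> time_shift d \<omega> \<in> ?S}"
      using d dt by (auto simp: c time_shift_time_shift intro: time_shift_cadlag) (auto simp: time_shift_def)
    then show ?thesis using markov[OF S d, of i j] by simp
  qed
  have top: "{\<omega> \<in> switching_paths. visits cs \<omega> \<and> \<omega> s = k \<and> time_shift s \<omega> \<in> space path_algebra} =
     {\<omega> \<in> switching_paths. visits cs \<omega> \<and> \<omega> s = k}" if "0 \<le> s" for s and cs :: "(real \<times> 'm) list"
    using that by (auto intro: time_shift_cadlag)
  show ?case
    using reduce[OF C] reduce[OF sets.top] Cons.IH[OF _ le, of j] Cons.prems(1) top[of t "c # cs"] top[of "t - d" cs] dt
    by simp
qed

lemma indicator_density_distr:
  assumes A: "A \<in> sets (chain i)" and g: "g \<in> path_algebra \<rightarrow>\<^sub>M path_algebra" and B: "B \<in> sets path_algebra"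
  shows "emeasure (distr (density (chain i) (indicator A)) path_algebra g) B
    = ennreal (measure (chain i) {\<omega> \<in> A. g \<omega> \<in> B})"
proof -
  have sp: "A \<subseteq> switching_paths" using sets.sets_into_space[OF A] by simp
  have g': "g \<in> chain i \<rightarrow>\<^sub>M path_algebra" using g by simp
  have m: "g -` B \<inter> switching_paths \<in> sets (chain i)"
    using measurable_sets[OF g' B] by simp
  have "emeasure (distr (density (chain i) (indicator A)) path_algebra g) B
     = emeasure (density (chain i) (indicator A)) (g -` B \<inter> switching_paths)"
    using g B by (subst emeasure_distr) (auto cong: measurable_cong_sets)
  also have "\<dots> = emeasure (chain i) (A \<inter> (g -` B \<inter> switching_paths))"
    using m A by (subst emeasure_density) (auto simp: nn_integral_indicator indicator_inter_arith[symmetric])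
  also have "A \<inter> (g -` B \<inter> switching_paths) = {\<omega> \<in> A. g \<omega> \<in> B}" using sp by auto
  finally show ?thesis by (simp add: chain.emeasure_eq_measure)
qed

text \<open>Given the state at time \<open>t\<close>, the past is independent of the future. The past is encoded in the frozen
  path; a cylinder event for the frozen path is a finite list of visits up to time \<open>t\<close>.\<close>

lemma past_markov_measure:
  assumes t: "0 \<le> t" and C: "C \<in> sets path_algebra"
  shows "distr (density (chain i) (indicator {\<omega> \<in> switching_paths. \<omega> t = k \<and> time_shift t \<omega> \<in> C})) path_algebra (stopped_at t)
   = density (distr (density (chain i) (indicator {\<omega> \<in> switching_paths. \<omega> t = k})) path_algebra (stopped_at t))
       (\<lambda>_. ennreal (measure (chain k) C))" (is "?M = ?N")
proof (rule path_measure_eqI)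
  let ?A1 = "{\<omega> \<in> switching_paths. \<omega> t = k \<and> time_shift t \<omega> \<in> C}"
  let ?A2 = "{\<omega> \<in> switching_paths. \<omega> t = k}"
  have A1: "?A1 \<in> sets (chain i)" using sets_shift_event[OF C t] by simp
  have A2: "?A2 \<in> sets (chain i)"
    using sets_cylinder[of "{t}" "\<lambda>_. k"] t by (simp add: cylinder_def)
  have st: "stopped_at t \<in> path_algebra \<rightarrow>\<^sub>M (path_algebra :: (real \<Rightarrow> 'm) measure)"
    by (rule measurable_stopped_at[OF t])
  show "sets ?M = sets path_algebra" "sets ?N = sets path_algebra" by simp_all
  have "emeasure ?M (space path_algebra) \<noteq> \<infinity>"
    by (subst indicator_density_distr[OF A1 st]) auto
  then show "emeasure ?M switching_paths \<noteq> \<infinity>" by simp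
  fix S :: "real set" and f :: "real \<Rightarrow> 'm" assume S: "finite S" "S \<subseteq> {0..}"
  have cyl: "cylinder S f \<in> sets path_algebra" by (rule sets_cylinder[OF S])
  let ?L = "sort_key fst (map (\<lambda>s. (min s t, f s)) (sorted_list_of_set S))"
  obtain cs where cs: "\<forall>c\<in>set cs. 0 \<le> fst c" "sum_list (map fst cs) \<le> t - 0"
     "\<And>\<omega>. visits cs (time_shift 0 \<omega>) \<longleftrightarrow> (\<forall>p\<in>set ?L. \<omega> (fst p) = snd p)"
    using constraints_as_visits[of ?L 0 t] S t by auto
  have vis: "stopped_at t \<omega> \<in> cylinder S f \<longleftrightarrow> visits cs \<omega>" if \<omega>: "\<omega> \<in> switching_paths" for \<omega>
  proof -
    have "stopped_at t \<omega> \<in> cylinder S f \<longleftrightarrow> (\<forall>s\<in>S. \<omega> (min s t) = f s)"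
    proof -
      have "stopped_at t \<omega> s = \<omega> (min s t)" if "s \<in> S" for s
        using that S by (auto simp: stopped_at_def)
      then show ?thesis
        using stopped_at_cadlag[OF \<omega> t] by (simp add: cylinder_def cong: ball_cong)
    qed
    then show ?thesis
      using cs(3)[of \<omega>] S by (simp add: time_shift_0[OF \<omega>])
  qed
  have "emeasure ?M (cylinder S f) = ennreal (measure (chain i) {\<omega> \<in> ?A1. stopped_at t \<omega> \<in> cylinder S f})"
    by (rule indicator_density_distr[OF A1 st cyl])
  also have "{\<omega> \<in> ?A1. stopped_at t \<omega> \<in> cylinder S f} =
     {\<omega> \<in> switching_paths. visits cs \<omega> \<and> \<omega> t = k \<and> time_shift t \<omega> \<in> C}"
    using vis by auto
  also have "measure (chain i) \<dots> = measure (chain i) {\<omega> \<in> switching_paths. visits cs \<omega> \<and> \<omega> t = k} * measure (chain k) C"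
    using cs by (intro markov_visits C) auto
  also have "{\<omega> \<in> switching_paths. visits cs \<omega> \<and> \<omega> t = k} = {\<omega> \<in> ?A2. stopped_at t \<omega> \<in> cylinder S f}"
    using vis by auto
  also have "ennreal (measure (chain i) {\<omega> \<in> ?A2. stopped_at t \<omega> \<in> cylinder S f} * measure (chain k) C) =
     emeasure ?N (cylinder S f)"
    using cyl by (subst emeasure_density_const) (auto simp: indicator_density_distr[OF A2 st] ennreal_mult mult.commute)
  finally show "emeasure ?M (cylinder S f) = emeasure ?N (cylinder S f)" .
qed

lemma past_markov_integral:
  fixes Y :: "(real \<Rightarrow> 'm) \<Rightarrow> real"
  assumes t: "0 \<le> t" and C: "C \<in> sets path_algebra"
    and Y: "Y \<in> borel_measurable path_algebra"
    and past: "\<And>\<omega>. \<omega> \<in> switching_paths \<Longrightarrow> Y (stopped_at t \<omega>) = Y \<omega>"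
  shows "(LINT \<omega>|chain i. indicator {\<omega> \<in> switching_paths. \<omega> t = k \<and> time_shift t \<omega> \<in> C} \<omega> * Y \<omega>)
     = measure (chain k) C * (LINT \<omega>|chain i. indicator {\<omega> \<in> switching_paths. \<omega> t = k} \<omega> * Y \<omega>)"
proof -
  let ?A1 = "{\<omega> \<in> switching_paths. \<omega> t = k \<and> time_shift t \<omega> \<in> C}"
  let ?A2 = "{\<omega> \<in> switching_paths. \<omega> t = k}"
  have A1: "?A1 \<in> sets (chain i)" using sets_shift_event[OF C t] by simp
  have A2: "?A2 \<in> sets (chain i)"
    using sets_cylinder[of "{t}" "\<lambda>_. k"] t by (simp add: cylinder_def)
  have st: "stopped_at t \<in> path_algebra \<rightarrow>\<^sub>M (path_algebra :: (real \<Rightarrow> 'm) measure)"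
    by (rule measurable_stopped_at[OF t])
  have I: "(LINT \<omega>|distr (density (chain i) (indicator A)) path_algebra (stopped_at t). Y \<omega>) =
    (LINT \<omega>|chain i. indicator A \<omega> * Y \<omega>)" if A: "A \<in> sets (chain i)" for A
  proof -
    have "(LINT \<omega>|distr (density (chain i) (indicator A)) path_algebra (stopped_at t). Y \<omega>) =
      (LINT \<omega>|density (chain i) (indicator A). Y (stopped_at t \<omega>))"
      using st Y by (intro integral_distr) (auto cong: measurable_cong_sets)
    also have "\<dots> = (LINT \<omega>|density (chain i) (\<lambda>\<omega>. ennreal (indicator A \<omega>)). Y (stopped_at t \<omega>))"
      by (simp add: ennreal_indicator)
    also have "\<dots> = (LINT \<omega>|chain i. indicator A \<omega> *\<^sub>R Y (stopped_at t \<omega>))"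
      using A measurable_compose[OF st Y] by (intro integral_density) (auto cong: measurable_cong_sets)
    also have "\<dots> = (LINT \<omega>|chain i. indicator A \<omega> * Y \<omega>)"
      by (intro Bochner_Integration.integral_cong) (auto simp: past)
    finally show ?thesis .
  qed
  have "(LINT \<omega>|chain i. indicator ?A1 \<omega> * Y \<omega>) =
     (LINT \<omega>|density (distr (density (chain i) (indicator ?A2)) path_algebra (stopped_at t))
       (\<lambda>_. ennreal (measure (chain k) C)). Y \<omega>)"
    unfolding I[OF A1, symmetric] past_markov_measure[OF t C] ..
  also have "\<dots> = (LINT \<omega>|distr (density (chain i) (indicator ?A2)) path_algebra (stopped_at t). measure (chain k) C *\<^sub>R Y \<omega>)"
    by (intro integral_density) (use Y in auto)
  also have "\<dots> = measure (chain k) C * (LINT \<omega>|chain i. indicator ?A2 \<omega> * Y \<omega>)"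
    by (simp add: I[OF A2])
  finally show ?thesis .
qed

lemma past_markov_next:
  fixes Y :: "(real \<Rightarrow> 'm) \<Rightarrow> real"
  assumes t: "0 \<le> t" and r: "0 \<le> r" and Y: "Y \<in> borel_measurable path_algebra"
    and past: "\<And>\<omega>. \<omega> \<in> switching_paths \<Longrightarrow> Y (stopped_at t \<omega>) = Y \<omega>"
  shows "(LINT \<omega>|chain i. indicator {\<omega> \<in> switching_paths. \<omega> t = k \<and> \<omega> (t + r) = j} \<omega> * Y \<omega>)
     = transition \<Lambda> r k j * (LINT \<omega>|chain i. indicator {\<omega> \<in> switching_paths. \<omega> t = k} \<omega> * Y \<omega>)"
proof -
  let ?C = "{\<omega> \<in> switching_paths. \<omega> r = j}"
  have "?C \<in> sets (path_algebra :: (real \<Rightarrow> 'm) measure)"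
    using sets_cylinder[of "{r}" "\<lambda>_. j"] r by (simp add: cylinder_def)
  moreover have "{\<omega> \<in> switching_paths. \<omega> t = k \<and> time_shift t \<omega> \<in> ?C} = {\<omega> \<in> switching_paths. \<omega> t = k \<and> \<omega> (t + r) = j}"
    using t r by (auto intro: time_shift_cadlag) (auto simp: time_shift_def add.commute)
  ultimately show ?thesis
    using past_markov_integral[OF t _ Y past, of ?C i k] chain_marginal[OF r, of k j] by simp
qed

text \<open>The last time is split off: the event at the earlier times belongs to the past of \<open>t k\<close>.\<close>

lemma finite_dimensional:
  fixes k :: nat
  assumes "1 \<le> k" "0 \<le> t 1" "strict_mono_on {1..k} t"
  shows "measure (chain i) {\<omega> \<in> switching_paths. \<forall>l\<in>{1..k}. \<omega> (t l) = j l} =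
    transition \<Lambda> (t 1) i (j 1) * (\<Prod>l = 2..k. transition \<Lambda> (t l - t (l - 1)) (j (l - 1)) (j l))"
  using assms
proof (induction k rule: nat_induct_at_least)
  case base
  then show ?case by (simp add: chain_marginal)
next
  case (Suc k)
  have mono: "strict_mono_on {1..k} t"
    using Suc.prems by (auto simp: strict_mono_on_def)
  have tl: "0 \<le> t l \<and> t l \<le> t k" if "l \<in> {1..k}" for l
    using that mono Suc.prems Suc.hyps strict_mono_on_leD[OF mono, of 1 l] strict_mono_on_leD[OF mono, of l k] by auto
  have tk: "0 \<le> t k" "t k < t (Suc k)"
    using tl[of k] Suc.prems Suc.hyps by (auto simp: strict_mono_on_def)
  define Y :: "(real \<Rightarrow> 'm) \<Rightarrow> real" where "Y = indicator {\<omega> \<in> switching_paths. \<forall>l\<in>{1..k}. \<omega> (t l) = j l}"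
  have set: "{\<omega> \<in> switching_paths. \<forall>l\<in>{1..k}. \<omega> (t l) = j l} \<in> sets path_algebra"
    by (rule sets_prescribed_states) (use tl in auto)
  have Y: "Y \<in> borel_measurable path_algebra" unfolding Y_def using set by simp
  have past: "Y (stopped_at (t k) \<omega>) = Y \<omega>" if \<omega>: "\<omega> \<in> switching_paths" for \<omega>
  proof -
    have "stopped_at (t k) \<omega> (t l) = \<omega> (t l)" if "l \<in> {1..k}" for l
      using tl[OF that] by (simp add: stopped_at_def)
    then have "(\<forall>l\<in>{1..k}. stopped_at (t k) \<omega> (t l) = j l) \<longleftrightarrow> (\<forall>l\<in>{1..k}. \<omega> (t l) = j l)"
      by metis
    then show ?thesis
      unfolding Y_def indicator_def using stopped_at_cadlag[OF \<omega> tk(1)] \<omega> by simp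
  qed
  have "measure (chain i) {\<omega> \<in> switching_paths. \<forall>l\<in>{1..Suc k}. \<omega> (t l) = j l} =
     (LINT \<omega>|chain i. indicator {\<omega> \<in> switching_paths. \<forall>l\<in>{1..Suc k}. \<omega> (t l) = j l} \<omega>)"
    by (auto intro!: arg_cong[where f = "measure (chain i)"])
  also have "\<dots> = (LINT \<omega>|chain i. indicator {\<omega> \<in> switching_paths. \<omega> (t k) = j k \<and> \<omega> (t k + (t (Suc k) - t k)) = j (Suc k)} \<omega> * Y \<omega>)"
    using Suc.hyps by (intro Bochner_Integration.integral_cong) (auto simp: Y_def indicator_def atLeastAtMostSuc_conv)
  also have "\<dots> = transition \<Lambda> (t (Suc k) - t k) (j k) (j (Suc k)) *
       (LINT \<omega>|chain i. indicator {\<omega> \<in> switching_paths. \<omega> (t k) = j k} \<omega> * Y \<omega>)"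
    by (rule past_markov_next[OF _ _ Y past]) (use tk in auto)
  also have "(LINT \<omega>|chain i. indicator {\<omega> \<in> switching_paths. \<omega> (t k) = j k} \<omega> * Y \<omega>) =
     (LINT \<omega>|chain i. indicator {\<omega> \<in> switching_paths. \<forall>l\<in>{1..k}. \<omega> (t l) = j l} \<omega>)"
    using Suc.hyps by (intro Bochner_Integration.integral_cong) (auto simp: Y_def indicator_def)
  also have "\<dots> = measure (chain i) {\<omega> \<in> switching_paths. \<forall>l\<in>{1..k}. \<omega> (t l) = j l}"
    by (auto intro!: arg_cong[where f = "measure (chain i)"])
  also have "\<dots> = transition \<Lambda> (t 1) i (j 1) * (\<Prod>l = 2..k. transition \<Lambda> (t l - t (l - 1)) (j (l - 1)) (j l))"
    using Suc.IH Suc.prems mono by auto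
  finally show ?case
    using Suc.hyps by (simp add: mult_ac)
qed

definition mixture :: "real ^ 'm \<Rightarrow> (real \<Rightarrow> 'm) measure" where
  "mixture a = measure_pmf (embed_pmf (($) a)) \<bind> chain"

lemma emeasure_mixture:
  assumes a: "a \<in> simplex_vectors" and X: "X \<in> sets path_algebra"
  shows "emeasure (mixture a) X = ennreal (\<Sum>i\<in>UNIV. a $ i * measure (chain i) X)"
proof -
  have a0: "\<And>i. 0 \<le> a $ i" using a by (auto simp: simplex_vectors_def)
  have pmf: "pmf (embed_pmf (($) a)) i = a $ i" for i
    using a by (intro pmf_embed_pmf) (auto simp: simplex_vectors_def nn_integral_count_space_finite sum_ennreal)
  have "chain \<in> measure_pmf (embed_pmf (($) a)) \<rightarrow>\<^sub>M subprob_algebra path_algebra"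
    by (auto simp: space_subprob_algebra chain.prob_space_axioms prob_space_imp_subprob_space)
  then have "emeasure (mixture a) X = (\<integral>\<^sup>+i. emeasure (chain i) X \<partial>measure_pmf (embed_pmf (($) a)))"
    unfolding mixture_def by (intro emeasure_bind[where N = path_algebra] X) auto
  also have "\<dots> = (\<Sum>i\<in>UNIV. emeasure (chain i) X * ennreal (a $ i))"
    by (subst nn_integral_measure_pmf_support[of UNIV]) (auto simp: pmf)
  also have "\<dots> = ennreal (\<Sum>i\<in>UNIV. a $ i * measure (chain i) X)"
    using a0 by (subst sum_ennreal[symmetric]) (auto simp: chain.emeasure_eq_measure ennreal_mult mult.commute)
  finally show ?thesis .
qed

lemma sets_mixture: "sets (mixture a) = sets path_algebra"
  unfolding mixture_def by (intro sets_bind) auto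

lemma measure_mixture:
  assumes a: "a \<in> simplex_vectors" and X: "X \<in> sets path_algebra"
  shows "measure (mixture a) X = (\<Sum>i\<in>UNIV. a $ i * measure (chain i) X)"
  using a unfolding measure_def emeasure_mixture[OF assms]
  by (intro enn2real_ennreal sum_nonneg) (auto simp: simplex_vectors_def)

lemma is_path_law_mixture:
  assumes a: "a \<in> simplex_vectors"
  shows "is_path_law \<Lambda> a (mixture a)"
  unfolding is_path_law_def
proof (intro conjI allI impI sets_mixture)
  have sp: "space (mixture a) = switching_paths"
    using sets_eq_imp_space_eq[OF sets_mixture, of a] by simp
  show "prob_space (mixture a)"
  proof (rule prob_spaceI)
    have "emeasure (mixture a) (space path_algebra) = ennreal (\<Sum>i\<in>UNIV. a $ i * measure (chain i) (space (chain i)))"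
      by (subst emeasure_mixture[OF a]) auto
    also have "\<dots> = 1"
      using a by (simp only: chain.prob_space) (simp add: simplex_vectors_def)
    finally show "emeasure (mixture a) (space (mixture a)) = 1" by (simp add: sp)
  qed
  fix k :: nat and t :: "nat \<Rightarrow> real" and j :: "nat \<Rightarrow> 'm"
  assume k: "1 \<le> k" and t: "0 \<le> t 1 \<and> strict_mono_on {1..k} t"
  have tl: "0 \<le> t l" if "l \<in> {1..k}" for l
    using that t strict_mono_on_leD[of "{1..k}" t 1 l] by auto
  have "{\<omega> \<in> switching_paths. \<forall>l\<in>{1..k}. \<omega> (t l) = j l} \<in> sets path_algebra"
    by (rule sets_prescribed_states) (use tl in auto)
  then have "measure (mixture a) {\<omega> \<in> switching_paths. \<forall>l\<in>{1..k}. \<omega> (t l) = j l} =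
     (\<Sum>i\<in>UNIV. a $ i * measure (chain i) {\<omega> \<in> switching_paths. \<forall>l\<in>{1..k}. \<omega> (t l) = j l})"
    by (rule measure_mixture[OF a])
  also have "\<dots> = (\<Sum>i\<in>UNIV. a $ i * (transition \<Lambda> (t 1) i (j 1) * (\<Prod>l = 2..k. transition \<Lambda> (t l - t (l - 1)) (j (l - 1)) (j l))))"
    by (intro sum.cong arg_cong2[where f = "(*)"] refl finite_dimensional) (use k t in auto)
  finally show "measure (mixture a) {\<omega> \<in> switching_paths. \<forall>l\<in>{1..k}. \<omega> (t l) = j l} =
      (a v* matrix_exp (- t 1 *\<^sub>R \<Lambda>)) $ j 1 *
      (\<Prod>l = 2..k. matrix_exp (- (t l - t (l - 1)) *\<^sub>R \<Lambda>) $ j (l - 1) $ j l)"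
    by (simp add: vector_matrix_mult_def transition_def sum_distrib_right mult_ac)
qed

lemma path_law_mixture:
  assumes "a \<in> simplex_vectors"
  shows "path_law \<Lambda> a = mixture a"
  unfolding path_law_def
  by (rule the_equality) (auto intro: is_path_law_mixture[OF assms] is_path_law_unique)

lemma path_law_axis: "path_law \<Lambda> (axis i 1) = chain i"
proof -
  have ax: "axis i (1::real) \<in> simplex_vectors"
    by (auto simp: simplex_vectors_def axis_def)
  interpret M: prob_space "mixture (axis i 1)"
    using is_path_law_mixture[OF ax] by (simp add: is_path_law_def)
  have "mixture (axis i 1) = chain i"
  proof (rule measure_eqI)
    fix A assume "A \<in> sets (mixture (axis i 1))"
    then have "emeasure (mixture (axis i 1)) A = ennreal (\<Sum>k\<in>UNIV. axis i 1 $ k * measure (chain k) A)"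
      by (intro emeasure_mixture[OF ax]) (simp add: sets_mixture)
    also have "(\<Sum>k\<in>UNIV. axis i 1 $ k * measure (chain k) A) = (\<Sum>k\<in>UNIV. if k = i then measure (chain k) A else 0)"
      by (intro sum.cong) (auto simp: axis_def)
    also have "\<dots> = measure (chain i) A" by simp
    finally show "emeasure (mixture (axis i 1)) A = emeasure (chain i) A"
      by (simp add: chain.emeasure_eq_measure)
  qed (simp add: sets_mixture)
  then show ?thesis by (simp add: path_law_mixture[OF ax])
qed

text \<open>The law started from \<open>a\<close> is the mixture of the laws started from the single states with weights
  \<open>a\<close>, so if all weights are positive its null sets are the common null sets of those laws.\<close>

lemma almost_surely_iff: "almost_surely \<Lambda> Q \<longleftrightarrow> (\<forall>i. AE \<omega> in chain i. Q \<omega>)"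
proof
  assume as: "almost_surely \<Lambda> Q"
  define a :: "real ^ 'm" where "a = (\<chi> i. 1 / real CARD('m))"
  have a: "a \<in> simplex_vectors" and pos: "\<And>i. 0 < a $ i"
    by (auto simp: a_def simplex_vectors_def)
  have "AE \<omega> in path_law \<Lambda> a. Q \<omega>"
    using as a pos unfolding almost_surely_def by blast
  then have "AE \<omega> in mixture a. Q \<omega>"
    unfolding path_law_mixture[OF a] .
  then obtain N where N: "{\<omega> \<in> space (mixture a). \<not> Q \<omega>} \<subseteq> N" "emeasure (mixture a) N = 0" "N \<in> sets (mixture a)"
    by (rule AE_E)
  have Ns: "N \<in> sets path_algebra" using N by (simp add: sets_mixture)
  have "(\<Sum>i\<in>UNIV. a $ i * measure (chain i) N) \<le> 0"
    using N emeasure_mixture[OF a Ns] by (simp add: ennreal_eq_0_iff)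
  then have z: "measure (chain i) N = 0" for i
  proof -
    have "a $ i * measure (chain i) N \<le> (\<Sum>i\<in>UNIV. a $ i * measure (chain i) N)"
      using less_imp_le[OF pos] by (intro member_le_sum) auto
    then have "a $ i * measure (chain i) N \<le> 0"
      using \<open>(\<Sum>i\<in>UNIV. a $ i * measure (chain i) N) \<le> 0\<close> by linarith
    then show ?thesis
      using pos[of i] measure_nonneg[of "chain i" N] by (simp add: mult_le_0_iff)
  qed
  show "\<forall>i. AE \<omega> in chain i. Q \<omega>"
  proof
    fix i
    have "N \<in> null_sets (chain i)"
      using z Ns by (auto simp: null_sets_def chain.emeasure_eq_measure)
    then show "AE \<omega> in chain i. Q \<omega>"
      by (rule AE_I') (use N sets_eq_imp_space_eq[OF sets_mixture, of a] in auto)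
  qed
next
  assume as: "\<forall>i. AE \<omega> in chain i. Q \<omega>"
  then have "\<forall>i. \<exists>N. {\<omega> \<in> space (chain i). \<not> Q \<omega>} \<subseteq> N \<and> emeasure (chain i) N = 0 \<and> N \<in> sets (chain i)"
    by (metis AE_E)
  then obtain N where N: "\<And>i. {\<omega> \<in> space (chain i). \<not> Q \<omega>} \<subseteq> N i"
      "\<And>i. emeasure (chain i) (N i) = 0" "\<And>i. N i \<in> sets (chain i)"
    by metis
  define N0 where "N0 = (\<Inter>i. N i)"
  have N0: "N0 \<in> sets path_algebra"
    unfolding N0_def using N(3) by (intro sets.finite_INT) auto
  have z: "measure (chain i) N0 = 0" for i
  proof -
    have "emeasure (chain i) N0 \<le> emeasure (chain i) (N i)"
      by (rule emeasure_mono) (use N(3) in \<open>auto simp: N0_def\<close>)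
    then show ?thesis using N(2) by (simp add: measure_def)
  qed
  show "almost_surely \<Lambda> Q"
    unfolding almost_surely_def
  proof (intro ballI impI)
    fix a :: "real ^ 'm" assume a: "a \<in> simplex_vectors"
    have "N0 \<in> null_sets (mixture a)"
      using N0 z by (auto simp: null_sets_def sets_mixture emeasure_mixture[OF a])
    moreover have "{\<omega> \<in> space (mixture a). \<not> Q \<omega>} \<subseteq> N0"
      using N(1) sets_eq_imp_space_eq[OF sets_mixture, of a] by (auto simp: N0_def)
    ultimately show "AE \<omega> in path_law \<Lambda> a. Q \<omega>"
      unfolding path_law_mixture[OF a] by (rule AE_I')
  qed
qed

text \<open>On \<open>\<omega> t = j\<close> the shifted path is a path started from \<open>j\<close>, scaled by the probability of that event.\<close>

lemma future_markov_measure: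
  assumes t: "0 \<le> t"
  shows "distr (density (chain i) (indicator {\<omega> \<in> switching_paths. \<omega> t = j})) path_algebra (time_shift t)
   = density (chain j) (\<lambda>_. ennreal (transition \<Lambda> t i j))"
proof (rule measure_eqI)
  let ?A = "{\<omega> \<in> switching_paths. \<omega> t = j}"
  have A: "?A \<in> sets (chain i)"
    using sets_cylinder[of "{t}" "\<lambda>_. j"] t by (simp add: cylinder_def)
  fix B assume "B \<in> sets (distr (density (chain i) (indicator ?A)) path_algebra (time_shift t))"
  then have B: "B \<in> sets path_algebra" by simp
  have p0: "0 \<le> transition \<Lambda> t i j" by (rule transition_nonneg[OF t])
  have "emeasure (distr (density (chain i) (indicator ?A)) path_algebra (time_shift t)) B =
     ennreal (measure (chain i) {\<omega> \<in> ?A. time_shift t \<omega> \<in> B})"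
    by (rule indicator_density_distr[OF A measurable_time_shift[OF t] B])
  also have "{\<omega> \<in> ?A. time_shift t \<omega> \<in> B} = {\<omega> \<in> switching_paths. \<omega> t = j \<and> time_shift t \<omega> \<in> B}" by auto
  also have "ennreal (measure (chain i) \<dots>) = ennreal (transition \<Lambda> t i j) * emeasure (chain j) B"
    using markov[OF B t, of i j] p0 by (simp add: ennreal_mult chain.emeasure_eq_measure)
  also have "\<dots> = emeasure (density (chain j) (\<lambda>_. ennreal (transition \<Lambda> t i j))) B"
    using B by (subst emeasure_density_const) auto
  finally show "emeasure (distr (density (chain i) (indicator ?A)) path_algebra (time_shift t)) B =
     emeasure (density (chain j) (\<lambda>_. ennreal (transition \<Lambda> t i j))) B" .
qed simp

lemma future_markov_integral:
  fixes \<Phi> :: "(real \<Rightarrow> 'm) \<Rightarrow> real"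
  assumes t: "0 \<le> t" and \<Phi>: "integrable (chain j) \<Phi>"
  shows "integrable (chain i) (\<lambda>\<omega>. indicator {\<omega> \<in> switching_paths. \<omega> t = j} \<omega> * \<Phi> (time_shift t \<omega>))" (is ?int)
    and "(LINT \<omega>|chain i. indicator {\<omega> \<in> switching_paths. \<omega> t = j} \<omega> * \<Phi> (time_shift t \<omega>)) =
      transition \<Lambda> t i j * (LINT \<omega>|chain j. \<Phi> \<omega>)" (is ?eq)
proof -
  let ?A = "{\<omega> \<in> switching_paths. \<omega> t = j}"
  have A: "?A \<in> sets (chain i)"
    using sets_cylinder[of "{t}" "\<lambda>_. j"] t by (simp add: cylinder_def)
  have p0: "0 \<le> transition \<Lambda> t i j" by (rule transition_nonneg[OF t])
  have \<Phi>m: "\<Phi> \<in> borel_measurable path_algebra" using borel_measurable_integrable[OF \<Phi>] by simp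
  have sh: "time_shift t \<in> path_algebra \<rightarrow>\<^sub>M (path_algebra :: (real \<Rightarrow> 'm) measure)"
    by (rule measurable_time_shift[OF t])
  let ?D = "density (chain i) (\<lambda>\<omega>. ennreal (indicator ?A \<omega>))"
  have D: "distr ?D path_algebra (time_shift t) = density (chain j) (\<lambda>_. ennreal (transition \<Lambda> t i j))"
    using future_markov_measure[OF t, of i j] by (simp add: ennreal_indicator)
  have sh': "time_shift t \<in> ?D \<rightarrow>\<^sub>M path_algebra" using sh by (simp cong: measurable_cong_sets)
  have \<Phi>sh: "(\<lambda>\<omega>. \<Phi> (time_shift t \<omega>)) \<in> borel_measurable (chain i)"
    using measurable_compose[OF sh \<Phi>m] by simp
  have "integrable (density (chain j) (\<lambda>_. ennreal (transition \<Lambda> t i j))) \<Phi>"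
    using \<Phi> p0 by (subst integrable_density) auto
  then have "integrable ?D (\<lambda>\<omega>. \<Phi> (time_shift t \<omega>))"
    unfolding D[symmetric] by (rule integrable_distr[OF sh'])
  then show ?int
    using A \<Phi>sh by (subst (asm) integrable_density) auto
  have "(LINT \<omega>|chain i. indicator ?A \<omega> * \<Phi> (time_shift t \<omega>)) = (LINT \<omega>|?D. \<Phi> (time_shift t \<omega>))"
    using A \<Phi>sh by (subst integral_density) auto
  also have "\<dots> = (LINT \<omega>|distr ?D path_algebra (time_shift t). \<Phi> \<omega>)"
    by (rule integral_distr[OF sh' \<Phi>m, symmetric])
  also have "\<dots> = transition \<Lambda> t i j * (LINT \<omega>|chain j. \<Phi> \<omega>)"
    unfolding D using p0 \<Phi> by (subst integral_density) auto
  finally show ?eq .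
qed


section \<open>Short-time behaviour of the transition probabilities\<close>

lemma transition_sum:
  assumes t: "0 \<le> t"
  shows "(\<Sum>j\<in>UNIV. transition \<Lambda> t i j) = 1"
proof -
  have "(\<Union>j. {\<omega> \<in> switching_paths. \<omega> t = j}) = (switching_paths :: (real \<Rightarrow> 'm) set)" by auto
  then have "1 = measure (chain i) (\<Union>j. {\<omega> \<in> switching_paths. \<omega> t = j})"
    using chain.prob_space[of i] by simp
  also have "\<dots> = (\<Sum>j\<in>UNIV. measure (chain i) {\<omega> \<in> switching_paths. \<omega> t = j})"
  proof (rule chain.finite_measure_finite_Union)
    have "{\<omega> \<in> switching_paths. \<omega> t = j} \<in> sets (chain i)" for j
      using sets_cylinder[of "{t}" "\<lambda>_. j"] t by (simp add: cylinder_def)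
    then show "(\<lambda>j. {\<omega> \<in> switching_paths. \<omega> t = j}) ` UNIV \<subseteq> sets (chain i)" by auto
  qed (auto simp: disjoint_family_on_def)
  finally show ?thesis by (simp add: chain_marginal[OF t])
qed

definition intensity :: real where
  "intensity = (\<Sum>i\<in>UNIV. \<Sum>j\<in>UNIV. \<bar>\<Lambda> $ i $ j\<bar>)"

lemma intensity_nonneg: "0 \<le> intensity"
  unfolding intensity_def by (intro sum_nonneg) auto

lemma row_le_intensity: "(\<Sum>j\<in>UNIV. \<bar>\<Lambda> $ i $ j\<bar>) \<le> intensity"
  unfolding intensity_def
  by (rule member_le_sum[of i UNIV "\<lambda>i. \<Sum>j\<in>UNIV. \<bar>\<Lambda> $ i $ j\<bar>"]) (auto intro: sum_nonneg)

lemma transition_first_order: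
  assumes h: "0 \<le> h"
  shows "\<bar>transition \<Lambda> h i j - (if i = j then 1 else 0)\<bar> \<le> intensity * h"
proof (cases "h = 0")
  case False
  with h have "0 < h" by simp
  then obtain z where z: "0 < z" "z < h"
    "transition \<Lambda> h i j - transition \<Lambda> 0 i j = (h - 0) * - (\<Sum>k\<in>UNIV. \<Lambda> $ i $ k * transition \<Lambda> z k j)"
    using MVT2[of 0 h "\<lambda>t. transition \<Lambda> t i j" "\<lambda>z. - (\<Sum>k\<in>UNIV. \<Lambda> $ i $ k * transition \<Lambda> z k j)"]
      transition_has_derivative by blast
  have "\<bar>\<Sum>k\<in>UNIV. \<Lambda> $ i $ k * transition \<Lambda> z k j\<bar> \<le> (\<Sum>k\<in>UNIV. \<bar>\<Lambda> $ i $ k\<bar>)"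
    using z transition_le_1[of z _ j] transition_nonneg[of z _ j]
    by (intro order_trans[OF sum_abs] sum_mono) (auto simp: abs_mult intro!: mult_left_le)
  also have "\<dots> \<le> intensity" by (rule row_le_intensity)
  finally have "h * \<bar>\<Sum>k\<in>UNIV. \<Lambda> $ i $ k * transition \<Lambda> z k j\<bar> \<le> h * intensity"
    using h by (rule mult_left_mono)
  then show ?thesis
    using z(3) h by (simp add: transition_0 abs_mult mult.commute)
qed (simp add: transition_0)

text \<open>The expression inside the absolute value vanishes at \<open>h = 0\<close>, and its derivative at \<open>z\<close> is \<open>- \<Lambda> (exp (- z \<Lambda>) - 1)\<close>, which is of order \<open>z\<close>.\<close>

lemma transition_second_order:
  assumes h: "0 \<le> h"
  shows "\<bar>transition \<Lambda> h i j - (if i = j then 1 else 0) + h * \<Lambda> $ i $ j\<bar> \<le> intensity\<^sup>2 * h\<^sup>2"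
proof (cases "h = 0")
  case False
  with h have h0: "0 < h" by simp
  let ?g = "\<lambda>t. transition \<Lambda> t i j + t * \<Lambda> $ i $ j"
  let ?g' = "\<lambda>z. - (\<Sum>k\<in>UNIV. \<Lambda> $ i $ k * transition \<Lambda> z k j) + \<Lambda> $ i $ j"
  have "(?g has_real_derivative ?g' z) (at z)" for z
    by (auto intro!: derivative_eq_intros transition_has_derivative)
  then obtain z where z: "0 < z" "z < h" "?g h - ?g 0 = (h - 0) * ?g' z"
    using MVT2[OF h0, of ?g ?g'] by blast
  have "?g' z = - (\<Sum>k\<in>UNIV. \<Lambda> $ i $ k * (transition \<Lambda> z k j - (if k = j then 1 else 0)))"
    by (simp add: right_diff_distrib sum_subtractf if_distrib[of "\<lambda>x. _ * x"] cong: if_cong)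
  also have "\<bar>\<dots>\<bar> \<le> (\<Sum>k\<in>UNIV. \<bar>\<Lambda> $ i $ k\<bar> * (intensity * z))"
    unfolding abs_minus_cancel
  proof (intro order_trans[OF sum_abs] sum_mono)
    fix k
    show "\<bar>\<Lambda> $ i $ k * (transition \<Lambda> z k j - (if k = j then 1 else 0))\<bar> \<le> \<bar>\<Lambda> $ i $ k\<bar> * (intensity * z)"
      unfolding abs_mult by (intro mult_left_mono transition_first_order) (use z in auto)
  qed
  also have "\<dots> \<le> intensity * (intensity * z)"
    unfolding sum_distrib_right[symmetric] using z intensity_nonneg
    by (intro mult_right_mono row_le_intensity) auto
  also have "\<dots> \<le> intensity * (intensity * h)"
    using z intensity_nonneg by (intro mult_left_mono) auto
  finally have "h * \<bar>?g' z\<bar> \<le> h * (intensity * (intensity * h))"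
    using h by (rule mult_left_mono)
  moreover have "\<bar>?g h - ?g 0\<bar> = h * \<bar>?g' z\<bar>"
    using z(3) h by (simp add: abs_mult)
  ultimately show ?thesis
    by (simp add: transition_0 power2_eq_square mult_ac)
qed (simp add: transition_0)

end

section \<open>The torus and the Lagrangian\<close>

lemma continuous_on_if_locally_lipschitz:
  fixes f :: "'a::real_normed_vector \<Rightarrow> real"
  assumes C: "0 \<le> C" and lip: "\<And>x y. norm (y - x) \<le> 1 \<Longrightarrow> \<bar>f y - f x\<bar> \<le> C * norm (y - x)"
  shows "continuous_on UNIV f"
proof (unfold continuous_on_iff, intro ballI allI impI)
  fix x :: 'a and e :: real assume e: "0 < e"
  show "\<exists>d>0. \<forall>x'\<in>UNIV. dist x' x < d \<longrightarrow> dist (f x') (f x) < e"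
  proof (intro exI[of _ "min 1 (e / (C + 1))"] conjI ballI impI)
    show "0 < min 1 (e / (C + 1))" using e C by simp
    fix x' assume d: "dist x' x < min 1 (e / (C + 1))"
    then have "\<bar>f x' - f x\<bar> \<le> C * norm (x' - x)" by (intro lip) (simp add: dist_norm)
    also have "\<dots> \<le> (C + 1) * norm (x' - x)" by (intro mult_right_mono) auto
    also have "\<dots> < (C + 1) * (e / (C + 1))" using d C by (intro mult_strict_left_mono) (auto simp: dist_norm)
    also have "\<dots> = e" using C by simp
    finally show "dist (f x') (f x) < e" by (simp add: dist_real_def)
  qed
qed

lemma torus_of_rep: "torus_of (rep_torus X) = X"
  by (rule Quotient_abs_rep[OF Quotient_torus])

lemma torus_of_eq_iff: "torus_of x = torus_of y \<longleftrightarrow> integer_equiv x y"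
  by (rule torus.abs_eq_iff)

lemma torus_of_add: "torus_of x + torus_of y = torus_of (x + y)"
  by (rule plus_torus.abs_eq)

lemma torus_of_0: "torus_of 0 = 0"
  by (simp add: zero_torus_def)

lemma continuous_on_torus_of: "continuous_on S torus_of"
proof (rule continuous_on_subset)
  show "continuous_on UNIV (torus_of :: real ^ 'n \<Rightarrow> 'n torus)"
    by (subst continuous_on_open_vimage) (auto simp: open_torus_def)
qed simp

lemma continuous_on_torusI:
  fixes f :: "'n::finite torus \<Rightarrow> 'b::topological_space"
  assumes "continuous_on UNIV (\<lambda>z. f (torus_of z))"
  shows "continuous_on UNIV f"
proof (subst continuous_on_open_vimage, simp, intro allI impI)
  fix B :: "'b set" assume "open B"
  with assms have "open ((\<lambda>z. f (torus_of z)) -` B \<inter> UNIV)"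
    by (subst (asm) continuous_on_open_vimage) auto
  then show "open (f -` B \<inter> UNIV)"
    by (simp add: open_torus_def vimage_def)
qed

text \<open>Rounding down reaches a fixed ball by a lattice translation, so periodic functions can be studied on
  a compact set.\<close>

lemma torus_representative:
  fixes z :: "real ^ 'n::finite"
  shows "\<exists>k. z - k \<in> cball 0 (real CARD('n)) \<and> (\<forall>x. torus_of (x - k) = torus_of x)"
proof (intro exI conjI allI)
  let ?k = "\<chi> i. of_int \<lfloor>z $ i\<rfloor> :: real ^ 'n"
  have "norm (z - ?k) \<le> (\<Sum>i\<in>UNIV. \<bar>(z - ?k) $ i\<bar>)"
    by (rule norm_le_l1_cart)
  also have "\<dots> \<le> (\<Sum>i\<in>(UNIV :: 'n set). 1)"
    by (intro sum_mono) (simp add: abs_le_iff, linarith)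
  finally show "z - ?k \<in> cball 0 (real CARD('n))" by simp
  show "torus_of (x - ?k) = torus_of x" for x
    by (simp add: torus_of_eq_iff integer_equiv_def)
qed

lemma periodic_bounded:
  fixes f :: "real ^ 'n::finite \<Rightarrow> 'b::metric_space \<Rightarrow> real"
  assumes cont: "continuous_on (UNIV \<times> S) (\<lambda>(z, p). f z p)" and S: "compact S"
    and per: "\<And>z z' p. torus_of z = torus_of z' \<Longrightarrow> f z p = f z' p"
  obtains B where "\<And>z p. p \<in> S \<Longrightarrow> \<bar>f z p\<bar> \<le> B"
proof -
  have "compact ((\<lambda>(z, p). f z p) ` (cball 0 (real CARD('n)) \<times> S))"
    by (intro compact_continuous_image compact_Times S continuous_on_subset[OF cont]) auto
  then obtain B where B: "\<forall>y\<in>(\<lambda>(z, p). f z p) ` (cball 0 (real CARD('n)) \<times> S). \<bar>y\<bar> \<le> B"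
    by (auto dest!: compact_imp_bounded simp: bounded_iff)
  show ?thesis
  proof (rule that)
    fix z :: "real ^ 'n" and p assume p: "p \<in> S"
    obtain k where k: "z - k \<in> cball 0 (real CARD('n))" "\<And>x. torus_of (x - k) = torus_of x"
      using torus_representative[of z] by metis
    have "(z - k, p) \<in> cball 0 (real CARD('n)) \<times> S" using k(1) p by simp
    then have "(\<lambda>(z, p). f z p) (z - k, p) \<in> (\<lambda>(z, p). f z p) ` (cball 0 (real CARD('n)) \<times> S)"
      by (rule imageI)
    with B have "\<bar>(\<lambda>(z, p). f z p) (z - k, p)\<bar> \<le> B" by (rule bspec)
    then have "\<bar>f (z - k) p\<bar> \<le> B" by simp
    then show "\<bar>f z p\<bar> \<le> B" using per[OF k(2)] by simp
  qed
qed

lemma periodic_uniformly_continuous: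
  fixes f :: "real ^ 'n::finite \<Rightarrow> 'b::metric_space \<Rightarrow> real"
  assumes cont: "continuous_on (UNIV \<times> S) (\<lambda>(z, p). f z p)" and S: "compact S"
    and per: "\<And>z z' p. torus_of z = torus_of z' \<Longrightarrow> f z p = f z' p" and e: "0 < e"
  obtains d where "0 < d" "\<And>z z' p. p \<in> S \<Longrightarrow> norm (z - z') < d \<Longrightarrow> \<bar>f z p - f z' p\<bar> < e"
proof -
  let ?K = "cball 0 (real CARD('n) + 1) \<times> S :: ((real ^ 'n) \<times> 'b) set"
  have "uniformly_continuous_on ?K (\<lambda>(z, p). f z p)"
    by (intro compact_uniformly_continuous compact_Times S continuous_on_subset[OF cont]) auto
  then obtain d where d: "0 < d" "\<And>x x'. x \<in> ?K \<Longrightarrow> x' \<in> ?K \<Longrightarrow> dist x' x < d \<Longrightarrow>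
      dist (case x' of (z, p) \<Rightarrow> f z p) (case x of (z, p) \<Rightarrow> f z p) < e"
    unfolding uniformly_continuous_on_def using e by metis
  show ?thesis
  proof (rule that[of "min d 1"])
    fix z z' :: "real ^ 'n" and p assume p: "p \<in> S" and zz: "norm (z - z') < min d 1"
    obtain k where k: "z - k \<in> cball 0 (real CARD('n))" "\<And>x. torus_of (x - k) = torus_of x"
      using torus_representative[of z] by metis
    have "norm (z' - k) \<le> norm (z - k) + norm (z - z')"
      using norm_triangle_ineq4[of "z - k" "z - z'"] by simp
    with k zz have "(z - k, p) \<in> ?K" "(z' - k, p) \<in> ?K"
      using p by auto
    then have "dist (f (z - k) p) (f (z' - k) p) < e"
      using d(2)[of "(z' - k, p)" "(z - k, p)"] zz by (simp add: dist_Pair_Pair dist_norm)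
    then show "\<bar>f z p - f z' p\<bar> < e"
      using per[OF k(2)] by (simp add: dist_real_def)
  qed (use d in auto)
qed


locale hamiltonian_system = switching \<Lambda>
  for \<Lambda> :: "real ^ 'm ^ 'm::finite" +
  fixes H :: "'m \<Rightarrow> 'n::finite torus \<Rightarrow> real ^ 'n \<Rightarrow> real"
  assumes H_continuous: "\<And>i. continuous_on UNIV (\<lambda>(x, p). H i x p)"
    and H_convex: "\<And>i x. convex_on UNIV (H i x)"
    and H_superlinear: "\<And>i x. superlinear (H i x)"
begin

lemma H_lift_continuous: "continuous_on S (\<lambda>(z, p). H i (torus_of z) p)"
proof -
  have "continuous_on S (\<lambda>x. (\<lambda>(x, p). H i x p) (torus_of (fst x), snd x))"
    by (rule continuous_on_compose2[OF H_continuous])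
       (auto intro!: continuous_intros continuous_on_compose2[OF continuous_on_torus_of])
  then show ?thesis by (simp add: case_prod_beta')
qed

text \<open>Superlinearity is only given for each \<open>x\<close> separately. Growth on one large sphere persists under a small
  change of \<open>x\<close> by continuity, and convexity in \<open>p\<close> propagates it outwards from the sphere.\<close>

lemma H_superlinear_locally:
  assumes K: "0 \<le> K"
  shows "\<exists>d>0. \<exists>C. \<forall>z p. norm (z - z0) < d \<longrightarrow> K * norm p - C \<le> H i (torus_of z) p"
proof -
  let ?G = "\<lambda>z p. H i (torus_of z) p"
  let ?h = "\<bar>?G z0 0\<bar>"
  have "\<forall>\<^sub>F p in at_infinity. K + ?h + 2 \<le> ?G z0 p / norm p"
    using H_superlinear[of i "torus_of z0"] unfolding superlinear_def filterlim_at_top by blast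
  then obtain R0 where R0: "\<And>p. R0 \<le> norm p \<Longrightarrow> K + ?h + 2 \<le> ?G z0 p / norm p"
    by (auto simp: eventually_at_infinity)
  \<comment> \<open>\<open>1 \<le> R\<close> turns the excess \<open>?h + 2\<close> in the slope into the same excess on the sphere\<close>
  define R where "R = max R0 1"
  have R: "1 \<le> R" by (simp add: R_def)
  have sphere: "K * R + ?h + 2 \<le> ?G z0 p" if p: "norm p = R" for p
  proof -
    have "K + ?h + 2 \<le> ?G z0 p / R"
      using R0[of p] p by (simp add: R_def)
    then have "(K + ?h + 2) * R \<le> ?G z0 p"
      using R by (simp add: field_simps)
    moreover have "1 * (?h + 2) \<le> R * (?h + 2)"
      using R by (intro mult_right_mono) auto
    ultimately show ?thesis by (simp add: algebra_simps)
  qed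
  let ?S = "cball z0 1 \<times> cball 0 R :: ((real ^ 'n) \<times> (real ^ 'n)) set"
  have "uniformly_continuous_on ?S (\<lambda>(z, p). ?G z p)"
    by (intro compact_uniformly_continuous compact_Times H_lift_continuous) auto
  then obtain d where d: "0 < d" "\<And>x x'. x \<in> ?S \<Longrightarrow> x' \<in> ?S \<Longrightarrow> dist x' x < d \<Longrightarrow>
      dist (case x' of (z, p) \<Rightarrow> ?G z p) (case x of (z, p) \<Rightarrow> ?G z p) < 1"
    unfolding uniformly_continuous_on_def using zero_less_one by metis
  have near: "\<bar>?G z p - ?G z0 p\<bar> < 1" if "norm (z - z0) < min d 1" "norm p \<le> R" for z p
    using d(2)[of "(z0, p)" "(z, p)"] that by (auto simp: dist_Pair_Pair dist_norm norm_minus_commute)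
  have "compact ((\<lambda>(z, p). ?G z p) ` ?S)"
    by (intro compact_continuous_image compact_Times H_lift_continuous) auto
  then obtain B where B: "\<forall>y\<in>(\<lambda>(z, p). ?G z p) ` ?S. \<bar>y\<bar> \<le> B"
    by (auto dest!: compact_imp_bounded simp: bounded_iff)
  have "K * norm p - (K * R + B) \<le> ?G z p" if z: "norm (z - z0) < min d 1" for z p
  proof (cases "norm p \<le> R")
    case True
    have "\<bar>?G z p\<bar> \<le> B"
      using B z True by (auto simp: dist_norm norm_minus_commute)
    moreover have "K * norm p \<le> K * R" using True K by (rule mult_left_mono)
    ultimately show ?thesis by linarith
  next
    case False
    define t where "t = R / norm p"
    have p: "R < norm p" "p \<noteq> 0" using False R by auto
    have t: "0 < t" "t < 1" using p R by (auto simp: t_def)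
    have "?G z ((1 - t) *\<^sub>R 0 + t *\<^sub>R p) \<le> (1 - t) * ?G z 0 + t * ?G z p"
      by (rule convex_onD[OF H_convex]) (use t in auto)
    then have conv: "?G z (t *\<^sub>R p) \<le> (1 - t) * ?G z 0 + t * ?G z p" by simp
    have nt: "norm (t *\<^sub>R p) = R" using p R by (simp add: t_def)
    have "K * R + ?h + 1 \<le> ?G z (t *\<^sub>R p)"
      using sphere[OF nt] near[OF z, of "t *\<^sub>R p"] nt by linarith
    moreover have "?G z 0 \<le> ?h + 1"
      using near[OF z, of 0] R by auto
    ultimately have "K * R \<le> t * (?G z p - ?G z 0)"
      using conv by (simp add: algebra_simps)
    then have "R * (K * norm p) \<le> R * (?G z p - ?G z 0)"
      using p by (simp add: t_def divide_le_eq le_divide_eq field_simps)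
    then have "K * norm p \<le> ?G z p - ?G z 0"
      using R by (simp only: mult_le_cancel_left_pos)
    moreover have "\<bar>?G z 0\<bar> \<le> B"
      using B z R by (auto simp: dist_norm norm_minus_commute)
    moreover have "0 \<le> K * R" using K R by simp
    ultimately show ?thesis by linarith
  qed
  then show ?thesis using d(1) by (intro exI[of _ "min d 1"] conjI exI[of _ "K * R + B"]) auto
qed

lemma H_superlinear_uniform:
  obtains C where "\<And>i X p. K * norm p - C \<le> H i X p"
proof -
  have ex: "\<exists>C. \<forall>X p. \<bar>K\<bar> * norm p - C \<le> H i X p" for i
  proof -
    obtain d C where dC: "\<And>z0. 0 < d z0" "\<And>z0 z p. norm (z - z0) < d z0 \<Longrightarrow> \<bar>K\<bar> * norm p - C z0 \<le> H i (torus_of z) p"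
      using H_superlinear_locally[of "\<bar>K\<bar>" _ i] by (metis abs_ge_zero)
    let ?Q = "cball 0 (real CARD('n)) :: (real ^ 'n) set"
    have "?Q \<subseteq> (\<Union>z0\<in>?Q. ball z0 (d z0))" using dC(1) by fastforce
    then obtain F where F: "F \<subseteq> ?Q" "finite F" "?Q \<subseteq> (\<Union>z0\<in>F. ball z0 (d z0))"
      by (rule compactE_image[OF compact_cball open_ball])
    have "\<bar>K\<bar> * norm p - (\<Sum>z0\<in>F. \<bar>C z0\<bar>) \<le> H i X p" for X p
    proof -
      obtain k where k: "rep_torus X - k \<in> ?Q" "\<And>x. torus_of (x - k) = torus_of x"
        using torus_representative[of "rep_torus X"] by metis
      from k(1) F(3) obtain z0 where "z0 \<in> F" "rep_torus X - k \<in> ball z0 (d z0)" by blast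
      then have z0: "z0 \<in> F" "norm ((rep_torus X - k) - z0) < d z0"
        by (auto simp: dist_norm norm_minus_commute)
      have "C z0 \<le> (\<Sum>z0\<in>F. \<bar>C z0\<bar>)"
        using member_le_sum[of z0 F "\<lambda>z0. \<bar>C z0\<bar>"] z0 F by auto
      then show ?thesis
        using dC(2)[OF z0(2), of p] by (simp add: k(2) torus_of_rep)
    qed
    then show ?thesis by blast
  qed
  then obtain C where C: "\<And>i X p. \<bar>K\<bar> * norm p - C i \<le> H i X p" by metis
  show ?thesis
  proof (rule that[of "\<Sum>i\<in>UNIV. \<bar>C i\<bar>"])
    fix i X and p :: "real ^ 'n"
    have "C i \<le> (\<Sum>i\<in>UNIV. \<bar>C i\<bar>)"
      using member_le_sum[of i UNIV "\<lambda>i. \<bar>C i\<bar>"] by auto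
    moreover have "K * norm p \<le> \<bar>K\<bar> * norm p" by (intro mult_right_mono) auto
    ultimately show "K * norm p - (\<Sum>i\<in>UNIV. \<bar>C i\<bar>) \<le> H i X p" using C[of p i X] by linarith
  qed
qed

lemma inner_le_norm_mult: "(p :: real ^ 'n) \<bullet> q \<le> norm q * norm p"
  using norm_cauchy_schwarz[of p q] by (simp add: mult.commute)

lemma bdd_above_legendre: "bdd_above (range (\<lambda>p. p \<bullet> q - H i X p))"
proof -
  obtain C where C: "\<And>i X p. norm q * norm p - C \<le> H i X p"
    using H_superlinear_uniform by blast
  have "p \<bullet> q - H i X p \<le> C" for p
    using C[of p i X] inner_le_norm_mult[of p q] by linarith
  then show ?thesis by (intro bdd_aboveI2[of _ _ C]) auto
qed

lemma fenchel_young: "p \<bullet> q \<le> lagrangian H i X q + H i X p"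
proof -
  have "p \<bullet> q - H i X p \<le> lagrangian H i X q"
    unfolding lagrangian_def by (rule cSUP_upper[OF _ bdd_above_legendre]) simp
  then show ?thesis by simp
qed

lemma lagrangian_leI: "(\<And>p. p \<bullet> q - H i X p \<le> c) \<Longrightarrow> lagrangian H i X q \<le> c"
  unfolding lagrangian_def by (rule cSUP_least) auto

text \<open>Biconjugation: a hyperplane separates \<open>(p, H p - e)\<close> from the epigraph, and its slope \<open>q\<close> nearly
  attains \<open>p \<bullet> q - L q = H p\<close>.\<close>

lemma hamiltonian_le_if_conjugate_le:
  assumes c: "\<And>q. p \<bullet> q - lagrangian H i X q \<le> c"
  shows "H i X p \<le> c"
proof (rule field_le_epsilon)
  fix e :: real assume e: "0 < e"
  let ?E = "epigraph UNIV (H i X)"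
  have "continuous_on UNIV (\<lambda>x. H i (torus_of (rep_torus X)) x)"
    using continuous_on_compose2[OF H_lift_continuous[of UNIV i], of UNIV "\<lambda>p. (rep_torus X, p)"]
      continuous_on_Pair[OF continuous_on_const continuous_on_id, of UNIV "rep_torus X"]
    by simp
  then have cont: "continuous_on UNIV (H i X)" by (simp add: torus_of_rep)
  have "?E = {x. H i X (fst x) \<le> snd x}" by (auto simp: epigraph_def)
  moreover have "closed {x. H i X (fst x) \<le> snd x}"
    by (intro closed_Collect_le continuous_intros continuous_on_compose2[OF cont]) auto
  ultimately have "closed ?E" by simp
  moreover have "convex ?E" using H_convex convex_epigraph by blast
  moreover have "(p, H i X p - e) \<notin> ?E" using e by (auto simp: epigraph_def)
  ultimately have "\<exists>a \<beta>. a \<bullet> (p, H i X p - e) < \<beta> \<and> (\<forall>x\<in>?E. \<beta> < a \<bullet> x)"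
    by (intro separating_hyperplane_closed_point)
  then obtain a \<beta> where ab: "a \<bullet> (p, H i X p - e) < \<beta>" "\<And>x. x \<in> ?E \<Longrightarrow> \<beta> < a \<bullet> x"
    by metis
  obtain a1 a2 where a: "a = (a1, a2)" by (cases a)
  have sep: "a1 \<bullet> p + a2 * (H i X p - e) < a1 \<bullet> p' + a2 * H i X p'" for p'
    using ab(1) ab(2)[of "(p', H i X p')"] by (auto simp: a epigraph_def inner_Pair)
  have "0 < a2 * e" using sep[of p] by (simp add: algebra_simps)
  then have a2: "0 < a2" using e by (simp add: zero_less_mult_iff)
  define q where "q = - a1 /\<^sub>R a2"
  have q: "a1 \<bullet> x = - a2 * (x \<bullet> q)" for x
    using a2 by (simp add: q_def inner_commute)
  have "p' \<bullet> q - H i X p' \<le> p \<bullet> q - H i X p + e" for p'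
  proof -
    have "a2 * (p' \<bullet> q - H i X p') \<le> a2 * (p \<bullet> q - H i X p + e)"
      using sep[of p'] unfolding q by (simp add: algebra_simps)
    then show ?thesis using a2 by simp
  qed
  then have "lagrangian H i X q \<le> p \<bullet> q - H i X p + e" by (rule lagrangian_leI)
  then show "H i X p \<le> c + e" using c[of q] by simp
qed

lemma H_bounded:
  obtains m where "\<And>i X p. norm p \<le> R \<Longrightarrow> \<bar>H i X p\<bar> \<le> m"
proof -
  have "\<exists>m. \<forall>X p. norm p \<le> R \<longrightarrow> \<bar>H i X p\<bar> \<le> m" for i
  proof -
    obtain m where m: "\<And>z p. p \<in> cball 0 R \<Longrightarrow> \<bar>H i (torus_of z) p\<bar> \<le> m"
      using periodic_bounded[of "cball 0 R" "\<lambda>z p. H i (torus_of z) p"] H_lift_continuous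
      by (metis compact_cball)
    have "\<bar>H i X p\<bar> \<le> m" if "norm p \<le> R" for X p
      using m[of p "rep_torus X"] that by (simp add: torus_of_rep)
    then show ?thesis by blast
  qed
  then obtain m where m: "\<And>i X p. norm p \<le> R \<Longrightarrow> \<bar>H i X p\<bar> \<le> m i" by metis
  show ?thesis
  proof (rule that[of "\<Sum>i\<in>UNIV. \<bar>m i\<bar>"])
    fix i X and p :: "real ^ 'n" assume "norm p \<le> R"
    then show "\<bar>H i X p\<bar> \<le> (\<Sum>i\<in>UNIV. \<bar>m i\<bar>)"
      using m[of p i X] member_le_sum[of i UNIV "\<lambda>i. \<bar>m i\<bar>"] by auto
  qed
qed

lemma lagrangian_bounded:
  obtains B where "\<And>i X q. norm q \<le> R \<Longrightarrow> \<bar>lagrangian H i X q\<bar> \<le> B"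
proof -
  obtain C where C: "\<And>i X p. \<bar>R\<bar> * norm p - C \<le> H i X p" using H_superlinear_uniform by blast
  obtain m where m: "\<And>i X p. norm p \<le> 0 \<Longrightarrow> \<bar>H i X p\<bar> \<le> m" using H_bounded by blast
  show ?thesis
  proof (rule that[of "max C m"])
    fix i X and q :: "real ^ 'n" assume q: "norm q \<le> R"
    have "lagrangian H i X q \<le> C"
    proof (rule lagrangian_leI)
      fix p :: "real ^ 'n"
      have "norm q * norm p \<le> \<bar>R\<bar> * norm p" using q by (intro mult_right_mono) auto
      then show "p \<bullet> q - H i X p \<le> C"
        using C[of p i X] inner_le_norm_mult[of p q] by linarith
    qed
    moreover have "- m \<le> lagrangian H i X q"
      using fenchel_young[of 0 q i X] m[of 0 i X] by (simp add: abs_le_iff)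
    ultimately show "\<bar>lagrangian H i X q\<bar> \<le> max C m" by linarith
  qed
qed

text \<open>If \<open>q\<close> stays in a ball, uniform superlinearity confines the relevant \<open>p\<close> in the supremum to a ball,
  where \<open>H\<close> is uniformly continuous.\<close>

lemma lagrangian_uniformly_continuous:
  assumes e: "0 < e"
  obtains d where "0 < d" "\<And>i z z' q q'. norm q \<le> R \<Longrightarrow> norm q' \<le> R \<Longrightarrow> norm (z - z') < d \<Longrightarrow>
     norm (q - q') < d \<Longrightarrow> \<bar>lagrangian H i (torus_of z) q - lagrangian H i (torus_of z') q'\<bar> \<le> e"
proof -
  obtain C where C: "\<And>i X p. (\<bar>R\<bar> + 1) * norm p - C \<le> H i X p" using H_superlinear_uniform by blast
  obtain m where m: "\<And>i X p. norm p \<le> 0 \<Longrightarrow> \<bar>H i X p\<bar> \<le> m" using H_bounded by blast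
  define \<rho> where "\<rho> = \<bar>C\<bar> + \<bar>m\<bar> + 1"
  have \<rho>: "0 < \<rho>" by (simp add: \<rho>_def)
  have "\<exists>d>0. \<forall>z z' p. norm p \<le> \<rho> \<longrightarrow> norm (z - z') < d \<longrightarrow> \<bar>H i (torus_of z) p - H i (torus_of z') p\<bar> < e / 2" for i
  proof -
    obtain d where "0 < d" "\<And>z z' p. p \<in> cball 0 \<rho> \<Longrightarrow> norm (z - z') < d \<Longrightarrow>
        \<bar>H i (torus_of z) p - H i (torus_of z') p\<bar> < e / 2"
      using periodic_uniformly_continuous[of "cball 0 \<rho>" "\<lambda>z p. H i (torus_of z) p" "e / 2"] H_lift_continuous e
      by (metis compact_cball half_gt_zero)
    then show ?thesis by auto
  qed
  then obtain d where d: "\<And>i. 0 < d i" "\<And>i z z' p. norm p \<le> \<rho> \<Longrightarrow> norm (z - z') < d i \<Longrightarrow>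
      \<bar>H i (torus_of z) p - H i (torus_of z') p\<bar> < e / 2" by metis
  define d0 where "d0 = min (Min (range d)) (e / (2 * \<rho>))"
  have d0: "0 < d0" "\<And>i. d0 \<le> d i" "d0 * \<rho> \<le> e / 2"
  proof -
    show "0 < d0" using d(1) e \<rho> by (simp add: d0_def)
    have "Min (range d) \<le> d i" for i by (rule Min_le) auto
    then show "d0 \<le> d i" for i unfolding d0_def by (meson min.coboundedI1)
    have "d0 * \<rho> \<le> e / (2 * \<rho>) * \<rho>"
      using \<rho> by (intro mult_right_mono) (auto simp: d0_def)
    then show "d0 * \<rho> \<le> e / 2" using \<rho> by simp
  qed
  have half: "lagrangian H i (torus_of z) q \<le> lagrangian H i (torus_of z') q' + e"
    if q: "norm q \<le> R" and z: "norm (z - z') < d0" and qq: "norm (q - q') < d0"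
    for i and z z' q q' :: "real ^ 'n"
  proof (rule lagrangian_leI)
    fix p :: "real ^ 'n"
    show "p \<bullet> q - H i (torus_of z) p \<le> lagrangian H i (torus_of z') q' + e"
    proof (cases "norm p \<le> \<rho>")
      case True
      have "p \<bullet> (q - q') \<le> norm (q - q') * norm p" by (rule inner_le_norm_mult)
      also have "\<dots> \<le> d0 * \<rho>" using True qq d0(1) by (intro mult_mono) auto
      finally have "p \<bullet> q \<le> p \<bullet> q' + e / 2" using d0(3) by (simp add: inner_diff_right)
      moreover have "norm (z - z') < d i" using z d0(2)[of i] by linarith
      ultimately show ?thesis
        using d(2)[OF True, of z z' i] fenchel_young[of p q' i "torus_of z'"] by linarith
    next
      case False
      have "norm q * norm p \<le> \<bar>R\<bar> * norm p" using q by (intro mult_right_mono) auto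
      moreover have "(\<bar>R\<bar> + 1) * norm p = \<bar>R\<bar> * norm p + norm p" by (simp add: algebra_simps)
      ultimately have "p \<bullet> q - H i (torus_of z) p \<le> C - norm p"
        using C[of p i "torus_of z"] inner_le_norm_mult[of p q] by linarith
      also have "\<dots> \<le> - m" using False by (simp add: \<rho>_def)
      also have "- m \<le> lagrangian H i (torus_of z') q'"
        using fenchel_young[of 0 q' i "torus_of z'"] m[of 0 i "torus_of z'"] by (simp add: abs_le_iff)
      finally show ?thesis using e by simp
    qed
  qed
  show ?thesis
  proof (rule that[OF d0(1)])
    fix i and z z' q q' :: "real ^ 'n"
    assume "norm q \<le> R" "norm q' \<le> R" "norm (z - z') < d0" "norm (q - q') < d0"
    then show "\<bar>lagrangian H i (torus_of z) q - lagrangian H i (torus_of z') q'\<bar> \<le> e"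
      using half[of q z z' q' i] half[of q' z' z q i] by (simp add: norm_minus_commute abs_le_iff)
  qed
qed

lemma lagrangian_lift_continuous:
  "continuous_on UNIV (\<lambda>x. lagrangian H i (torus_of (fst x)) (snd x))"
proof (unfold continuous_on_iff, intro ballI allI impI)
  fix x :: "(real ^ 'n) \<times> (real ^ 'n)" and e :: real assume e: "0 < e"
  have "0 < e / 2" using e by simp
  then obtain d where d: "0 < d" "\<And>i z z' q q'. norm q \<le> norm (snd x) + 1 \<Longrightarrow> norm q' \<le> norm (snd x) + 1 \<Longrightarrow>
     norm (z - z') < d \<Longrightarrow> norm (q - q') < d \<Longrightarrow>
     \<bar>lagrangian H i (torus_of z) q - lagrangian H i (torus_of z') q'\<bar> \<le> e / 2"
    by (rule lagrangian_uniformly_continuous[of _ "norm (snd x) + 1"]) blast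
  show "\<exists>d>0. \<forall>x'\<in>UNIV. dist x' x < d \<longrightarrow>
     dist (lagrangian H i (torus_of (fst x')) (snd x')) (lagrangian H i (torus_of (fst x)) (snd x)) < e"
  proof (intro exI[of _ "min d 1"] conjI ballI impI)
    fix x' :: "(real ^ 'n) \<times> (real ^ 'n)" assume x': "dist x' x < min d 1"
    have 1: "norm (fst x' - fst x) < d" "norm (snd x' - snd x) < d" "norm (snd x' - snd x) < 1"
      using dist_fst_le[of x' x] dist_snd_le[of x' x] x' by (auto simp: dist_norm)
    moreover have "norm (snd x') \<le> norm (snd x) + 1"
      using 1(3) norm_triangle_sub[of "snd x'" "snd x"] by linarith
    ultimately have "\<bar>lagrangian H i (torus_of (fst x')) (snd x') - lagrangian H i (torus_of (fst x)) (snd x)\<bar> \<le> e / 2"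
      by (intro d(2)) auto
    then show "dist (lagrangian H i (torus_of (fst x')) (snd x')) (lagrangian H i (torus_of (fst x)) (snd x)) < e"
      using e by (simp add: dist_real_def)
  qed (use d in auto)
qed

end


section \<open>Sup-convolution of subsolutions\<close>

text \<open>The periodic counterpart of a multiple of the squared norm, vanishing exactly on the lattice. Smoothness and
  periodicity make it a test function on the whole torus.\<close>

definition bump :: "real ^ 'n::finite \<Rightarrow> real" where
  "bump z = (\<Sum>k\<in>UNIV. 1 - cos (2 * pi * z $ k))"

definition bump_gradient :: "real ^ 'n::finite \<Rightarrow> real ^ 'n" where
  "bump_gradient z = (\<chi> k. 2 * pi * sin (2 * pi * z $ k))"

lemma bump_nonneg: "0 \<le> bump z"
  unfolding bump_def by (intro sum_nonneg) simp

lemma bump_0 [simp]: "bump 0 = 0"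
  by (simp add: bump_def)

lemma periodic_cos_sin:
  assumes "x - y \<in> \<int>"
  shows "cos (2 * pi * x) = cos (2 * pi * y)" "sin (2 * pi * x) = sin (2 * pi * y)"
proof -
  obtain n where "x - y = of_int n" using assms by (auto elim: Ints_cases)
  then have "x = y + of_int n" by simp
  then have x: "2 * pi * x = 2 * pi * y + 2 * pi * of_int n" by (simp add: algebra_simps)
  show "cos (2 * pi * x) = cos (2 * pi * y)" "sin (2 * pi * x) = sin (2 * pi * y)"
    unfolding x by (simp_all add: cos_add sin_add)
qed

lemma bump_periodic:
  assumes "torus_of z = torus_of z'"
  shows "bump (z - x) = bump (z' - x)" "bump_gradient (z - x) = bump_gradient (z' - x)"
proof -
  have "(z - x) $ k - (z' - x) $ k \<in> \<int>" for k
    using assms by (simp add: torus_of_eq_iff integer_equiv_def)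
  note p = periodic_cos_sin[OF this]
  show "bump (z - x) = bump (z' - x)" unfolding bump_def p ..
  show "bump_gradient (z - x) = bump_gradient (z' - x)" unfolding bump_gradient_def p ..
qed

lemma bump_has_gradient: "GDERIV (\<lambda>z. bump (z - x)) z :> bump_gradient (z - x)"
proof -
  have "((\<lambda>z. 1 - cos (2 * pi * (z - x) $ k)) has_derivative
     (\<lambda>h. h $ k * (2 * pi * sin (2 * pi * (z - x) $ k)))) (at z)" for k
  proof -
    have c: "((\<lambda>x. x $ k) has_derivative (\<lambda>h. h $ k)) (at z)"
      by (rule bounded_linear_imp_has_derivative[OF bounded_linear_vec_nth])
    show ?thesis
      by (auto intro!: derivative_eq_intros c simp: algebra_simps)
  qed
  then have "((\<lambda>z. \<Sum>k\<in>UNIV. 1 - cos (2 * pi * (z - x) $ k)) has_derivative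
     (\<lambda>h. \<Sum>k\<in>UNIV. h $ k * (2 * pi * sin (2 * pi * (z - x) $ k)))) (at z)"
    by (intro has_derivative_sum)
  then show ?thesis
    by (simp add: gderiv_def bump_def bump_gradient_def inner_vec_def)
qed

lemma continuous_bump: "continuous_on S (\<lambda>z. bump (z - x))"
  unfolding bump_def by (intro continuous_intros)

lemma continuous_bump_gradient: "continuous_on S (\<lambda>z. bump_gradient (z - x))"
  unfolding bump_gradient_def by (intro continuous_on_vec_lambda continuous_intros)

text \<open>Taylor expansion in \<open>b\<close> to second order; the second derivative is \<open>cos (a - t) \<le> 1\<close>.\<close>

lemma one_minus_cos_expand:
  fixes a b :: real
  shows "1 - cos (a - b) \<le> 1 - cos a - sin a * b + b\<^sup>2 / 2"
proof -
  define f where "f = (\<lambda>m b. (if m = 0 then 1 else 0) - cos (a - b - real m * (pi / 2)))"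
  have "(f m has_real_derivative f (Suc m) x) (at x)" for m x
  proof -
    have "a - x - real (Suc m) * (pi / 2) = (a - x - real m * (pi / 2)) - pi / 2"
      by (simp add: algebra_simps)
    then have "f (Suc m) x = - sin (a - x - real m * (pi / 2))"
      unfolding f_def by (simp only: cos_diff) simp
    then show ?thesis
      unfolding f_def by (auto intro!: derivative_eq_intros)
  qed
  then obtain t where t: "f 0 b = (\<Sum>m<2. f m 0 / fact m * b ^ m) + f 2 t / fact 2 * b\<^sup>2"
    using Maclaurin_all_le[of f "f 0" b 2] by auto
  have "f 2 t = cos (a - t)" by (simp add: f_def cos_diff)
  then have "f 2 t / 2 * b\<^sup>2 \<le> 1 / 2 * b\<^sup>2"
    by (intro mult_right_mono) auto
  with t show ?thesis
    by (simp add: f_def numeral_2_eq_2 cos_diff)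
qed

lemma bump_expand:
  "bump (z - e) \<le> bump z - bump_gradient z \<bullet> e + 2 * pi\<^sup>2 * (norm e)\<^sup>2"
proof -
  have "bump (z - e) = (\<Sum>k\<in>UNIV. 1 - cos (2 * pi * z $ k - 2 * pi * e $ k))"
    by (simp add: bump_def right_diff_distrib)
  also have "\<dots> \<le> (\<Sum>k\<in>UNIV. 1 - cos (2 * pi * z $ k) - sin (2 * pi * z $ k) * (2 * pi * e $ k) + (2 * pi * e $ k)\<^sup>2 / 2)"
    by (intro sum_mono one_minus_cos_expand)
  also have "\<dots> = bump z - bump_gradient z \<bullet> e + 2 * pi\<^sup>2 * (e \<bullet> e)"
    by (simp add: bump_def bump_gradient_def inner_vec_def sum.distrib sum_subtractf sum_distrib_left
        power2_eq_square mult_ac)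
  finally show ?thesis by (simp add: power2_norm_eq_inner)
qed

lemma norm_bump_gradient: "norm (bump_gradient (z :: real ^ 'n::finite)) \<le> 2 * pi * real CARD('n)"
proof -
  have "norm (bump_gradient z) \<le> (\<Sum>k\<in>UNIV. \<bar>bump_gradient z $ k\<bar>)" by (rule norm_le_l1_cart)
  also have "\<dots> \<le> (\<Sum>k\<in>(UNIV :: 'n set). 2 * pi * 1)"
    unfolding bump_gradient_def by (intro sum_mono) (simp add: abs_mult)
  finally show ?thesis by (simp add: mult.commute)
qed

lemma bump_small_imp_close:
  assumes r: "0 < r"
  obtains d where "0 < d" "\<And>z :: real ^ 'n::finite. bump z \<le> d \<Longrightarrow> \<exists>k. norm (z - k) \<le> r \<and> (\<forall>x. torus_of (x + k) = torus_of x)"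
proof -
  \<comment> \<open>cosine decreases on half a period; the \<open>\<ell>\<^sup>1\<close> norm is at most \<open>CARD('n) * s\<close>\<close>
  define s where "s = min (1 / 4) (r / real CARD('n))"
  have s: "0 < s" "s \<le> 1 / 4" "real CARD('n) * s \<le> r"
    using r by (auto simp: s_def min_def field_simps)
  define d where "d = 1 - cos (2 * pi * s)"
  have "cos (2 * pi * s) < cos 0"
    by (rule cos_monotone_0_pi) (use s in auto)
  then have d: "0 < d" by (simp add: d_def)
  show ?thesis
  proof (rule that[OF d])
    fix z :: "real ^ 'n" assume z: "bump z \<le> d"
    define k :: "real ^ 'n" where "k = (\<chi> i. of_int (round (z $ i)))"
    have "\<bar>(z - k) $ i\<bar> \<le> s" for i
    proof (rule ccontr)
      assume "\<not> \<bar>(z - k) $ i\<bar> \<le> s"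
      then have lt: "s < \<bar>(z - k) $ i\<bar>" by simp
      have le: "\<bar>(z - k) $ i\<bar> \<le> 1 / 2"
        using of_int_round_abs_le[of "z $ i"] by (simp add: k_def abs_minus_commute)
      have "cos (2 * pi * \<bar>(z - k) $ i\<bar>) < cos (2 * pi * s)"
        by (rule cos_monotone_0_pi) (use s lt le in auto)
      moreover have "cos (2 * pi * \<bar>(z - k) $ i\<bar>) = cos (2 * pi * (z - k) $ i)"
      proof -
        have "2 * pi * \<bar>(z - k) $ i\<bar> = \<bar>2 * pi * (z - k) $ i\<bar>" by (simp add: abs_mult)
        then show ?thesis by (simp only: cos_abs_real)
      qed
      moreover have "cos (2 * pi * (z - k) $ i) = cos (2 * pi * z $ i)"
        by (rule periodic_cos_sin) (simp add: k_def)
      ultimately have "d < 1 - cos (2 * pi * z $ i)" by (simp add: d_def)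
      also have "\<dots> \<le> bump z"
        unfolding bump_def by (rule member_le_sum[of i UNIV "\<lambda>i. 1 - cos (2 * pi * z $ i)"]) auto
      finally show False using z by simp
    qed
    then have "(\<Sum>i\<in>UNIV. \<bar>(z - k) $ i\<bar>) \<le> (\<Sum>i\<in>(UNIV :: 'n set). s)" by (intro sum_mono)
    then have "norm (z - k) \<le> r"
      using norm_le_l1_cart[of "z - k"] s(3) by simp
    moreover have "torus_of (x + k) = torus_of x" for x
      by (simp add: torus_of_eq_iff integer_equiv_def k_def)
    ultimately show "\<exists>k. norm (z - k) \<le> r \<and> (\<forall>x. torus_of (x + k) = torus_of x)" by blast
  qed
qed

context hamiltonian_system
begin

text \<open>Since \<open>bump\<close> is periodic, the supremum over the covering space is a supremum over the torus.\<close>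

definition supconv :: "('n torus \<Rightarrow> real ^ 'm) \<Rightarrow> real \<Rightarrow> real ^ 'n \<Rightarrow> real ^ 'm" where
  "supconv w e x = (\<chi> i. SUP z. w (torus_of z) $ i - bump (z - x) / e)"

lemma supconv_attained:
  assumes w: "continuous_on UNIV w" and e: "0 < e"
  shows "\<exists>z. supconv w e x $ i = w (torus_of z) $ i - bump (z - x) / e \<and>
     (\<forall>z'. w (torus_of z') $ i - bump (z' - x) / e \<le> w (torus_of z) $ i - bump (z - x) / e)"
proof -
  let ?g = "\<lambda>z. w (torus_of z) $ i - bump (z - x) / e"
  let ?Q = "cball 0 (real CARD('n)) :: (real ^ 'n) set"
  have "continuous_on ?Q ?g"
    using e by (intro continuous_intros continuous_bump continuous_on_compose2[OF w continuous_on_torus_of]) auto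
  then obtain z where z: "z \<in> ?Q" "\<forall>z'\<in>?Q. ?g z' \<le> ?g z"
    using continuous_attains_sup[of ?Q ?g] by auto
  have max: "?g z' \<le> ?g z" for z'
  proof -
    obtain k where k: "z' - k \<in> ?Q" "\<And>x. torus_of (x - k) = torus_of x"
      using torus_representative[of z'] by metis
    have "?g (z' - k) = ?g z'"
      using k(2)[of z'] bump_periodic(1)[of "z' - k" z' x] by simp
    then show ?thesis using z(2) k(1) by metis
  qed
  have "(SUP z'. ?g z') = ?g z"
    by (rule cSup_eq_maximum) (use max in auto)
  with max show ?thesis
    by (intro exI[of _ z]) (auto simp: supconv_def)
qed

lemma supconv_ge:
  assumes w: "continuous_on UNIV w" and e: "0 < e"
  shows "w (torus_of z) $ i - bump (z - x) / e \<le> supconv w e x $ i"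
  using supconv_attained[OF w e, of x i] by metis

lemma continuous_torus_bounded:
  fixes w :: "'n torus \<Rightarrow> real ^ 'm"
  assumes w: "continuous_on UNIV w"
  obtains B where "0 \<le> B" "\<And>X i. \<bar>w X $ i\<bar> \<le> B"
proof -
  have "continuous_on (UNIV \<times> {0}) (\<lambda>(z, p). norm (w (torus_of z)))"
    unfolding case_prod_beta'
    by (intro continuous_intros continuous_on_compose2[OF w] continuous_on_compose2[OF continuous_on_torus_of]) auto
  then obtain B where B: "\<And>z p. p \<in> {0::real} \<Longrightarrow> \<bar>norm (w (torus_of z))\<bar> \<le> B"
    using periodic_bounded[of "{0::real}" "\<lambda>z p. norm (w (torus_of z))"] by (metis finite.emptyI finite.insertI finite_imp_compact)
  show ?thesis
  proof (rule that[of "\<bar>B\<bar>"])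
    show "\<bar>w X $ i\<bar> \<le> \<bar>B\<bar>" for X i
      using B[of 0 "rep_torus X"] component_le_norm_cart[of "w X" i] by (simp add: torus_of_rep)
  qed simp
qed

lemma continuous_torus_uniform:
  fixes w :: "'n torus \<Rightarrow> real ^ 'm"
  assumes w: "continuous_on UNIV w" and e: "0 < e"
  obtains d where "0 < d" "\<And>z z' i. norm (z - z') < d \<Longrightarrow> \<bar>w (torus_of z) $ i - w (torus_of z') $ i\<bar> < e"
proof -
  have "\<exists>d>0. \<forall>z z'. norm (z - z') < d \<longrightarrow> \<bar>w (torus_of z) $ i - w (torus_of z') $ i\<bar> < e" for i
  proof -
    have "continuous_on (UNIV \<times> {0}) (\<lambda>(z, p). w (torus_of z) $ i)"
      unfolding case_prod_beta'
      by (intro continuous_intros continuous_on_compose2[OF w] continuous_on_compose2[OF continuous_on_torus_of]) auto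
    then obtain d where "0 < d" "\<And>z z' p. p \<in> {0::real} \<Longrightarrow> norm (z - z') < d \<Longrightarrow> \<bar>w (torus_of z) $ i - w (torus_of z') $ i\<bar> < e"
      using periodic_uniformly_continuous[of "{0::real}" "\<lambda>z p. w (torus_of z) $ i" e] e
      by (metis finite.emptyI finite.insertI finite_imp_compact)
    then show ?thesis by blast
  qed
  then obtain d where d: "\<And>i. 0 < d i" "\<And>i z z'. norm (z - z') < d i \<Longrightarrow> \<bar>w (torus_of z) $ i - w (torus_of z') $ i\<bar> < e"
    by metis
  show ?thesis
  proof (rule that[of "Min (range d)"])
    show "0 < Min (range d)" using d(1) by simp
    fix z z' :: "real ^ 'n" and i assume "norm (z - z') < Min (range d)"
    also have "Min (range d) \<le> d i" by (rule Min_le) auto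
    finally show "\<bar>w (torus_of z) $ i - w (torus_of z') $ i\<bar> < e" by (rule d(2))
  qed
qed

text \<open>For small \<open>e\<close> the penalty exceeds the oscillation of \<open>w\<close> unless \<open>z\<close> is close to \<open>x\<close> modulo the lattice.\<close>

lemma supconv_uniformly_close:
  assumes w: "continuous_on UNIV w" and \<eta>: "0 < \<eta>" and r: "0 < r"
  obtains e where "0 < e" "\<And>x i. \<bar>supconv w e x $ i - w (torus_of x) $ i\<bar> \<le> \<eta>"
    "\<And>x i z. supconv w e x $ i = w (torus_of z) $ i - bump (z - x) / e \<Longrightarrow>
       \<exists>z'. torus_of z' = torus_of z \<and> norm (z' - x) \<le> r"
proof -
  obtain B where B: "0 \<le> B" "\<And>X i. \<bar>w X $ i\<bar> \<le> B" by (rule continuous_torus_bounded[OF w]) blast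
  obtain d where d: "0 < d" "\<And>z z' i. norm (z - z') < d \<Longrightarrow> \<bar>w (torus_of z) $ i - w (torus_of z') $ i\<bar> < \<eta>"
    by (rule continuous_torus_uniform[OF w \<eta>]) blast
  define r' where "r' = min r (d / 2)"
  have r': "0 < r'" "r' \<le> r" "r' < d" using r d by (auto simp: r'_def)
  obtain c where c: "0 < c" "\<And>z :: real ^ 'n. bump z \<le> c \<Longrightarrow> \<exists>k. norm (z - k) \<le> r' \<and> (\<forall>x. torus_of (x + k) = torus_of x)"
    by (rule bump_small_imp_close[OF r'(1)]) blast
  define e where "e = c / (2 * B + 1)"
  have e: "0 < e" using c B by (simp add: e_def)
  have close: "\<exists>z'. torus_of z' = torus_of z \<and> norm (z' - x) \<le> r'"
    if z: "supconv w e x $ i = w (torus_of z) $ i - bump (z - x) / e" for x i z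
  proof -
    have "w (torus_of x) $ i \<le> w (torus_of z) $ i - bump (z - x) / e"
      using supconv_ge[OF w e, of x i x] z by simp
    then have "bump (z - x) / e \<le> 2 * B"
      using B(2)[of "torus_of x" i] B(2)[of "torus_of z" i] by linarith
    then have "bump (z - x) \<le> 2 * B * e" using e by (simp add: field_simps)
    also have "\<dots> \<le> c" using c B by (simp add: e_def field_simps)
    finally obtain k where k: "norm (z - x - k) \<le> r'" "\<And>x. torus_of (x + k) = torus_of x"
      using c(2) by blast
    have "torus_of (z - k) = torus_of z" using k(2)[of "z - k"] by simp
    moreover have "norm ((z - k) - x) \<le> r'" using k(1) by (simp add: algebra_simps)
    ultimately show ?thesis by blast
  qed
  show ?thesis
  proof (rule that[OF e])
    fix x i
    obtain z where z: "supconv w e x $ i = w (torus_of z) $ i - bump (z - x) / e"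
      using supconv_attained[OF w e] by metis
    then obtain z' where z': "torus_of z' = torus_of z" "norm (z' - x) \<le> r'" using close by blast
    have "\<bar>w (torus_of z) $ i - w (torus_of x) $ i\<bar> < \<eta>"
      using d(2)[of z' x i] z' r' by simp
    moreover have "0 \<le> bump (z - x) / e" using bump_nonneg[of "z - x"] e by simp
    ultimately show "\<bar>supconv w e x $ i - w (torus_of x) $ i\<bar> \<le> \<eta>"
      using supconv_ge[OF w e, of x i x] z by simp
  next
    fix x i z
    assume "supconv w e x $ i = w (torus_of z) $ i - bump (z - x) / e"
    then show "\<exists>z'. torus_of z' = torus_of z \<and> norm (z' - x) \<le> r"
      using close[of x i z] r'(2) by force
  qed
qed

text \<open>The maximiser for \<open>x\<close> competes in the supremum for \<open>x + v\<close>.\<close>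

lemma supconv_shift:
  assumes w: "continuous_on UNIV w" and e: "0 < e"
    and z: "supconv w e x $ i = w (torus_of z) $ i - bump (z - x) / e"
  shows "supconv w e x $ i + (bump_gradient (z - x) \<bullet> v) / e - 2 * pi\<^sup>2 / e * (norm v)\<^sup>2 \<le> supconv w e (x + v) $ i"
proof -
  have "bump (z - (x + v)) \<le> bump (z - x) - bump_gradient (z - x) \<bullet> v + 2 * pi\<^sup>2 * (norm v)\<^sup>2"
    using bump_expand[of "z - x" v] by (simp add: algebra_simps)
  then have "bump (z - (x + v)) / e \<le> (bump (z - x) - bump_gradient (z - x) \<bullet> v + 2 * pi\<^sup>2 * (norm v)\<^sup>2) / e"
    using e by (intro divide_right_mono) auto
  then show ?thesis
    using supconv_ge[OF w e, of z i "x + v"] z by (simp add: add_divide_distrib diff_divide_distrib)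
qed

lemma supconv_lipschitz:
  assumes w: "continuous_on UNIV w" and e: "0 < e"
  obtains C where "0 \<le> C" "\<And>x y i. norm (y - x) \<le> 1 \<Longrightarrow> \<bar>supconv w e y $ i - supconv w e x $ i\<bar> \<le> C * norm (y - x)"
proof -
  let ?C = "2 * pi * real CARD('n) / e + 2 * pi\<^sup>2 / e"
  have le: "supconv w e x $ i - ?C * norm (y - x) \<le> supconv w e y $ i" if y: "norm (y - x) \<le> 1" for x y i
  proof -
    obtain z where z: "supconv w e x $ i = w (torus_of z) $ i - bump (z - x) / e"
      using supconv_attained[OF w e] by metis
    have "\<bar>bump_gradient (z - x) \<bullet> (y - x)\<bar> \<le> norm (bump_gradient (z - x)) * norm (y - x)"
      by (rule Cauchy_Schwarz_ineq2)
    also have "\<dots> \<le> 2 * pi * real CARD('n) * norm (y - x)"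
      by (intro mult_right_mono norm_bump_gradient) simp
    finally have "- (2 * pi * real CARD('n) * norm (y - x)) / e \<le> (bump_gradient (z - x) \<bullet> (y - x)) / e"
      using e by (intro divide_right_mono) auto
    moreover have "(norm (y - x))\<^sup>2 \<le> norm (y - x)"
      using y by (simp add: power2_eq_square mult_left_le)
    then have "2 * pi\<^sup>2 / e * (norm (y - x))\<^sup>2 \<le> 2 * pi\<^sup>2 / e * norm (y - x)"
      using e by (intro mult_left_mono) auto
    ultimately show ?thesis
      using supconv_shift[OF w e z, of "y - x"] by (simp add: algebra_simps)
  qed
  show ?thesis
  proof (rule that[of ?C])
    fix x y :: "real ^ 'n" and i assume "norm (y - x) \<le> 1"
    then show "\<bar>supconv w e y $ i - supconv w e x $ i\<bar> \<le> ?C * norm (y - x)"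
      using le[of y x i] le[of x y i] by (simp add: norm_minus_commute abs_le_iff)
  qed (use e in auto)
qed

lemma set_integral_inner:
  fixes \<xi> :: "real \<Rightarrow> real ^ 'n"
  assumes "set_integrable lborel A \<xi>"
  shows "set_integrable lborel A (\<lambda>s. p \<bullet> \<xi> s)" "(LBINT s:A. p \<bullet> \<xi> s) = p \<bullet> (LBINT s:A. \<xi> s)"
proof -
  have eq: "(\<lambda>s. indicator A s *\<^sub>R (p \<bullet> \<xi> s)) = (\<lambda>s. p \<bullet> (indicator A s *\<^sub>R \<xi> s))" by simp
  show "set_integrable lborel A (\<lambda>s. p \<bullet> \<xi> s)"
    using assms unfolding set_integrable_def eq by (rule integrable_inner_right)
  show "(LBINT s:A. p \<bullet> \<xi> s) = p \<bullet> (LBINT s:A. \<xi> s)"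
    using assms unfolding set_lebesgue_integral_def set_integrable_def eq by (intro integral_inner_right)
qed

lemma set_integrable_const_Icc: "set_integrable lborel {a..b::real} (\<lambda>s. c::real)"
  unfolding set_integrable_def by (intro integrable_scaleR_left) (simp add: emeasure_lborel_Icc_eq)

lemma set_integral_const_Icc: "a \<le> b \<Longrightarrow> (LBINT s:{a..b::real}. c::real) = (b - a) * c"
  unfolding set_lebesgue_integral_def by simp

lemma norm_set_integral_le:
  fixes f :: "real \<Rightarrow> 'b::{banach, second_countable_topology}"
  assumes f: "set_integrable lborel {a..b} f" and ab: "a \<le> b" and R: "\<And>s. s \<in> {a..b} \<Longrightarrow> norm (f s) \<le> R"
  shows "norm (LBINT s:{a..b}. f s) \<le> R * (b - a)"
proof -
  have "norm (LBINT s:{a..b}. f s) \<le> (LBINT s:{a..b}. norm (f s))"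
    by (rule set_integral_norm_bound[OF f])
  also have "\<dots> \<le> (LBINT s:{a..b}. R)"
    by (rule set_integral_mono[OF set_integrable_norm[OF f] set_integrable_const_Icc]) (rule R)
  finally show ?thesis using ab by (simp add: set_integral_const_Icc mult.commute)
qed

lemma row_inner: "\<Lambda> $ i \<bullet> v = (\<Sum>j\<in>UNIV. \<Lambda> $ i $ j * v $ j)"
  by (simp add: inner_vec_def)

lemma row_inner_diff_le:
  assumes "\<And>j. \<bar>v $ j - v' $ j\<bar> \<le> c"
  shows "\<bar>\<Lambda> $ i \<bullet> v - \<Lambda> $ i \<bullet> v'\<bar> \<le> intensity * c"
proof -
  have c: "0 \<le> c" using assms[of undefined] by linarith
  have "\<bar>\<Lambda> $ i \<bullet> v - \<Lambda> $ i \<bullet> v'\<bar> = \<bar>\<Sum>j\<in>UNIV. \<Lambda> $ i $ j * (v $ j - v' $ j)\<bar>"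
    by (simp add: row_inner right_diff_distrib sum_subtractf)
  also have "\<dots> \<le> (\<Sum>j\<in>UNIV. \<bar>\<Lambda> $ i $ j\<bar> * c)"
    by (intro order_trans[OF sum_abs] sum_mono) (auto simp: abs_mult assms intro!: mult_left_mono)
  also have "\<dots> \<le> intensity * c"
    unfolding sum_distrib_right[symmetric] by (intro mult_right_mono row_le_intensity c)
  finally show ?thesis .
qed

text \<open>The substitute for differentiability: along every curve with speed at most \<open>R\<close> the subsolution
  inequality holds in integrated form, up to an error that is quadratic in the duration.\<close>

definition one_step_bound :: "real \<Rightarrow> real \<Rightarrow> real \<Rightarrow> real \<Rightarrow> (real ^ 'n \<Rightarrow> real ^ 'm) \<Rightarrow> bool" where
  "one_step_bound R h0 \<beta> C u \<longleftrightarrow> (\<forall>i a b \<xi> X. a \<le> b \<longrightarrow> b - a \<le> h0 \<longrightarrow> set_integrable lborel {a..b} \<xi> \<longrightarrow>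
     (\<forall>s\<in>{a..b}. norm (\<xi> s) \<le> R) \<longrightarrow> (\<forall>s\<in>{a..b}. X s = X a + (LBINT r:{a..s}. \<xi> r)) \<longrightarrow>
     set_integrable lborel {a..b} (\<lambda>s. lagrangian H i (torus_of (X s)) (- \<xi> s)) \<longrightarrow>
     u (X a) $ i \<le> u (X b) $ i + (LBINT s:{a..b}. lagrangian H i (torus_of (X s)) (- \<xi> s))
       + (b - a) * (\<beta> - \<Lambda> $ i \<bullet> u (X a)) + C * (b - a)\<^sup>2)"

text \<open>Let \<open>z\<close> maximise in the sup-convolution at the initial point \<open>X a\<close>, with slope \<open>p\<close>. There the penalty is a
  test function, so \<open>H(z, p) + \<Lambda> w(z) \<le> \<alpha>\<close>. By \<open>supconv_shift\<close> the increment of \<open>u\<close> is at least \<open>p\<close> times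
  the displacement, that is, the integral of \<open>p \<bullet> \<xi>\<close>, and by Fenchel--Young \<open>p \<bullet> \<xi> \<ge> - L(z, - \<xi>) - H(z, p)\<close>.
  Since \<open>z\<close> is close to the curve modulo the lattice, \<open>L(z, - \<xi>)\<close> and \<open>w(z)\<close> may be replaced by their values
  along the curve at the price of \<open>\<eta>\<close>.\<close>

lemma subsolution_one_step:
  assumes sub: "subsolution H \<Lambda> \<alpha> w" and R: "0 < R" and \<eta>: "0 < \<eta>"
  obtains u :: "real ^ 'n \<Rightarrow> real ^ 'm" and C h0 where "0 < h0" "0 \<le> C"
    "\<And>x i. \<bar>u x $ i - w (torus_of x) $ i\<bar> \<le> \<eta>"
    "\<And>x y i. norm (y - x) \<le> 1 \<Longrightarrow> \<bar>u y $ i - u x $ i\<bar> \<le> C * norm (y - x)"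
    "one_step_bound R h0 (\<alpha> + \<eta>) C u"
proof -
  have w: "continuous_on UNIV w" using sub by (simp add: subsolution_def)
  \<comment> \<open>an error of \<open>2 * \<theta>\<close> in the components of \<open>u\<close> costs at most \<open>\<eta> / 2\<close> in the coupling term\<close>
  define \<theta> where "\<theta> = min \<eta> (\<eta> / (4 * (intensity + 1)))"
  have \<theta>: "0 < \<theta>" "\<theta> \<le> \<eta>" using \<eta> intensity_nonneg by (auto simp: \<theta>_def)
  have \<theta>i: "intensity * (2 * \<theta>) \<le> \<eta> / 2"
  proof -
    have "\<theta> \<le> \<eta> / (4 * (intensity + 1))" by (simp add: \<theta>_def)
    then have "\<theta> * (4 * (intensity + 1)) \<le> \<eta>"
      using intensity_nonneg by (subst (asm) pos_le_divide_eq) auto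
    then show ?thesis using \<theta> by (simp add: algebra_simps)
  qed
  have "0 < \<eta> / 2" using \<eta> by simp
  then obtain d where d: "0 < d" "\<And>i z z' q q'. norm q \<le> R \<Longrightarrow> norm q' \<le> R \<Longrightarrow> norm (z - z') < d \<Longrightarrow>
     norm (q - q') < d \<Longrightarrow> \<bar>lagrangian H i (torus_of z) q - lagrangian H i (torus_of z') q'\<bar> \<le> \<eta> / 2"
    by (rule lagrangian_uniformly_continuous[of _ R]) blast
  obtain d' where d': "0 < d'" "\<And>z z' i. norm (z - z') < d' \<Longrightarrow> \<bar>w (torus_of z) $ i - w (torus_of z') $ i\<bar> < \<theta>"
    by (rule continuous_torus_uniform[OF w \<theta>(1)]) blast
  \<comment> \<open>a third of \<open>d\<close> for the distance of the maximiser, a third for the travel during the step\<close>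
  define r where "r = min (d / 3) (d' / 2)"
  have r: "0 < r" "r \<le> d / 3" "r < d'" using d d' by (auto simp: r_def)
  obtain e where e: "0 < e" "\<And>x i. \<bar>supconv w e x $ i - w (torus_of x) $ i\<bar> \<le> \<theta>"
    "\<And>x i z. supconv w e x $ i = w (torus_of z) $ i - bump (z - x) / e \<Longrightarrow>
       \<exists>z'. torus_of z' = torus_of z \<and> norm (z' - x) \<le> r"
    by (rule supconv_uniformly_close[OF w \<theta>(1) r(1)]) blast
  let ?u = "supconv w e"
  obtain C where C: "0 \<le> C" "\<And>x y i. norm (y - x) \<le> 1 \<Longrightarrow> \<bar>?u y $ i - ?u x $ i\<bar> \<le> C * norm (y - x)"
    by (rule supconv_lipschitz[OF w e(1)]) blast
  define C2 where "C2 = 2 * pi\<^sup>2 / e * R\<^sup>2"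
  have C2: "0 \<le> C2" using e by (simp add: C2_def)
  define h0 where "h0 = d / (3 * R)"
  have h0: "0 < h0" using d R by (simp add: h0_def)
  have step: "?u (X a) $ i \<le> ?u (X b) $ i + (LBINT s:{a..b}. lagrangian H i (torus_of (X s)) (- \<xi> s))
         + (b - a) * (\<alpha> + \<eta> - \<Lambda> $ i \<bullet> ?u (X a)) + C2 * (b - a)\<^sup>2"
    if ab: "a \<le> b" "b - a \<le> h0" and \<xi>: "set_integrable lborel {a..b} \<xi>" and \<xi>R: "\<And>s. s \<in> {a..b} \<Longrightarrow> norm (\<xi> s) \<le> R"
      and X: "\<And>s. s \<in> {a..b} \<Longrightarrow> X s = X a + (LBINT r:{a..s}. \<xi> r)"
      and L: "set_integrable lborel {a..b} (\<lambda>s. lagrangian H i (torus_of (X s)) (- \<xi> s))"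
    for i a b and \<xi> X :: "real \<Rightarrow> real ^ 'n"
  proof -
    obtain z where z: "?u (X a) $ i = w (torus_of z) $ i - bump (z - X a) / e"
      "\<And>z'. w (torus_of z') $ i - bump (z' - X a) / e \<le> w (torus_of z) $ i - bump (z - X a) / e"
      using supconv_attained[OF w e(1), of "X a" i] by blast
    obtain z' where z': "torus_of z' = torus_of z" "norm (z' - X a) \<le> r" using e(3)[OF z(1)] by blast
    define p where "p = bump_gradient (z - X a) /\<^sub>R e"
    define \<psi> where "\<psi> = (\<lambda>Y. bump (rep_torus Y - X a) / e)"
    define G where "G = (\<lambda>Y. bump_gradient (rep_torus Y - X a) /\<^sub>R e)"
    have \<psi>: "\<psi> (torus_of x) = bump (x - X a) / e" for x
      unfolding \<psi>_def using bump_periodic(1)[of "rep_torus (torus_of x)" x "X a"] by (simp add: torus_of_rep)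
    have G: "G (torus_of x) = bump_gradient (x - X a) /\<^sub>R e" for x
      unfolding G_def using bump_periodic(2)[of "rep_torus (torus_of x)" x "X a"] by (simp add: torus_of_rep)
    have "torus_C1_gradient \<psi> G"
      unfolding torus_C1_gradient_def
    proof (intro conjI allI)
      show "continuous_on UNIV G"
        by (rule continuous_on_torusI) (simp add: G, intro continuous_intros continuous_bump_gradient)
      show "GDERIV (\<lambda>x. \<psi> (torus_of x)) x :> G (torus_of x)" for x
        unfolding \<psi> G using GDERIV_scaleR bump_has_gradient[of "X a" x]
        unfolding gderiv_def by (auto intro!: derivative_eq_intros simp: divide_inverse)
    qed
    moreover have "w Y $ i - \<psi> Y \<le> w (torus_of z) $ i - \<psi> (torus_of z)" for Y
      using z(2)[of "rep_torus Y"] unfolding \<psi> by (simp add: \<psi>_def torus_of_rep)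
    ultimately have "H i (torus_of z) (G (torus_of z)) + \<Lambda> $ i \<bullet> w (torus_of z) \<le> \<alpha>"
      using sub unfolding subsolution_def by blast
    then have visc: "H i (torus_of z) p + \<Lambda> $ i \<bullet> w (torus_of z) \<le> \<alpha>" by (simp add: G p_def)
    define v where "v = X b - X a"
    have v: "v = (LBINT s:{a..b}. \<xi> s)" using X[of b] ab by (simp add: v_def)
    have "norm v \<le> R * (b - a)" unfolding v by (rule norm_set_integral_le[OF \<xi> ab(1) \<xi>R])
    then have "(norm v)\<^sup>2 \<le> (R * (b - a))\<^sup>2" by (intro power_mono) auto
    then have "2 * pi\<^sup>2 / e * (norm v)\<^sup>2 \<le> C2 * (b - a)\<^sup>2"
      using mult_left_mono[of "(norm v)\<^sup>2" "(R * (b - a))\<^sup>2" "2 * pi\<^sup>2 / e"] e(1)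
      by (simp add: C2_def power_mult_distrib mult.assoc)
    then have shift: "?u (X a) $ i + p \<bullet> v - C2 * (b - a)\<^sup>2 \<le> ?u (X b) $ i"
      using supconv_shift[OF w e(1) z(1), of v] by (simp add: v_def p_def divide_inverse mult.commute)
    define c where "c = \<Lambda> $ i \<bullet> w (torus_of z) - \<alpha> - \<eta> / 2"
    have near: "c - lagrangian H i (torus_of (X s)) (- \<xi> s) \<le> p \<bullet> \<xi> s" if s: "s \<in> {a..b}" for s
    proof -
      have "X s - X a = (LBINT r:{a..s}. \<xi> r)" using X[OF s] by simp
      then have "norm (X s - X a) \<le> R * (s - a)"
        using s \<xi>R by (simp only:) (intro norm_set_integral_le set_integrable_subset[OF \<xi>], auto)
      moreover have "R * (s - a) \<le> R * h0" using s ab R by (intro mult_left_mono) auto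
      moreover have "R * h0 = d / 3" using R by (simp add: h0_def)
      moreover have "norm (z' - X s) \<le> norm (z' - X a) + norm (X s - X a)"
        using norm_triangle_ineq4[of "z' - X a" "X s - X a"] by simp
      ultimately have "norm (z' - X s) < d" using z'(2) r(2) d(1) by linarith
      then have "\<bar>lagrangian H i (torus_of z') (- \<xi> s) - lagrangian H i (torus_of (X s)) (- \<xi> s)\<bar> \<le> \<eta> / 2"
        using \<xi>R[OF s] d(1) by (intro d(2)) auto
      then have "lagrangian H i (torus_of z) (- \<xi> s) \<le> lagrangian H i (torus_of (X s)) (- \<xi> s) + \<eta> / 2"
        unfolding z'(1) by linarith
      moreover have "- (p \<bullet> \<xi> s) \<le> lagrangian H i (torus_of z) (- \<xi> s) + H i (torus_of z) p"
        using fenchel_young[of p "- \<xi> s" i "torus_of z"] by simp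
      ultimately show ?thesis using visc unfolding c_def by linarith
    qed
    have "(LBINT s:{a..b}. c - lagrangian H i (torus_of (X s)) (- \<xi> s)) \<le> (LBINT s:{a..b}. p \<bullet> \<xi> s)"
      by (rule set_integral_mono[OF set_integral_diff(1)[OF set_integrable_const_Icc L] set_integral_inner(1)[OF \<xi>]])
         (rule near)
    then have "(b - a) * c - (LBINT s:{a..b}. lagrangian H i (torus_of (X s)) (- \<xi> s)) \<le> p \<bullet> v"
      by (simp add: set_integral_diff(2)[OF set_integrable_const_Icc L] set_integral_const_Icc[OF ab(1)]
          set_integral_inner(2)[OF \<xi>] v)
    moreover have "(b - a) * (- c) \<le> (b - a) * (\<alpha> + \<eta> - \<Lambda> $ i \<bullet> ?u (X a))"
    proof (rule mult_left_mono)
      have "\<bar>w (torus_of z) $ j - ?u (X a) $ j\<bar> \<le> 2 * \<theta>" for j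
        using d'(2)[of z' "X a" j] z' r(3) e(2)[of "X a" j] by auto
      then have "\<bar>\<Lambda> $ i \<bullet> w (torus_of z) - \<Lambda> $ i \<bullet> ?u (X a)\<bar> \<le> intensity * (2 * \<theta>)"
        by (rule row_inner_diff_le)
      then show "- c \<le> \<alpha> + \<eta> - \<Lambda> $ i \<bullet> ?u (X a)" using \<theta>i unfolding c_def by linarith
    qed (use ab in simp)
    ultimately show ?thesis using shift by linarith
  qed
  show ?thesis
  proof (rule that[of h0 "max C C2" ?u])
    show "0 < h0" by (rule h0)
    show "0 \<le> max C C2" using C by simp
    show "\<bar>?u x $ i - w (torus_of x) $ i\<bar> \<le> \<eta>" for x i using e(2)[of x i] \<theta> by linarith
    show "\<bar>?u y $ i - ?u x $ i\<bar> \<le> max C C2 * norm (y - x)" if "norm (y - x) \<le> 1" for x y i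
      using C(2)[OF that, of i] mult_right_mono[of C "max C C2" "norm (y - x)"] by simp
    show "one_step_bound R h0 (\<alpha> + \<eta>) (max C C2) ?u"
      unfolding one_step_bound_def
    proof (intro allI impI)
      fix i a b and \<xi> X :: "real \<Rightarrow> real ^ 'n"
      assume A: "a \<le> b" "b - a \<le> h0" "set_integrable lborel {a..b} \<xi>" "\<forall>s\<in>{a..b}. norm (\<xi> s) \<le> R"
        "\<forall>s\<in>{a..b}. X s = X a + (LBINT r:{a..s}. \<xi> r)"
        "set_integrable lborel {a..b} (\<lambda>s. lagrangian H i (torus_of (X s)) (- \<xi> s))"
      have "C2 * (b - a)\<^sup>2 \<le> max C C2 * (b - a)\<^sup>2" by (intro mult_right_mono) auto
      with step[OF A(1-3) bspec[OF A(4)] bspec[OF A(5)] A(6)]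
      show "?u (X a) $ i \<le> ?u (X b) $ i + (LBINT s:{a..b}. lagrangian H i (torus_of (X s)) (- \<xi> s))
           + (b - a) * (\<alpha> + \<eta> - \<Lambda> $ i \<bullet> ?u (X a)) + max C C2 * (b - a)\<^sup>2" by linarith
    qed
  qed
qed

end

section \<open>Subsolutions lie below the expected cost\<close>

context switching
begin

lemma Collect_switching_Int:
  "{\<omega> \<in> switching_paths. Q \<omega>} \<inter> switching_paths = {\<omega> \<in> switching_paths. Q \<omega>}"
  by auto

lemma sets_path_equal: "0 \<le> t \<Longrightarrow> {\<omega> \<in> switching_paths. \<omega> t = k} \<in> sets (path_algebra :: (real \<Rightarrow> 'm) measure)"
  using sets_cylinder[of "{t}" "\<lambda>_. k"] by (simp add: cylinder_def)

lemma sets_path_equal2: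
  assumes "0 \<le> t" "0 \<le> s"
  shows "{\<omega> \<in> switching_paths. \<omega> t = k \<and> \<omega> s = j} \<in> sets (path_algebra :: (real \<Rightarrow> 'm) measure)"
proof -
  have "{\<omega> \<in> switching_paths. \<omega> t = k \<and> \<omega> s = j} = {\<omega> \<in> switching_paths. \<omega> t = k} \<inter> {\<omega> \<in> switching_paths. \<omega> s = j}"
    by auto
  then show ?thesis using assms by (auto intro!: sets.Int sets_path_equal)
qed

lemma integrable_chain_bounded:
  fixes f :: "(real \<Rightarrow> 'm) \<Rightarrow> real"
  assumes "f \<in> borel_measurable path_algebra" and "AE \<omega> in chain i. \<bar>f \<omega>\<bar> \<le> B"
  shows "integrable (chain i) f"
  by (rule chain.integrable_const_bound[where B = B]) (use assms in auto)

lemma integrable_indicator_times: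
  fixes Y :: "(real \<Rightarrow> 'm) \<Rightarrow> real"
  assumes A: "A \<in> sets path_algebra" and Y: "Y \<in> borel_measurable path_algebra"
    and B: "\<And>\<omega>. \<omega> \<in> switching_paths \<Longrightarrow> \<bar>Y \<omega>\<bar> \<le> B"
  shows "integrable (chain i) (\<lambda>\<omega>. indicator A \<omega> * Y \<omega>)"
proof (rule integrable_chain_bounded[where B = "\<bar>B\<bar>"])
  show "(\<lambda>\<omega>. indicator A \<omega> * Y \<omega>) \<in> borel_measurable path_algebra" using A Y by measurable
  show "AE \<omega> in chain i. \<bar>indicator A \<omega> * Y \<omega>\<bar> \<le> \<bar>B\<bar>"
  proof (rule AE_I2)
    fix \<omega> assume "\<omega> \<in> space (chain i)"
    then have "\<bar>Y \<omega>\<bar> \<le> \<bar>B\<bar>" using B[of \<omega>] by simp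
    then show "\<bar>indicator A \<omega> * Y \<omega>\<bar> \<le> \<bar>B\<bar>" by (simp add: indicator_def)
  qed
qed

text \<open>Conditioning on \<open>\<omega> t = k\<close> turns the new state into the row \<open>exp (- h \<Lambda>)\<^sub>k\<close>, whose second-order remainder
  is all that is left after the generator is subtracted.\<close>

lemma generator_step:
  fixes Y :: "'m \<Rightarrow> (real \<Rightarrow> 'm) \<Rightarrow> real"
  assumes t: "0 \<le> t" and h: "0 \<le> h" and Y: "\<And>j. Y j \<in> borel_measurable path_algebra"
    and past: "\<And>j \<omega>. \<omega> \<in> switching_paths \<Longrightarrow> Y j (stopped_at t \<omega>) = Y j \<omega>"
    and B: "\<And>j \<omega>. \<omega> \<in> switching_paths \<Longrightarrow> \<bar>Y j \<omega>\<bar> \<le> B"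
  shows "integrable (chain i) (\<lambda>\<omega>. Y (\<omega> t) \<omega> - Y (\<omega> (t + h)) \<omega> - h * (\<Sum>j\<in>UNIV. \<Lambda> $ (\<omega> t) $ j * Y j \<omega>))"
    and "(LINT \<omega>|chain i. Y (\<omega> t) \<omega> - Y (\<omega> (t + h)) \<omega> - h * (\<Sum>j\<in>UNIV. \<Lambda> $ (\<omega> t) $ j * Y j \<omega>))
      \<le> real CARD('m) * intensity\<^sup>2 * h\<^sup>2 * B"
proof -
  let ?I = "\<lambda>k. indicator {\<omega> \<in> switching_paths. \<omega> t = k} :: (real \<Rightarrow> 'm) \<Rightarrow> real"
  let ?J = "\<lambda>k j. indicator {\<omega> \<in> switching_paths. \<omega> t = k \<and> \<omega> (t + h) = j} :: (real \<Rightarrow> 'm) \<Rightarrow> real"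
  let ?f = "\<lambda>\<omega>. Y (\<omega> t) \<omega> - Y (\<omega> (t + h)) \<omega> - h * (\<Sum>j\<in>UNIV. \<Lambda> $ (\<omega> t) $ j * Y j \<omega>)"
  let ?g = "\<lambda>\<omega>. (\<Sum>k\<in>UNIV. ?I k \<omega> * Y k \<omega>) - (\<Sum>k\<in>UNIV. \<Sum>j\<in>UNIV. ?J k j \<omega> * Y j \<omega>)
      - h * (\<Sum>k\<in>UNIV. \<Sum>j\<in>UNIV. \<Lambda> $ k $ j * (?I k \<omega> * Y j \<omega>))"
  have fg: "?f \<omega> = ?g \<omega>" if \<omega>: "\<omega> \<in> switching_paths" for \<omega>
  proof -
    have 1: "(\<Sum>k\<in>UNIV. ?I k \<omega> * F k) = F (\<omega> t)" for F
    proof -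
      have "(\<Sum>k\<in>UNIV. ?I k \<omega> * F k) = (\<Sum>k\<in>UNIV. if k = \<omega> t then F k else 0)"
        using \<omega> by (intro sum.cong) (auto simp: indicator_def)
      then show ?thesis by simp
    qed
    have 2: "(\<Sum>k\<in>UNIV. \<Sum>j\<in>UNIV. ?J k j \<omega> * Y j \<omega>) = Y (\<omega> (t + h)) \<omega>"
    proof -
      have "(\<Sum>k\<in>UNIV. \<Sum>j\<in>UNIV. ?J k j \<omega> * Y j \<omega>) =
         (\<Sum>k\<in>UNIV. if k = \<omega> t then (\<Sum>j\<in>UNIV. if j = \<omega> (t + h) then Y j \<omega> else 0) else 0)"
        using \<omega> by (intro sum.cong) (auto simp: indicator_def intro!: sum.neutral sum.cong)
      then show ?thesis by simp
    qed
    have 3: "(\<Sum>k\<in>UNIV. \<Sum>j\<in>UNIV. \<Lambda> $ k $ j * (?I k \<omega> * Y j \<omega>)) = (\<Sum>j\<in>UNIV. \<Lambda> $ (\<omega> t) $ j * Y j \<omega>)"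
    proof -
      have "(\<Sum>k\<in>UNIV. \<Sum>j\<in>UNIV. \<Lambda> $ k $ j * (?I k \<omega> * Y j \<omega>)) = (\<Sum>k\<in>UNIV. ?I k \<omega> * (\<Sum>j\<in>UNIV. \<Lambda> $ k $ j * Y j \<omega>))"
      proof (intro sum.cong refl)
        fix k
        show "(\<Sum>j\<in>UNIV. \<Lambda> $ k $ j * (?I k \<omega> * Y j \<omega>)) = ?I k \<omega> * (\<Sum>j\<in>UNIV. \<Lambda> $ k $ j * Y j \<omega>)"
          unfolding sum_distrib_left by (intro sum.cong refl) (rule mult.left_commute)
      qed
      also have "\<dots> = (\<Sum>j\<in>UNIV. \<Lambda> $ (\<omega> t) $ j * Y j \<omega>)" by (rule 1)
      finally show ?thesis .
    qed
    show ?thesis unfolding 1 2 3 ..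
  qed
  have iI: "integrable (chain i) (\<lambda>\<omega>. ?I k \<omega> * Y j \<omega>)" for k j
    by (rule integrable_indicator_times[OF sets_path_equal[OF t] Y B])
  have iJ: "integrable (chain i) (\<lambda>\<omega>. ?J k j \<omega> * Y l \<omega>)" for k j l
    by (rule integrable_indicator_times[OF sets_path_equal2 Y B]) (use t h in auto)
  have ig: "integrable (chain i) ?g"
    by (intro Bochner_Integration.integrable_diff Bochner_Integration.integrable_sum integrable_mult_right iI iJ)
  show "integrable (chain i) ?f"
    using ig by (rule Bochner_Integration.integrable_cong[THEN iffD2, rotated 2]) (auto simp: fg)
  define e where "e k j = (LINT \<omega>|chain i. ?I k \<omega> * Y j \<omega>)" for k j
  define m where "m k = measure (chain i) {\<omega> \<in> switching_paths. \<omega> t = k}" for k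
  have ekj: "\<bar>e k j\<bar> \<le> m k * B" for k j
  proof -
    have iB: "integrable (chain i) (\<lambda>\<omega>. ?I k \<omega> * B)"
      by (rule integrable_indicator_times[OF sets_path_equal[OF t], where B = "\<bar>B\<bar>"]) auto
    have "\<bar>e k j\<bar> \<le> (LINT \<omega>|chain i. \<bar>?I k \<omega> * Y j \<omega>\<bar>)"
      unfolding e_def by (rule integral_abs_bound)
    also have "\<dots> \<le> (LINT \<omega>|chain i. ?I k \<omega> * B)"
      by (rule integral_mono[OF integrable_abs[OF iI] iB]) (auto simp: abs_mult indicator_def B)
    also have "\<dots> = m k * B"
      using sets_path_equal[OF t, of k] by (simp add: m_def Collect_switching_Int)
    finally show ?thesis .
  qed
  have m_sum: "(\<Sum>k\<in>UNIV. m k) = 1"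
    unfolding m_def chain_marginal[OF t] by (rule transition_sum[OF t])
  have m_nonneg: "0 \<le> m k" for k by (simp add: m_def)
  have "(LINT \<omega>|chain i. ?f \<omega>) = (LINT \<omega>|chain i. ?g \<omega>)"
    by (rule Bochner_Integration.integral_cong) (auto simp: fg)
  also have "\<dots> = (\<Sum>k\<in>UNIV. e k k) - (\<Sum>k\<in>UNIV. \<Sum>j\<in>UNIV. transition \<Lambda> h k j * e k j) - h * (\<Sum>k\<in>UNIV. \<Sum>j\<in>UNIV. \<Lambda> $ k $ j * e k j)"
    by (simp only: Bochner_Integration.integral_diff Bochner_Integration.integral_sum Bochner_Integration.integrable_sum
        Bochner_Integration.integrable_diff integral_mult_right_zero integrable_mult_right
        iI iJ past_markov_next[OF t h Y past] e_def)
  also have "(\<Sum>k\<in>UNIV. e k k) = (\<Sum>k\<in>UNIV. \<Sum>j\<in>UNIV. (if k = j then 1 else 0) * e k j)"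
    by (simp add: if_distrib[of "\<lambda>x. x * _"] cong: if_cong)
  also have "(\<Sum>k\<in>UNIV. \<Sum>j\<in>UNIV. (if k = j then 1 else 0) * e k j) - (\<Sum>k\<in>UNIV. \<Sum>j\<in>UNIV. transition \<Lambda> h k j * e k j) - h * (\<Sum>k\<in>UNIV. \<Sum>j\<in>UNIV. \<Lambda> $ k $ j * e k j)
     = (\<Sum>k\<in>UNIV. \<Sum>j\<in>UNIV. - (transition \<Lambda> h k j - (if k = j then 1 else 0) + h * \<Lambda> $ k $ j) * e k j)"
    unfolding sum_distrib_left sum_subtractf[symmetric] by (intro sum.cong refl) (simp add: algebra_simps)
  also have "\<dots> \<le> (\<Sum>k\<in>UNIV. \<Sum>j\<in>(UNIV :: 'm set). (intensity\<^sup>2 * h\<^sup>2) * (m k * B))"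
  proof (intro sum_mono)
    fix k j
    have "- (transition \<Lambda> h k j - (if k = j then 1 else 0) + h * \<Lambda> $ k $ j) * e k j
       \<le> \<bar>transition \<Lambda> h k j - (if k = j then 1 else 0) + h * \<Lambda> $ k $ j\<bar> * \<bar>e k j\<bar>"
      unfolding abs_mult[symmetric] by (metis abs_ge_self abs_minus_cancel mult_minus_left)
    also have "\<dots> \<le> (intensity\<^sup>2 * h\<^sup>2) * (m k * B)"
      by (intro mult_mono transition_second_order h ekj) auto
    finally show "- (transition \<Lambda> h k j - (if k = j then 1 else 0) + h * \<Lambda> $ k $ j) * e k j \<le> (intensity\<^sup>2 * h\<^sup>2) * (m k * B)" .
  qed
  also have "\<dots> = real CARD('m) * intensity\<^sup>2 * h\<^sup>2 * B * (\<Sum>k\<in>UNIV. m k)"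
    unfolding sum_distrib_left by (intro sum.cong refl) (simp add: mult_ac)
  finally show "(LINT \<omega>|chain i. ?f \<omega>) \<le> real CARD('m) * intensity\<^sup>2 * h\<^sup>2 * B"
    by (simp add: m_sum)
qed

lemma sets_switched:
  assumes "0 \<le> t" "0 \<le> s"
  shows "{\<omega> \<in> switching_paths. \<omega> s \<noteq> \<omega> t} \<in> sets (path_algebra :: (real \<Rightarrow> 'm) measure)"
proof -
  have [measurable]: "(\<lambda>\<omega>. \<omega> s) \<in> (path_algebra :: (real \<Rightarrow> 'm) measure) \<rightarrow>\<^sub>M count_space UNIV"
    "(\<lambda>\<omega>. \<omega> t) \<in> (path_algebra :: (real \<Rightarrow> 'm) measure) \<rightarrow>\<^sub>M count_space UNIV"
    using assms by (auto intro: measurable_path_eval)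
  have "{\<omega> \<in> space path_algebra. \<omega> s \<noteq> \<omega> t} \<in> sets (path_algebra :: (real \<Rightarrow> 'm) measure)" by measurable
  then show ?thesis by simp
qed

lemma switch_probability:
  assumes t: "0 \<le> t" and h: "0 \<le> h"
  shows "measure (chain i) {\<omega> \<in> switching_paths. \<omega> (t + h) \<noteq> \<omega> t} \<le> intensity * h"
proof -
  have "measure (chain i) {\<omega> \<in> switching_paths. \<omega> (t + h) \<noteq> \<omega> t} + (\<Sum>k\<in>UNIV. measure (chain i) {\<omega> \<in> switching_paths. \<omega> t = k \<and> \<omega> (t + h) = k}) = 1"
  proof -
    have "(\<Sum>k\<in>UNIV. measure (chain i) {\<omega> \<in> switching_paths. \<omega> t = k \<and> \<omega> (t + h) = k}) =
       measure (chain i) (\<Union>k. {\<omega> \<in> switching_paths. \<omega> t = k \<and> \<omega> (t + h) = k})"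
      using sets_path_equal2[of t "t + h"] t h
      by (intro chain.finite_measure_finite_Union[symmetric]) (auto simp: disjoint_family_on_def)
    also have "(\<Union>k. {\<omega> \<in> switching_paths. \<omega> t = k \<and> \<omega> (t + h) = k}) = space (chain i) - {\<omega> \<in> switching_paths. \<omega> (t + h) \<noteq> \<omega> t}"
      by auto
    also have "measure (chain i) \<dots> = 1 - measure (chain i) {\<omega> \<in> switching_paths. \<omega> (t + h) \<noteq> \<omega> t}"
      using sets_switched[of t "t + h"] t h by (intro chain.prob_compl) auto
    finally show ?thesis by simp
  qed
  moreover have "measure (chain i) {\<omega> \<in> switching_paths. \<omega> t = k \<and> \<omega> (t + h) = k} = transition \<Lambda> h k k * transition \<Lambda> t i k" for k
    using past_markov_next[OF t h, of "\<lambda>_. 1" i k k] sets_path_equal2[of t "t + h" k k] sets_path_equal[OF t, of k] t h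
    by (simp add: chain_marginal Collect_switching_Int)
  ultimately have "measure (chain i) {\<omega> \<in> switching_paths. \<omega> (t + h) \<noteq> \<omega> t} =
      (\<Sum>k\<in>UNIV. transition \<Lambda> t i k) - (\<Sum>k\<in>UNIV. transition \<Lambda> h k k * transition \<Lambda> t i k)"
    by (simp add: transition_sum[OF t])
  also have "\<dots> = (\<Sum>k\<in>UNIV. (1 - transition \<Lambda> h k k) * transition \<Lambda> t i k)"
    by (simp add: left_diff_distrib sum_subtractf)
  also have "\<dots> \<le> (\<Sum>k\<in>UNIV. (intensity * h) * transition \<Lambda> t i k)"
  proof (intro sum_mono mult_right_mono)
    show "1 - transition \<Lambda> h k k \<le> intensity * h" for k
      using transition_first_order[OF h, of k k] by (simp add: abs_le_iff)
  qed (rule transition_nonneg[OF t])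
  also have "\<dots> = intensity * h" by (simp add: sum_distrib_left[symmetric] transition_sum[OF t])
  finally show ?thesis .
qed

text \<open>During this time the running cost is not the one of the state at the beginning of the step.\<close>

definition away_time :: "real \<Rightarrow> real \<Rightarrow> (real \<Rightarrow> 'm) \<Rightarrow> real" where
  "away_time t h \<omega> = (LBINT s:{t..t+h}. of_bool (\<omega> s \<noteq> \<omega> t))"

lemma joint_measurable_away:
  assumes t: "0 \<le> t"
  shows "(\<lambda>x. (if t \<le> snd x \<and> snd x \<le> t + h then of_bool (fst x (max 0 (snd x)) \<noteq> fst x t) else 0) :: real)
     \<in> borel_measurable ((path_algebra :: (real \<Rightarrow> 'm) measure) \<Otimes>\<^sub>M lborel)"
proof -
  have [measurable]: "(\<lambda>x. fst x (max 0 (snd x))) \<in> (path_algebra :: (real \<Rightarrow> 'm) measure) \<Otimes>\<^sub>M lborel \<rightarrow>\<^sub>M count_space UNIV"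
    by (rule measurable_path_at_random_time) auto
  have [measurable]: "(\<lambda>x. fst x t) \<in> (path_algebra :: (real \<Rightarrow> 'm) measure) \<Otimes>\<^sub>M lborel \<rightarrow>\<^sub>M count_space UNIV"
    by (rule measurable_path_at_random_time) (use t in auto)
  show ?thesis by measurable
qed

lemma away_time_eq:
  assumes t: "0 \<le> t"
  shows "away_time t h \<omega> = (LINT s|lborel. (if t \<le> s \<and> s \<le> t + h then of_bool (\<omega> (max 0 s) \<noteq> \<omega> t) else 0))"
  unfolding away_time_def set_lebesgue_integral_def using t
  by (intro Bochner_Integration.integral_cong) (auto simp: indicator_def)

lemma measurable_away_time:
  assumes t: "0 \<le> t"
  shows "away_time t h \<in> borel_measurable path_algebra"
  unfolding away_time_eq[OF t, abs_def]
  using joint_measurable_away[OF t, of h]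
  by (intro lborel.borel_measurable_lebesgue_integral) (simp add: case_prod_beta')

lemma away_set_integrable:
  fixes \<omega> :: "real \<Rightarrow> 'm"
  assumes t: "0 \<le> t" and \<omega>: "\<omega> \<in> switching_paths"
  shows "set_integrable lborel {t..t+h} (\<lambda>s. of_bool (\<omega> s \<noteq> \<omega> t) :: real)"
  unfolding set_integrable_def
proof (rule Bochner_Integration.integrable_bound)
  show "integrable lborel (\<lambda>s. indicator {t..t+h} s :: real)"
    by (simp add: emeasure_lborel_Icc_eq)
  have "(\<lambda>s. if t \<le> s \<and> s \<le> t + h then of_bool (\<omega> (max 0 s) \<noteq> \<omega> t) else 0 :: real) \<in> borel_measurable lborel"
    using measurable_compose[OF measurable_Pair1'[of \<omega> path_algebra lborel] joint_measurable_away[OF t, of h],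
        unfolded fst_conv snd_conv] \<omega>
    by simp
  also have "(\<lambda>s. if t \<le> s \<and> s \<le> t + h then of_bool (\<omega> (max 0 s) \<noteq> \<omega> t) else 0 :: real) =
     (\<lambda>s. indicator {t..t+h} s *\<^sub>R of_bool (\<omega> s \<noteq> \<omega> t))"
    using t by (auto simp: indicator_def fun_eq_iff)
  finally show "(\<lambda>s. indicator {t..t+h} s *\<^sub>R of_bool (\<omega> s \<noteq> \<omega> t) :: real) \<in> borel_measurable lborel" .
qed (auto simp: indicator_def)

lemma away_time_nonneg: "0 \<le> away_time t h \<omega>"
  unfolding away_time_def set_lebesgue_integral_def by (intro Bochner_Integration.integral_nonneg) auto

lemma away_time_le:
  assumes t: "0 \<le> t" and h: "0 \<le> h" and \<omega>: "\<omega> \<in> switching_paths"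
  shows "away_time t h \<omega> \<le> h"
proof -
  have "away_time t h \<omega> \<le> (LBINT s:{t..t+h}. 1)"
    unfolding away_time_def
    by (rule set_integral_mono[OF away_set_integrable[OF t \<omega>]])
       (auto simp: set_integrable_def emeasure_lborel_Icc_eq)
  then show ?thesis using h by (simp add: set_lebesgue_integral_def)
qed

text \<open>By Tonelli's theorem, from the switching probability at each single time.\<close>

lemma expected_away_time:
  assumes t: "0 \<le> t" and h: "0 \<le> h"
  shows "integrable (chain i) (away_time t h)"
    and "(LINT \<omega>|chain i. away_time t h \<omega>) \<le> intensity * h\<^sup>2"
proof -
  show int: "integrable (chain i) (away_time t h)"
    using measurable_away_time[OF t] away_time_nonneg away_time_le[OF t h]
    by (intro integrable_chain_bounded[where B = h]) (auto simp: abs_of_nonneg intro!: AE_I2)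
  let ?f = "\<lambda>x. ennreal (if t \<le> snd x \<and> snd x \<le> t + h then of_bool (fst x (max 0 (snd x)) \<noteq> fst x t) else 0)"
  interpret pair_sigma_finite "chain i" lborel ..
  have f_meas: "?f \<in> borel_measurable (chain i \<Otimes>\<^sub>M lborel)"
    using joint_measurable_away[OF t, of h] by (simp cong: measurable_cong_sets sets_pair_measure_cong)
  have "ennreal (LINT \<omega>|chain i. away_time t h \<omega>) = (\<integral>\<^sup>+\<omega>. ennreal (away_time t h \<omega>) \<partial>chain i)"
    by (rule nn_integral_eq_integral[symmetric, OF int]) (simp add: away_time_nonneg)
  also have "\<dots> = (\<integral>\<^sup>+\<omega>. (\<integral>\<^sup>+s. ?f (\<omega>, s) \<partial>lborel) \<partial>chain i)"
  proof (rule nn_integral_cong)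
    fix \<omega> assume "\<omega> \<in> space (chain i)"
    then have \<omega>: "\<omega> \<in> switching_paths" by simp
    have "integrable lborel (\<lambda>s. indicator {t..t+h} s *\<^sub>R of_bool (\<omega> s \<noteq> \<omega> t) :: real)"
      using away_set_integrable[OF t \<omega>] by (simp add: set_integrable_def)
    then have "ennreal (away_time t h \<omega>) = (\<integral>\<^sup>+s. ennreal (indicator {t..t+h} s *\<^sub>R of_bool (\<omega> s \<noteq> \<omega> t)) \<partial>lborel)"
      unfolding away_time_def set_lebesgue_integral_def by (intro nn_integral_eq_integral[symmetric]) auto
    also have "\<dots> = (\<integral>\<^sup>+s. ?f (\<omega>, s) \<partial>lborel)"
      using t by (intro nn_integral_cong) (auto simp: indicator_def)
    finally show "ennreal (away_time t h \<omega>) = (\<integral>\<^sup>+s. ?f (\<omega>, s) \<partial>lborel)" .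
  qed
  also have "\<dots> = (\<integral>\<^sup>+s. (\<integral>\<^sup>+\<omega>. ?f (\<omega>, s) \<partial>chain i) \<partial>lborel)"
    by (rule Fubini[OF f_meas, symmetric])
  also have "\<dots> \<le> (\<integral>\<^sup>+s. ennreal (intensity * h) * indicator {t..t+h} s \<partial>lborel)"
  proof (rule nn_integral_mono)
    fix s :: real
    show "(\<integral>\<^sup>+\<omega>. ?f (\<omega>, s) \<partial>chain i) \<le> ennreal (intensity * h) * indicator {t..t+h} s"
    proof (cases "t \<le> s \<and> s \<le> t + h")
      case True
      have "(\<integral>\<^sup>+\<omega>. ?f (\<omega>, s) \<partial>chain i) = (\<integral>\<^sup>+\<omega>. indicator {\<omega> \<in> switching_paths. \<omega> s \<noteq> \<omega> t} \<omega> \<partial>chain i)"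
        using True t by (intro nn_integral_cong) (auto simp: indicator_def max_def)
      also have "\<dots> = ennreal (measure (chain i) {\<omega> \<in> switching_paths. \<omega> s \<noteq> \<omega> t})"
        using sets_switched[of t s] t True by (simp add: chain.emeasure_eq_measure)
      also have "\<dots> \<le> ennreal (intensity * (s - t))"
        using switch_probability[OF t, of "s - t" i] True by (intro ennreal_leI) simp
      also have "\<dots> \<le> ennreal (intensity * h)"
        using True intensity_nonneg by (intro ennreal_leI mult_left_mono) auto
      finally show ?thesis using True by simp
    next
      case False
      then have "(t \<le> s \<and> s \<le> t + h) = False" by blast
      then show ?thesis by (simp only: fst_conv snd_conv if_False) simp
    qed
  qed
  also have "\<dots> = ennreal (intensity * h) * ennreal h"
    using h by (subst nn_integral_cmult_indicator) auto
  also have "\<dots> = ennreal (intensity * h\<^sup>2)"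
    using h intensity_nonneg by (simp add: ennreal_mult[symmetric] power2_eq_square mult.assoc)
  finally show "(LINT \<omega>|chain i. away_time t h \<omega>) \<le> intensity * h\<^sup>2"
    by (rule ennreal_le_iff[THEN iffD1, rotated]) (use intensity_nonneg in auto)
qed

end


section \<open>Controlled trajectories\<close>

definition trajectory :: "real ^ 'n \<Rightarrow> (real \<Rightarrow> real ^ 'n::finite) \<Rightarrow> real \<Rightarrow> real ^ 'n" where
  "trajectory x \<xi> t = x + (LBINT r:{0..t}. \<xi> r)"

lemma trajectory_torus: "torus_of x + torus_path \<xi> t = torus_of (trajectory x \<xi> t)"
  by (simp add: trajectory_def torus_path_def torus_of_add)

lemma set_integral_Icc_point:
  fixes f :: "real \<Rightarrow> 'b::{banach, second_countable_topology}"
  shows "(LBINT r:{a..a}. f r) = 0"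
  unfolding set_lebesgue_integral_def
proof (rule integral_eq_zero_AE)
  show "AE r in lborel. indicator {a..a} r *\<^sub>R f r = 0"
    using AE_lborel_singleton[of a] by eventually_elim (simp add: indicator_def)
qed

lemma trajectory_0 [simp]: "trajectory x \<xi> 0 = x"
  unfolding trajectory_def set_integral_Icc_point by simp

lemma set_integral_Icc_split:
  fixes f :: "real \<Rightarrow> 'b::{banach, second_countable_topology}"
  assumes f: "set_integrable lborel {a..c} f" and ab: "a \<le> b" and bc: "b \<le> c"
  shows "(LBINT r:{a..c}. f r) = (LBINT r:{a..b}. f r) + (LBINT r:{b..c}. f r)"
proof -
  have 1: "set_integrable lborel {a..b} f" and 2: "set_integrable lborel {b..c} f"
    using ab bc by (auto intro: set_integrable_subset[OF f])
  have "(LBINT r:{a..c}. f r) = (LINT r|lborel. indicator {a..b} r *\<^sub>R f r + indicator {b..c} r *\<^sub>R f r)"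
    unfolding set_lebesgue_integral_def
  proof (rule integral_cong_AE)
    show "AE r in lborel. indicator {a..c} r *\<^sub>R f r = indicator {a..b} r *\<^sub>R f r + indicator {b..c} r *\<^sub>R f r"
      using AE_lborel_singleton[of b] by eventually_elim (use ab bc in \<open>auto simp: indicator_def\<close>)
  qed (use f 1 2 in \<open>auto simp: set_integrable_def dest: borel_measurable_integrable\<close>)
  also have "\<dots> = (LBINT r:{a..b}. f r) + (LBINT r:{b..c}. f r)"
    unfolding set_lebesgue_integral_def
    by (rule Bochner_Integration.integral_add) (use 1 2 in \<open>auto simp: set_integrable_def\<close>)
  finally show ?thesis .
qed

lemma bounded_set_integrable:
  fixes f :: "real \<Rightarrow> 'b::{banach, second_countable_topology}"
  assumes "(\<lambda>s. indicator {a..b} s *\<^sub>R f s) \<in> borel_measurable borel" and "\<And>s. s \<in> {a..b} \<Longrightarrow> norm (f s) \<le> B"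
  shows "set_integrable lborel {a..b} f"
  unfolding set_integrable_def
proof (rule Bochner_Integration.integrable_bound)
  show "integrable lborel (\<lambda>s. indicator {a..b} s * B)"
    by (rule integrable_mult_left) (simp add: emeasure_lborel_Icc_eq)
  show "AE s in lborel. norm (indicator {a..b} s *\<^sub>R f s) \<le> norm (indicator {a..b} s * B)"
  proof (rule AE_I2)
    fix s show "norm (indicator {a..b} s *\<^sub>R f s) \<le> norm (indicator {a..b} s * B)"
      using assms(2)[of s] by (cases "s \<in> {a..b}") (auto intro: order_trans)
  qed
qed (use assms in simp)

lemma measurable_velocity_joint:
  assumes \<Xi>: "\<Xi> \<in> M \<rightarrow>\<^sub>M velocity_algebra"
  shows "(\<lambda>x. \<Xi> (fst x) (max 0 (snd x)) :: real ^ 'n::finite) \<in> borel_measurable (M \<Otimes>\<^sub>M borel)"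
proof -
  have "(\<lambda>(x, s). \<Xi> x (max 0 s)) \<in> borel_measurable (M \<Otimes>\<^sub>M borel)"
  proof (rule joint_measurable_right_continuous)
    show "(\<lambda>x. \<Xi> x s) \<in> borel_measurable M" if "0 \<le> s" for s
      by (rule measurable_compose[OF \<Xi> measurable_velocity_eval[OF that]])
    show "(\<Xi> x \<longlongrightarrow> \<Xi> x s) (at_right s)" if "x \<in> space M" "0 \<le> s" for x s
      using measurable_space[OF \<Xi> that(1)] that(2) by (intro cadlag_right_continuous) auto
  qed
  then show ?thesis by (simp add: case_prod_beta')
qed

lemma measurable_trajectory_joint:
  fixes \<Xi> :: "'a \<Rightarrow> real \<Rightarrow> real ^ 'n::finite"
  assumes \<Xi>: "\<Xi> \<in> M \<rightarrow>\<^sub>M velocity_algebra"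
  shows "(\<lambda>x. trajectory z (\<Xi> (fst x)) (snd x)) \<in> borel_measurable (M \<Otimes>\<^sub>M borel)"
proof -
  have "(\<lambda>y. ((fst (fst y)), snd y)) \<in> (M \<Otimes>\<^sub>M borel) \<Otimes>\<^sub>M lborel \<rightarrow>\<^sub>M M \<Otimes>\<^sub>M (borel :: real measure)"
    by measurable
  from measurable_compose[OF this measurable_velocity_joint[OF \<Xi>]]
  have [measurable]: "(\<lambda>y. \<Xi> (fst (fst y)) (max 0 (snd y))) \<in> borel_measurable ((M \<Otimes>\<^sub>M (borel :: real measure)) \<Otimes>\<^sub>M lborel)"
    by simp
  have "(\<lambda>y. if 0 \<le> snd y \<and> snd y \<le> snd (fst y) then \<Xi> (fst (fst y)) (max 0 (snd y)) else 0) \<in> borel_measurable ((M \<Otimes>\<^sub>M borel) \<Otimes>\<^sub>M lborel)"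
    by measurable
  then have "(\<lambda>x. LINT r|lborel. (if 0 \<le> r \<and> r \<le> snd x then \<Xi> (fst x) (max 0 r) else 0)) \<in> borel_measurable (M \<Otimes>\<^sub>M borel)"
    by (intro lborel.borel_measurable_lebesgue_integral) (simp add: case_prod_beta')
  moreover have "trajectory z (\<Xi> (fst x)) (snd x) = z + (LINT r|lborel. (if 0 \<le> r \<and> r \<le> snd x then \<Xi> (fst x) (max 0 r) else 0))" for x
    unfolding trajectory_def set_lebesgue_integral_def
    by (intro arg_cong2[where f = "(+)"] refl Bochner_Integration.integral_cong) (auto simp: indicator_def)
  ultimately show ?thesis by simp
qed

context hamiltonian_system
begin

definition cost_rate :: "real ^ 'n \<Rightarrow> (real \<Rightarrow> 'm) \<Rightarrow> (real \<Rightarrow> real ^ 'n) \<Rightarrow> real \<Rightarrow> real" where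
  "cost_rate x \<omega> \<xi> s = lagrangian H (\<omega> s) (torus_of (trajectory x \<xi> s)) (- \<xi> s)"

definition accrued :: "real ^ 'n \<Rightarrow> (real \<Rightarrow> 'm) \<Rightarrow> (real \<Rightarrow> real ^ 'n) \<Rightarrow> real \<Rightarrow> real" where
  "accrued x \<omega> \<xi> t = (LBINT s:{0..t}. cost_rate x \<omega> \<xi> s)"

text \<open>The trajectory is evaluated at unclipped times: it is constant before time \<open>0\<close>.\<close>

lemma measurable_lagrangian_joint:
  assumes \<Xi>: "\<Xi> \<in> path_algebra \<rightarrow>\<^sub>M velocity_algebra"
  shows "(\<lambda>y. lagrangian H i (torus_of (trajectory x (\<Xi> (fst y)) (snd y))) (- \<Xi> (fst y) (max 0 (snd y))))
     \<in> borel_measurable ((path_algebra :: (real \<Rightarrow> 'm) measure) \<Otimes>\<^sub>M borel)"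
proof -
  have L: "(\<lambda>x. lagrangian H i (torus_of (fst x)) (snd x)) \<in> borel_measurable (borel \<Otimes>\<^sub>M borel)"
    using lagrangian_lift_continuous[of i] by (simp add: borel_measurable_continuous_onI borel_prod)
  have "(\<lambda>y. (trajectory x (\<Xi> (fst y)) (snd y), - \<Xi> (fst y) (max 0 (snd y)))) \<in> path_algebra \<Otimes>\<^sub>M borel \<rightarrow>\<^sub>M borel \<Otimes>\<^sub>M borel"
    by (intro measurable_Pair measurable_trajectory_joint \<Xi> borel_measurable_uminus measurable_velocity_joint)
  from measurable_compose[OF this L] show ?thesis by simp
qed

lemma measurable_cost_rate_joint:
  assumes \<Xi>: "\<Xi> \<in> path_algebra \<rightarrow>\<^sub>M velocity_algebra"
  shows "(\<lambda>y. cost_rate x (fst y) (\<Xi> (fst y)) (max 0 (snd y))) \<in> borel_measurable ((path_algebra :: (real \<Rightarrow> 'm) measure) \<Otimes>\<^sub>M borel)"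
proof -
  have idx: "(\<lambda>y. fst y (max 0 (snd y))) \<in> (path_algebra :: (real \<Rightarrow> 'm) measure) \<Otimes>\<^sub>M borel \<rightarrow>\<^sub>M count_space UNIV"
    by (rule measurable_path_at_random_time) auto
  have clip: "(\<lambda>y. (fst y, max 0 (snd y))) \<in> (path_algebra :: (real \<Rightarrow> 'm) measure) \<Otimes>\<^sub>M borel \<rightarrow>\<^sub>M path_algebra \<Otimes>\<^sub>M (borel :: real measure)"
    by measurable
  have "(\<lambda>y. lagrangian H i (torus_of (trajectory x (\<Xi> (fst y)) (max 0 (snd y)))) (- \<Xi> (fst y) (max 0 (snd y))))
     \<in> borel_measurable ((path_algebra :: (real \<Rightarrow> 'm) measure) \<Otimes>\<^sub>M borel)" for i
    using measurable_compose[OF clip measurable_lagrangian_joint[OF \<Xi>, of i x]] by simp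
  then show ?thesis
    unfolding cost_rate_def
    by (rule measurable_compose_countable'[OF _ idx]) (auto intro: countable_finite)
qed

lemma measurable_accrued:
  assumes \<Xi>: "\<Xi> \<in> path_algebra \<rightarrow>\<^sub>M velocity_algebra"
    and \<sigma>: "\<sigma> \<in> borel_measurable (path_algebra :: (real \<Rightarrow> 'm) measure)"
  shows "(\<lambda>\<omega>. accrued x \<omega> (\<Xi> \<omega>) (\<sigma> \<omega>)) \<in> borel_measurable path_algebra"
proof -
  have [measurable]: "(\<lambda>y. cost_rate x (fst y) (\<Xi> (fst y)) (max 0 (snd y))) \<in> borel_measurable ((path_algebra :: (real \<Rightarrow> 'm) measure) \<Otimes>\<^sub>M lborel)"
    using measurable_cost_rate_joint[OF \<Xi>, of x] by (simp cong: measurable_cong_sets sets_pair_measure_cong)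
  have [measurable]: "(\<lambda>y. \<sigma> (fst y)) \<in> borel_measurable ((path_algebra :: (real \<Rightarrow> 'm) measure) \<Otimes>\<^sub>M (lborel :: real measure))"
    by (rule measurable_compose[OF measurable_fst \<sigma>])
  have "(\<lambda>y. if 0 \<le> snd y \<and> snd y \<le> \<sigma> (fst y) then cost_rate x (fst y) (\<Xi> (fst y)) (max 0 (snd y)) else 0)
    \<in> borel_measurable ((path_algebra :: (real \<Rightarrow> 'm) measure) \<Otimes>\<^sub>M lborel)"
    by measurable
  then have "(\<lambda>\<omega>. LINT s|lborel. (if 0 \<le> s \<and> s \<le> \<sigma> \<omega> then cost_rate x \<omega> (\<Xi> \<omega>) (max 0 s) else 0)) \<in> borel_measurable path_algebra"
    by (intro lborel.borel_measurable_lebesgue_integral) (simp add: case_prod_beta')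
  moreover have "accrued x \<omega> (\<Xi> \<omega>) (\<sigma> \<omega>) = (LINT s|lborel. (if 0 \<le> s \<and> s \<le> \<sigma> \<omega> then cost_rate x \<omega> (\<Xi> \<omega>) (max 0 s) else 0))" for \<omega>
    unfolding accrued_def set_lebesgue_integral_def
    by (intro Bochner_Integration.integral_cong) (auto simp: indicator_def)
  ultimately show ?thesis by simp
qed

lemma path_set_integrable:
  assumes \<Xi>: "\<Xi> \<in> path_algebra \<rightarrow>\<^sub>M velocity_algebra" and \<omega>: "(\<omega> :: real \<Rightarrow> 'm) \<in> switching_paths" and a: "0 \<le> a"
  shows "set_integrable lborel {a..b} (\<Xi> \<omega>)"
    and "set_integrable lborel {a..b} (\<lambda>s. lagrangian H i (torus_of (trajectory x (\<Xi> \<omega>) s)) (- \<Xi> \<omega> s))"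
    and "set_integrable lborel {a..b} (cost_rate x \<omega> (\<Xi> \<omega>))"
proof -
  have sp: "\<omega> \<in> space path_algebra" using \<omega> by simp
  have "\<Xi> \<omega> \<in> cadlag_paths euclidean" using measurable_space[OF \<Xi> sp] by simp
  from cadlag_bounded_on[OF this, of b] obtain R where "\<forall>q\<in>\<Xi> \<omega> ` {0..b}. norm q \<le> R"
    unfolding bounded_iff by blast
  then have R: "\<And>s. s \<in> {0..b} \<Longrightarrow> norm (\<Xi> \<omega> s) \<le> R" by blast
  obtain B where B: "\<And>i X q. norm q \<le> R \<Longrightarrow> \<bar>lagrangian H i X q\<bar> \<le> B" by (rule lagrangian_bounded[of R]) blast
  have [measurable]: "(\<lambda>s. \<Xi> \<omega> (max 0 s)) \<in> borel_measurable borel"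
    using measurable_compose[OF measurable_Pair1'[OF sp] measurable_velocity_joint[OF \<Xi>]] by simp
  have [measurable]: "(\<lambda>s. lagrangian H i (torus_of (trajectory x (\<Xi> \<omega>) s)) (- \<Xi> \<omega> (max 0 s))) \<in> borel_measurable borel" for i
    using measurable_compose[OF measurable_Pair1'[OF sp] measurable_lagrangian_joint[OF \<Xi>, of i x]] by simp
  have [measurable]: "(\<lambda>s. cost_rate x \<omega> (\<Xi> \<omega>) (max 0 s)) \<in> borel_measurable borel"
    using measurable_compose[OF measurable_Pair1'[OF sp] measurable_cost_rate_joint[OF \<Xi>, of x]] by simp
  show "set_integrable lborel {a..b} (\<Xi> \<omega>)"
  proof (rule bounded_set_integrable[where B = R])
    have "(\<lambda>s. indicator {a..b} s *\<^sub>R \<Xi> \<omega> s) = (\<lambda>s. indicator {a..b} s *\<^sub>R \<Xi> \<omega> (max 0 s))"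
      using a by (auto simp: indicator_def fun_eq_iff)
    then show "(\<lambda>s. indicator {a..b} s *\<^sub>R \<Xi> \<omega> s) \<in> borel_measurable borel" by simp
  qed (use R a in auto)
  show "set_integrable lborel {a..b} (\<lambda>s. lagrangian H i (torus_of (trajectory x (\<Xi> \<omega>) s)) (- \<Xi> \<omega> s))"
  proof (rule bounded_set_integrable[where B = B])
    have "(\<lambda>s. indicator {a..b} s *\<^sub>R lagrangian H i (torus_of (trajectory x (\<Xi> \<omega>) s)) (- \<Xi> \<omega> s)) =
      (\<lambda>s. indicator {a..b} s *\<^sub>R lagrangian H i (torus_of (trajectory x (\<Xi> \<omega>) s)) (- \<Xi> \<omega> (max 0 s)))"
      using a by (auto simp: indicator_def fun_eq_iff)
    then show "(\<lambda>s. indicator {a..b} s *\<^sub>R lagrangian H i (torus_of (trajectory x (\<Xi> \<omega>) s)) (- \<Xi> \<omega> s)) \<in> borel_measurable borel" by simp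
  qed (use R B a in auto)
  show "set_integrable lborel {a..b} (cost_rate x \<omega> (\<Xi> \<omega>))"
  proof (rule bounded_set_integrable[where B = B])
    have "(\<lambda>s. indicator {a..b} s *\<^sub>R cost_rate x \<omega> (\<Xi> \<omega>) s) = (\<lambda>s. indicator {a..b} s *\<^sub>R cost_rate x \<omega> (\<Xi> \<omega>) (max 0 s))"
      using a by (auto simp: indicator_def fun_eq_iff)
    then show "(\<lambda>s. indicator {a..b} s *\<^sub>R cost_rate x \<omega> (\<Xi> \<omega>) s) \<in> borel_measurable borel" by simp
  qed (use R B a in \<open>auto simp: cost_rate_def\<close>)
qed

lemma control_essentially_bounded:
  assumes \<Xi>: "is_control \<Lambda> \<Xi>" and t: "0 < t"
  obtains R where "0 < R" "\<And>i. AE \<omega> in chain i. \<forall>s\<in>{0..t}. norm (\<Xi> \<omega> s :: real ^ 'n) \<le> R"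
proof -
  obtain R where R: "0 < R" "almost_surely \<Lambda> (\<lambda>\<omega>. (SUP s\<in>{0..t}. norm (\<Xi> \<omega> s)) < R)"
    using \<Xi> t unfolding is_control_def by blast
  have meas: "\<Xi> \<in> path_algebra \<rightarrow>\<^sub>M velocity_algebra" using \<Xi> by (simp add: is_control_def)
  have "AE \<omega> in chain i. \<forall>s\<in>{0..t}. norm (\<Xi> \<omega> s) \<le> R" for i
  proof -
    have "AE \<omega> in chain i. (SUP s\<in>{0..t}. norm (\<Xi> \<omega> s)) < R" using R(2) by (simp add: almost_surely_iff)
    then show ?thesis
      using AE_space
    proof eventually_elim
      case (elim \<omega>)
      then have "\<Xi> \<omega> \<in> cadlag_paths euclidean" using measurable_space[OF meas, of \<omega>] by simp
      then have "bounded (\<Xi> \<omega> ` {0..t})" by (rule cadlag_bounded_on)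
      then have "bdd_above ((\<lambda>s. norm (\<Xi> \<omega> s)) ` {0..t})"
        by (auto simp: bounded_iff bdd_above_def)
      then have "norm (\<Xi> \<omega> s) \<le> (SUP s\<in>{0..t}. norm (\<Xi> \<omega> s))" if "s \<in> {0..t}" for s
        using that by (intro cSUP_upper) auto
      then show ?case using elim(1) by force
    qed
  qed
  with R(1) show ?thesis by (rule that)
qed

lemma trajectory_increment:
  fixes x :: "real ^ 'n" and \<Xi> :: "(real \<Rightarrow> 'm) \<Rightarrow> real \<Rightarrow> real ^ 'n"
  assumes \<Xi>: "\<Xi> \<in> path_algebra \<rightarrow>\<^sub>M velocity_algebra" and \<omega>: "(\<omega> :: real \<Rightarrow> 'm) \<in> switching_paths"
    and a: "0 \<le> a" "a \<le> b"
  shows "trajectory x (\<Xi> \<omega>) b = trajectory x (\<Xi> \<omega>) a + (LBINT r:{a..b}. \<Xi> \<omega> r)"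
  unfolding trajectory_def
  using set_integral_Icc_split[OF path_set_integrable(1)[OF \<Xi> \<omega> order_refl[of "0::real"], of b] a] by simp

lemma accrued_increment:
  fixes x :: "real ^ 'n" and \<Xi> :: "(real \<Rightarrow> 'm) \<Rightarrow> real \<Rightarrow> real ^ 'n"
  assumes \<Xi>: "\<Xi> \<in> path_algebra \<rightarrow>\<^sub>M velocity_algebra" and \<omega>: "(\<omega> :: real \<Rightarrow> 'm) \<in> switching_paths"
    and a: "0 \<le> a" "a \<le> b"
  shows "accrued x \<omega> (\<Xi> \<omega>) b = accrued x \<omega> (\<Xi> \<omega>) a + (LBINT r:{a..b}. cost_rate x \<omega> (\<Xi> \<omega>) r)"
  unfolding accrued_def
  by (rule set_integral_Icc_split[OF path_set_integrable(3)[OF \<Xi> \<omega> order_refl[of "0::real"]] a])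

lemma trajectory_nonanticipating:
  assumes \<Xi>: "is_control \<Lambda> \<Xi>" and \<omega>: "\<omega> \<in> switching_paths" and t: "0 \<le> t"
  shows "trajectory x (\<Xi> (stopped_at t \<omega>)) t = trajectory x (\<Xi> \<omega>) t"
proof (cases "t = 0")
  case False
  with t have t0: "0 < t" by simp
  have "\<forall>s\<in>{0..t}. stopped_at t \<omega> s = \<omega> s" by (auto simp: stopped_at_def)
  then have "\<forall>s\<in>{0..t}. \<Xi> (stopped_at t \<omega>) s = \<Xi> \<omega> s"
    using \<Xi> t0 \<omega> stopped_at_cadlag[OF \<omega> t] unfolding is_control_def by blast
  then show ?thesis
    unfolding trajectory_def by (intro arg_cong2[where f = "(+)"] refl set_lebesgue_integral_cong) auto
qed simp

lemma measurable_bounded_stopping_time: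
  assumes "bounded_stopping_time \<tau>"
  shows "\<tau> \<in> borel_measurable (path_algebra :: (real \<Rightarrow> 'm) measure)"
  using assms unfolding bounded_stopping_time_def
  by (intro measurable_stopping_time[where F = path_filtration] sets_path_filtration_subset) auto

text \<open>One step of the grid. On \<open>t < \<tau>\<close> the pathwise bound for the state \<open>\<omega> t\<close> is used although the state may
  change during the step. Four errors arise: the generator remainder; the change of \<open>u\<close> between switched components,
  of order \<open>h\<close> on an event of probability \<open>O(h)\<close>; the running cost of the wrong state during the away time; and the
  error of \<open>one_step_bound\<close>. All are quadratic in \<open>h\<close> in expectation, except for the slack \<open>h * \<eta>\<close>.\<close>

lemma expected_one_step:
  fixes \<tau> :: "(real \<Rightarrow> 'm) \<Rightarrow> real" and \<Xi> :: "(real \<Rightarrow> 'm) \<Rightarrow> real \<Rightarrow> real ^ 'n" and u :: "real ^ 'n \<Rightarrow> real ^ 'm"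
  assumes \<tau>: "bounded_stopping_time \<tau>" and \<Xi>: "is_control \<Lambda> \<Xi>"
    and t: "0 \<le> t" and h: "0 \<le> h" "h \<le> h0" "R * h \<le> 1" and R: "0 \<le> R"
    and bounded: "AE \<omega> in chain i. \<forall>s\<in>{0..t+h}. norm (\<Xi> \<omega> s) \<le> R"
    and BL: "\<And>i X q. norm q \<le> R \<Longrightarrow> \<bar>lagrangian H i X q\<bar> \<le> BL"
    and Bu: "\<And>x j. \<bar>u x $ j\<bar> \<le> Bu"
    and C: "0 \<le> C" "\<And>x y i. norm (y - x) \<le> 1 \<Longrightarrow> \<bar>u y $ i - u x $ i\<bar> \<le> C * norm (y - x)"
    and step: "one_step_bound R h0 (\<alpha> + \<eta>) C u"
    and \<eta>: "0 \<le> \<eta>"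
    and Z: "\<And>s \<omega>. Z s \<omega> = u (trajectory x (\<Xi> \<omega>) s) $ (\<omega> s) + accrued x \<omega> (\<Xi> \<omega>) s + \<alpha> * s"
    and D: "\<And>\<omega>. D \<omega> = (if t < \<tau> \<omega> then Z t \<omega> - Z (t + h) \<omega> else 0)"
  shows "integrable (chain i) D"
    and "(LINT \<omega>|chain i. D \<omega>) \<le> h * \<eta> + (real CARD('m) * intensity\<^sup>2 * Bu + 2 * C * R * intensity + 2 * BL * intensity + C) * h\<^sup>2"
proof -
  have \<Xi>m: "\<Xi> \<in> path_algebra \<rightarrow>\<^sub>M velocity_algebra" using \<Xi> by (simp add: is_control_def)
  have \<tau>m [measurable]: "\<tau> \<in> borel_measurable (path_algebra :: (real \<Rightarrow> 'm) measure)"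
    by (rule measurable_bounded_stopping_time[OF \<tau>])
  have Bu0: "0 \<le> Bu" using Bu[of 0 undefined] by linarith
  have BL0: "0 \<le> BL" using BL[of 0 undefined undefined] R by (smt (verit) norm_zero)
  have "continuous_on UNIV (\<lambda>x. u x $ j)" for j
    by (rule continuous_on_if_locally_lipschitz[OF C])
  then have u_meas: "(\<lambda>x. u x $ j) \<in> borel_measurable borel" for j
    by (rule borel_measurable_continuous_onI)
  have traj_meas: "(\<lambda>\<omega>. trajectory x (\<Xi> \<omega>) s) \<in> borel_measurable path_algebra" for s
    using measurable_compose[OF measurable_Pair2'[of s borel path_algebra] measurable_trajectory_joint[OF \<Xi>m, of x]] by simp
  have Z_meas: "Z s \<in> borel_measurable path_algebra" if "0 \<le> s" for s
  proof -
    have "(\<lambda>\<omega>. u (trajectory x (\<Xi> \<omega>) s) $ (\<omega> s)) \<in> borel_measurable path_algebra"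
      by (rule measurable_compose_countable'[where g = "\<lambda>\<omega>. \<omega> s" and I = UNIV and f = "\<lambda>j \<omega>. u (trajectory x (\<Xi> \<omega>) s) $ j"])
         (auto intro: countable_finite measurable_path_eval[OF that] measurable_compose[OF traj_meas u_meas])
    moreover have "(\<lambda>\<omega>. accrued x \<omega> (\<Xi> \<omega>) s) \<in> borel_measurable path_algebra"
      by (rule measurable_accrued[OF \<Xi>m]) simp
    ultimately show ?thesis unfolding Z[abs_def] by measurable
  qed
  have D_meas: "D \<in> borel_measurable path_algebra"
  proof -
    have [measurable]: "Z t \<in> borel_measurable path_algebra" "Z (t + h) \<in> borel_measurable path_algebra"
      using Z_meas t h by auto
    show ?thesis unfolding D[abs_def] by measurable
  qed
  define A where "A = {\<omega> \<in> switching_paths. t < \<tau> \<omega>}"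
  have A_past: "stopped_at t \<omega> \<in> A \<longleftrightarrow> \<omega> \<in> A" if "\<omega> \<in> switching_paths" for \<omega>
  proof -
    have "Measurable.pred (path_filtration t) (\<lambda>\<omega>. t < \<tau> \<omega>)"
      using \<tau> by (auto simp: bounded_stopping_time_def intro: stopping_timeD2)
    then have "{\<omega> \<in> space (path_filtration t). t < \<tau> \<omega>} \<in> sets (path_filtration t)" by (rule predE)
    then have "A \<in> sets (path_filtration t)" by (simp add: A_def)
    from path_filtration_stopped_iff[OF this t that] show ?thesis .
  qed
  have A_sets: "A \<in> sets path_algebra"
  proof -
    have "{\<omega> \<in> space path_algebra. t < \<tau> \<omega>} \<in> sets (path_algebra :: (real \<Rightarrow> 'm) measure)" by measurable
    then show ?thesis by (simp add: A_def)
  qed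
  define Y where "Y j \<omega> = indicator A \<omega> * u (trajectory x (\<Xi> \<omega>) t) $ j" for j \<omega>
  have Y_meas: "Y j \<in> borel_measurable path_algebra" for j
    unfolding Y_def using A_sets measurable_compose[OF traj_meas u_meas] by measurable
  have Y_past: "Y j (stopped_at t \<omega>) = Y j \<omega>" if "\<omega> \<in> switching_paths" for j \<omega>
    using A_past[OF that] trajectory_nonanticipating[OF \<Xi> that t] by (simp add: Y_def indicator_def)
  have Y_bound: "\<bar>Y j \<omega>\<bar> \<le> Bu" if "\<omega> \<in> switching_paths" for j \<omega>
    using Bu Bu0 by (simp add: Y_def indicator_def)
  define G where "G \<omega> = Y (\<omega> t) \<omega> - Y (\<omega> (t + h)) \<omega> - h * (\<Sum>j\<in>UNIV. \<Lambda> $ (\<omega> t) $ j * Y j \<omega>)" for \<omega>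
  define S where "S \<omega> = (indicator {\<omega> \<in> switching_paths. \<omega> (t + h) \<noteq> \<omega> t} \<omega> :: real)" for \<omega> :: "real \<Rightarrow> 'm"
  have point: "D \<omega> \<le> G \<omega> + 2 * C * R * h * S \<omega> + 2 * BL * away_time t h \<omega> + (h * \<eta> + C * h\<^sup>2)
      \<and> \<bar>D \<omega>\<bar> \<le> 2 * Bu + BL * h + \<bar>\<alpha> * h\<bar>"
    if \<omega>: "\<omega> \<in> switching_paths" and b: "\<forall>s\<in>{0..t+h}. norm (\<Xi> \<omega> s) \<le> R" for \<omega>
  proof (cases "\<omega> \<in> A")
    case False
    then have "D \<omega> = 0" using \<omega> by (simp add: D A_def)
    moreover have "G \<omega> = 0" using False by (simp add: G_def Y_def)
    moreover have "0 \<le> 2 * C * R * h * S \<omega>" using C R h by (simp add: S_def)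
    moreover have "0 \<le> 2 * BL * away_time t h \<omega>" using BL0 away_time_nonneg by simp
    moreover have "0 \<le> h * \<eta> + C * h\<^sup>2" using h \<eta> C by simp
    ultimately show ?thesis using Bu0 BL0 h by simp
  next
    case True
    let ?X = "trajectory x (\<Xi> \<omega>)"
    let ?i = "\<omega> t" and ?j = "\<omega> (t + h)"
    have th: "t \<le> t + h" using h by simp
    have Dt: "D \<omega> = Z t \<omega> - Z (t + h) \<omega>" using True by (simp add: D A_def)
    have acc: "accrued x \<omega> (\<Xi> \<omega>) (t + h) = accrued x \<omega> (\<Xi> \<omega>) t + (LBINT r:{t..t+h}. cost_rate x \<omega> (\<Xi> \<omega>) r)"
      by (rule accrued_increment[OF \<Xi>m \<omega> t th])
    have D_eq: "D \<omega> = u (?X t) $ ?i - u (?X (t + h)) $ ?j - (LBINT r:{t..t+h}. cost_rate x \<omega> (\<Xi> \<omega>) r) - \<alpha> * h"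
      unfolding Dt Z acc by (simp add: algebra_simps)
    have inR: "norm (\<Xi> \<omega> s) \<le> R" if "s \<in> {t..t+h}" for s using b that t by auto
    have int\<xi>: "set_integrable lborel {t..t+h} (\<Xi> \<omega>)" by (rule path_set_integrable(1)[OF \<Xi>m \<omega> t])
    have intL: "set_integrable lborel {t..t+h} (\<lambda>s. lagrangian H k (torus_of (?X s)) (- \<Xi> \<omega> s))" for k
      by (rule path_set_integrable(2)[OF \<Xi>m \<omega> t])
    have intc: "set_integrable lborel {t..t+h} (cost_rate x \<omega> (\<Xi> \<omega>))" by (rule path_set_integrable(3)[OF \<Xi>m \<omega> t])
    have "u (?X t) $ ?i \<le> u (?X (t + h)) $ ?i + (LBINT s:{t..t+h}. lagrangian H ?i (torus_of (?X s)) (- \<Xi> \<omega> s))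
         + ((t + h) - t) * (\<alpha> + \<eta> - \<Lambda> $ ?i \<bullet> u (?X t)) + C * ((t + h) - t)\<^sup>2"
    proof (rule step[unfolded one_step_bound_def, rule_format, OF th _ int\<xi> inR _ intL])
      show "?X s = ?X t + (LBINT r:{t..s}. \<Xi> \<omega> r)" if "s \<in> {t..t+h}" for s
        using trajectory_increment[OF \<Xi>m \<omega> t, of s x] that by simp
    qed (use h in auto)
    then have main: "u (?X t) $ ?i \<le> u (?X (t + h)) $ ?i + (LBINT s:{t..t+h}. lagrangian H ?i (torus_of (?X s)) (- \<Xi> \<omega> s))
         + h * (\<alpha> + \<eta> - \<Lambda> $ ?i \<bullet> u (?X t)) + C * h\<^sup>2" by simp
    have "norm (?X (t + h) - ?X t) \<le> R * ((t + h) - t)"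
      using norm_set_integral_le[OF int\<xi> th inR] trajectory_increment[OF \<Xi>m \<omega> t th, of x] by simp
    then have nX: "norm (?X (t + h) - ?X t) \<le> R * h" by simp
    have lip: "\<bar>u (?X (t + h)) $ k - u (?X t) $ k\<bar> \<le> C * (R * h)" for k
      using C(2)[of "?X (t + h)" "?X t" k] nX h(3) mult_left_mono[OF nX C(1)] by linarith
    have switch: "u (?X (t + h)) $ ?i - u (?X (t + h)) $ ?j \<le> u (?X t) $ ?i - u (?X t) $ ?j + 2 * C * R * h * S \<omega>"
    proof (cases "?i = ?j")
      case True
      then show ?thesis by (simp add: S_def)
    next
      case False
      then have "S \<omega> = 1" using \<omega> by (simp add: S_def)
      then show ?thesis using lip[of ?i] lip[of ?j] by (simp add: abs_le_iff)
    qed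
    have "(LBINT s:{t..t+h}. lagrangian H ?i (torus_of (?X s)) (- \<Xi> \<omega> s)) - (LBINT r:{t..t+h}. cost_rate x \<omega> (\<Xi> \<omega>) r)
      = (LBINT s:{t..t+h}. lagrangian H ?i (torus_of (?X s)) (- \<Xi> \<omega> s) - cost_rate x \<omega> (\<Xi> \<omega>) s)"
      by (rule set_integral_diff(2)[OF intL intc, symmetric])
    also have "\<dots> \<le> (LBINT s:{t..t+h}. 2 * BL * of_bool (\<omega> s \<noteq> \<omega> t))"
    proof (rule set_integral_mono)
      show "set_integrable lborel {t..t+h} (\<lambda>s. lagrangian H ?i (torus_of (?X s)) (- \<Xi> \<omega> s) - cost_rate x \<omega> (\<Xi> \<omega>) s)"
        by (rule set_integral_diff(1)[OF intL intc])
      show "set_integrable lborel {t..t+h} (\<lambda>s. 2 * BL * of_bool (\<omega> s \<noteq> \<omega> t))"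
        by (intro set_integrable_mult_right) (rule away_set_integrable[OF t \<omega>])
      fix s assume s: "s \<in> {t..t+h}"
      show "lagrangian H ?i (torus_of (?X s)) (- \<Xi> \<omega> s) - cost_rate x \<omega> (\<Xi> \<omega>) s \<le> 2 * BL * of_bool (\<omega> s \<noteq> \<omega> t)"
      proof (cases "\<omega> s = \<omega> t")
        case True then show ?thesis by (simp add: cost_rate_def)
      next
        case False
        have "norm (- \<Xi> \<omega> s) \<le> R" using inR[OF s] by simp
        from BL[OF this, of ?i "torus_of (?X s)"] BL[OF this, of "\<omega> s" "torus_of (?X s)"] False
        show ?thesis by (simp add: cost_rate_def)
      qed
    qed
    also have "\<dots> = 2 * BL * away_time t h \<omega>"
      unfolding away_time_def by (rule set_integral_mult_right)
    finally have lag: "(LBINT s:{t..t+h}. lagrangian H ?i (torus_of (?X s)) (- \<Xi> \<omega> s)) - (LBINT r:{t..t+h}. cost_rate x \<omega> (\<Xi> \<omega>) r)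
       \<le> 2 * BL * away_time t h \<omega>" .
    have "\<Lambda> $ ?i \<bullet> u (?X t) = (\<Sum>j\<in>UNIV. \<Lambda> $ ?i $ j * Y j \<omega>)"
      using True by (simp add: row_inner Y_def)
    then have G_eq: "G \<omega> = u (?X t) $ ?i - u (?X t) $ ?j - h * (\<Lambda> $ ?i \<bullet> u (?X t))"
      using True by (simp add: G_def Y_def)
    have "D \<omega> \<le> G \<omega> + 2 * C * R * h * S \<omega> + 2 * BL * away_time t h \<omega> + (h * \<eta> + C * h\<^sup>2)"
      using main switch lag unfolding D_eq G_eq by (simp add: algebra_simps)
    moreover have "\<bar>LBINT r:{t..t+h}. cost_rate x \<omega> (\<Xi> \<omega>) r\<bar> \<le> BL * ((t + h) - t)"
      using norm_set_integral_le[OF intc th, of BL] inR BL by (simp add: cost_rate_def)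
    then have "\<bar>D \<omega>\<bar> \<le> 2 * Bu + BL * h + \<bar>\<alpha> * h\<bar>"
      using Bu[of "?X t" ?i] Bu[of "?X (t + h)" ?j] unfolding D_eq by (simp add: abs_le_iff) linarith
    ultimately show ?thesis by simp
  qed
  have AE_point: "AE \<omega> in chain i. D \<omega> \<le> G \<omega> + 2 * C * R * h * S \<omega> + 2 * BL * away_time t h \<omega> + (h * \<eta> + C * h\<^sup>2)
      \<and> \<bar>D \<omega>\<bar> \<le> 2 * Bu + BL * h + \<bar>\<alpha> * h\<bar>"
    using bounded AE_space by eventually_elim (use point in auto)
  then have "AE \<omega> in chain i. \<bar>D \<omega>\<bar> \<le> 2 * Bu + BL * h + \<bar>\<alpha> * h\<bar>" by eventually_elim simp
  then show D_int: "integrable (chain i) D" by (rule integrable_chain_bounded[OF D_meas])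
  have G_int: "integrable (chain i) G" and G_le: "(LINT \<omega>|chain i. G \<omega>) \<le> real CARD('m) * intensity\<^sup>2 * h\<^sup>2 * Bu"
    unfolding G_def using generator_step[OF t h(1) Y_meas Y_past Y_bound, of i] by auto
  have S_sets: "{\<omega> \<in> switching_paths. \<omega> (t + h) \<noteq> \<omega> t} \<in> sets (chain i)"
    using sets_switched[of t "t + h"] t h by simp
  have S_int: "integrable (chain i) S"
    unfolding S_def[abs_def] using S_sets by (intro integrable_real_indicator) (auto simp: chain.emeasure_eq_measure)
  have S_le: "(LINT \<omega>|chain i. S \<omega>) \<le> intensity * h"
    using switch_probability[OF t h(1), of i] S_sets by (simp add: S_def Collect_switching_Int)
  have W_int: "integrable (chain i) (away_time t h)" and W_le: "(LINT \<omega>|chain i. away_time t h \<omega>) \<le> intensity * h\<^sup>2"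
    by (rule expected_away_time[OF t h(1)])+
  have c_int: "integrable (chain i) (\<lambda>\<omega>. h * \<eta> + C * h\<^sup>2)" by simp
  have "(LINT \<omega>|chain i. D \<omega>) \<le> (LINT \<omega>|chain i. G \<omega> + 2 * C * R * h * S \<omega> + 2 * BL * away_time t h \<omega> + (h * \<eta> + C * h\<^sup>2))"
    using AE_point
    by (intro integral_mono_AE D_int Bochner_Integration.integrable_add integrable_mult_right G_int S_int W_int c_int) auto
  also have "\<dots> = (LINT \<omega>|chain i. G \<omega>) + 2 * C * R * h * (LINT \<omega>|chain i. S \<omega>) + 2 * BL * (LINT \<omega>|chain i. away_time t h \<omega>) + (h * \<eta> + C * h\<^sup>2)"
    using chain.prob_space[of i]
    by (simp add: Bochner_Integration.integral_add Bochner_Integration.integrable_add integrable_mult_right G_int S_int W_int)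
  also have "\<dots> \<le> real CARD('m) * intensity\<^sup>2 * h\<^sup>2 * Bu + 2 * C * R * h * (intensity * h) + 2 * BL * (intensity * h\<^sup>2) + (h * \<eta> + C * h\<^sup>2)"
    by (intro add_mono G_le mult_left_mono S_le W_le order_refl) (use C R h BL0 in auto)
  finally show "(LINT \<omega>|chain i. D \<omega>) \<le> h * \<eta> + (real CARD('m) * intensity\<^sup>2 * Bu + 2 * C * R * intensity + 2 * BL * intensity + C) * h\<^sup>2"
    by (simp add: algebra_simps power2_eq_square)
qed

lemma expected_cost_eq:
  assumes \<tau>: "bounded_stopping_time \<tau>" and \<Xi>: "is_control \<Lambda> \<Xi>"
  shows "expected_cost H \<Lambda> \<alpha> b i (torus_of x) \<tau> \<Xi>
    = (LINT \<omega>|chain i. accrued x \<omega> (\<Xi> \<omega>) (\<tau> \<omega>) + \<alpha> * \<tau> \<omega> + b $ (\<omega> (\<tau> \<omega>)))"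
proof -
  have \<Xi>m: "\<Xi> \<in> path_algebra \<rightarrow>\<^sub>M velocity_algebra" using \<Xi> by (simp add: is_control_def)
  have "(LBINT s:{0..\<tau> \<omega>}. lagrangian H (\<omega> s) (torus_of x + torus_path (\<Xi> \<omega>) s) (- \<Xi> \<omega> s) + \<alpha>) = accrued x \<omega> (\<Xi> \<omega>) (\<tau> \<omega>) + \<alpha> * \<tau> \<omega>"
    if \<omega>: "\<omega> \<in> switching_paths" for \<omega>
  proof -
    have "0 \<le> \<tau> \<omega>" using \<tau> \<omega> by (simp add: bounded_stopping_time_def)
    then show ?thesis
      using set_integral_add(2)[OF path_set_integrable(3)[OF \<Xi>m \<omega> order_refl[of "0::real"], of "\<tau> \<omega>" x] set_integrable_const_Icc[of 0 "\<tau> \<omega>" \<alpha>]]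
      by (simp add: set_integral_const_Icc accrued_def cost_rate_def trajectory_torus mult.commute)
  qed
  then show ?thesis
    unfolding expected_cost_def path_law_axis by (intro Bochner_Integration.integral_cong) auto
qed

lemma measurable_terminal:
  fixes \<sigma> :: "(real \<Rightarrow> 'm) \<Rightarrow> real" and b :: "real ^ 'm"
  assumes "\<sigma> \<in> borel_measurable path_algebra" "\<And>\<omega>. \<omega> \<in> switching_paths \<Longrightarrow> 0 \<le> \<sigma> \<omega>"
  shows "(\<lambda>\<omega>. b $ (\<omega> (\<sigma> \<omega>))) \<in> borel_measurable path_algebra"
proof -
  have "(\<lambda>\<omega>. \<omega> (\<sigma> \<omega>)) \<in> path_algebra \<rightarrow>\<^sub>M (count_space UNIV :: 'm measure)"
    using assms by (intro measurable_path_at_random_time) auto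
  from measurable_compose[OF this, of "\<lambda>j. b $ j" borel] show ?thesis by simp
qed

lemma cost_integrable:
  assumes \<tau>: "bounded_stopping_time \<tau>" and \<Xi>: "is_control \<Lambda> \<Xi>"
  shows "integrable (chain i) (\<lambda>\<omega>. accrued x \<omega> (\<Xi> \<omega>) (\<tau> \<omega>) + \<alpha> * \<tau> \<omega> + b $ (\<omega> (\<tau> \<omega>)))"
proof -
  have \<Xi>m: "\<Xi> \<in> path_algebra \<rightarrow>\<^sub>M velocity_algebra" using \<Xi> by (simp add: is_control_def)
  have \<tau>m [measurable]: "\<tau> \<in> borel_measurable (path_algebra :: (real \<Rightarrow> 'm) measure)"
    by (rule measurable_bounded_stopping_time[OF \<tau>])
  obtain T where T: "\<And>\<omega>. \<omega> \<in> switching_paths \<Longrightarrow> 0 \<le> \<tau> \<omega> \<and> \<tau> \<omega> \<le> T"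
    using \<tau> unfolding bounded_stopping_time_def by blast
  obtain R where R: "0 < R" "\<And>i. AE \<omega> in chain i. \<forall>s\<in>{0..\<bar>T\<bar> + 1}. norm (\<Xi> \<omega> s) \<le> R"
    by (rule control_essentially_bounded[OF \<Xi>, of "\<bar>T\<bar> + 1"]) auto
  obtain BL where BL: "\<And>i X q. norm q \<le> R \<Longrightarrow> \<bar>lagrangian H i X q\<bar> \<le> BL"
    by (rule lagrangian_bounded[of R]) blast
  have BL0: "0 \<le> BL" using BL[of 0 undefined undefined] R by simp
  have [measurable]: "(\<lambda>\<omega>. b $ (\<omega> (\<tau> \<omega>))) \<in> borel_measurable path_algebra"
    by (rule measurable_terminal[OF \<tau>m]) (use T in auto)
  have meas: "(\<lambda>\<omega>. accrued x \<omega> (\<Xi> \<omega>) (\<tau> \<omega>) + \<alpha> * \<tau> \<omega> + b $ (\<omega> (\<tau> \<omega>))) \<in> borel_measurable path_algebra"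
    using measurable_accrued[OF \<Xi>m \<tau>m, of x] by measurable
  show ?thesis
  proof (rule integrable_chain_bounded[OF meas, where B = "BL * \<bar>T\<bar> + \<bar>\<alpha>\<bar> * \<bar>T\<bar> + norm b"])
    show "AE \<omega> in chain i. \<bar>accrued x \<omega> (\<Xi> \<omega>) (\<tau> \<omega>) + \<alpha> * \<tau> \<omega> + b $ (\<omega> (\<tau> \<omega>))\<bar> \<le> BL * \<bar>T\<bar> + \<bar>\<alpha>\<bar> * \<bar>T\<bar> + norm b"
      using R(2)[of i] AE_space
    proof eventually_elim
      case (elim \<omega>)
      then have \<omega>: "\<omega> \<in> switching_paths" by simp
      note T' = T[OF \<omega>]
      have "\<bar>accrued x \<omega> (\<Xi> \<omega>) (\<tau> \<omega>)\<bar> \<le> BL * (\<tau> \<omega> - 0)"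
        unfolding accrued_def real_norm_def[symmetric]
        by (rule norm_set_integral_le[OF path_set_integrable(3)[OF \<Xi>m \<omega> order_refl[of "0::real"]]])
           (use elim T' BL in \<open>auto simp: cost_rate_def\<close>)
      moreover have "BL * (\<tau> \<omega> - 0) \<le> BL * \<bar>T\<bar>" using T' BL0 by (intro mult_left_mono) auto
      moreover have "\<bar>\<alpha> * \<tau> \<omega>\<bar> \<le> \<bar>\<alpha>\<bar> * \<bar>T\<bar>" using T' unfolding abs_mult by (intro mult_left_mono) auto
      moreover have "\<bar>b $ (\<omega> (\<tau> \<omega>))\<bar> \<le> norm b" by (rule component_le_norm_cart)
      ultimately show ?case by linarith
    qed
  qed
qed

lemma AE_initial_state: "AE \<omega> in chain i. \<omega> 0 = i"
proof -
  have "measure (chain i) {\<omega> \<in> switching_paths. \<omega> 0 = i} = 1"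
    by (simp add: chain_marginal transition_0)
  from chain.AE_prob_1[OF this] show ?thesis by eventually_elim simp
qed

text \<open>The differences of one step telescope to the difference between time \<open>0\<close> and the rounded stopping time
  \<open>\<sigma> n\<close>. As \<open>\<sigma> n\<close> decreases to \<open>\<tau>\<close>, right continuity of the paths makes the state at \<open>\<sigma> n\<close> agree with the state at
  \<open>\<tau>\<close> with probability tending to \<open>1\<close>, and at time \<open>\<tau>\<close> the trajectory has reached \<open>y\<close>.\<close>

lemma subsolution_le_expected_cost:
  fixes w :: "'n torus \<Rightarrow> real ^ 'm"
  assumes sub: "subsolution H \<Lambda> \<alpha> w" and wy: "w y = b" and \<tau>: "bounded_stopping_time \<tau>"
    and reach: "\<Xi> \<in> controls_reaching \<Lambda> \<tau> (y - torus_of x)"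
  shows "w (torus_of x) $ i \<le> expected_cost H \<Lambda> \<alpha> b i (torus_of x) \<tau> \<Xi>"
proof (rule field_le_epsilon)
  fix e :: real assume e: "0 < e"
  have w: "continuous_on UNIV w" using sub by (simp add: subsolution_def)
  have \<Xi>: "is_control \<Lambda> \<Xi>" and target: "\<And>i. AE \<omega> in chain i. torus_path (\<Xi> \<omega>) (\<tau> \<omega>) = y - torus_of x"
    using reach by (auto simp: controls_reaching_def almost_surely_iff)
  have \<Xi>m: "\<Xi> \<in> path_algebra \<rightarrow>\<^sub>M velocity_algebra" using \<Xi> by (simp add: is_control_def)
  have \<tau>m [measurable]: "\<tau> \<in> borel_measurable (path_algebra :: (real \<Rightarrow> 'm) measure)"
    by (rule measurable_bounded_stopping_time[OF \<tau>])
  obtain T where T: "\<And>\<omega>. \<omega> \<in> switching_paths \<Longrightarrow> 0 \<le> \<tau> \<omega> \<and> \<tau> \<omega> \<le> T"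
    using \<tau> unfolding bounded_stopping_time_def by blast
  define N where "N = nat \<lceil>\<bar>T\<bar>\<rceil> + 1"
  have TN: "T \<le> real N" unfolding N_def by linarith
  \<comment> \<open>\<open>\<eta>\<close> is paid per unit of time up to \<open>N\<close>, and once at either end for \<open>u\<close> against \<open>w\<close>\<close>
  define \<eta> where "\<eta> = e / (real N + 2)"
  have \<eta>: "0 < \<eta>" using e by (simp add: \<eta>_def)
  obtain R where R: "0 < R" "\<And>i. AE \<omega> in chain i. \<forall>s\<in>{0..real N + 1}. norm (\<Xi> \<omega> s) \<le> R"
    by (rule control_essentially_bounded[OF \<Xi>, of "real N + 1"]) auto
  obtain u C h0 where h0: "0 < h0" and C: "0 \<le> C"
    and close: "\<And>x i. \<bar>u x $ i - w (torus_of x) $ i\<bar> \<le> \<eta>"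
    and lip: "\<And>x y i. norm (y - x) \<le> 1 \<Longrightarrow> \<bar>u y $ i - u x $ i\<bar> \<le> C * norm (y - x)"
    and step: "one_step_bound R h0 (\<alpha> + \<eta>) C u"
    by (rule subsolution_one_step[OF sub R(1) \<eta>]) blast
  obtain BL where BL: "\<And>i X q. norm q \<le> R \<Longrightarrow> \<bar>lagrangian H i X q\<bar> \<le> BL"
    by (rule lagrangian_bounded[of R]) blast
  have BL0: "0 \<le> BL" using BL[of 0 undefined undefined] R by simp
  obtain Bw where Bw: "0 \<le> Bw" "\<And>X i. \<bar>w X $ i\<bar> \<le> Bw" by (rule continuous_torus_bounded[OF w]) blast
  define Bu where "Bu = Bw + \<eta>"
  have Bu: "\<bar>u z $ j\<bar> \<le> Bu" for z j using close[of z j] Bw(2)[of "torus_of z" j] by (simp add: Bu_def)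
  have Bu0: "0 \<le> Bu" using Bw \<eta> by (simp add: Bu_def)
  define Z where "Z s \<omega> = u (trajectory x (\<Xi> \<omega>) s) $ (\<omega> s) + accrued x \<omega> (\<Xi> \<omega>) s + \<alpha> * s" for s \<omega>
  define K2 where "K2 = real CARD('m) * intensity\<^sup>2 * Bu + 2 * C * R * intensity + 2 * BL * intensity + C"
  define K3 where "K3 = C * R + BL + \<bar>\<alpha>\<bar>"
  define EC where "EC = expected_cost H \<Lambda> \<alpha> b i (torus_of x) \<tau> \<Xi>"
  \<comment> \<open>the stopping time rounded up to the grid of mesh \<open>1 / n\<close>\<close>
  define \<sigma> where "\<sigma> n \<omega> = real (nat \<lceil>\<tau> \<omega> * real n\<rceil>) / real n" for n \<omega>
  define S where "S n \<omega> = (indicator {\<omega> \<in> switching_paths. \<omega> (\<sigma> n \<omega>) \<noteq> \<omega> (\<tau> \<omega>)} \<omega> :: real)" for n \<omega>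
  define Q where "Q n = (LINT \<omega>|chain i. S n \<omega>)" for n
  have \<sigma>_bounds: "\<tau> \<omega> \<le> \<sigma> n \<omega>" "\<sigma> n \<omega> \<le> \<tau> \<omega> + 1 / real n" if "\<omega> \<in> switching_paths" "1 \<le> n" for n \<omega>
  proof -
    have "0 \<le> \<tau> \<omega> * real n" using T[OF that(1)] by simp
    then have "\<tau> \<omega> * real n \<le> real (nat \<lceil>\<tau> \<omega> * real n\<rceil>)" "real (nat \<lceil>\<tau> \<omega> * real n\<rceil>) \<le> \<tau> \<omega> * real n + 1"
      by linarith+
    then show "\<tau> \<omega> \<le> \<sigma> n \<omega>" "\<sigma> n \<omega> \<le> \<tau> \<omega> + 1 / real n"
      using that(2) by (auto simp: \<sigma>_def field_simps)
  qed
  have \<sigma>m [measurable]: "\<sigma> n \<in> borel_measurable (path_algebra :: (real \<Rightarrow> 'm) measure)" for n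
    unfolding \<sigma>_def by measurable
  have S_sets: "{\<omega> \<in> switching_paths. \<omega> (\<sigma> n \<omega>) \<noteq> \<omega> (\<tau> \<omega>)} \<in> sets (path_algebra :: (real \<Rightarrow> 'm) measure)" for n
  proof -
    have [measurable]: "(\<lambda>\<omega>. \<omega> (\<sigma> n \<omega>)) \<in> (path_algebra :: (real \<Rightarrow> 'm) measure) \<rightarrow>\<^sub>M count_space UNIV"
      by (rule measurable_path_at_random_time) (auto simp: \<sigma>_def)
    have [measurable]: "(\<lambda>\<omega>. \<omega> (\<tau> \<omega>)) \<in> (path_algebra :: (real \<Rightarrow> 'm) measure) \<rightarrow>\<^sub>M count_space UNIV"
      by (rule measurable_path_at_random_time) (use T in auto)
    have "{\<omega> \<in> space path_algebra. \<omega> (\<sigma> n \<omega>) \<noteq> \<omega> (\<tau> \<omega>)} \<in> sets (path_algebra :: (real \<Rightarrow> 'm) measure)" by measurable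
    then show ?thesis by simp
  qed
  have S_meas: "S n \<in> borel_measurable (chain i)" for n
    unfolding S_def[abs_def] using S_sets[of n] by simp
  have S_int: "integrable (chain i) (S n)" for n
  proof (rule integrable_chain_bounded[where B = 1])
    show "S n \<in> borel_measurable path_algebra" using S_meas[of n] by simp
  qed (simp add: S_def indicator_def)
  have Q0: "Q \<longlonglongrightarrow> 0"
  proof -
    have "(\<lambda>n. LINT \<omega>|chain i. S n \<omega>) \<longlonglongrightarrow> (LINT \<omega>|chain i. 0)"
    proof (rule integral_dominated_convergence[where w = "\<lambda>_. 1"])
      show "AE \<omega> in chain i. (\<lambda>n. S n \<omega>) \<longlonglongrightarrow> 0"
      proof (rule AE_I2)
        fix \<omega> assume "\<omega> \<in> space (chain i)"
        then have \<omega>: "\<omega> \<in> switching_paths" by simp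
        have "\<forall>\<^sub>F s in at_right (\<tau> \<omega>). \<omega> s = \<omega> (\<tau> \<omega>)"
          by (rule switching_right_constant[OF \<omega>]) (use T[OF \<omega>] in auto)
        then obtain r where r: "\<tau> \<omega> < r" "\<And>s. \<tau> \<omega> < s \<Longrightarrow> s < r \<Longrightarrow> \<omega> s = \<omega> (\<tau> \<omega>)"
          by (auto simp: eventually_at_right_field)
        have "\<forall>\<^sub>F n in sequentially. 1 / real n < r - \<tau> \<omega>"
          using lim_1_over_n r(1) by (intro order_tendstoD(2)) auto
        then have "\<forall>\<^sub>F n in sequentially. S n \<omega> = 0"
          using eventually_ge_at_top[of "1 :: nat"]
        proof eventually_elim
          case (elim n)
          have "\<omega> (\<sigma> n \<omega>) = \<omega> (\<tau> \<omega>)"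
          proof (cases "\<sigma> n \<omega> = \<tau> \<omega>")
            case False
            with \<sigma>_bounds[OF \<omega> elim(2)] elim(1) show ?thesis by (intro r(2)) auto
          qed simp
          then show ?case by (simp add: S_def)
        qed
        then show "(\<lambda>n. S n \<omega>) \<longlonglongrightarrow> 0" by (rule tendsto_eventually)
      qed
      show "S n \<in> borel_measurable (chain i)" for n by (rule S_meas)
      show "AE \<omega> in chain i. norm (S n \<omega>) \<le> 1" for n by (simp add: S_def indicator_def)
    qed simp_all
    then show ?thesis by (simp add: Q_def[abs_def])
  qed
  have est: "u x $ i \<le> real N * \<eta> + real N * K2 * (1 / real n) + EC + \<eta> + 2 * Bu * Q n + K3 * (1 / real n)"
    if n: "1 \<le> n" "1 / real n \<le> h0" "R * (1 / real n) \<le> 1" for n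
  proof -
    define h where "h = 1 / real n"
    have h: "0 \<le> h" "h \<le> h0" "R * h \<le> 1" "0 < h" "h \<le> 1" "real n * h = 1" using n by (auto simp: h_def)
    define D where "D k \<omega> = (if real k * h < \<tau> \<omega> then Z (real k * h) \<omega> - Z (real k * h + h) \<omega> else 0)" for k \<omega>
    have Dk: "integrable (chain i) (D k) \<and> (LINT \<omega>|chain i. D k \<omega>) \<le> h * \<eta> + K2 * h\<^sup>2" if k: "k < N * n" for k
    proof -
      have "real k * h + h = real (Suc k) * h" by (simp add: algebra_simps)
      also have "real (Suc k) \<le> real (N * n)" using k by (simp only: of_nat_le_iff Suc_le_eq)
      then have "real (Suc k) * h \<le> real (N * n) * h" using h(1) by (rule mult_right_mono)
      also have "\<dots> = real N" using h by (simp add: mult.assoc)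
      finally have "real k * h + h \<le> real N" .
      then have b: "AE \<omega> in chain i. \<forall>s\<in>{0..real k * h + h}. norm (\<Xi> \<omega> s) \<le> R"
        using R(2)[of i] by (auto elim!: eventually_mono)
      have kh: "0 \<le> real k * h" using h by simp
      show ?thesis
        unfolding K2_def
        using expected_one_step[OF \<tau> \<Xi> kh h(1-3) less_imp_le[OF R(1)] b BL Bu C lip step less_imp_le[OF \<eta>] Z_def D_def]
        by blast
    qed
    have tele: "(\<Sum>k<N * n. D k \<omega>) = Z 0 \<omega> - Z (\<sigma> n \<omega>) \<omega>" if \<omega>: "\<omega> \<in> switching_paths" for \<omega>
    proof -
      define \<kappa> where "\<kappa> = nat \<lceil>\<tau> \<omega> * real n\<rceil>"
      have lt: "real k * h < \<tau> \<omega> \<longleftrightarrow> k < \<kappa>" for k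
      proof -
        have "real k * h < \<tau> \<omega> \<longleftrightarrow> real k < \<tau> \<omega> * real n" using n by (simp add: h_def field_simps)
        also have "\<dots> \<longleftrightarrow> int k < \<lceil>\<tau> \<omega> * real n\<rceil>" by (simp add: less_ceiling_iff)
        also have "\<dots> \<longleftrightarrow> k < \<kappa>" unfolding \<kappa>_def by linarith
        finally show ?thesis .
      qed
      have "\<tau> \<omega> * real n \<le> real N * real n" using T[OF \<omega>] TN by (intro mult_right_mono) auto
      then have "\<lceil>\<tau> \<omega> * real n\<rceil> \<le> int (N * n)" by (simp add: ceiling_le_iff)
      then have \<kappa>: "\<kappa> \<le> N * n" unfolding \<kappa>_def by linarith
      have "(\<Sum>k<N * n. D k \<omega>) = (\<Sum>k<N * n. if k \<in> {..<\<kappa>} then Z (real k * h) \<omega> - Z (real (Suc k) * h) \<omega> else 0)"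
        unfolding D_def lt by (intro sum.cong) (auto simp: algebra_simps)
      also have "\<dots> = (\<Sum>k\<in>{..<N * n} \<inter> {..<\<kappa>}. Z (real k * h) \<omega> - Z (real (Suc k) * h) \<omega>)"
        by (rule sum.inter_restrict[symmetric]) simp
      also have "{..<N * n} \<inter> {..<\<kappa>} = {..<\<kappa>}" using \<kappa> by auto
      also have "(\<Sum>k<\<kappa>. Z (real k * h) \<omega> - Z (real (Suc k) * h) \<omega>) = Z (real 0 * h) \<omega> - Z (real \<kappa> * h) \<omega>"
        by (rule sum_lessThan_telescope')
      finally show ?thesis by (simp add: \<sigma>_def \<kappa>_def h_def)
    qed
    have main: "AE \<omega> in chain i. u x $ i \<le> (\<Sum>k<N * n. D k \<omega>)
       + ((accrued x \<omega> (\<Xi> \<omega>) (\<tau> \<omega>) + \<alpha> * \<tau> \<omega> + b $ (\<omega> (\<tau> \<omega>))) + 2 * Bu * S n \<omega> + (\<eta> + K3 * h))"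
      using R(2)[of i] target[of i] AE_initial_state[of i] AE_space
    proof eventually_elim
      case (elim \<omega>)
      then have \<omega>: "\<omega> \<in> switching_paths" by simp
      let ?s = "\<sigma> n \<omega>" and ?t = "\<tau> \<omega>" and ?X = "trajectory x (\<Xi> \<omega>)"
      have st: "0 \<le> ?t" "?t \<le> ?s" "?s - ?t \<le> h" "?s \<le> real N + 1"
        using \<sigma>_bounds[OF \<omega> n(1)] T[OF \<omega>] TN h(5) unfolding h_def[symmetric] by linarith+
      have inR: "norm (\<Xi> \<omega> r) \<le> R" if "r \<in> {?t..?s}" for r using elim(1) that st by auto
      have "norm (?X ?s - ?X ?t) \<le> R * (?s - ?t)"
        using norm_set_integral_le[OF path_set_integrable(1)[OF \<Xi>m \<omega> st(1)] st(2) inR]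
          trajectory_increment[OF \<Xi>m \<omega> st(1,2), of x] by simp
      also have "\<dots> \<le> R * h" using st R by (intro mult_left_mono) auto
      finally have nX: "norm (?X ?s - ?X ?t) \<le> R * h" .
      have 1: "u (?X ?s) $ (\<omega> ?s) \<le> u (?X ?t) $ (\<omega> ?s) + C * R * h"
        using lip[of "?X ?s" "?X ?t" "\<omega> ?s"] nX h(3) mult_left_mono[OF nX C] by (simp add: mult.assoc abs_le_iff)
      have 2: "u (?X ?t) $ (\<omega> ?s) \<le> u (?X ?t) $ (\<omega> ?t) + 2 * Bu * S n \<omega>"
      proof (cases "\<omega> ?s = \<omega> ?t")
        case True then show ?thesis by (simp add: S_def)
      next
        case False
        then have "S n \<omega> = 1" using \<omega> by (simp add: S_def)
        then show ?thesis using Bu[of "?X ?t" "\<omega> ?s"] Bu[of "?X ?t" "\<omega> ?t"] by (simp add: abs_le_iff)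
      qed
      have "torus_of (?X ?t) = y"
        using elim(2) trajectory_torus[of x "\<Xi> \<omega>" ?t] by simp
      then have 3: "u (?X ?t) $ (\<omega> ?t) \<le> b $ (\<omega> ?t) + \<eta>"
        using close[of "?X ?t" "\<omega> ?t"] wy by (simp add: abs_le_iff)
      have "\<bar>LBINT r:{?t..?s}. cost_rate x \<omega> (\<Xi> \<omega>) r\<bar> \<le> BL * (?s - ?t)"
        using norm_set_integral_le[OF path_set_integrable(3)[OF \<Xi>m \<omega> st(1)] st(2), of x BL] inR BL
        by (simp add: cost_rate_def)
      also have "\<dots> \<le> BL * h" using st BL0 by (intro mult_left_mono) auto
      finally have 4: "accrued x \<omega> (\<Xi> \<omega>) ?s \<le> accrued x \<omega> (\<Xi> \<omega>) ?t + BL * h"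
        using accrued_increment[OF \<Xi>m \<omega> st(1,2), of x] by simp
      have "\<alpha> * (?s - ?t) \<le> \<bar>\<alpha>\<bar> * h" using st by (intro mult_mono) auto
      then have 5: "\<alpha> * ?s \<le> \<alpha> * ?t + \<bar>\<alpha>\<bar> * h" by (simp add: algebra_simps)
      have "Z 0 \<omega> = u x $ i" using elim(3) by (simp add: Z_def accrued_def set_integral_Icc_point[of "0::real", simplified])
      then have "u x $ i = (\<Sum>k<N * n. D k \<omega>) + Z ?s \<omega>" using tele[OF \<omega>] by simp
      moreover have "Z ?s \<omega> \<le> (accrued x \<omega> (\<Xi> \<omega>) ?t + \<alpha> * ?t + b $ (\<omega> ?t)) + 2 * Bu * S n \<omega> + (\<eta> + K3 * h)"
        unfolding Z_def K3_def using 1 2 3 4 5 by (simp add: distrib_right)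
      ultimately show ?case by simp
    qed
    have D_int: "integrable (chain i) (\<lambda>\<omega>. \<Sum>k<N * n. D k \<omega>)" using Dk by (intro Bochner_Integration.integrable_sum) auto
    have c_int: "integrable (chain i) (\<lambda>\<omega>. accrued x \<omega> (\<Xi> \<omega>) (\<tau> \<omega>) + \<alpha> * \<tau> \<omega> + b $ (\<omega> (\<tau> \<omega>)))"
      by (rule cost_integrable[OF \<tau> \<Xi>])
    have "u x $ i = (LINT \<omega>|chain i. u x $ i)" using chain.prob_space[of i] by simp
    also have "\<dots> \<le> (LINT \<omega>|chain i. (\<Sum>k<N * n. D k \<omega>)
       + ((accrued x \<omega> (\<Xi> \<omega>) (\<tau> \<omega>) + \<alpha> * \<tau> \<omega> + b $ (\<omega> (\<tau> \<omega>))) + 2 * Bu * S n \<omega> + (\<eta> + K3 * h)))"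
      by (intro integral_mono_AE main Bochner_Integration.integrable_add D_int c_int integrable_mult_right S_int) auto
    also have "\<dots> = (\<Sum>k<N * n. LINT \<omega>|chain i. D k \<omega>) + (EC + 2 * Bu * Q n + (\<eta> + K3 * h))"
      using Dk chain.prob_space[of i]
      by (simp add: Bochner_Integration.integral_add D_int c_int S_int Bochner_Integration.integrable_add
          Bochner_Integration.integral_sum EC_def Q_def expected_cost_eq[OF \<tau> \<Xi>])
    also have "\<dots> \<le> (\<Sum>k<N * n. h * \<eta> + K2 * h\<^sup>2) + (EC + 2 * Bu * Q n + (\<eta> + K3 * h))"
      using Dk by (intro add_right_mono sum_mono) auto
    also have "(\<Sum>k<N * n. h * \<eta> + K2 * h\<^sup>2) = real N * (real n * h) * \<eta> + real N * (real n * h) * K2 * h"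
      by (simp add: power2_eq_square algebra_simps)
    finally have "u x $ i \<le> (real N * (real n * h) * \<eta> + real N * (real n * h) * K2 * h) + (EC + 2 * Bu * Q n + (\<eta> + K3 * h))" .
    then show ?thesis unfolding h(6) by (simp add: h_def[symmetric])
  qed
  have "(\<lambda>n. real N * \<eta> + real N * K2 * (1 / real n) + EC + \<eta> + 2 * Bu * Q n + K3 * (1 / real n)) \<longlonglongrightarrow>
      real N * \<eta> + real N * K2 * 0 + EC + \<eta> + 2 * Bu * 0 + K3 * 0"
    by (intro tendsto_intros Q0 lim_1_over_n)
  moreover have "\<forall>\<^sub>F n in sequentially. u x $ i \<le> real N * \<eta> + real N * K2 * (1 / real n) + EC + \<eta> + 2 * Bu * Q n + K3 * (1 / real n)"
  proof -
    have "\<forall>\<^sub>F n in sequentially. 1 / real n < min h0 (1 / R)"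
      using lim_1_over_n h0 R(1) by (intro order_tendstoD(2)) auto
    then show ?thesis
      using eventually_ge_at_top[of "1 :: nat"]
      by eventually_elim (rule est, use R(1) in \<open>auto simp: field_simps\<close>)
  qed
  ultimately have "u x $ i \<le> real N * \<eta> + EC + \<eta>"
    using tendsto_lowerbound[of _ _ sequentially "u x $ i"] by fastforce
  then have "w (torus_of x) $ i \<le> EC + (real N + 2) * \<eta>"
    using close[of x i] by (simp add: abs_le_iff algebra_simps)
  also have "(real N + 2) * \<eta> = e" by (simp add: \<eta>_def)
  finally show "w (torus_of x) $ i \<le> expected_cost H \<Lambda> \<alpha> b i (torus_of x) \<tau> \<Xi> + e"
    by (simp add: EC_def)
qed

section \<open>Concatenation of strategies\<close>

text \<open>An event that is almost sure from every initial state remains so after a shift, when the state at that time is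
  taken as the initial one.\<close>

lemma future_AE:
  assumes h: "0 \<le> h" and Q: "\<And>j. AE \<omega> in chain j. Q j \<omega>"
  shows "AE \<omega> in chain i. Q (\<omega> h) (time_shift h \<omega>)"
proof -
  have "\<forall>j. \<exists>N. {\<omega> \<in> space (chain j). \<not> Q j \<omega>} \<subseteq> N \<and> emeasure (chain j) N = 0 \<and> N \<in> sets (chain j)"
  proof
    fix j show "\<exists>N. {\<omega> \<in> space (chain j). \<not> Q j \<omega>} \<subseteq> N \<and> emeasure (chain j) N = 0 \<and> N \<in> sets (chain j)"
      by (rule AE_E[OF Q[of j]]) blast
  qed
  from choice[OF this] obtain N where
    "\<forall>j. {\<omega> \<in> space (chain j). \<not> Q j \<omega>} \<subseteq> N j \<and> emeasure (chain j) (N j) = 0 \<and> N j \<in> sets (chain j)" ..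
  then have N: "\<And>j. {\<omega> \<in> space (chain j). \<not> Q j \<omega>} \<subseteq> N j"
      "\<And>j. emeasure (chain j) (N j) = 0" "\<And>j. N j \<in> sets (chain j)"
    by blast+
  define M where "M j = {\<omega> \<in> switching_paths. \<omega> h = j \<and> time_shift h \<omega> \<in> N j}" for j
  have "M j \<in> null_sets (chain i)" for j
  proof -
    have Nj: "N j \<in> sets path_algebra" using N(3)[of j] by simp
    have "measure (chain i) (M j) = 0"
      unfolding M_def markov[OF Nj h] using N(2)[of j] by (simp add: measure_def)
    moreover have "M j \<in> sets (chain i)" using sets_shift_event[OF Nj h, of j] by (simp add: M_def)
    ultimately show ?thesis by (simp add: null_sets_def chain.emeasure_eq_measure)
  qed
  then have "(\<Union>j. M j) \<in> null_sets (chain i)" by (intro null_sets_UN') (auto intro: countable_finite)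
  moreover have "{\<omega> \<in> space (chain i). \<not> Q (\<omega> h) (time_shift h \<omega>)} \<subseteq> (\<Union>j. M j)"
    using N(1) time_shift_cadlag[OF _ h] by (fastforce simp: M_def)
  ultimately show ?thesis by (rule AE_I')
qed

text \<open>The definition of a control asks for nonanticipation only at positive times. The case \<open>t = 0\<close> is needed at the
  moment where two controls are spliced.\<close>

lemma nonanticipating_initially:
  fixes \<Xi> :: "(real \<Rightarrow> 'm) \<Rightarrow> real \<Rightarrow> real ^ 'n"
  assumes \<Xi>: "is_control \<Lambda> \<Xi>" and t: "0 \<le> t"
    and \<omega>: "\<omega>1 \<in> switching_paths" "\<omega>2 \<in> switching_paths" and eq: "\<forall>s\<in>{0..t}. \<omega>1 s = \<omega>2 s"
  shows "\<forall>s\<in>{0..t}. \<Xi> \<omega>1 s = \<Xi> \<omega>2 s"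
proof -
  \<comment> \<open>paths that agree up to \<open>t\<close> agree a little longer, by right continuity\<close>
  obtain r1 where r1: "t < r1" "\<And>s. t < s \<Longrightarrow> s < r1 \<Longrightarrow> \<omega>1 s = \<omega>1 t"
    using switching_right_constant[OF \<omega>(1) t] by (auto simp: eventually_at_right_field)
  obtain r2 where r2: "t < r2" "\<And>s. t < s \<Longrightarrow> s < r2 \<Longrightarrow> \<omega>2 s = \<omega>2 t"
    using switching_right_constant[OF \<omega>(2) t] by (auto simp: eventually_at_right_field)
  define r where "r = (t + min r1 r2) / 2"
  have r: "t < r" "r < r1" "r < r2" using r1(1) r2(1) by (auto simp: r_def min_def field_simps)
  have "\<omega>1 s = \<omega>2 s" if "s \<in> {0..r}" for s
  proof (cases "s \<le> t")
    case True then show ?thesis using eq that by auto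
  next
    case False
    then have "\<omega>1 s = \<omega>1 t" "\<omega>2 s = \<omega>2 t" using that r by (auto intro!: r1(2) r2(2))
    then show ?thesis using eq t by auto
  qed
  moreover have "0 < r" using r t by simp
  ultimately have "\<forall>s\<in>{0..r}. \<Xi> \<omega>1 s = \<Xi> \<omega>2 s" using \<Xi> \<omega> unfolding is_control_def by blast
  then show ?thesis using r by auto
qed

text \<open>Velocity \<open>q\<close> up to time \<open>h\<close>, then the control assigned to the state found at \<open>h\<close>, fed with the path seen
  from there.\<close>

definition then_control :: "real \<Rightarrow> real ^ 'n \<Rightarrow> ('m \<Rightarrow> (real \<Rightarrow> 'm) \<Rightarrow> real \<Rightarrow> real ^ 'n) \<Rightarrow> (real \<Rightarrow> 'm) \<Rightarrow> real \<Rightarrow> real ^ 'n" where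
  "then_control h q \<Xi> \<omega> = spliced h (constant_path q) (\<Xi> (\<omega> h) (time_shift h \<omega>))"

definition then_time :: "real \<Rightarrow> ('m \<Rightarrow> (real \<Rightarrow> 'm) \<Rightarrow> real) \<Rightarrow> (real \<Rightarrow> 'm) \<Rightarrow> real" where
  "then_time h \<tau> \<omega> = h + \<tau> (\<omega> h) (time_shift h \<omega>)"

lemma bounded_stopping_time_then_time:
  assumes h: "0 \<le> h" and \<tau>: "\<And>j. bounded_stopping_time (\<tau> j)"
  shows "bounded_stopping_time (then_time h \<tau>)"
  unfolding bounded_stopping_time_def
proof (intro conjI ballI)
  have shift: "time_shift h \<omega> \<in> switching_paths" if "\<omega> \<in> switching_paths" for \<omega> :: "real \<Rightarrow> 'm"
    by (rule time_shift_cadlag[OF that h])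
  have nonneg: "0 \<le> \<tau> j \<omega>" if "\<omega> \<in> switching_paths" for j \<omega>
    using \<tau>[of j] that by (simp add: bounded_stopping_time_def)
  show "stopping_time path_filtration (then_time h \<tau>)"
  proof
    fix t
    show "Measurable.pred (path_filtration t) (\<lambda>\<omega>. then_time h \<tau> \<omega> \<le> t)"
    proof (cases "h \<le> t")
      case False
      have "Measurable.pred (path_filtration t) (\<lambda>\<omega>. False)" by simp
      then show ?thesis
      proof (rule measurable_cong[THEN iffD1, rotated])
        fix \<omega> :: "real \<Rightarrow> 'm" assume "\<omega> \<in> space (path_filtration t)"
        then have "0 \<le> \<tau> (\<omega> h) (time_shift h \<omega>)" by (intro nonneg shift) simp
        then show "False = (then_time h \<tau> \<omega> \<le> t)" using False by (simp add: then_time_def)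
      qed
    next
      case True
      have sh: "time_shift h \<in> path_filtration t \<rightarrow>\<^sub>M (path_filtration (t - h) :: (real \<Rightarrow> 'm) measure)"
        using measurable_time_shift_filtration[OF h, of "t - h"] by simp
      have "Measurable.pred (path_filtration (t - h)) (\<lambda>\<omega>. \<tau> j \<omega> \<le> t - h)" for j
        using \<tau>[of j] by (auto simp: bounded_stopping_time_def intro: stopping_timeD)
      then have "Measurable.pred (path_filtration t) (\<lambda>\<omega>. \<tau> j (time_shift h \<omega>) \<le> t - h)" for j
        by (rule measurable_compose[OF sh])
      then have "Measurable.pred (path_filtration t) (\<lambda>\<omega>. \<tau> (\<omega> h) (time_shift h \<omega>) \<le> t - h)"
        by (rule measurable_compose_countable'[where f = "\<lambda>j \<omega>. \<tau> j (time_shift h \<omega>) \<le> t - h" and I = UNIV])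
           (use h True in \<open>auto intro: countable_finite measurable_filtration_eval\<close>)
      then show ?thesis by (simp add: then_time_def algebra_simps)
    qed
  qed
  show "0 \<le> then_time h \<tau> \<omega>" if "\<omega> \<in> switching_paths" for \<omega>
    using nonneg[OF shift[OF that]] h by (simp add: then_time_def)
  have "\<forall>j. \<exists>T. \<forall>\<omega>\<in>switching_paths. \<tau> j \<omega> \<le> T" using \<tau> by (simp add: bounded_stopping_time_def)
  then obtain T where T: "\<And>j \<omega>. \<omega> \<in> switching_paths \<Longrightarrow> \<tau> j \<omega> \<le> T j" by metis
  have "then_time h \<tau> \<omega> \<le> h + (\<Sum>j\<in>UNIV. \<bar>T j\<bar>)" if "\<omega> \<in> switching_paths" for \<omega>
    using T[OF shift[OF that], of "\<omega> h"] member_le_sum[of "\<omega> h" UNIV "\<lambda>j. \<bar>T j\<bar>"]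
    by (simp add: then_time_def)
  then show "\<exists>T. \<forall>\<omega>\<in>switching_paths. then_time h \<tau> \<omega> \<le> T" by blast
qed

lemma is_control_then_control:
  assumes h: "0 < h" and \<Xi>: "\<And>j. is_control \<Lambda> (\<Xi> j)"
  shows "is_control \<Lambda> (then_control h q \<Xi>)"
  unfolding is_control_def
proof (intro conjI allI impI ballI)
  have h0: "0 \<le> h" using h by simp
  have shift: "time_shift h \<omega> \<in> switching_paths" if "\<omega> \<in> switching_paths" for \<omega> :: "real \<Rightarrow> 'm"
    by (rule time_shift_cadlag[OF that h0])
  have \<Xi>m: "\<Xi> j \<in> path_algebra \<rightarrow>\<^sub>M velocity_algebra" for j using \<Xi> by (simp add: is_control_def)
  have cadlag: "\<Xi> j \<omega> \<in> cadlag_paths euclidean" if "\<omega> \<in> switching_paths" for j \<omega>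
    using measurable_space[OF \<Xi>m, of \<omega> j] that by simp
  show "then_control h q \<Xi> \<in> path_algebra \<rightarrow>\<^sub>M velocity_algebra"
  proof (rule measurable_velocity_algebraI)
    fix \<omega> :: "real \<Rightarrow> 'm" assume "\<omega> \<in> space path_algebra"
    then show "then_control h q \<Xi> \<omega> \<in> cadlag_paths euclidean"
      unfolding then_control_def by (intro spliced_cadlag constant_path_cadlag cadlag shift h0) auto
  next
    fix s :: real assume s: "0 \<le> s"
    show "(\<lambda>\<omega>. then_control h q \<Xi> \<omega> s) \<in> borel_measurable path_algebra"
    proof (cases "s < h")
      case True then show ?thesis using s by (simp add: then_control_def spliced_def constant_path_def)
    next
      case False
      have "(\<lambda>\<omega>. \<Xi> j (time_shift h \<omega>) (s - h)) \<in> borel_measurable path_algebra" for j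
        by (rule measurable_compose[OF measurable_time_shift[OF h0] measurable_compose[OF \<Xi>m measurable_velocity_eval]])
           (use False in auto)
      then have "(\<lambda>\<omega>. \<Xi> (\<omega> h) (time_shift h \<omega>) (s - h)) \<in> borel_measurable path_algebra"
        by (rule measurable_compose_countable'[where f = "\<lambda>j \<omega>. \<Xi> j (time_shift h \<omega>) (s - h)" and I = UNIV])
           (use h0 in \<open>auto intro: countable_finite measurable_path_eval\<close>)
      then show ?thesis using s False by (simp add: then_control_def spliced_def)
    qed
  qed
  show "\<exists>R>0. almost_surely \<Lambda> (\<lambda>\<omega>. (SUP s\<in>{0..t}. norm (then_control h q \<Xi> \<omega> s)) < R)" if t: "0 < t" for t
  proof -
    have "\<forall>j. \<exists>R. \<forall>i. AE \<omega> in chain i. \<forall>s\<in>{0..t}. norm (\<Xi> j \<omega> s) \<le> R"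
    proof
      fix j show "\<exists>R. \<forall>i. AE \<omega> in chain i. \<forall>s\<in>{0..t}. norm (\<Xi> j \<omega> s) \<le> R"
        by (rule control_essentially_bounded[OF \<Xi> t, of j]) blast
    qed
    from choice[OF this] obtain R where
      "\<forall>j. \<forall>i. AE \<omega> in chain i. \<forall>s\<in>{0..t}. norm (\<Xi> j \<omega> s) \<le> R j" ..
    then have R: "\<And>j i. AE \<omega> in chain i. \<forall>s\<in>{0..t}. norm (\<Xi> j \<omega> s) \<le> R j" by blast
    define R' where "R' = norm q + (\<Sum>j\<in>UNIV. \<bar>R j\<bar>)"
    have R'0: "0 \<le> R'" unfolding R'_def by (intro add_nonneg_nonneg sum_nonneg) auto
    have RR': "R j \<le> R'" for j
    proof -
      have "\<bar>R j\<bar> \<le> (\<Sum>j\<in>UNIV. \<bar>R j\<bar>)" by (rule member_le_sum) auto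
      then show ?thesis unfolding R'_def using norm_ge_zero[of q] by linarith
    qed
    have "AE \<omega> in chain i. (SUP s\<in>{0..t}. norm (then_control h q \<Xi> \<omega> s)) < R' + 1" for i
      using future_AE[OF h0, of "\<lambda>j \<omega>. \<forall>s\<in>{0..t}. norm (\<Xi> j \<omega> s) \<le> R j" i, OF R]
    proof eventually_elim
      case (elim \<omega>)
      have "norm (then_control h q \<Xi> \<omega> s) \<le> R'" if "s \<in> {0..t}" for s
      proof (cases "s < h")
        case True
        then have "then_control h q \<Xi> \<omega> s = q" using that by (simp add: then_control_def spliced_def constant_path_def)
        then show ?thesis by (simp add: R'_def sum_nonneg)
      next
        case False
        then have "norm (then_control h q \<Xi> \<omega> s) \<le> R (\<omega> h)"
          using elim that h0 by (simp add: then_control_def spliced_def)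
        with RR'[of "\<omega> h"] show ?thesis by simp
      qed
      then have "(SUP s\<in>{0..t}. norm (then_control h q \<Xi> \<omega> s)) \<le> R'"
        using t by (intro cSUP_least) auto
      then show ?case by simp
    qed
    then show ?thesis
      using R'0 by (intro exI[of _ "R' + 1"]) (auto simp: almost_surely_iff)
  qed
  show "then_control h q \<Xi> \<omega>1 s = then_control h q \<Xi> \<omega>2 s"
    if t: "0 < t" and \<omega>: "\<omega>1 \<in> switching_paths" "\<omega>2 \<in> switching_paths"
      and eq: "\<forall>s\<in>{0..t}. \<omega>1 s = \<omega>2 s" and s: "s \<in> {0..t}" for t \<omega>1 \<omega>2 s
  proof (cases "s < h")
    case True then show ?thesis by (simp add: then_control_def spliced_def)
  next
    case False
    then have ht: "h \<le> t" using s by simp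
    have "\<omega>1 h = \<omega>2 h" using eq ht h0 by simp
    moreover have "\<forall>r\<in>{0..t - h}. time_shift h \<omega>1 r = time_shift h \<omega>2 r"
      using eq h0 by (auto simp: time_shift_def)
    then have "\<forall>r\<in>{0..t - h}. \<Xi> (\<omega>1 h) (time_shift h \<omega>1) r = \<Xi> (\<omega>1 h) (time_shift h \<omega>2) r"
      using ht by (intro nonanticipating_initially[OF \<Xi>] shift \<omega>) auto
    ultimately show ?thesis using False s by (simp add: then_control_def spliced_def)
  qed
qed

lemma set_integral_translate:
  fixes f :: "real \<Rightarrow> 'b::{banach, second_countable_topology}"
  shows "(LBINT r:{h..h+T}. f (r - h)) = (LBINT r:{0..T}. f r)"
proof -
  have "(LINT r|lborel. indicator {h..h+T} r *\<^sub>R f (r - h)) =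
     \<bar>1\<bar> *\<^sub>R (LINT r|lborel. indicator {h..h+T} (h + 1 * r) *\<^sub>R f (h + 1 * r - h))"
    by (rule lborel_integral_real_affine) simp
  also have "\<dots> = (LINT r|lborel. indicator {0..T} r *\<^sub>R f r)"
    by (simp, intro Bochner_Integration.integral_cong) (auto simp: indicator_def)
  finally show ?thesis by (simp add: set_lebesgue_integral_def)
qed

lemma trajectory_then_before:
  assumes s: "0 \<le> s" "s \<le> h"
  shows "trajectory x (then_control h q \<Xi> \<omega>) s = x + s *\<^sub>R q"
proof -
  have "(LBINT r:{0..s}. then_control h q \<Xi> \<omega> r) = (LINT r|lborel. indicator {0..s} r *\<^sub>R q)"
  proof -
    have "(LINT r|lborel. indicator {0..s} r *\<^sub>R then_control h q \<Xi> \<omega> r) = (LINT r|lborel. indicator {0..<s} r *\<^sub>R q)"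
    proof (rule integral_cong_AE)
      have eq: "(\<lambda>r. indicator {0..s} r *\<^sub>R then_control h q \<Xi> \<omega> r) =
        (\<lambda>r. indicator {0..<s} r *\<^sub>R q + indicator {s} r *\<^sub>R then_control h q \<Xi> \<omega> s)"
        using s by (auto simp: fun_eq_iff indicator_def then_control_def spliced_def constant_path_def)
      show "(\<lambda>r. indicator {0..s} r *\<^sub>R then_control h q \<Xi> \<omega> r) \<in> borel_measurable lborel"
        unfolding eq by measurable
      show "AE r in lborel. indicator {0..s} r *\<^sub>R then_control h q \<Xi> \<omega> r = indicator {0..<s} r *\<^sub>R q"
        using AE_lborel_singleton[of s]
        by eventually_elim (use s in \<open>auto simp: indicator_def then_control_def spliced_def constant_path_def\<close>)
    qed measurable
    also have "\<dots> = (LINT r|lborel. indicator {0..s} r *\<^sub>R q)"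
      using s by simp
    finally show ?thesis by (simp add: set_lebesgue_integral_def)
  qed
  also have "\<dots> = s *\<^sub>R q" using s by simp
  finally show ?thesis by (simp add: trajectory_def)
qed

lemma then_control_after:
  assumes "h \<le> r" "0 \<le> h"
  shows "then_control h q \<Xi> \<omega> r = \<Xi> (\<omega> h) (time_shift h \<omega>) (r - h)"
  using assms by (simp add: then_control_def spliced_def)

lemma trajectory_then_after:
  assumes h: "0 < h" and \<Xi>: "\<And>j. is_control \<Lambda> (\<Xi> j)" and \<omega>: "\<omega> \<in> switching_paths" and T: "0 \<le> T"
  shows "trajectory x (then_control h q \<Xi> \<omega>) (h + T) = trajectory (x + h *\<^sub>R q) (\<Xi> (\<omega> h) (time_shift h \<omega>)) T"
proof -
  have m: "then_control h q \<Xi> \<in> path_algebra \<rightarrow>\<^sub>M velocity_algebra"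
    using is_control_then_control[OF h \<Xi>, where q = q] by (simp add: is_control_def)
  have "trajectory x (then_control h q \<Xi> \<omega>) (h + T) = trajectory x (then_control h q \<Xi> \<omega>) h + (LBINT r:{h..h+T}. then_control h q \<Xi> \<omega> r)"
    using h T by (intro trajectory_increment[OF m \<omega>]) auto
  also have "(LBINT r:{h..h+T}. then_control h q \<Xi> \<omega> r) = (LBINT r:{h..h+T}. \<Xi> (\<omega> h) (time_shift h \<omega>) (r - h))"
    using h by (intro set_lebesgue_integral_cong) (auto simp: then_control_after)
  also have "\<dots> = (LBINT r:{0..T}. \<Xi> (\<omega> h) (time_shift h \<omega>) r)" by (rule set_integral_translate)
  finally show ?thesis using h trajectory_then_before[of h h x q \<Xi> \<omega>] by (simp add: trajectory_def[of "x + h *\<^sub>R q"])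
qed

lemma accrued_then:
  assumes h: "0 < h" and \<Xi>: "\<And>j. is_control \<Lambda> (\<Xi> j)" and \<omega>: "\<omega> \<in> switching_paths" and T: "0 \<le> T"
  shows "accrued x \<omega> (then_control h q \<Xi> \<omega>) (h + T) =
    accrued x \<omega> (then_control h q \<Xi> \<omega>) h + accrued (x + h *\<^sub>R q) (time_shift h \<omega>) (\<Xi> (\<omega> h) (time_shift h \<omega>)) T"
proof -
  have m: "then_control h q \<Xi> \<in> path_algebra \<rightarrow>\<^sub>M velocity_algebra"
    using is_control_then_control[OF h \<Xi>, where q = q] by (simp add: is_control_def)
  have "accrued x \<omega> (then_control h q \<Xi> \<omega>) (h + T) = accrued x \<omega> (then_control h q \<Xi> \<omega>) h
     + (LBINT r:{h..h+T}. cost_rate x \<omega> (then_control h q \<Xi> \<omega>) r)"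
    using h T by (intro accrued_increment[OF m \<omega>]) auto
  also have "(LBINT r:{h..h+T}. cost_rate x \<omega> (then_control h q \<Xi> \<omega>) r)
    = (LBINT r:{h..h+T}. cost_rate (x + h *\<^sub>R q) (time_shift h \<omega>) (\<Xi> (\<omega> h) (time_shift h \<omega>)) (r - h))"
  proof (rule set_lebesgue_integral_cong)
    show "\<forall>r. r \<in> {h..h+T} \<longrightarrow> cost_rate x \<omega> (then_control h q \<Xi> \<omega>) r =
       cost_rate (x + h *\<^sub>R q) (time_shift h \<omega>) (\<Xi> (\<omega> h) (time_shift h \<omega>)) (r - h)"
    proof (intro allI impI)
      fix r assume r: "r \<in> {h..h+T}"
      have "trajectory x (then_control h q \<Xi> \<omega>) r = trajectory (x + h *\<^sub>R q) (\<Xi> (\<omega> h) (time_shift h \<omega>)) (r - h)"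
        using trajectory_then_after[OF h \<Xi> \<omega>, of "r - h" x q] r by simp
      moreover have "time_shift h \<omega> (r - h) = \<omega> r" using r by (simp add: time_shift_def)
      ultimately show "cost_rate x \<omega> (then_control h q \<Xi> \<omega>) r =
         cost_rate (x + h *\<^sub>R q) (time_shift h \<omega>) (\<Xi> (\<omega> h) (time_shift h \<omega>)) (r - h)"
        using r h by (simp add: cost_rate_def then_control_after)
    qed
  qed simp
  also have "\<dots> = accrued (x + h *\<^sub>R q) (time_shift h \<omega>) (\<Xi> (\<omega> h) (time_shift h \<omega>)) T"
    unfolding accrued_def by (rule set_integral_translate)
  finally show ?thesis .
qed

lemma controls_reaching_then:
  assumes h: "0 < h" and \<tau>: "\<And>j. bounded_stopping_time (\<tau> j)"
    and \<Xi>: "\<And>j. \<Xi> j \<in> controls_reaching \<Lambda> (\<tau> j) (y - torus_of (x + h *\<^sub>R q))"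
  shows "then_control h q \<Xi> \<in> controls_reaching \<Lambda> (then_time h \<tau>) (y - torus_of x)"
proof -
  have c: "\<And>j. is_control \<Lambda> (\<Xi> j)"
    and r: "\<And>j i. AE \<omega> in chain i. torus_path (\<Xi> j \<omega>) (\<tau> j \<omega>) = y - torus_of (x + h *\<^sub>R q)"
    using \<Xi> by (auto simp: controls_reaching_def almost_surely_iff)
  have h0: "0 \<le> h" using h by simp
  have "AE \<omega> in chain i. torus_path (then_control h q \<Xi> \<omega>) (then_time h \<tau> \<omega>) = y - torus_of x" for i
    using future_AE[OF h0, of "\<lambda>j \<omega>. torus_path (\<Xi> j \<omega>) (\<tau> j \<omega>) = y - torus_of (x + h *\<^sub>R q)" i, OF r] AE_space
  proof eventually_elim
    case (elim \<omega>)
    then have \<omega>: "\<omega> \<in> switching_paths" by simp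
    let ?\<theta> = "time_shift h \<omega>"
    have "?\<theta> \<in> switching_paths" by (rule time_shift_cadlag[OF \<omega> h0])
    then have T: "0 \<le> \<tau> (\<omega> h) ?\<theta>" using \<tau> by (simp add: bounded_stopping_time_def)
    have "torus_of x + torus_path (then_control h q \<Xi> \<omega>) (then_time h \<tau> \<omega>) =
       torus_of (x + h *\<^sub>R q) + torus_path (\<Xi> (\<omega> h) ?\<theta>) (\<tau> (\<omega> h) ?\<theta>)"
      unfolding trajectory_torus then_time_def trajectory_then_after[OF h c \<omega> T] ..
    also have "\<dots> = y" using elim(1) by simp
    finally show ?case by (simp add: algebra_simps)
  qed
  then show ?thesis
    using is_control_then_control[OF h c] by (simp add: controls_reaching_def almost_surely_iff)
qed

lemma expected_cost_then:
  assumes h: "0 < h" and \<tau>: "\<And>j. bounded_stopping_time (\<tau> j)" and \<Xi>: "\<And>j. is_control \<Lambda> (\<Xi> j)"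
  shows "integrable (chain i) (\<lambda>\<omega>. accrued x \<omega> (then_control h q \<Xi> \<omega>) h)"
    and "expected_cost H \<Lambda> \<alpha> b i (torus_of x) (then_time h \<tau>) (then_control h q \<Xi>) =
      (LINT \<omega>|chain i. accrued x \<omega> (then_control h q \<Xi> \<omega>) h) + \<alpha> * h +
      (\<Sum>j\<in>UNIV. transition \<Lambda> h i j * expected_cost H \<Lambda> \<alpha> b j (torus_of (x + h *\<^sub>R q)) (\<tau> j) (\<Xi> j))"
proof -
  have h0: "0 \<le> h" using h by simp
  have c: "is_control \<Lambda> (then_control h q \<Xi>)" by (rule is_control_then_control[OF h \<Xi>])
  have m: "then_control h q \<Xi> \<in> path_algebra \<rightarrow>\<^sub>M velocity_algebra" using c by (simp add: is_control_def)
  have st: "bounded_stopping_time (then_time h \<tau>)" by (rule bounded_stopping_time_then_time[OF h0 \<tau>])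
  show first: "integrable (chain i) (\<lambda>\<omega>. accrued x \<omega> (then_control h q \<Xi> \<omega>) h)"
  proof -
    have "bounded_stopping_time (\<lambda>_ :: real \<Rightarrow> 'm. h)"
      using h0 by (auto simp: bounded_stopping_time_def stopping_time_const)
    from cost_integrable[OF this c, of i x 0 0] show ?thesis by simp
  qed
  define \<Phi> where "\<Phi> j \<omega> = accrued (x + h *\<^sub>R q) \<omega> (\<Xi> j \<omega>) (\<tau> j \<omega>) + \<alpha> * \<tau> j \<omega> + b $ (\<omega> (\<tau> j \<omega>))" for j \<omega>
  have \<Phi>: "integrable (chain k) (\<Phi> j)" for k j
    unfolding \<Phi>_def[abs_def] by (rule cost_integrable[OF \<tau> \<Xi>])
  have split: "accrued x \<omega> (then_control h q \<Xi> \<omega>) (then_time h \<tau> \<omega>) + \<alpha> * then_time h \<tau> \<omega> + b $ (\<omega> (then_time h \<tau> \<omega>)) =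
     (accrued x \<omega> (then_control h q \<Xi> \<omega>) h + \<alpha> * h) + (\<Sum>j\<in>UNIV. indicator {\<omega> \<in> switching_paths. \<omega> h = j} \<omega> * \<Phi> j (time_shift h \<omega>))"
    if \<omega>: "\<omega> \<in> switching_paths" for \<omega>
  proof -
    let ?\<theta> = "time_shift h \<omega>" and ?j = "\<omega> h"
    have "?\<theta> \<in> switching_paths" by (rule time_shift_cadlag[OF \<omega> h0])
    then have T: "0 \<le> \<tau> ?j ?\<theta>" using \<tau> by (simp add: bounded_stopping_time_def)
    have "(\<Sum>j\<in>UNIV. indicator {\<omega> \<in> switching_paths. \<omega> h = j} \<omega> * \<Phi> j ?\<theta>) = (\<Sum>j\<in>UNIV. if j = ?j then \<Phi> j ?\<theta> else 0)"
      using \<omega> by (intro sum.cong) (auto simp: indicator_def)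
    also have "\<dots> = \<Phi> ?j ?\<theta>" by simp
    finally have "(\<Sum>j\<in>UNIV. indicator {\<omega> \<in> switching_paths. \<omega> h = j} \<omega> * \<Phi> j ?\<theta>) = \<Phi> ?j ?\<theta>" .
    moreover have "?\<theta> (\<tau> ?j ?\<theta>) = \<omega> (then_time h \<tau> \<omega>)"
      using T by (simp add: then_time_def time_shift_def[of h \<omega>] add.commute)
    ultimately show ?thesis
      using accrued_then[OF h \<Xi> \<omega> T, of x q] by (simp add: then_time_def \<Phi>_def algebra_simps)
  qed
  have i2: "integrable (chain i) (\<lambda>\<omega>. indicator {\<omega> \<in> switching_paths. \<omega> h = j} \<omega> * \<Phi> j (time_shift h \<omega>))" for j
    by (rule future_markov_integral(1)[OF h0 \<Phi>])
  have i1: "integrable (chain i) (\<lambda>\<omega>. accrued x \<omega> (then_control h q \<Xi> \<omega>) h + \<alpha> * h)"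
    using first by simp
  have "expected_cost H \<Lambda> \<alpha> b i (torus_of x) (then_time h \<tau>) (then_control h q \<Xi>) =
    (LINT \<omega>|chain i. (accrued x \<omega> (then_control h q \<Xi> \<omega>) h + \<alpha> * h) + (\<Sum>j\<in>UNIV. indicator {\<omega> \<in> switching_paths. \<omega> h = j} \<omega> * \<Phi> j (time_shift h \<omega>)))"
    unfolding expected_cost_eq[OF st c] by (rule Bochner_Integration.integral_cong) (auto simp: split)
  also have "\<dots> = (LINT \<omega>|chain i. accrued x \<omega> (then_control h q \<Xi> \<omega>) h + \<alpha> * h) +
     (LINT \<omega>|chain i. (\<Sum>j\<in>UNIV. indicator {\<omega> \<in> switching_paths. \<omega> h = j} \<omega> * \<Phi> j (time_shift h \<omega>)))"
    by (intro Bochner_Integration.integral_add i1 Bochner_Integration.integrable_sum i2)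
  also have "(LINT \<omega>|chain i. accrued x \<omega> (then_control h q \<Xi> \<omega>) h + \<alpha> * h) = (LINT \<omega>|chain i. accrued x \<omega> (then_control h q \<Xi> \<omega>) h) + \<alpha> * h"
    using first chain.prob_space[of i] by simp
  also have "(LINT \<omega>|chain i. (\<Sum>j\<in>UNIV. indicator {\<omega> \<in> switching_paths. \<omega> h = j} \<omega> * \<Phi> j (time_shift h \<omega>))) =
     (\<Sum>j\<in>UNIV. LINT \<omega>|chain i. indicator {\<omega> \<in> switching_paths. \<omega> h = j} \<omega> * \<Phi> j (time_shift h \<omega>))"
    by (intro Bochner_Integration.integral_sum i2)
  also have "\<dots> = (\<Sum>j\<in>UNIV. transition \<Lambda> h i j * expected_cost H \<Lambda> \<alpha> b j (torus_of (x + h *\<^sub>R q)) (\<tau> j) (\<Xi> j))"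
  proof -
    have "expected_cost H \<Lambda> \<alpha> b j (torus_of (x + h *\<^sub>R q)) (\<tau> j) (\<Xi> j) = (LINT \<omega>|chain j. \<Phi> j \<omega>)" for j
      unfolding expected_cost_eq[OF \<tau> \<Xi>] \<Phi>_def ..
    then show ?thesis by (simp only: future_markov_integral(2)[OF h0 \<Phi>])
  qed
  finally show "expected_cost H \<Lambda> \<alpha> b i (torus_of x) (then_time h \<tau>) (then_control h q \<Xi>) =
      (LINT \<omega>|chain i. accrued x \<omega> (then_control h q \<Xi> \<omega>) h) + \<alpha> * h +
      (\<Sum>j\<in>UNIV. transition \<Lambda> h i j * expected_cost H \<Lambda> \<alpha> b j (torus_of (x + h *\<^sub>R q)) (\<tau> j) (\<Xi> j))" .
qed

text \<open>As long as the state has not left \<open>i\<close> the running cost is at most \<open>c\<close>; the remaining time is the away time.\<close>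

lemma first_stage_bound:
  assumes h: "0 < h" and \<Xi>: "\<And>j. is_control \<Lambda> (\<Xi> j)"
    and int: "integrable (chain i) (\<lambda>\<omega>. accrued x \<omega> (then_control h q \<Xi> \<omega>) h)"
    and BL: "\<And>i X. \<bar>lagrangian H i X (- q)\<bar> \<le> BL"
    and near: "\<And>s. 0 \<le> s \<Longrightarrow> s \<le> h \<Longrightarrow> lagrangian H i (torus_of (x + s *\<^sub>R q)) (- q) \<le> c"
  shows "(LINT \<omega>|chain i. accrued x \<omega> (then_control h q \<Xi> \<omega>) h) \<le> c * h + 2 * BL * (intensity * h\<^sup>2)"
proof -
  have h0: "0 \<le> h" using h by simp
  have m: "then_control h q \<Xi> \<in> path_algebra \<rightarrow>\<^sub>M velocity_algebra"
    using is_control_then_control[OF h \<Xi>, where q = q] by (simp add: is_control_def)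
  have point: "accrued x \<omega> (then_control h q \<Xi> \<omega>) h \<le> c * h + 2 * BL * away_time 0 h \<omega>"
    if \<omega>: "\<omega> \<in> switching_paths" and start: "\<omega> 0 = i" for \<omega>
  proof -
    have ai: "set_integrable lborel {0..h} (\<lambda>s. of_bool (\<omega> s \<noteq> \<omega> 0) :: real)"
      using away_set_integrable[OF order_refl \<omega>, of h] by simp
    have "accrued x \<omega> (then_control h q \<Xi> \<omega>) h \<le> (LBINT s:{0..h}. c + 2 * BL * of_bool (\<omega> s \<noteq> \<omega> 0))"
      unfolding accrued_def
    proof (rule set_integral_mono_AE)
      show "set_integrable lborel {0..h} (cost_rate x \<omega> (then_control h q \<Xi> \<omega>))"
        by (rule path_set_integrable(3)[OF m \<omega>]) simp
      show "set_integrable lborel {0..h} (\<lambda>s. c + 2 * BL * of_bool (\<omega> s \<noteq> \<omega> 0))"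
        by (intro set_integral_add(1) set_integrable_const_Icc set_integrable_mult_right ai)
      show "AE s\<in>{0..h} in lborel. cost_rate x \<omega> (then_control h q \<Xi> \<omega>) s \<le> c + 2 * BL * of_bool (\<omega> s \<noteq> \<omega> 0)"
        using AE_lborel_singleton[of h]
      proof (eventually_elim, intro impI)
        fix s assume "s \<noteq> h" and s: "s \<in> {0..h}"
        then have sh: "s < h" by simp
        have "then_control h q \<Xi> \<omega> s = q" using s sh by (simp add: then_control_def spliced_def constant_path_def)
        then have cr: "cost_rate x \<omega> (then_control h q \<Xi> \<omega>) s = lagrangian H (\<omega> s) (torus_of (x + s *\<^sub>R q)) (- q)"
          using s by (simp add: cost_rate_def trajectory_then_before)
        show "cost_rate x \<omega> (then_control h q \<Xi> \<omega>) s \<le> c + 2 * BL * of_bool (\<omega> s \<noteq> \<omega> 0)"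
        proof (cases "\<omega> s = \<omega> 0")
          case True then show ?thesis using near[of s] s start by (simp add: cr)
        next
          case False
          then show ?thesis
            using near[of s] s BL[of i "torus_of (x + s *\<^sub>R q)"] BL[of "\<omega> s" "torus_of (x + s *\<^sub>R q)"]
            by (simp add: cr abs_le_iff)
        qed
      qed
    qed
    also have "\<dots> = (LBINT s:{0..h}. c) + (LBINT s:{0..h}. 2 * BL * of_bool (\<omega> s \<noteq> \<omega> 0))"
      by (intro set_integral_add(2) set_integrable_const_Icc set_integrable_mult_right ai)
    also have "\<dots> = c * h + 2 * BL * away_time 0 h \<omega>"
      using h0 by (simp add: set_integral_const_Icc away_time_def mult.commute)
    finally show ?thesis .
  qed
  have W: "integrable (chain i) (away_time 0 h)" "(LINT \<omega>|chain i. away_time 0 h \<omega>) \<le> intensity * h\<^sup>2"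
    using expected_away_time[OF order_refl h0, of i] by auto
  have BL0: "0 \<le> BL" using BL[of undefined undefined] by linarith
  have "(LINT \<omega>|chain i. accrued x \<omega> (then_control h q \<Xi> \<omega>) h) \<le> (LINT \<omega>|chain i. c * h + 2 * BL * away_time 0 h \<omega>)"
  proof (rule integral_mono_AE[OF int])
    show "integrable (chain i) (\<lambda>\<omega>. c * h + 2 * BL * away_time 0 h \<omega>)" using W(1) by simp
    show "AE \<omega> in chain i. accrued x \<omega> (then_control h q \<Xi> \<omega>) h \<le> c * h + 2 * BL * away_time 0 h \<omega>"
      using AE_initial_state[of i] AE_space by eventually_elim (use point in auto)
  qed
  also have "\<dots> = c * h + 2 * BL * (LINT \<omega>|chain i. away_time 0 h \<omega>)"
    using W(1) chain.prob_space[of i] by simp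
  also have "\<dots> \<le> c * h + 2 * BL * (intensity * h\<^sup>2)"
    using W(2) BL0 by (intro add_left_mono mult_left_mono) auto
  finally show ?thesis .
qed

lemma is_control_rest: "is_control \<Lambda> (\<lambda>_. constant_path (0 :: real ^ 'n))"
  unfolding is_control_def
proof (intro conjI allI impI ballI)
  show "(\<lambda>_. constant_path (0 :: real ^ 'n)) \<in> path_algebra \<rightarrow>\<^sub>M velocity_algebra"
    by (rule measurable_velocity_algebraI) (auto intro: constant_path_cadlag)
  fix t :: real assume t: "0 < t"
  have "(SUP s\<in>{0..t}. norm (constant_path (0 :: real ^ 'n) s)) \<le> 0"
    using t by (intro cSUP_least) (auto simp: constant_path_def)
  then show "\<exists>R>0. almost_surely \<Lambda> (\<lambda>\<omega>. (SUP s\<in>{0..t}. norm (constant_path (0 :: real ^ 'n) s)) < R)"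
    by (intro exI[of _ 1]) (auto simp: almost_surely_iff)
qed simp

lemma stay_put:
  "bounded_stopping_time (\<lambda>_ :: real \<Rightarrow> 'm. 0)"
  "(\<lambda>_. constant_path (0 :: real ^ 'n)) \<in> controls_reaching \<Lambda> (\<lambda>_. 0) (y - y)"
  "expected_cost H \<Lambda> \<alpha> b i (torus_of x) (\<lambda>_. 0) (\<lambda>_. constant_path 0) = b $ i"
proof -
  show st: "bounded_stopping_time (\<lambda>_ :: real \<Rightarrow> 'm. 0)"
    by (auto simp: bounded_stopping_time_def stopping_time_const)
  have "torus_path \<xi> 0 = (0 :: 'n torus)" for \<xi>
    unfolding torus_path_def set_integral_Icc_point by (rule torus_of_0)
  then show "(\<lambda>_. constant_path (0 :: real ^ 'n)) \<in> controls_reaching \<Lambda> (\<lambda>_. 0) (y - y)"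
    using is_control_rest by (simp add: controls_reaching_def almost_surely_iff)
  have "expected_cost H \<Lambda> \<alpha> b i (torus_of x) (\<lambda>_. 0) (\<lambda>_. constant_path 0) = (LINT \<omega>|chain i. b $ (\<omega> 0))"
    unfolding expected_cost_eq[OF st is_control_rest]
    by (simp add: accrued_def set_integral_Icc_point[of 0, simplified])
  also have "\<dots> = (LINT \<omega>|chain i. b $ i)"
    by (rule integral_cong_AE)
       (use AE_initial_state[of i] measurable_terminal[of "\<lambda>_. 0" b] in \<open>auto elim!: eventually_mono\<close>)
  also have "\<dots> = b $ i" using chain.prob_space[of i] by simp
  finally show "expected_cost H \<Lambda> \<alpha> b i (torus_of x) (\<lambda>_. 0) (\<lambda>_. constant_path 0) = b $ i" .
qed

end

section \<open>The value function\<close>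

locale value_problem = hamiltonian_system \<Lambda> H
  for \<Lambda> :: "real ^ 'm ^ 'm::finite" and H :: "'m \<Rightarrow> 'n::finite torus \<Rightarrow> real ^ 'n \<Rightarrow> real" +
  fixes \<alpha> :: real and y :: "'n torus" and b :: "real ^ 'm"
  assumes b_admissible: "b \<in> admissible_values H \<Lambda> \<alpha> y"
begin

definition costs :: "'m \<Rightarrow> 'n torus \<Rightarrow> real set" where
  "costs i X = {expected_cost H \<Lambda> \<alpha> b i X \<tau> \<Xi> | \<tau> \<Xi>.
     bounded_stopping_time \<tau> \<and> \<Xi> \<in> controls_reaching \<Lambda> \<tau> (y - X)}"

abbreviation V :: "'n torus \<Rightarrow> real ^ 'm" where
  "V \<equiv> value_function H \<Lambda> \<alpha> y b"

lemma V_component: "V X $ i = Inf (costs i X)"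
  by (simp add: value_function_def costs_def)

lemma subsolution_lower_bound:
  assumes "subsolution H \<Lambda> \<alpha> w" "w y = b" "c \<in> costs i X"
  shows "w X $ i \<le> c"
  using subsolution_le_expected_cost[OF assms(1,2), where x = "rep_torus X"] assms(3)
  by (auto simp: costs_def torus_of_rep)

lemma obtain_subsolution:
  obtains w where "subsolution H \<Lambda> \<alpha> w" "w y = b"
  using b_admissible by (auto simp: admissible_values_def)

lemma bdd_below_costs: "bdd_below (costs i X)"
  using obtain_subsolution subsolution_lower_bound by (metis bdd_belowI)

lemma costs_then:
  assumes h: "0 < h" and c: "\<And>j. c j \<in> costs j (torus_of (x + h *\<^sub>R q))"
    and BL: "\<And>i X. \<bar>lagrangian H i X (- q)\<bar> \<le> BL"
    and near: "\<And>s. 0 \<le> s \<Longrightarrow> s \<le> h \<Longrightarrow> lagrangian H i (torus_of (x + s *\<^sub>R q)) (- q) \<le> l"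
  shows "\<exists>c'\<in>costs i (torus_of x). c' \<le> (l + \<alpha>) * h + 2 * BL * intensity * h\<^sup>2 + (\<Sum>j\<in>UNIV. transition \<Lambda> h i j * c j)"
proof -
  have "\<forall>j. \<exists>p. c j = expected_cost H \<Lambda> \<alpha> b j (torus_of (x + h *\<^sub>R q)) (fst p) (snd p) \<and>
      bounded_stopping_time (fst p) \<and> snd p \<in> controls_reaching \<Lambda> (fst p) (y - torus_of (x + h *\<^sub>R q))"
    using c by (fastforce simp: costs_def)
  from choice[OF this] obtain p where p:
    "\<And>j. c j = expected_cost H \<Lambda> \<alpha> b j (torus_of (x + h *\<^sub>R q)) (fst (p j)) (snd (p j))"
    "\<And>j. bounded_stopping_time (fst (p j))" "\<And>j. snd (p j) \<in> controls_reaching \<Lambda> (fst (p j)) (y - torus_of (x + h *\<^sub>R q))"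
    by blast
  have ctl: "\<And>j. is_control \<Lambda> (snd (p j))" using p(3) by (simp add: controls_reaching_def)
  let ?\<tau> = "then_time h (\<lambda>j. fst (p j))" and ?\<Xi> = "then_control h q (\<lambda>j. snd (p j))"
  have "expected_cost H \<Lambda> \<alpha> b i (torus_of x) ?\<tau> ?\<Xi> \<in> costs i (torus_of x)"
    unfolding costs_def
    using bounded_stopping_time_then_time[where \<tau> = "\<lambda>j. fst (p j)", OF less_imp_le[OF h] p(2)]
      controls_reaching_then[where \<tau> = "\<lambda>j. fst (p j)" and \<Xi> = "\<lambda>j. snd (p j)", OF h p(2,3)]
    by blast
  moreover have "expected_cost H \<Lambda> \<alpha> b i (torus_of x) ?\<tau> ?\<Xi>
      \<le> (l + \<alpha>) * h + 2 * BL * intensity * h\<^sup>2 + (\<Sum>j\<in>UNIV. transition \<Lambda> h i j * c j)"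
    using first_stage_bound[where \<Xi> = "\<lambda>j. snd (p j)", OF h ctl
        expected_cost_then(1)[where \<tau> = "\<lambda>j. fst (p j)" and \<Xi> = "\<lambda>j. snd (p j)", OF h p(2) ctl] BL near]
    unfolding expected_cost_then(2)[where \<tau> = "\<lambda>j. fst (p j)" and \<Xi> = "\<lambda>j. snd (p j)", OF h p(2) ctl] p(1)[symmetric]
    by (simp add: algebra_simps)
  ultimately show ?thesis by blast
qed

lemma boundary_cost: "b $ i \<in> costs i y"
  unfolding costs_def
  using stay_put(1) stay_put(2)[of y] stay_put(3)[of \<alpha> b i "rep_torus y"]
  by (auto simp: torus_of_rep intro!: exI[of _ "\<lambda>_. 0"] exI[of _ "\<lambda>_. constant_path 0"])

text \<open>From every point the target is reached in unit time along a segment between representatives in a fixed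
  ball, so the speed is bounded uniformly.\<close>

lemma V_bounded_above:
  obtains B where "\<And>X i. costs i X \<noteq> {} \<and> V X $ i \<le> B"
proof -
  let ?N = "real CARD('n)"
  obtain BL where BL: "\<And>i X q. norm q \<le> 2 * ?N \<Longrightarrow> \<bar>lagrangian H i X q\<bar> \<le> BL"
    by (rule lagrangian_bounded[of "2 * ?N"]) blast
  obtain ky where ky: "rep_torus y - ky \<in> cball 0 ?N" "\<And>x. torus_of (x - ky) = torus_of x"
    using torus_representative[of "rep_torus y"] by metis
  show ?thesis
  proof (rule that[of "(BL + \<alpha>) * 1 + 2 * BL * intensity * 1\<^sup>2 + norm b"])
    fix X :: "'n torus" and i
    obtain k where k: "rep_torus X - k \<in> cball 0 ?N" "\<And>x. torus_of (x - k) = torus_of x"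
      using torus_representative[of "rep_torus X"] by metis
    define x where "x = rep_torus X - k"
    define q where "q = (rep_torus y - ky) - x"
    have q: "norm (- q) \<le> 2 * ?N"
      using norm_triangle_ineq4[of "rep_torus y - ky" x] ky(1) k(1) by (simp add: q_def x_def norm_minus_commute)
    have X: "torus_of x = X" by (simp add: x_def k(2) torus_of_rep)
    have yq: "torus_of (x + 1 *\<^sub>R q) = y" by (simp add: q_def ky(2) torus_of_rep)
    obtain c where c: "c \<in> costs i (torus_of x)"
       "c \<le> (BL + \<alpha>) * 1 + 2 * BL * intensity * 1\<^sup>2 + (\<Sum>j\<in>UNIV. transition \<Lambda> 1 i j * b $ j)"
      using costs_then[of 1 "\<lambda>j. b $ j" x q BL i BL] boundary_cost yq BL[OF q] by (auto simp: abs_le_iff)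
    have "(\<Sum>j\<in>UNIV. transition \<Lambda> 1 i j * b $ j) \<le> (\<Sum>j\<in>UNIV. transition \<Lambda> 1 i j * norm b)"
      using component_le_norm_cart[of b] transition_nonneg[of 1]
      by (intro sum_mono mult_left_mono) (auto intro: order_trans[OF abs_ge_self])
    also have "\<dots> = norm b" by (simp add: sum_distrib_right[symmetric] transition_sum)
    finally have "c \<le> (BL + \<alpha>) * 1 + 2 * BL * intensity * 1\<^sup>2 + norm b" using c(2) by linarith
    moreover have "V X $ i \<le> c"
      unfolding V_component using c(1) X by (intro cInf_lower bdd_below_costs) auto
    ultimately show "costs i X \<noteq> {} \<and> V X $ i \<le> (BL + \<alpha>) * 1 + 2 * BL * intensity * 1\<^sup>2 + norm b"
      using c(1) X by auto
  qed
qed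

lemma costs_nonempty: "costs i X \<noteq> {}"
  by (rule V_bounded_above) blast

lemma V_ge_subsolution:
  assumes "subsolution H \<Lambda> \<alpha> w" "w y = b"
  shows "w X $ i \<le> V X $ i"
  unfolding V_component using subsolution_lower_bound[OF assms] by (intro cInf_greatest costs_nonempty)

lemma V_bounded:
  obtains B where "0 \<le> B" "\<And>X i. \<bar>V X $ i\<bar> \<le> B"
proof -
  obtain B where B: "\<And>X i. costs i X \<noteq> {} \<and> V X $ i \<le> B" by (rule V_bounded_above) blast
  obtain w where w: "subsolution H \<Lambda> \<alpha> w" "w y = b" by (rule obtain_subsolution)
  have "continuous_on UNIV w" using w by (simp add: subsolution_def)
  then obtain Bw where Bw: "0 \<le> Bw" "\<And>X i. \<bar>w X $ i\<bar> \<le> Bw" by (rule continuous_torus_bounded) blast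
  have "\<bar>V X $ i\<bar> \<le> \<bar>B\<bar> + Bw" for X i
    using B[of i X] Bw(2)[of X i] V_ge_subsolution[OF w, of X i] Bw(1) by linarith
  with Bw(1) show ?thesis by (intro that[of "\<bar>B\<bar> + Bw"]) auto
qed

lemma V_at_target: "V y = b"
proof -
  obtain w where w: "subsolution H \<Lambda> \<alpha> w" "w y = b" by (rule obtain_subsolution)
  have "V y $ i = b $ i" for i
  proof (rule antisym)
    show "V y $ i \<le> b $ i" unfolding V_component by (rule cInf_lower[OF boundary_cost bdd_below_costs])
    show "b $ i \<le> V y $ i" using V_ge_subsolution[OF w, of y i] w(2) by simp
  qed
  then show ?thesis by (simp add: vec_eq_iff)
qed

lemma dynamic_programming:
  assumes h: "0 < h"
    and BL: "\<And>i X. \<bar>lagrangian H i X (- q)\<bar> \<le> BL"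
    and near: "\<And>s. 0 \<le> s \<Longrightarrow> s \<le> h \<Longrightarrow> lagrangian H i (torus_of (x + s *\<^sub>R q)) (- q) \<le> l"
  shows "V (torus_of x) $ i \<le> (l + \<alpha>) * h + 2 * BL * intensity * h\<^sup>2 +
    (\<Sum>j\<in>UNIV. transition \<Lambda> h i j * V (torus_of (x + h *\<^sub>R q)) $ j)"
proof (rule field_le_epsilon)
  fix e :: real assume e: "0 < e"
  let ?z = "torus_of (x + h *\<^sub>R q)"
  have "\<exists>c\<in>costs j ?z. c < V ?z $ j + e" for j
    unfolding V_component using cInf_lessD[OF costs_nonempty, of j ?z "Inf (costs j ?z) + e"] e by auto
  then obtain c where c: "\<And>j. c j \<in> costs j ?z" "\<And>j. c j < V ?z $ j + e" by metis
  obtain c' where c': "c' \<in> costs i (torus_of x)"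
    "c' \<le> (l + \<alpha>) * h + 2 * BL * intensity * h\<^sup>2 + (\<Sum>j\<in>UNIV. transition \<Lambda> h i j * c j)"
    using costs_then[OF h c(1) BL near] by blast
  have "(\<Sum>j\<in>UNIV. transition \<Lambda> h i j * c j) \<le> (\<Sum>j\<in>UNIV. transition \<Lambda> h i j * (V ?z $ j + e))"
    using c(2) h by (intro sum_mono mult_left_mono transition_nonneg) (auto intro: less_imp_le)
  also have "\<dots> = (\<Sum>j\<in>UNIV. transition \<Lambda> h i j * V ?z $ j) + e"
    using h by (simp add: distrib_left sum.distrib sum_distrib_right[symmetric] transition_sum)
  finally have "c' \<le> (l + \<alpha>) * h + 2 * BL * intensity * h\<^sup>2 + (\<Sum>j\<in>UNIV. transition \<Lambda> h i j * V ?z $ j) + e"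
    using c'(2) by linarith
  moreover have "V (torus_of x) $ i \<le> c'"
    unfolding V_component by (rule cInf_lower[OF c'(1) bdd_below_costs])
  ultimately show "V (torus_of x) $ i \<le> (l + \<alpha>) * h + 2 * BL * intensity * h\<^sup>2 +
    (\<Sum>j\<in>UNIV. transition \<Lambda> h i j * V ?z $ j) + e" by linarith
qed

lemma transition_average_first_order:
  assumes h: "0 \<le> h" and B: "\<And>j. \<bar>g j\<bar> \<le> B"
  shows "(\<Sum>j\<in>UNIV. transition \<Lambda> h i j * g j) \<le> g i + real CARD('m) * intensity * B * h"
proof -
  have "(\<Sum>j\<in>UNIV. transition \<Lambda> h i j * g j) = g i + (\<Sum>j\<in>UNIV. (transition \<Lambda> h i j - (if i = j then 1 else 0)) * g j)"
    by (simp add: left_diff_distrib sum_subtractf if_distrib[of "\<lambda>x. x * _"] cong: if_cong)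
  also have "(\<Sum>j\<in>UNIV. (transition \<Lambda> h i j - (if i = j then 1 else 0)) * g j) \<le> (\<Sum>j\<in>(UNIV :: 'm set). (intensity * h) * B)"
  proof (rule sum_mono)
    fix j
    have "(transition \<Lambda> h i j - (if i = j then 1 else 0)) * g j \<le> \<bar>transition \<Lambda> h i j - (if i = j then 1 else 0)\<bar> * \<bar>g j\<bar>"
      unfolding abs_mult[symmetric] by (rule abs_ge_self)
    also have "\<dots> \<le> (intensity * h) * B"
      using h intensity_nonneg by (intro mult_mono transition_first_order B) auto
    finally show "(transition \<Lambda> h i j - (if i = j then 1 else 0)) * g j \<le> (intensity * h) * B" .
  qed
  finally show ?thesis by (simp add: mult_ac)
qed

lemma transition_average_second_order:
  assumes h: "0 \<le> h" and B: "\<And>j. \<bar>g $ j\<bar> \<le> B"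
  shows "(\<Sum>j\<in>UNIV. transition \<Lambda> h i j * g $ j) \<le> g $ i - h * (\<Lambda> $ i \<bullet> g) + real CARD('m) * intensity\<^sup>2 * B * h\<^sup>2"
proof -
  have "(\<Sum>j\<in>UNIV. transition \<Lambda> h i j * g $ j) = (\<Sum>j\<in>UNIV. (if i = j then 1 else 0) * g $ j) - (\<Sum>j\<in>UNIV. h * \<Lambda> $ i $ j * g $ j)
      + (\<Sum>j\<in>UNIV. (transition \<Lambda> h i j - (if i = j then 1 else 0) + h * \<Lambda> $ i $ j) * g $ j)"
    unfolding sum_subtractf[symmetric] sum.distrib[symmetric] by (intro sum.cong refl) (simp add: algebra_simps)
  also have "(\<Sum>j\<in>UNIV. (if i = j then 1 else 0) * g $ j) = g $ i"
    by (simp add: if_distrib[of "\<lambda>x. x * _"] cong: if_cong)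
  also have "(\<Sum>j\<in>UNIV. h * \<Lambda> $ i $ j * g $ j) = h * (\<Lambda> $ i \<bullet> g)"
    by (simp add: row_inner sum_distrib_left mult.assoc)
  also have "(\<Sum>j\<in>UNIV. (transition \<Lambda> h i j - (if i = j then 1 else 0) + h * \<Lambda> $ i $ j) * g $ j) \<le> (\<Sum>j\<in>(UNIV :: 'm set). (intensity\<^sup>2 * h\<^sup>2) * B)"
  proof (rule sum_mono)
    fix j
    have "(transition \<Lambda> h i j - (if i = j then 1 else 0) + h * \<Lambda> $ i $ j) * g $ j \<le> \<bar>transition \<Lambda> h i j - (if i = j then 1 else 0) + h * \<Lambda> $ i $ j\<bar> * \<bar>g $ j\<bar>"
      unfolding abs_mult[symmetric] by (rule abs_ge_self)
    also have "\<dots> \<le> (intensity\<^sup>2 * h\<^sup>2) * B"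
      by (intro mult_mono transition_second_order h B) auto
    finally show "(transition \<Lambda> h i j - (if i = j then 1 else 0) + h * \<Lambda> $ i $ j) * g $ j \<le> (intensity\<^sup>2 * h\<^sup>2) * B" .
  qed
  finally show ?thesis by (simp add: mult_ac)
qed

text \<open>Travelling at unit speed from \<open>x\<close> to \<open>z\<close> costs a multiple of the distance, and the state
  changes on the way with a probability of the same order.\<close>

lemma V_lipschitz:
  obtains C where "0 \<le> C" "\<And>x z i. norm (z - x) \<le> 1 \<Longrightarrow> \<bar>V (torus_of z) $ i - V (torus_of x) $ i\<bar> \<le> C * norm (z - x)"
proof -
  obtain BL where BL: "\<And>i X q. norm q \<le> 1 \<Longrightarrow> \<bar>lagrangian H i X q\<bar> \<le> BL" by (rule lagrangian_bounded[of 1]) blast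
  have BL0: "0 \<le> BL" using BL[of 0 undefined undefined] by simp
  obtain B where B: "0 \<le> B" "\<And>X i. \<bar>V X $ i\<bar> \<le> B" by (rule V_bounded) blast
  define C where "C = BL + \<bar>\<alpha>\<bar> + 2 * BL * intensity + real CARD('m) * intensity * B"
  have C: "0 \<le> C" using BL0 B intensity_nonneg by (simp add: C_def)
  have half: "V (torus_of x) $ i - V (torus_of z) $ i \<le> C * norm (z - x)" if z: "norm (z - x) \<le> 1" for x z i
  proof (cases "z = x")
    case False
    define h where "h = norm (z - x)"
    define q where "q = (z - x) /\<^sub>R h"
    have h: "0 < h" "h \<le> 1" using False z by (auto simp: h_def)
    have q: "norm (- q) \<le> 1" using h by (simp add: q_def h_def)
    have xz: "x + h *\<^sub>R q = z" using h by (simp add: q_def)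
    have "V (torus_of x) $ i \<le> (BL + \<alpha>) * h + 2 * BL * intensity * h\<^sup>2 + (\<Sum>j\<in>UNIV. transition \<Lambda> h i j * V (torus_of z) $ j)"
      unfolding xz[symmetric] by (rule dynamic_programming[OF h(1)]) (use BL[OF q] in \<open>auto simp: abs_le_iff\<close>)
    moreover have "(\<Sum>j\<in>UNIV. transition \<Lambda> h i j * V (torus_of z) $ j) \<le> V (torus_of z) $ i + real CARD('m) * intensity * B * h"
      by (rule transition_average_first_order) (use h B in auto)
    moreover have "2 * BL * intensity * h\<^sup>2 \<le> 2 * BL * intensity * h"
      using h BL0 intensity_nonneg by (intro mult_left_mono) (auto simp: power2_eq_square)
    moreover have "\<alpha> * h \<le> \<bar>\<alpha>\<bar> * h" using h by (intro mult_right_mono) auto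
    ultimately show ?thesis unfolding C_def h_def[symmetric] by (simp add: algebra_simps)
  qed simp
  show ?thesis
  proof (rule that[OF C])
    fix x z :: "real ^ 'n" and i assume "norm (z - x) \<le> 1"
    then show "\<bar>V (torus_of z) $ i - V (torus_of x) $ i\<bar> \<le> C * norm (z - x)"
      using half[of z x i] half[of x z i] by (simp add: norm_minus_commute abs_le_iff)
  qed
qed

lemma V_continuous: "continuous_on UNIV V"
proof (rule continuous_on_torusI)
  obtain C where C: "0 \<le> C" "\<And>x z i. norm (z - x) \<le> 1 \<Longrightarrow> \<bar>V (torus_of z) $ i - V (torus_of x) $ i\<bar> \<le> C * norm (z - x)"
    by (rule V_lipschitz) blast
  have "continuous_on UNIV (\<lambda>z. V (torus_of z) $ i)" for i
    by (rule continuous_on_if_locally_lipschitz[OF C])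
  then have "continuous_on UNIV (\<lambda>z. \<chi> i. V (torus_of z) $ i)" by (intro continuous_on_vec_lambda)
  then show "continuous_on UNIV (\<lambda>z. V (torus_of z))" by simp
qed

text \<open>At the maximum, \<open>dynamic_programming\<close> bounds \<open>v\<^sub>i\<close> from above by its own value plus the increment of \<open>\<psi>\<close>
  along \<open>x + h q\<close> and terms of order \<open>h\<close>; dividing by \<open>h\<close> gives the inequality for the velocity \<open>q = - q'\<close>, and
  conjugation turns the family of these inequalities into the one for \<open>H\<close>.\<close>

lemma V_viscosity:
  assumes grad: "torus_C1_gradient \<psi> G" and max: "\<And>Z. V Z $ i - \<psi> Z \<le> V X $ i - \<psi> X"
  shows "H i X (G X) + \<Lambda> $ i \<bullet> V X \<le> \<alpha>"
proof -
  define x where "x = rep_torus X"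
  have X: "torus_of x = X" by (simp add: x_def torus_of_rep)
  define g where "g = (\<lambda>z. \<psi> (torus_of z))"
  have g: "(g has_derivative (\<lambda>v. v \<bullet> G X)) (at x)"
    using grad X unfolding torus_C1_gradient_def gderiv_def g_def by metis
  obtain C where C: "0 \<le> C" "\<And>x z i. norm (z - x) \<le> 1 \<Longrightarrow> \<bar>V (torus_of z) $ i - V (torus_of x) $ i\<bar> \<le> C * norm (z - x)"
    by (rule V_lipschitz) blast
  obtain B where B: "0 \<le> B" "\<And>X i. \<bar>V X $ i\<bar> \<le> B" by (rule V_bounded) blast
  have "G X \<bullet> q' - lagrangian H i X q' \<le> \<alpha> - \<Lambda> $ i \<bullet> V X" for q'
  proof (rule field_le_epsilon)
    fix e :: real assume e: "0 < e"
    define q where "q = - q'"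
    obtain BL where BL: "\<And>i X q. norm q \<le> norm q' \<Longrightarrow> \<bar>lagrangian H i X q\<bar> \<le> BL" by (rule lagrangian_bounded[of "norm q'"]) blast
    then have BLq: "\<And>i X. \<bar>lagrangian H i X (- q)\<bar> \<le> BL" by (simp add: q_def)
    obtain d where d: "0 < d" "\<And>i z z' p p'. norm p \<le> norm q' \<Longrightarrow> norm p' \<le> norm q' \<Longrightarrow> norm (z - z') < d \<Longrightarrow>
       norm (p - p') < d \<Longrightarrow> \<bar>lagrangian H i (torus_of z) p - lagrangian H i (torus_of z') p'\<bar> \<le> e"
      by (rule lagrangian_uniformly_continuous[OF e, of "norm q'"]) blast
    define K where "K = 2 * BL * intensity + real CARD('m) * intensity\<^sup>2 * B + intensity * C * norm q"
    define \<mu> where "\<mu> = lagrangian H i X (- q) + e + \<alpha> - \<Lambda> $ i \<bullet> V X"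
    have ineq: "0 \<le> \<mu> + (g (x + h *\<^sub>R q) - g x) / h + K * h" if h: "0 < h" "h * norm q < min d 1" for h
    proof -
      let ?z = "torus_of (x + h *\<^sub>R q)"
      have nz: "norm ((x + h *\<^sub>R q) - x) = h * norm q" using h by simp
      have 1: "V X $ i \<le> (lagrangian H i X (- q) + e + \<alpha>) * h + 2 * BL * intensity * h\<^sup>2 + (\<Sum>j\<in>UNIV. transition \<Lambda> h i j * V ?z $ j)"
        unfolding X[symmetric]
      proof (rule dynamic_programming[OF h(1) BLq])
        fix s assume s: "0 \<le> s" "s \<le> h"
        have "norm ((x + s *\<^sub>R q) - x) \<le> h * norm q" using s by (simp add: mult_right_mono)
        also have "\<dots> < d" using h(2) by simp
        finally have "\<bar>lagrangian H i (torus_of (x + s *\<^sub>R q)) (- q) - lagrangian H i (torus_of x) (- q)\<bar> \<le> e"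
          using d(1) by (intro d(2)) (auto simp: q_def)
        then show "lagrangian H i (torus_of (x + s *\<^sub>R q)) (- q) \<le> lagrangian H i (torus_of x) (- q) + e"
          by (simp add: abs_le_iff)
      qed
      have 2: "(\<Sum>j\<in>UNIV. transition \<Lambda> h i j * V ?z $ j) \<le> V ?z $ i - h * (\<Lambda> $ i \<bullet> V ?z) + real CARD('m) * intensity\<^sup>2 * B * h\<^sup>2"
        using h B by (intro transition_average_second_order) auto
      have 3: "V ?z $ i \<le> V X $ i + (g (x + h *\<^sub>R q) - g x)"
        using max[of ?z] by (simp add: g_def X)
      have "\<bar>V ?z $ j - V X $ j\<bar> \<le> C * (h * norm q)" for j
      proof -
        have "norm ((x + h *\<^sub>R q) - x) \<le> 1" unfolding nz using h(2) by simp
        from C(2)[OF this, of j] show ?thesis unfolding nz X .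
      qed
      then have "\<bar>\<Lambda> $ i \<bullet> V ?z - \<Lambda> $ i \<bullet> V X\<bar> \<le> intensity * (C * (h * norm q))" by (rule row_inner_diff_le)
      then have "\<Lambda> $ i \<bullet> V X - \<Lambda> $ i \<bullet> V ?z \<le> intensity * (C * (h * norm q))" by (simp add: abs_le_iff)
      then have 4: "h * (\<Lambda> $ i \<bullet> V X - \<Lambda> $ i \<bullet> V ?z) \<le> h * (intensity * (C * (h * norm q)))"
        using h(1) by (intro mult_left_mono) auto
      have "0 \<le> \<mu> * h + (g (x + h *\<^sub>R q) - g x) + K * h\<^sup>2"
        using 1 2 3 4 unfolding \<mu>_def K_def by (simp add: algebra_simps power2_eq_square)
      then have "0 \<le> (\<mu> * h + (g (x + h *\<^sub>R q) - g x) + K * h\<^sup>2) / h" using h(1) by simp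
      also have "\<dots> = \<mu> + (g (x + h *\<^sub>R q) - g x) / h + K * h"
        using h(1) by (simp add: add_divide_distrib power2_eq_square)
      finally show ?thesis .
    qed
    have "((\<lambda>h. g (x + h *\<^sub>R q)) has_real_derivative (q \<bullet> G X)) (at 0)"
    proof -
      have "((\<lambda>h. x + h *\<^sub>R q) has_derivative (\<lambda>h. h *\<^sub>R q)) (at (0::real))"
        by (auto intro!: derivative_eq_intros)
      moreover have "(g has_derivative (\<lambda>v. v \<bullet> G X)) (at (x + 0 *\<^sub>R q))" using g by simp
      ultimately have "((\<lambda>h. g (x + h *\<^sub>R q)) has_derivative (\<lambda>h. (h *\<^sub>R q) \<bullet> G X)) (at 0)"
        by (rule has_derivative_compose)
      then show ?thesis
        by (rule has_derivative_imp_has_field_derivative) simp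
    qed
    then have "((\<lambda>h. (g (x + h *\<^sub>R q) - g x) / h) \<longlongrightarrow> q \<bullet> G X) (at 0)"
      by (simp add: has_field_derivative_iff)
    then have "((\<lambda>h. (g (x + h *\<^sub>R q) - g x) / h) \<longlongrightarrow> q \<bullet> G X) (at_right 0)"
      by (rule filterlim_mono) (auto simp: at_le)
    then have "((\<lambda>h. \<mu> + (g (x + h *\<^sub>R q) - g x) / h + K * h) \<longlongrightarrow> \<mu> + q \<bullet> G X + K * 0) (at_right 0)"
      by (intro tendsto_intros)
    moreover have "\<forall>\<^sub>F h in at_right 0. 0 \<le> \<mu> + (g (x + h *\<^sub>R q) - g x) / h + K * h"
      unfolding eventually_at_right_field
    proof (intro exI[of _ "min d 1 / (norm q + 1)"] conjI allI impI)
      show "0 < min d 1 / (norm q + 1)" using d(1) by (intro divide_pos_pos add_nonneg_pos) auto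
      fix h :: real assume h: "0 < h" "h < min d 1 / (norm q + 1)"
      have n: "0 < norm q + 1" using norm_ge_zero[of q] by linarith
      have "h * norm q \<le> h * (norm q + 1)" using h by (intro mult_left_mono) auto
      also have "\<dots> < min d 1" using h(2) n by (simp add: pos_less_divide_eq)
      finally show "0 \<le> \<mu> + (g (x + h *\<^sub>R q) - g x) / h + K * h" using h by (intro ineq) auto
    qed
    ultimately have "0 \<le> \<mu> + q \<bullet> G X + K * 0"
      by (intro tendsto_lowerbound[where F = "at_right (0::real)"]) auto
    then show "G X \<bullet> q' - lagrangian H i X q' \<le> \<alpha> - \<Lambda> $ i \<bullet> V X + e"
      unfolding \<mu>_def q_def by (simp add: inner_commute)
  qed
  then have "H i X (G X) \<le> \<alpha> - \<Lambda> $ i \<bullet> V X" by (rule hamiltonian_le_if_conjugate_le)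
  then show ?thesis by simp
qed

lemma V_maximal: "maximal_subsolution H \<Lambda> \<alpha> y b V"
  unfolding maximal_subsolution_def subsolution_def[of _ _ _ V]
  using V_continuous V_viscosity V_at_target V_ge_subsolution by blast

end

theorem theorem5p6:
  fixes H :: "'m::finite \<Rightarrow> 'n::finite torus \<Rightarrow> real ^ 'n \<Rightarrow> real"
    and \<Lambda> :: "real ^ 'm ^ 'm"
    and \<alpha> :: real and y :: "'n torus" and b :: "real ^ 'm"
    and v :: "'n torus \<Rightarrow> real ^ 'm"
  assumes "\<And>i. continuous_on UNIV (\<lambda>(x, p). H i x p)"
    and "\<And>i x. convex_on UNIV (H i x)"
    and "\<And>i x. superlinear (H i x)"
    and "coupling_matrix \<Lambda>"
    and "\<alpha> \<ge> critical_value H \<Lambda>"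
    and "b \<in> admissible_values H \<Lambda> \<alpha> y"
    and "v = value_function H \<Lambda> \<alpha> y b"
  shows "v y = b \<and>
    maximal_subsolution H \<Lambda> \<alpha> y b v \<and>
    (\<alpha> = critical_value H \<Lambda> \<and> y \<in> aubry_set H \<Lambda> \<longrightarrow> solution H \<Lambda> (critical_value H \<Lambda>) v)"
proof -
  interpret value_problem \<Lambda> H \<alpha> y b
    by unfold_locales (use assms in \<open>auto simp: coupling_matrix_def\<close>)
  have max: "maximal_subsolution H \<Lambda> \<alpha> y b v" using V_maximal assms(7) by simp
  moreover have "v y = b" using V_at_target assms(7) by simp
  moreover have "solution H \<Lambda> (critical_value H \<Lambda>) v" if "\<alpha> = critical_value H \<Lambda>" "y \<in> aubry_set H \<Lambda>"
    using max that assms(6) unfolding aubry_set_def by blast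
  ultimately show ?thesis by blast
qed

end
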